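(* Let $d\ge2$ and $q\in\left(2,2+\frac4d\right]$. If there exists $u\in H^1(\mathcal G_1^d)$ such that $Q_{q,\mathcal G_1^d}(u)\geq d^{\frac{(d-2)(q-2)}{4}}K_{q,\mathbb R^d}$, then $K_{q,\mathcal G_1^d}$ is attained.
   Context: $\mathcal G_1^d\subset\mathbb R^d$ is the metric graph with vertex set $\mathbb Z^d$ and whose edges are the unit segments joining pairs of vertices at distance $1$. $L^q(\mathcal G_1^d)$ norms are with respect to arclength on the edges, $u'$ is the derivative along edges, and $H^1(\mathcal G_1^d)$ is the space of continuous functions $u$ on $\mathcal G_1^d$ that are $H^1$ on each edge with $u,u'\in L^2(\mathcal G_1^d)$. For nonzero $u\in H^1(\mathcal G_1^d)$ and nonzero $v\in H^1(\mathbb R^d)$ set $$Q_{q,\mathcal G_1^d}(u)=\frac{\|u\|_{L^q(\mathcal G_1^d)}^q}{\|u\|_{L^2(\mathcal G_1^d)}^{d+(2-d)\frac q2}\|u'\|_{L^2(\mathcal G_1^d)}^{(\frac q2-1)d}},\qquad Q_{q,\mathbb R^d}(v)=\frac{\|v\|_{L^q(\mathbb R^d)}^q}{\|v\|_{L^2(\mathbb R^d)}^{d+(2-d)\frac q2}\|\nabla v\|_{L^2(\mathbb R^d)}^{(\frac q2-1)d}},$$ $K_{q,\mathcal G_1^d}=\sup_{u}Q_{q,\mathcal G_1^d}(u)$ and $K_{q,\mathbb R^d}=\sup_vQ_{q,\mathbb R^d}(v)$, the suprema being over nonzero functions. "$K_{q,\mathcal G_1^d}$ is attained" means there is a nonzero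 $u\in H^1(\mathcal G_1^d)$ with $Q_{q,\mathcal G_1^d}(u)=K_{q,\mathcal G_1^d}$. *)

theory Defs
  imports "HOL-Analysis.Analysis"
begin

section \<open>Lebesgue spaces\<close>

definition Lp_space :: "'a measure \<Rightarrow> real \<Rightarrow> ('a \<Rightarrow> 'b::real_normed_vector) set" where
  "Lp_space M p = {f \<in> borel_measurable M. integrable M (\<lambda>x. norm (f x) powr p)}"

definition Lp_norm :: "'a measure \<Rightarrow> real \<Rightarrow> ('a \<Rightarrow> 'b::real_normed_vector) \<Rightarrow> real" where
  "Lp_norm M p f = (\<integral>x. norm (f x) powr p \<partial>M) powr (1 / p)"


section \<open>Weak gradients and the Sobolev space on an open set\<close>

primrec Ck :: "nat \<Rightarrow> ('a::euclidean_space \<Rightarrow> real) \<Rightarrow> bool" where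
  "Ck 0 f \<longleftrightarrow> continuous_on UNIV f"
| "Ck (Suc k) f \<longleftrightarrow>
     (\<forall>x. f differentiable (at x)) \<and> (\<forall>b\<in>Basis. Ck k (\<lambda>x. frechet_derivative f (at x) b))"

definition test_functions :: "'a::euclidean_space set \<Rightarrow> ('a \<Rightarrow> real) set" where
  "test_functions \<Omega> =
     {\<phi>. (\<forall>k. Ck k \<phi>) \<and> compact (closure {x. \<phi> x \<noteq> 0}) \<and> closure {x. \<phi> x \<noteq> 0} \<subseteq> \<Omega>}"

definition locally_integrable_on ::
  "('a::euclidean_space \<Rightarrow> 'b::euclidean_space) \<Rightarrow> 'a set \<Rightarrow> bool" where
  "locally_integrable_on f \<Omega> \<longleftrightarrow> (\<forall>K. compact K \<and> K \<subseteq> \<Omega> \<longrightarrow> f absolutely_integrable_on K)"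

definition has_weak_gradient_on ::
  "('a::euclidean_space \<Rightarrow> real) \<Rightarrow> ('a \<Rightarrow> 'a) \<Rightarrow> 'a set \<Rightarrow> bool" where
  "has_weak_gradient_on f g \<Omega> \<longleftrightarrow>
     locally_integrable_on f \<Omega> \<and> locally_integrable_on g \<Omega> \<and>
     (\<forall>\<phi>\<in>test_functions \<Omega>. \<forall>b\<in>Basis.
        (\<integral>x. f x * frechet_derivative \<phi> (at x) b \<partial>lebesgue_on \<Omega>) =
        - (\<integral>x. (g x \<bullet> b) * \<phi> x \<partial>lebesgue_on \<Omega>))"

text \<open>A weak gradient is determined only up to a null set; the choice of representative
  does not affect Lebesgue norms. In dimension one (\<^typ>\<open>real\<close>, whose basis is
  \<open>{1}\<close>) this is the weak derivative.\<close>

definition weak_gradient :: "'a::euclidean_space set \<Rightarrow> ('a \<Rightarrow> real) \<Rightarrow> 'a \<Rightarrow> 'a" where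
  "weak_gradient \<Omega> f = (SOME g. has_weak_gradient_on f g \<Omega>)"

definition H1 :: "'a::euclidean_space set \<Rightarrow> ('a \<Rightarrow> real) set" where
  "H1 \<Omega> = {f \<in> Lp_space (lebesgue_on \<Omega>) 2.
            \<exists>g \<in> Lp_space (lebesgue_on \<Omega>) 2. has_weak_gradient_on f g \<Omega>}"


section \<open>The metric graph\<close>

definition vertices :: "(real^'n) set" where
  "vertices = {x. \<forall>i. x $ i \<in> \<int>}"

text \<open>Two vertices are at distance 1 iff they differ by plus or minus a coordinate unit vector,
  so every edge is the segment from \<open>k\<close> to \<open>k + axis i 1\<close> for exactly one pair
  \<open>(k, i)\<close>. Functions on the graph are functions on \<^typ>\<open>real^'n\<close> of which only the
  values on \<open>grid\<close> matter.\<close>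

definition edges :: "((real^'n) \<times> 'n) set" where
  "edges = vertices \<times> UNIV"

definition edge_point :: "(real^'n) \<times> 'n \<Rightarrow> real \<Rightarrow> real^'n" where
  "edge_point e t = fst e + t *\<^sub>R axis (snd e) 1"

definition grid :: "(real^'n) set" where
  "grid = (\<Union>e\<in>edges. edge_point e ` {0..1})"

text \<open>Arclength measure, in the coordinates \<open>(e, t)\<close> given by \<open>edge_point\<close>;
  the vertices form a null set and are omitted.\<close>

definition arclength :: "(((real^'n) \<times> 'n) \<times> real) measure" where
  "arclength = count_space edges \<Otimes>\<^sub>M lebesgue_on {0<..<1}"

definition on_edges :: "(real^'n \<Rightarrow> real) \<Rightarrow> ((real^'n) \<times> 'n) \<times> real \<Rightarrow> real" where
  "on_edges u = (\<lambda>(e, t). u (edge_point e t))"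

definition edge_deriv :: "(real^'n \<Rightarrow> real) \<Rightarrow> ((real^'n) \<times> 'n) \<times> real \<Rightarrow> real" where
  "edge_deriv u = (\<lambda>(e, t). weak_gradient {0<..<1} (\<lambda>s. u (edge_point e s)) t)"

definition H1_grid :: "(real^'n \<Rightarrow> real) set" where
  "H1_grid = {u. continuous_on grid u \<and>
                 (\<forall>e\<in>edges. (\<lambda>t. u (edge_point e t)) \<in> H1 {0<..<1}) \<and>
                 on_edges u \<in> Lp_space arclength 2 \<and>
                 edge_deriv u \<in> Lp_space arclength 2}"


section \<open>Gagliardo--Nirenberg quotients and their suprema\<close>

text \<open>The quotients are real-valued: in the range of \<open>q\<close> considered, Sobolev embedding makes
  the \<open>q\<close>-norms of functions in \<open>H1_grid\<close> and \<open>H1 UNIV\<close> finite. The suprema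
  are taken in the extended reals.\<close>

definition GN_quotient :: "real \<Rightarrow> real \<Rightarrow> real \<Rightarrow> real \<Rightarrow> real \<Rightarrow> real" where
  "GN_quotient d q Nq N2 D2 =
     Nq powr q / (N2 powr (d + (2 - d) * (q / 2)) * D2 powr ((q / 2 - 1) * d))"

definition Q_grid :: "real \<Rightarrow> (real^'n \<Rightarrow> real) \<Rightarrow> real" where
  "Q_grid q u = GN_quotient (real CARD('n)) q
     (Lp_norm arclength q (on_edges u))
     (Lp_norm arclength 2 (on_edges u))
     (Lp_norm arclength 2 (edge_deriv u))"

definition Q_space :: "real \<Rightarrow> (real^'n \<Rightarrow> real) \<Rightarrow> real" where
  "Q_space q v = GN_quotient (real CARD('n)) q
     (Lp_norm lebesgue q v)
     (Lp_norm lebesgue 2 v)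
     (Lp_norm lebesgue 2 (weak_gradient UNIV v))"

definition nonzero_H1_grid :: "(real^'n \<Rightarrow> real) set" where
  "nonzero_H1_grid = {u \<in> H1_grid. \<exists>x\<in>grid. u x \<noteq> 0}"

definition nonzero_H1_space :: "(real^'n \<Rightarrow> real) set" where
  "nonzero_H1_space = {v \<in> H1 UNIV. \<not> (AE x in lebesgue. v x = 0)}"

definition K_grid :: "'n::finite itself \<Rightarrow> real \<Rightarrow> ereal" where
  "K_grid _ q = (SUP u \<in> (nonzero_H1_grid :: (real^'n \<Rightarrow> real) set). ereal (Q_grid q u))"

definition K_space :: "'n::finite itself \<Rightarrow> real \<Rightarrow> ereal" where
  "K_space _ q = (SUP v \<in> (nonzero_H1_space :: (real^'n \<Rightarrow> real) set). ereal (Q_space q v))"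

definition K_grid_attained :: "'n::finite itself \<Rightarrow> real \<Rightarrow> bool" where
  "K_grid_attained T q \<longleftrightarrow>
     (\<exists>u \<in> (nonzero_H1_grid :: (real^'n \<Rightarrow> real) set). ereal (Q_grid q u) = K_grid T q)"

end

theory Submission
  imports Defs "HOL-Complex_Analysis.Great_Picard"
begin

text \<open>Write \<open>Q u = mass q u / ((mass 2 u)\<^sup>s (dirichlet u)\<^sup>t)\<close> with \<open>s + t = q / 2 > 1\<close>, and suppose the given
  function is not itself a maximizer, so that \<open>K\<close> strictly exceeds \<open>d\<close> to the power \<open>(d - 2) (q - 2) / 4\<close> times the
  constant of Euclidean space. Normalize \<open>mass 2 u = 1\<close>. If \<open>dirichlet u\<close> is small, then \<open>u\<close> differs little from the
  multilinear interpolation of its vertex values; the interpolation has at most the same Dirichlet energy, while its square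
  mass is about \<open>1 / d\<close> and the graph carries \<open>d\<close> unit edges per unit cell, so the Euclidean inequality bounds \<open>Q u\<close> by
  the quantity above. If \<open>dirichlet u\<close> is large, then \<open>Q u\<close> is small by the one-dimensional sup bound on edges. A
  maximizing sequence therefore has energies in a compact interval, and, since its \<open>q\<close>-mass stays away from \<open>0\<close>, after
  lattice translations it has a nonzero pointwise limit. Brezis--Lieb splitting of the three functionals
  and strict superadditivity, due to \<open>s + t > 1\<close>, show that nothing is lost in the limit.\<close>

section \<open>Smooth cut-off functions\<close>

text \<open>The exponent in the hypothesis is \<open>1 - \<alpha> / 2\<close> with
  \<open>\<alpha> = d + (2 - d) * (q / 2)\<close>: at low energy the \<open>q\<close>-mass is about
  \<open>d\<close> lattice sums, while the lattice square sum is about \<open>1 / d\<close> and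
  enters the Euclidean inequality with power \<open>\<alpha> / 2\<close>. The energy enters with
  power \<open>\<beta> / 2 = (q - 2) * d / 4\<close>, and for \<open>d \<ge> 2\<close> this exceeds
  the power \<open>(q - 2) / 4\<close> that the sup bound on edges produces, hence the loss at high
  energy. The hypothesis itself makes the Euclidean constant finite; finiteness of the graph
  constant comes from the compact energy window. The main obstacle is that \<open>edge_deriv\<close>
  is an arbitrary choice among weak derivatives. It is identified almost everywhere by testing with
  smooth cut-offs, and after that the Dirichlet integral is handled as an increasing limit of finite
  quadratic forms in point values. Its splitting comes from the perfect square
  \<open>(1 + e) * p^2 + (1 + 1 / e) * r^2 - (p - r)^2\<close>, which makes a combination of
  energies monotone under refinement.\<close>

lemma Ck_Suc_imp: "Ck (Suc k) f \<Longrightarrow> Ck k f"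
proof (induction k arbitrary: f)
  case 0
  then have "\<And>x. f differentiable (at x)" by simp
  then show ?case
    by (simp add: continuous_on_eq_continuous_at differentiable_imp_continuous_within)
next
  case (Suc k)
  then show ?case using Ck.simps(2) by blast
qed

text \<open>Derivatives are unique, so the choice operator inside \<open>frechet_derivative\<close>
  has to return \<open>D x\<close>. Closure properties of \<open>Ck\<close> thereby reduce to
  derivative formulas.\<close>

lemma Ck_SucI:
  assumes "\<And>x. (f has_derivative D x) (at x)" and "\<And>b. b \<in> Basis \<Longrightarrow> Ck k (\<lambda>x. D x b)"
  shows "Ck (Suc k) f"
proof -
  have "frechet_derivative f (at x) = D x" for x
    using frechet_derivative_at[OF assms(1)[of x]] by simp
  then show ?thesis using assms by (auto simp: differentiable_def)
qed

lemma Ck_SucD: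
  assumes "Ck (Suc k) f"
  shows "(f has_derivative frechet_derivative f (at x)) (at x)"
    and "b \<in> Basis \<Longrightarrow> Ck k (\<lambda>x. frechet_derivative f (at x) b)"
  using assms by (auto simp: frechet_derivative_works)

lemma Ck_const [simp]: "Ck k (\<lambda>x. c)"
proof (induction k arbitrary: c)
  case (Suc k)
  show ?case by (rule Ck_SucI[where D="\<lambda>x h. 0"]) (auto intro: Suc)
qed simp

lemma Ck_add: "Ck k f \<Longrightarrow> Ck k g \<Longrightarrow> Ck k (\<lambda>x. f x + g x)"
proof (induction k arbitrary: f g)
  case 0 then show ?case by (auto intro: continuous_intros)
next
  case (Suc k)
  note f = Ck_SucD[OF Suc.prems(1)] and g = Ck_SucD[OF Suc.prems(2)]
  show ?case
    by (rule Ck_SucI[OF has_derivative_add[OF f(1) g(1)]]) (use Suc.IH f(2) g(2) in auto)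
qed

lemma Ck_mult: "Ck k f \<Longrightarrow> Ck k g \<Longrightarrow> Ck k (\<lambda>x. f x * g x)"
proof (induction k arbitrary: f g)
  case 0 then show ?case by (auto intro: continuous_intros)
next
  case (Suc k)
  note f = Ck_SucD[OF Suc.prems(1)] and g = Ck_SucD[OF Suc.prems(2)]
  \<comment> \<open>The product rule leaves one factor undifferentiated, and the induction
    hypothesis wants that factor at order \<open>k\<close>.\<close>
  note fg = Suc.prems[THEN Ck_Suc_imp]
  show ?case
    by (rule Ck_SucI[OF has_derivative_mult[OF f(1) g(1)]])
       (use Suc.IH f(2) g(2) fg in \<open>auto intro!: Ck_add\<close>)
qed

lemma Ck_prod: "finite I \<Longrightarrow> (\<And>i. i \<in> I \<Longrightarrow> Ck k (f i)) \<Longrightarrow> Ck k (\<lambda>x. \<Prod>i\<in>I. f i x)"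
  by (induction I rule: finite_induct) (auto intro: Ck_mult)

lemma Ck_inverse: "Ck k f \<Longrightarrow> (\<And>x. f x \<noteq> 0) \<Longrightarrow> Ck k (\<lambda>x. inverse (f x))"
proof (induction k)
  case 0 then show ?case by (auto intro: continuous_intros)
next
  case (Suc k)
  note f = Ck_SucD[OF Suc.prems(1)]
  have inv: "Ck k (\<lambda>x. inverse (f x))" using Suc Ck_Suc_imp by blast
  show ?case
  proof (rule Ck_SucI)
    show "((\<lambda>x. inverse (f x)) has_derivative
       (\<lambda>h. (-1) * (inverse (f x) * frechet_derivative f (at x) h * inverse (f x)))) (at x)" for x
      using Deriv.has_derivative_inverse[OF Suc.prems(2) f(1), of x] by simp
    show "Ck k (\<lambda>x. (-1) * (inverse (f x) * frechet_derivative f (at x) b * inverse (f x)))"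
      if "b \<in> Basis" for b
      by (intro Ck_mult inv Ck_const f(2) that)
  qed
qed

text \<open>Each derivative is a constant times the same composition with \<open>h'\<close> in place
  of \<open>h\<close>, which keeps the induction inside this family. Cut-offs along a coordinate
  have this form.\<close>

lemma Ck_compose_affine:
  fixes h :: "real \<Rightarrow> real" and c :: "'a::euclidean_space"
  shows "Ck k h \<Longrightarrow> Ck k (\<lambda>x. h (c \<bullet> x + r))"
proof (induction k arbitrary: h)
  case 0
  then show ?case
    by (auto intro!: continuous_intros continuous_on_compose2[of UNIV h])
next
  case (Suc k)
  note h = Ck_SucD[OF Suc.prems]
  let ?h' = "\<lambda>x. frechet_derivative h (at x) 1"
  show ?case
  proof (rule Ck_SucI)
    fix x
    have "((\<lambda>x. c \<bullet> x + r) has_derivative (\<lambda>v. c \<bullet> v)) (at x)"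
      by (auto intro!: derivative_eq_intros)
    from has_derivative_compose[OF this h(1)]
    have "((\<lambda>x. h (c \<bullet> x + r)) has_derivative
        (\<lambda>v. frechet_derivative h (at (c \<bullet> x + r)) (c \<bullet> v))) (at x)" by simp
    also have "(\<lambda>v. frechet_derivative h (at (c \<bullet> x + r)) (c \<bullet> v)) =
               (\<lambda>v. (c \<bullet> v) * ?h' (c \<bullet> x + r))"
    proof
      fix v
      have "linear (frechet_derivative h (at (c \<bullet> x + r)))"
        using h(1) has_derivative_linear by blast
      from linear_cmul[OF this, of "c \<bullet> v" 1]
      show "frechet_derivative h (at (c \<bullet> x + r)) (c \<bullet> v) = (c \<bullet> v) * ?h' (c \<bullet> x + r)"
        by simp
    qed
    finally show "((\<lambda>x. h (c \<bullet> x + r)) has_derivative (\<lambda>v. (c \<bullet> v) * ?h' (c \<bullet> x + r))) (at x)" .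
  next
    fix b :: 'a assume "b \<in> Basis"
    show "Ck k (\<lambda>x. (c \<bullet> b) * ?h' (c \<bullet> x + r))"
      by (intro Ck_mult Ck_const Suc.IH h(2)) simp
  qed
qed

text \<open>Every derivative of \<open>exp (- 1 / x)\<close> has the form \<open>P (1 / x) exp (- 1 / x)\<close>, so this family is closed under
  differentiation, which gives smoothness by induction.\<close>

definition flat_exp :: "real poly \<Rightarrow> real \<Rightarrow> real" where
  "flat_exp p x = (if x > 0 then poly p (1 / x) * exp (- (1 / x)) else 0)"

lemma poly_times_exp_tendsto_0: "((\<lambda>y. poly p y * exp (- y)) \<longlongrightarrow> (0::real)) at_top"
proof -
  have "((\<lambda>y. \<Sum>i\<le>degree p. coeff p i * (y ^ i / exp y)) \<longlongrightarrow> (\<Sum>i\<le>degree p. coeff p i * 0)) at_top"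
    by (intro tendsto_intros tendsto_power_div_exp_0)
  moreover have "poly p y * exp (- y) = (\<Sum>i\<le>degree p. coeff p i * (y ^ i / exp y))" for y :: real
    unfolding poly_altdef sum_distrib_right by (intro sum.cong) (simp_all add: exp_minus field_simps)
  ultimately show ?thesis by simp
qed

lemma flat_exp_tendsto_0: "(flat_exp p \<longlongrightarrow> 0) (at 0)"
proof (rule filterlim_split_at)
  have "eventually (\<lambda>x::real. flat_exp p x = 0) (at_left 0)"
    by (simp add: flat_exp_def eventually_at_filter)
  then show "(flat_exp p \<longlongrightarrow> 0) (at_left 0)"
    using tendsto_eventually by blast
  have "((\<lambda>x. poly p (inverse x) * exp (- (inverse x))) \<longlongrightarrow> 0) (at_right 0)"
    using filterlim_compose[OF poly_times_exp_tendsto_0 filterlim_inverse_at_top_right] .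
  then show "(flat_exp p \<longlongrightarrow> 0) (at_right 0)"
    by (rule Lim_transform_eventually)
       (auto simp: flat_exp_def eventually_at_filter inverse_eq_divide)
qed

text \<open>For \<open>y = 1 / x\<close> one has \<open>dy/dx = - y^2\<close>, so
  \<open>P(y) exp(-y)\<close> has derivative \<open>y^2 (P - P')(y) exp(-y)\<close>;
  \<open>[:0, 0, 1:]\<close> is the factor \<open>y^2\<close>. At 0 the difference quotient is again
  a \<open>flat_exp\<close>, of the polynomial \<open>y P\<close>, and tends to 0.\<close>

lemma flat_exp_deriv:
  "(flat_exp p has_real_derivative flat_exp ([:0, 0, 1:] * (p - pderiv p)) x) (at x)"
proof -
  consider "x > 0" | "x < 0" | "x = 0" by linarith
  then show ?thesis
  proof cases
    case 1
    have "((\<lambda>x. poly p (1 / x) * exp (- (1 / x))) has_real_derivative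
        flat_exp ([:0, 0, 1:] * (p - pderiv p)) x) (at x)"
    proof -
      have inv: "((\<lambda>x. 1 / x) has_real_derivative - (1 / x^2)) (at x)"
        using 1 by (auto intro!: derivative_eq_intros simp: power2_eq_square)
      have "((\<lambda>x. poly p (1 / x)) has_real_derivative poly (pderiv p) (1 / x) * - (1 / x^2)) (at x)"
        using DERIV_chain2[OF poly_DERIV inv] .
      moreover have "((\<lambda>x. exp (- (1 / x))) has_real_derivative exp (- (1 / x)) * - (- (1 / x^2))) (at x)"
        using DERIV_chain2[OF DERIV_exp DERIV_minus[OF inv]] .
      ultimately have "((\<lambda>x. poly p (1 / x) * exp (- (1 / x))) has_real_derivative
          poly (pderiv p) (1 / x) * - (1 / x^2) * exp (- (1 / x)) +
          exp (- (1 / x)) * - (- (1 / x^2)) * poly p (1 / x)) (at x)"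
        by (rule DERIV_mult)
      also have "poly (pderiv p) (1 / x) * - (1 / x^2) * exp (- (1 / x)) +
          exp (- (1 / x)) * - (- (1 / x^2)) * poly p (1 / x) =
          flat_exp ([:0, 0, 1:] * (p - pderiv p)) x"
        using 1 by (simp add: flat_exp_def power2_eq_square) (simp add: algebra_simps flip: add_divide_distrib)
      finally show ?thesis .
    qed
    moreover have ev: "eventually (\<lambda>y. flat_exp p y = poly p (1 / y) * exp (- (1 / y))) (nhds x)"
      using eventually_nhds_in_open[of "{0<..}" x] 1
      by (auto elim!: eventually_mono simp: flat_exp_def)
    ultimately show ?thesis by (subst DERIV_cong_ev[OF refl ev refl])
  next
    case 2
    have ev: "eventually (\<lambda>y. flat_exp p y = 0) (nhds x)"
      using eventually_nhds_in_open[of "{..<0}" x] 2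
      by (auto elim!: eventually_mono simp: flat_exp_def)
    have "flat_exp ([:0, 0, 1:] * (p - pderiv p)) x = 0" using 2 by (simp add: flat_exp_def)
    then show ?thesis using DERIV_cong_ev[OF refl ev refl] by simp
  next
    case 3
    have "(\<lambda>h. flat_exp p h / h) = flat_exp ([:0, 1:] * p)"
      by (auto simp: flat_exp_def fun_eq_iff)
    then have "((\<lambda>h. (flat_exp p (0 + h) - flat_exp p 0) / h) \<longlongrightarrow> 0) (at 0)"
      using flat_exp_tendsto_0[of "[:0, 1:] * p"] by (simp add: flat_exp_def)
    then show ?thesis using 3 by (simp add: DERIV_def flat_exp_def)
  qed
qed

lemma Ck_flat_exp: "Ck k (flat_exp p)"
proof (induction k arbitrary: p)
  case 0
  show ?case using DERIV_isCont[OF flat_exp_deriv[of p]]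
    by (simp add: continuous_on_eq_continuous_at)
next
  case (Suc k)
  show ?case
    by (rule Ck_SucI[OF flat_exp_deriv[unfolded has_field_derivative_def]])
       (use Suc[of "[:0,0,1:] * (p - pderiv p)"] in \<open>simp\<close>)
qed

text \<open>The usual smooth transition. The denominator never vanishes because \<open>x\<close> and
  \<open>1 - x\<close> are not both nonpositive, and the values 0 and 1 are attained exactly outside
  the unit interval.\<close>

definition smooth_step :: "real \<Rightarrow> real" where
  "smooth_step x = flat_exp 1 x * inverse (flat_exp 1 x + flat_exp 1 (1 - x))"

lemma flat_exp_1_nonneg: "flat_exp 1 x \<ge> 0" and flat_exp_1_pos: "x > 0 \<Longrightarrow> flat_exp 1 x > 0"
  and flat_exp_nonpos: "x \<le> 0 \<Longrightarrow> flat_exp p x = 0"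
  by (auto simp: flat_exp_def)

lemma flat_exp_1_sum_pos: "flat_exp 1 x + flat_exp 1 (1 - x) > 0"
  using flat_exp_1_pos[of x] flat_exp_1_pos[of "1 - x"] flat_exp_1_nonneg[of x]
    flat_exp_1_nonneg[of "1 - x"] by (cases "x > 0") (auto intro: add_pos_nonneg add_nonneg_pos)

lemma smooth_step_0: "x \<le> 0 \<Longrightarrow> smooth_step x = 0"
  and smooth_step_1: "x \<ge> 1 \<Longrightarrow> smooth_step x = 1"
  using flat_exp_1_pos[of x] by (auto simp: smooth_step_def flat_exp_nonpos)

lemma smooth_step_bounds: "0 \<le> smooth_step x" "smooth_step x \<le> 1"
  using flat_exp_1_sum_pos[of x] flat_exp_1_nonneg[of x] flat_exp_1_nonneg[of "1 - x"]
  by (auto simp: smooth_step_def field_simps)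

lemma Ck_smooth_step: "Ck k smooth_step"
proof -
  have "Ck k (\<lambda>x. flat_exp 1 (1 - x))"
    using Ck_compose_affine[OF Ck_flat_exp, of k 1 "-1::real" 1] by (simp add: algebra_simps)
  moreover have "flat_exp 1 x + flat_exp 1 (1 - x) \<noteq> 0" for x
    using flat_exp_1_sum_pos[of x] by simp
  ultimately show ?thesis unfolding smooth_step_def
    by (intro Ck_mult Ck_inverse Ck_add Ck_flat_exp) auto
qed

text \<open>For positive \<epsilon> both transition layers, of width \<epsilon>, start at the end
  points and point inwards, so the support never leaves \<open>{a..b}\<close>.\<close>

definition cutoff :: "real \<Rightarrow> real \<Rightarrow> real \<Rightarrow> real \<Rightarrow> real" where
  "cutoff \<epsilon> a b x = smooth_step ((x - a) / \<epsilon>) * smooth_step ((b - x) / \<epsilon>)"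

lemma Ck_cutoff_inner: "Ck k (\<lambda>x::'a::euclidean_space. cutoff \<epsilon> a b (x \<bullet> i))"
proof -
  have "Ck k (\<lambda>x::'a. smooth_step ((x \<bullet> i - a) / \<epsilon>))" "Ck k (\<lambda>x::'a. smooth_step ((b - x \<bullet> i) / \<epsilon>))"
    using Ck_compose_affine[OF Ck_smooth_step, of k "i /\<^sub>R \<epsilon>" "- a / \<epsilon>"]
      Ck_compose_affine[OF Ck_smooth_step, of k "i /\<^sub>R (- \<epsilon>)" "b / \<epsilon>"]
    by (simp_all add: inner_commute diff_divide_distrib field_simps)
  then show ?thesis unfolding cutoff_def by (intro Ck_mult)
qed

lemma cutoff_bounds: "0 \<le> cutoff \<epsilon> a b x" "cutoff \<epsilon> a b x \<le> 1"
  using smooth_step_bounds by (auto simp: cutoff_def intro: mult_le_one)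

lemma cutoff_eq_0: "\<epsilon> > 0 \<Longrightarrow> x \<notin> {a..b} \<Longrightarrow> cutoff \<epsilon> a b x = 0"
  by (auto simp: cutoff_def smooth_step_0 divide_nonpos_pos)

text \<open>At each point the values are eventually constant: off the open interval one factor
  vanishes for every positive \<epsilon>, and inside both arguments of \<open>smooth_step\<close>
  eventually exceed 1. Hence the open interval appears in the limit, not the closed one.\<close>

lemma cutoff_tendsto_indicator:
  assumes "(\<epsilon> \<longlongrightarrow> 0) F" "eventually (\<lambda>n. \<epsilon> n > 0) F"
  shows "((\<lambda>n. cutoff (\<epsilon> n) a b x) \<longlongrightarrow> indicator {a<..<b} x) F"
proof (rule tendsto_eventually)
  have ev: "eventually (\<lambda>n. \<epsilon> n < c) F" if "c > 0" for c
    using order_tendstoD(2)[OF assms(1) that] .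
  show "eventually (\<lambda>n. cutoff (\<epsilon> n) a b x = indicator {a<..<b} x) F"
  proof (cases "a < x \<and> x < b")
    case False
    show ?thesis using assms(2)
      by eventually_elim (use False in \<open>auto simp: cutoff_def smooth_step_0 divide_nonpos_pos\<close>)
  next
    case True
    then have "eventually (\<lambda>n. \<epsilon> n < x - a) F" "eventually (\<lambda>n. \<epsilon> n < b - x) F" by (auto intro: ev)
    with assms(2) show ?thesis
      by eventually_elim (use True in \<open>auto simp: cutoff_def smooth_step_1\<close>)
  qed
qed

definition box_cutoff :: "real \<Rightarrow> 'a \<Rightarrow> 'a \<Rightarrow> 'a::euclidean_space \<Rightarrow> real" where
  "box_cutoff \<epsilon> a b x = (\<Prod>i\<in>Basis. cutoff \<epsilon> (a \<bullet> i) (b \<bullet> i) (x \<bullet> i))"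

lemma Ck_box_cutoff: "Ck k (box_cutoff \<epsilon> a b)"
  unfolding box_cutoff_def by (intro Ck_prod Ck_cutoff_inner) auto

lemma box_cutoff_bounds: "0 \<le> box_cutoff \<epsilon> a b x" "box_cutoff \<epsilon> a b x \<le> 1"
  unfolding box_cutoff_def using cutoff_bounds by (auto intro: prod_nonneg prod_le_1)

lemma box_cutoff_eq_0: "\<epsilon> > 0 \<Longrightarrow> x \<notin> cbox a b \<Longrightarrow> box_cutoff \<epsilon> a b x = 0"
  unfolding box_cutoff_def mem_box using cutoff_eq_0 by (fastforce intro!: prod_zero)

lemma box_cutoff_tendsto_indicator:
  assumes "(\<epsilon> \<longlongrightarrow> 0) F" "eventually (\<lambda>n. \<epsilon> n > 0) F"
  shows "((\<lambda>n. box_cutoff (\<epsilon> n) a b x) \<longlongrightarrow> indicator (box a b) x) F"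
proof -
  have "((\<lambda>n. box_cutoff (\<epsilon> n) a b x) \<longlongrightarrow> (\<Prod>i\<in>Basis. indicator {a \<bullet> i<..<b \<bullet> i} (x \<bullet> i))) F"
    unfolding box_cutoff_def by (intro tendsto_prod cutoff_tendsto_indicator assms)
  also have "(\<Prod>i\<in>Basis. indicator {a \<bullet> i<..<b \<bullet> i} (x \<bullet> i)) = (indicator (box a b) x :: real)"
  proof (cases "x \<in> box a b")
    case False
    then obtain i where "i \<in> Basis" "x \<bullet> i \<notin> {a \<bullet> i<..<b \<bullet> i}" by (auto simp: mem_box)
    then have "\<exists>i\<in>Basis. (indicator {a \<bullet> i<..<b \<bullet> i} (x \<bullet> i) :: real) = 0" by (auto intro: bexI[of _ i])
    then show ?thesis using False by (simp add: prod_zero_iff)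
  qed (auto simp: mem_box intro!: prod.neutral)
  finally show ?thesis .
qed

lemma box_cutoff_test:
  assumes "\<epsilon> > 0" "cbox a b \<subseteq> \<Omega>"
  shows "box_cutoff \<epsilon> a b \<in> test_functions \<Omega>"
proof -
  have "closure {x. box_cutoff \<epsilon> a b x \<noteq> 0} \<subseteq> cbox a b"
    using box_cutoff_eq_0[OF assms(1), of _ a b] by (intro closure_minimal closed_cbox) blast
  then show ?thesis unfolding test_functions_def
    using assms(2) Ck_box_cutoff compact_Int_closed[OF compact_cbox closed_closure]
    by (auto simp: compact_eq_bounded_closed intro: bounded_subset[OF bounded_cbox])
qed

section \<open>Inequalities for powers and the Brezis--Lieb lemma\<close>

text \<open>Convexity of the power at the points \<open>x / (1 - l)\<close> and
  \<open>y / l\<close>. For small \<open>l\<close> the weight of \<open>x\<close> is close to 1 and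
  that of \<open>y\<close> may be large, so a leading term keeps its sharp constant while an error
  term absorbs the loss.\<close>

lemma powr_add_le_weighted:
  fixes x y l p :: real
  assumes "0 < l" "l < 1" "1 \<le> p" "0 \<le> x" "0 \<le> y"
  shows "(x + y) powr p \<le> (1 - l) powr (1 - p) * x powr p + l powr (1 - p) * y powr p"
proof (cases "x = 0 \<or> y = 0")
  case True
  \<comment> \<open>Convexity is applied to positive arguments; if an argument vanishes, the claim
    reduces to both weights being at least 1.\<close>
  have "1 \<le> (1 - l) powr (1 - p)" "1 \<le> l powr (1 - p)"
    using powr_mono'[of "1 - p" 0 "1 - l"] powr_mono'[of "1 - p" 0 l] assms by simp_all
  from this[THEN mult_right_mono[OF _ powr_ge_zero]] True show ?thesis
    using assms by (auto simp: powr_0)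
next
  case False
  have "((1 - l) *\<^sub>R (x / (1 - l)) + l *\<^sub>R (y / l)) powr p
        \<le> (1 - l) * (x / (1 - l)) powr p + l * (y / l) powr p"
    by (rule convex_onD[OF powr_convex[of p]]) (use assms False in auto)
  also have "(1 - l) * (x / (1 - l)) powr p = (1 - l) powr (1 - p) * x powr p"
    using assms by (simp add: powr_divide powr_diff)
  also have "l * (y / l) powr p = l powr (1 - p) * y powr p"
    using assms by (simp add: powr_divide powr_diff)
  finally show ?thesis using assms by simp
qed

text \<open>The weighted inequality between geometric and arithmetic mean with weights
  \<open>s / (s + t)\<close> and \<open>t / (s + t)\<close>, raised to the power
  \<open>s + t\<close>. It reduces a question about two variables to one about their mean.\<close>

lemma weighted_powr_le:
  fixes x y s t :: real
  assumes "0 < s" "0 < t" "0 \<le> x" "0 \<le> y"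
  shows "x powr s * y powr t \<le> ((s * x + t * y) / (s + t)) powr (s + t)"
proof (cases "x = 0 \<or> y = 0")
  case True
  then show ?thesis by (auto simp: powr_0)
next
  case False
  define a where "a = s / (s + t)"
  have a: "0 \<le> a" "1 - a = t / (s + t)" "0 \<le> 1 - a" "a + (1 - a) = 1" 
    using assms by (simp_all add: a_def diff_divide_eq_iff flip: add_divide_distrib)
  have "x powr a * y powr (1 - a) \<le> a * x + (1 - a) * y"
    by (rule Youngs_inequality_0) (use a assms False in auto)
  also have "\<dots> = (s * x + t * y) / (s + t)"
    using assms by (simp add: a(2)) (simp add: a_def add_divide_distrib)
  finally have "(x powr a * y powr (1 - a)) powr (s + t) \<le> ((s * x + t * y) / (s + t)) powr (s + t)"
    by (rule powr_mono2[rotated 2]) (use assms in auto)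
  also have "(x powr a * y powr (1 - a)) powr (s + t) = x powr s * y powr t"
    using assms by (simp add: powr_mult powr_powr a(2)) (simp add: a_def)
  finally show ?thesis .
qed

lemma powr_lt_self: "0 < z \<Longrightarrow> z < 1 \<Longrightarrow> 1 < p \<Longrightarrow> z powr p < (z::real)"
  using powr_less_mono'[of z 1 p] by simp

text \<open>For the weighted mean \<open>z\<close> of \<open>x\<close> and \<open>y\<close> the
  hypothesis yields \<open>1 \<le> z^p + (1 - z)^p\<close> with \<open>p = s + t > 1\<close>, which
  fails for \<open>0 < z < 1\<close> because \<open>z^p < z\<close> there. Positivity of
  \<open>x\<close> excludes \<open>z = 0\<close>, and a mean of numbers at most 1 equals 1 only if
  both do.\<close>

lemma split_powr_rigidity:
  fixes x y s t :: real
  assumes st: "0 < s" "0 < t" "1 < s + t" and x: "0 < x" "x \<le> 1" and y: "0 \<le> y" "y \<le> 1"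
    and le: "1 \<le> x powr s * y powr t + (1 - x) powr s * (1 - y) powr t"
  shows "x = 1 \<and> y = 1"
proof -
  define z where "z = (s * x + t * y) / (s + t)"
  have z1: "1 - z = (s * (1 - x) + t * (1 - y)) / (s + t)"
    using st by (simp add: z_def field_simps)
  have z: "0 < z" "z \<le> 1"
  proof -
    show "0 < z" using st x y by (auto simp: z_def intro!: divide_pos_pos add_pos_nonneg)
    have "0 \<le> 1 - z" unfolding z1 using st x y by simp
    then show "z \<le> 1" by simp
  qed
  have le2: "1 \<le> z powr (s + t) + (1 - z) powr (s + t)"
    using le weighted_powr_le[of s t x y] weighted_powr_le[of s t "1 - x" "1 - y"] st x y
    unfolding z1 z_def[symmetric] by linarith
  have "z = 1"
  proof (rule ccontr)
    assume "z \<noteq> 1"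
    then have "z < 1" using z by simp
    then have "z powr (s + t) < z" "(1 - z) powr (s + t) < 1 - z"
      using z st by (auto intro!: powr_lt_self)
    then show False using le2 by linarith
  qed
  then have "s * (1 - x) + t * (1 - y) = 0" using z1 st by (auto simp: field_simps)
  moreover have "0 \<le> s * (1 - x)" "0 \<le> t * (1 - y)" using st x y by auto
  ultimately have "s * (1 - x) = 0" "t * (1 - y) = 0" by linarith+
  then show ?thesis using st by auto
qed

text \<open>The weighted inequality is applied to \<open>a\<close> as a perturbation of
  \<open>a - b\<close> and to \<open>a - b\<close> as a perturbation of \<open>a\<close>. The
  coefficient \<open>c - 1\<close> is small for small \<open>l\<close>, and only the power of
  \<open>b\<close> carries the large constant.\<close>

lemma abs_powr_diff_bound:
  fixes a b l p :: real
  assumes "0 < l" "l < 1" "1 \<le> p"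
  defines "c \<equiv> (1 - l) powr (1 - p)" and "C \<equiv> l powr (1 - p)"
  shows "\<bar>\<bar>a\<bar> powr p - \<bar>a - b\<bar> powr p\<bar> \<le> (c - 1) * \<bar>a\<bar> powr p + (c - 1) * \<bar>a - b\<bar> powr p + C * \<bar>b\<bar> powr p"
proof -
  have c1: "c \<ge> 1" unfolding c_def using powr_mono'[of "1 - p" 0 "1 - l"] assms(1-3) by simp
  have "\<bar>a\<bar> powr p \<le> (\<bar>a - b\<bar> + \<bar>b\<bar>) powr p" using assms by (intro powr_mono2) auto
  also have "\<dots> \<le> c * \<bar>a - b\<bar> powr p + C * \<bar>b\<bar> powr p"
    unfolding c_def C_def by (rule powr_add_le_weighted) (use assms in auto)
  finally have 1: "\<bar>a\<bar> powr p \<le> c * \<bar>a - b\<bar> powr p + C * \<bar>b\<bar> powr p" .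
  have "\<bar>a - b\<bar> powr p \<le> (\<bar>a\<bar> + \<bar>b\<bar>) powr p" using assms by (intro powr_mono2) auto
  also have "\<dots> \<le> c * \<bar>a\<bar> powr p + C * \<bar>b\<bar> powr p"
    unfolding c_def C_def by (rule powr_add_le_weighted) (use assms in auto)
  finally have 2: "\<bar>a - b\<bar> powr p \<le> c * \<bar>a\<bar> powr p + C * \<bar>b\<bar> powr p" .
  have "0 \<le> (c - 1) * \<bar>a\<bar> powr p" "0 \<le> (c - 1) * \<bar>a - b\<bar> powr p" using c1 by auto
  with 1 2 show ?thesis by (auto simp: abs_if algebra_simps split: if_splits)
qed

text \<open>Fatou's lemma in a form for Bochner integrals: a uniform bound survives an almost
  everywhere limit without a majorant.\<close>

lemma integrable_limit_bound:
  fixes h :: "nat \<Rightarrow> 'a \<Rightarrow> real"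
  assumes int: "\<And>n. integrable M (h n)" and nn: "\<And>n x. 0 \<le> h n x"
    and k: "k \<in> borel_measurable M" and lim: "AE x in M. (\<lambda>n. h n x) \<longlonglongrightarrow> k x"
    and B: "\<And>n. (\<integral>x. h n x \<partial>M) \<le> B"
  shows "integrable M k" "(\<integral>x. k x \<partial>M) \<le> B"
proof -
  have k0: "AE x in M. 0 \<le> k x"
    using lim by eventually_elim (rule LIMSEQ_le_const, auto simp: nn)
  have B0: "0 \<le> B" using B[of 0] nn by (meson Bochner_Integration.integral_nonneg order_trans)
  have "(\<integral>\<^sup>+x. ennreal (k x) \<partial>M) = (\<integral>\<^sup>+x. liminf (\<lambda>n. ennreal (h n x)) \<partial>M)"
  proof (rule nn_integral_cong_AE, use lim in eventually_elim)
    case (elim x)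
    then have "(\<lambda>n. ennreal (h n x)) \<longlonglongrightarrow> ennreal (k x)" by (rule tendsto_ennrealI)
    then show ?case by (simp add: lim_imp_Liminf)
  qed
  also have "\<dots> \<le> liminf (\<lambda>n. \<integral>\<^sup>+x. ennreal (h n x) \<partial>M)"
    by (rule nn_integral_liminf) (use int in auto)
  also have "\<dots> \<le> ennreal B"
  proof -
    have "(\<integral>\<^sup>+x. ennreal (h n x) \<partial>M) \<le> ennreal B" for n
      using nn_integral_eq_integral[OF int] nn B by (simp add: ennreal_leI)
    then show ?thesis by (intro Liminf_le) auto
  qed
  finally have le: "(\<integral>\<^sup>+x. ennreal (k x) \<partial>M) \<le> ennreal B" .
  show ik: "integrable M k"
    using k k0 le by (intro integrableI_nonneg) (auto simp: le_less_trans)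
  show "(\<integral>x. k x \<partial>M) \<le> B"
    using le nn_integral_eq_integral[OF ik k0] B0 by simp
qed

lemma weight_tendsto_1: "((\<lambda>l. (1 - l) powr (1 - p)) \<longlongrightarrow> (1::real)) (at_right 0)"
proof -
  have "((\<lambda>l. (1 - l) powr (1 - p)) \<longlongrightarrow> (1 - 0) powr (1 - p)) (at_right (0::real))"
    by (intro tendsto_intros) auto
  then show ?thesis by simp
qed

text \<open>The defect \<open>| |f|^p - |f - g|^p - |g|^p |\<close> exceeds a small multiple of
  \<open>|f|^p + |f - g|^p\<close> by at most a multiple of \<open>|g|^p\<close>. Dominated
  convergence removes this excess, and what remains is the small factor times a bounded
  integral.\<close>

lemma brezis_lieb:
  fixes f :: "nat \<Rightarrow> 'a \<Rightarrow> real"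
  assumes p: "1 \<le> p"
    and meas: "\<And>n. f n \<in> borel_measurable M" "g \<in> borel_measurable M"
    and lim: "AE x in M. (\<lambda>n. f n x) \<longlonglongrightarrow> g x"
    and int: "\<And>n. integrable M (\<lambda>x. \<bar>f n x\<bar> powr p)"
    and B: "\<And>n. (\<integral>x. \<bar>f n x\<bar> powr p \<partial>M) \<le> B"
  shows "integrable M (\<lambda>x. \<bar>g x\<bar> powr p)" "(\<integral>x. \<bar>g x\<bar> powr p \<partial>M) \<le> B"
    "\<And>n. integrable M (\<lambda>x. \<bar>f n x - g x\<bar> powr p)"
    "(\<lambda>n. (\<integral>x. \<bar>f n x\<bar> powr p \<partial>M) - (\<integral>x. \<bar>f n x - g x\<bar> powr p \<partial>M))
       \<longlonglongrightarrow> (\<integral>x. \<bar>g x\<bar> powr p \<partial>M)"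
proof -
  note [measurable] = meas
  have limp: "AE x in M. (\<lambda>n. \<bar>f n x\<bar> powr p) \<longlonglongrightarrow> \<bar>g x\<bar> powr p"
    using lim by eventually_elim (use p in \<open>auto intro!: tendsto_powr2 tendsto_intros\<close>)
  have limd: "AE x in M. (\<lambda>n. \<bar>f n x - g x\<bar> powr p) \<longlonglongrightarrow> 0"
    using lim
  proof eventually_elim
    case (elim x)
    then have "(\<lambda>n. \<bar>f n x - g x\<bar> powr p) \<longlonglongrightarrow> \<bar>g x - g x\<bar> powr p"
      using p by (intro tendsto_powr2 tendsto_intros) auto
    then show ?case using p by simp
  qed
  show ig: "integrable M (\<lambda>x. \<bar>g x\<bar> powr p)" and gB: "(\<integral>x. \<bar>g x\<bar> powr p \<partial>M) \<le> B"
    using integrable_limit_bound[OF int _ _ limp B] by auto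
  \<comment> \<open>The weight of the convexity inequality at \<open>l = 1/2\<close>, where no
    sharpness is required.\<close>
  define c2 where "c2 = (1/2::real) powr (1 - p)"
  have tri: "\<bar>a - b\<bar> powr p \<le> c2 * \<bar>a\<bar> powr p + c2 * \<bar>b\<bar> powr p" for a b :: real
  proof -
    have "\<bar>a - b\<bar> powr p \<le> (\<bar>a\<bar> + \<bar>b\<bar>) powr p" using p by (intro powr_mono2) auto
    also have "\<dots> \<le> c2 * \<bar>a\<bar> powr p + c2 * \<bar>b\<bar> powr p"
      using powr_add_le_weighted[of "1/2" p "\<bar>a\<bar>" "\<bar>b\<bar>"] p by (simp add: c2_def)
    finally show ?thesis .
  qed
  show id: "integrable M (\<lambda>x. \<bar>f n x - g x\<bar> powr p)" for n
    by (rule Bochner_Integration.integrable_bound[of _ "\<lambda>x. c2 * \<bar>f n x\<bar> powr p + c2 * \<bar>g x\<bar> powr p"])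
       (auto intro!: AE_I2 Bochner_Integration.integrable_add integrable_mult_right int ig
          order_trans[OF tri abs_ge_self])
  define D where "D = B + (c2 * B + c2 * B)"
  have c20: "0 \<le> c2" by (simp add: c2_def)
  have dB: "(\<integral>x. \<bar>f n x - g x\<bar> powr p \<partial>M) \<le> c2 * B + c2 * B" for n
  proof -
    have "(\<integral>x. \<bar>f n x - g x\<bar> powr p \<partial>M) \<le> (\<integral>x. c2 * \<bar>f n x\<bar> powr p + c2 * \<bar>g x\<bar> powr p \<partial>M)"
      by (rule integral_mono) (use tri in \<open>auto intro!: Bochner_Integration.integrable_add integrable_mult_right int ig id\<close>)
    also have "\<dots> = c2 * (\<integral>x. \<bar>f n x\<bar> powr p \<partial>M) + c2 * (\<integral>x. \<bar>g x\<bar> powr p \<partial>M)"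
      using int ig by simp
    also have "\<dots> \<le> c2 * B + c2 * B" using B[of n] gB c20 by (intro add_mono mult_left_mono)
    finally show ?thesis .
  qed
  define I where "I n = (\<integral>x. \<bar>f n x\<bar> powr p \<partial>M)" for n
  define J where "J n = (\<integral>x. \<bar>f n x - g x\<bar> powr p \<partial>M)" for n
  define G where "G = (\<integral>x. \<bar>g x\<bar> powr p \<partial>M)"
  have D0: "0 \<le> D" unfolding D_def using c20 B[of 0]
    by (intro add_nonneg_nonneg mult_nonneg_nonneg) (meson Bochner_Integration.integral_nonneg order_trans powr_ge_zero)+
  have "(\<lambda>n. I n - J n) \<longlonglongrightarrow> G"
  proof (rule LIMSEQ_I)
    fix r :: real assume r: "0 < r"
    \<comment> \<open>This \<open>l\<close> brings the part without majorant,
      \<open>(c - 1) * D\<close>, below \<open>r / 2\<close>; \<open>D + 1\<close> keeps the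
      denominator positive.\<close>
    have "eventually (\<lambda>l. (1 - l) powr (1 - p) < 1 + r / (2 * (D + 1))) (at_right 0)"
      using order_tendstoD(2)[OF weight_tendsto_1] r D0 by simp
    moreover have "eventually (\<lambda>l. l \<in> {0<..<1}) (at_right (0::real))"
      by (rule eventually_at_right_real) simp
    ultimately have "eventually (\<lambda>l. (1 - l) powr (1 - p) < 1 + r / (2 * (D + 1)) \<and> 0 < l \<and> l < 1) (at_right (0::real))"
      by eventually_elim auto
    then obtain l :: real where l: "0 < l" "l < 1" "(1 - l) powr (1 - p) < 1 + r / (2 * (D + 1))"
      using eventually_happens[of _ "at_right (0::real)"] by (auto simp: trivial_limit_at_right_real)
    define c where "c = (1 - l) powr (1 - p)"
    define C where "C = l powr (1 - p)"
    have c1: "0 \<le> c - 1" unfolding c_def using powr_mono'[of "1 - p" 0 "1 - l"] l p by simp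
    \<comment> \<open>Only the part of the defect above the small multiple is kept;
      \<open>abs_powr_diff_bound\<close> caps it by \<open>(C + 1) * |g|^p\<close> uniformly in
      \<open>n\<close>.\<close>
    define W where "W n x = max 0 (\<bar>\<bar>f n x\<bar> powr p - \<bar>f n x - g x\<bar> powr p - \<bar>g x\<bar> powr p\<bar>
        - (c - 1) * (\<bar>f n x\<bar> powr p + \<bar>f n x - g x\<bar> powr p))" for n x
    have W_le: "\<bar>W n x\<bar> \<le> (C + 1) * \<bar>g x\<bar> powr p" for n x
    proof -
      define X Y G t where "X = \<bar>f n x\<bar> powr p" and "Y = \<bar>f n x - g x\<bar> powr p"
        and "G = \<bar>g x\<bar> powr p" and "t = (c - 1) * (X + Y)"
      have "\<bar>X - Y\<bar> \<le> t + C * G" "0 \<le> G" "0 \<le> C * G"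
        using abs_powr_diff_bound[OF l(1,2) p, of "f n x" "g x"]
        unfolding X_def Y_def G_def t_def c_def C_def by (simp_all add: algebra_simps)
      then have "\<bar>max 0 (\<bar>X - Y - G\<bar> - t)\<bar> \<le> C * G + G" by (auto simp: max_def abs_if split: if_splits)
      then show ?thesis unfolding W_def X_def Y_def G_def t_def by (simp add: algebra_simps)
    qed
    have "AE x in M. (\<lambda>n. W n x) \<longlonglongrightarrow> 0"
      using limp limd
    proof eventually_elim
      case (elim x)
      have "(\<lambda>n. W n x) \<longlonglongrightarrow> max 0 (\<bar>\<bar>g x\<bar> powr p - 0 - \<bar>g x\<bar> powr p\<bar> - (c - 1) * (\<bar>g x\<bar> powr p + 0))"
        unfolding W_def by (intro tendsto_intros elim)
      also have "max 0 (\<bar>\<bar>g x\<bar> powr p - 0 - \<bar>g x\<bar> powr p\<bar> - (c - 1) * (\<bar>g x\<bar> powr p + 0)) = 0"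
        using mult_nonneg_nonneg[OF c1 powr_ge_zero[of "\<bar>g x\<bar>" p]] by simp
      finally show ?case .
    qed
    moreover have Wm[measurable]: "W n \<in> borel_measurable M" for n
      unfolding W_def by measurable
    ultimately have W: "(\<lambda>n. \<integral>x. W n x \<partial>M) \<longlonglongrightarrow> (\<integral>x. 0 \<partial>M)"
      by (intro integral_dominated_convergence[where w="\<lambda>x. (C + 1) * \<bar>g x\<bar> powr p"])
         (use ig W_le in \<open>auto simp del: abs_mult\<close>)
    have iW: "integrable M (W n)" for n
      by (rule Bochner_Integration.integrable_bound[of _ "\<lambda>x. (C + 1) * \<bar>g x\<bar> powr p"]) (use ig in \<open>auto intro!: AE_I2 order_trans[OF W_le abs_ge_self]\<close>)
    have le_max: "z \<le> max 0 (z - t) + t" for z t :: real by simp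
    have main: "\<bar>I n - J n - G\<bar> \<le> (\<integral>x. W n x \<partial>M) + (c - 1) * D" for n
    proof -
      have "\<bar>I n - J n - G\<bar> = \<bar>\<integral>x. \<bar>f n x\<bar> powr p - \<bar>f n x - g x\<bar> powr p - \<bar>g x\<bar> powr p \<partial>M\<bar>"
        unfolding I_def J_def G_def using int id ig by simp
      also have "\<dots> \<le> (\<integral>x. \<bar>\<bar>f n x\<bar> powr p - \<bar>f n x - g x\<bar> powr p - \<bar>g x\<bar> powr p\<bar> \<partial>M)"
        by (rule integral_abs_bound)
      also have "\<dots> \<le> (\<integral>x. W n x + (c - 1) * (\<bar>f n x\<bar> powr p + \<bar>f n x - g x\<bar> powr p) \<partial>M)"
        by (rule integral_mono)
           (use int id ig iW le_max in \<open>auto simp: W_def simp del: max_less_iff_conj\<close>)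
      also have "\<dots> = (\<integral>x. W n x \<partial>M) + (c - 1) * (I n + J n)"
        unfolding I_def J_def using int id iW by simp
      also have "\<dots> \<le> (\<integral>x. W n x \<partial>M) + (c - 1) * D"
        unfolding D_def I_def J_def using B[of n] dB[of n] c1 by (intro add_left_mono mult_left_mono) auto
      finally show ?thesis .
    qed
    have "(c - 1) * D \<le> r / (2 * (D + 1)) * D" using l(3) D0 unfolding c_def[symmetric] by (intro mult_right_mono) auto
    also have "\<dots> < r / 2"
      using r D0 by (simp add: field_simps)
    finally have cD: "(c - 1) * D < r / 2" .
    from LIMSEQ_D[OF W, of "r/2"] r obtain N where N: "\<And>n. n \<ge> N \<Longrightarrow> \<bar>\<integral>x. W n x \<partial>M\<bar> < r / 2" by auto
    have "norm (I n - J n - G) < r" if "n \<ge> N" for n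
      using main[of n] N[OF that] cD by simp
    then show "\<exists>N. \<forall>n\<ge>N. norm (I n - J n - G) < r" by blast
  qed
  then show "(\<lambda>n. (\<integral>x. \<bar>f n x\<bar> powr p \<partial>M) - (\<integral>x. \<bar>f n x - g x\<bar> powr p \<partial>M))
       \<longlonglongrightarrow> (\<integral>x. \<bar>g x\<bar> powr p \<partial>M)" by (simp add: I_def J_def G_def)
qed

section \<open>Uniqueness of weak gradients\<close>

text \<open>Positive and negative part are densities of two finite measures that agree on open
  boxes, an intersection-stable generator of the Borel sets, and such densities are unique almost
  everywhere.\<close>

lemma borel_AE_zero_if_box_integrals_zero:
  fixes g :: "'a::euclidean_space \<Rightarrow> real"
  assumes g: "integrable lborel g"
    and zero: "\<And>a b. (\<integral>x. indicator (box a b) x * g x \<partial>lborel) = 0"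
  shows "AE x in lborel. g x = 0"
proof -
  have [measurable]: "g \<in> borel_measurable borel" using g by (simp add: borel_measurable_integrable)
  let ?p = "\<lambda>x. ennreal (max 0 (g x))" and ?m = "\<lambda>x. ennreal (max 0 (- g x))"
  have ip: "integrable lborel (\<lambda>x. max 0 (g x))" and im: "integrable lborel (\<lambda>x. max 0 (- g x))"
    using g by auto
  have eq: "emeasure (density lborel ?p) (box a b) = emeasure (density lborel ?m) (box a b)" for a b
  proof -
    have i: "integrable lborel (\<lambda>x. indicator (box a b) x * max 0 (g x))"
      "integrable lborel (\<lambda>x. indicator (box a b) x * max 0 (- g x))"
      using ip im by (auto intro: integrable_mult_indicator[where 'b=real, simplified])
    have "(\<integral>x. indicator (box a b) x * max 0 (g x) \<partial>lborel) - (\<integral>x. indicator (box a b) x * max 0 (- g x) \<partial>lborel)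
        = (\<integral>x. indicator (box a b) x * g x \<partial>lborel)"
      by (subst Bochner_Integration.integral_diff[OF i, symmetric], rule Bochner_Integration.integral_cong)
         (auto simp: max_def indicator_def)
    then have *: "(\<integral>x. indicator (box a b) x * max 0 (g x) \<partial>lborel) = (\<integral>x. indicator (box a b) x * max 0 (- g x) \<partial>lborel)"
      using zero by simp
    have "emeasure (density lborel ?p) (box a b) = (\<integral>\<^sup>+x. ennreal (indicator (box a b) x * max 0 (g x)) \<partial>lborel)"
      by (simp add: emeasure_density ennreal_mult' ennreal_indicator mult.commute)
    also have "\<dots> = (\<integral>\<^sup>+x. ennreal (indicator (box a b) x * max 0 (- g x)) \<partial>lborel)"
      using * nn_integral_eq_integral[OF i(1)] nn_integral_eq_integral[OF i(2)] by simp
    also have "\<dots> = emeasure (density lborel ?m) (box a b)"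
      by (simp add: emeasure_density ennreal_mult' ennreal_indicator mult.commute)
    finally show ?thesis .
  qed
  have fin: "integral\<^sup>N lborel ?p \<noteq> \<infinity>"
    using nn_integral_eq_integral[OF ip] by simp
  have "density lborel ?p = density lborel ?m"
  proof (rule measure_eqI_generator_eq)
    let ?E = "range (\<lambda>(a, b). box a b::'a set)"
    let ?A = "\<lambda>n::nat. box (- (real n *\<^sub>R One)) (real n *\<^sub>R One) :: 'a set"
    show "Int_stable ?E"
      by (auto simp: Int_stable_def box_Int_box)
    show "?E \<subseteq> Pow UNIV" "sets (density lborel ?p) = sigma_sets UNIV ?E"
       "sets (density lborel ?m) = sigma_sets UNIV ?E"
      by (simp_all add: borel_eq_box)
    show "range ?A \<subseteq> ?E" "(\<Union>i. ?A i) = UNIV"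
      unfolding UN_box_eq_UNIV by auto
    show "emeasure (density lborel ?p) (?A i) \<noteq> \<infinity>" for i
    proof -
      have "emeasure (density lborel ?p) (?A i) \<le> integral\<^sup>N lborel ?p"
        by (subst emeasure_density) (auto intro!: nn_integral_mono simp: indicator_def)
      then show ?thesis using fin by (auto simp: top_unique)
    qed
    show "emeasure (density lborel ?p) X = emeasure (density lborel ?m) X" if "X \<in> ?E" for X
      using that eq by auto
  qed
  then have "AE x in lborel. ?p x = ?m x"
    by (subst (asm) finite_density_unique) (use fin in auto)
  then show ?thesis by eventually_elim (auto simp: max_def split: if_splits)
qed

text \<open>Reduction to the Borel case: a Lebesgue measurable function agrees almost everywhere
  with a Borel function.\<close>

lemma AE_zero_if_box_integrals_zero:
  fixes g :: "'a::euclidean_space \<Rightarrow> real"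
  assumes g: "integrable lebesgue g"
    and zero: "\<And>a b. (\<integral>x. indicator (box a b) x * g x \<partial>lebesgue) = 0"
  shows "AE x in lebesgue. g x = 0"
proof -
  obtain g' where g'[measurable]: "g' \<in> borel_measurable lborel" and eq: "AE x in lborel. g x = g' x"
    using completion_ex_borel_measurable_real[of g lborel] g borel_measurable_integrable by blast
  have eq': "AE x in lebesgue. g x = g' x" using eq by (rule AE_completion)
  have "integrable lebesgue g'"
    by (rule integrable_cong_AE_imp[OF g]) (use eq' in \<open>auto intro: measurable_completion\<close>)
  then have "integrable lborel g'" by (simp add: integrable_completion)
  moreover have "(\<integral>x. indicator (box a b) x * g' x \<partial>lborel) = 0" for a b :: 'a
  proof -
    have "(\<integral>x. indicator (box a b) x * g' x \<partial>lborel) = (\<integral>x. indicator (box a b) x * g' x \<partial>lebesgue)"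
      by (subst integral_completion) auto
    also have "\<dots> = (\<integral>x. indicator (box a b) x * g x \<partial>lebesgue)"
    proof (rule integral_cong_AE)
      show "AE x in lebesgue. indicator (box a b) x * g' x = indicator (box a b) x * g x"
        using eq' by eventually_elim simp
    qed (use borel_measurable_integrable[OF g] measurable_completion[OF g'] in
          \<open>auto intro!: borel_measurable_times borel_measurable_indicator\<close>)
    finally show ?thesis using zero by simp
  qed
  ultimately have "AE x in lborel. g' x = 0" by (rule borel_AE_zero_if_box_integrals_zero)
  from AE_completion[OF this] eq' show ?thesis by eventually_elim simp
qed

text \<open>Both gradients have the same pairing with each \<open>box_cutoff\<close>. Shrinking the
  transition layer turns the cut-off into the indicator of the open box.\<close>

lemma weak_gradient_box_integral_eq:
  fixes \<Omega> :: "'a::euclidean_space set"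
  assumes w: "has_weak_gradient_on f g1 \<Omega>" "has_weak_gradient_on f g2 \<Omega>"
    and sub: "cbox a b \<subseteq> \<Omega>" and open': "open \<Omega>" and i: "i \<in> Basis"
  shows "integrable lebesgue (\<lambda>x. indicator (box a b) x * ((g1 x - g2 x) \<bullet> i))"
    and "(\<integral>x. indicator (box a b) x * ((g1 x - g2 x) \<bullet> i) \<partial>lebesgue) = 0"
proof -
  have int: "integrable lebesgue (\<lambda>x. indicator (cbox a b) x * (g x \<bullet> i))"
    if "has_weak_gradient_on f g \<Omega>" for g
  proof -
    have "g absolutely_integrable_on cbox a b"
      using that sub compact_cbox by (auto simp: has_weak_gradient_on_def locally_integrable_on_def)
    then have "integrable lebesgue (\<lambda>x. (indicator (cbox a b) x *\<^sub>R g x) \<bullet> i)"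
      unfolding set_integrable_def by (rule integrable_inner_left)
    then show ?thesis by simp
  qed
  \<comment> \<open>The gradients are only locally integrable; truncation to the closed box gives a
    globally integrable function, which also serves as majorant.\<close>
  define h where "h x = indicator (cbox a b) x * ((g1 x - g2 x) \<bullet> i)" for x
  have h: "integrable lebesgue h"
    unfolding h_def using Bochner_Integration.integrable_diff[OF int[OF w(1)] int[OF w(2)]]
    by (simp add: inner_diff_left algebra_simps)
  have open_lebesgue: "\<Omega> \<inter> space lebesgue \<in> sets lebesgue" using open' by simp
  have z: "(\<integral>x. box_cutoff \<epsilon> a b x * h x \<partial>lebesgue) = 0" and zi: "integrable lebesgue (\<lambda>x. box_cutoff \<epsilon> a b x * h x)" if e: "\<epsilon> > 0" for \<epsilon>
  proof -
    have meas: "box_cutoff \<epsilon> a b \<in> borel_measurable lebesgue"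
      using Ck_box_cutoff[of 0 \<epsilon> a b]
      by (intro measurable_completion) (simp add: borel_measurable_continuous_onI)
    have bint: "integrable lebesgue (\<lambda>x. box_cutoff \<epsilon> a b x * k x)" if "integrable lebesgue k" for k :: "'a \<Rightarrow> real"
    proof (rule Bochner_Integration.integrable_bound[OF that])
      show "(\<lambda>x. box_cutoff \<epsilon> a b x * k x) \<in> borel_measurable lebesgue"
        using meas that by auto
      show "AE x in lebesgue. norm (box_cutoff \<epsilon> a b x * k x) \<le> norm (k x)"
        using box_cutoff_bounds[of \<epsilon> a b] by (auto simp: abs_mult intro!: mult_left_le_one_le)
    qed
    have rw: "(\<integral>x. (g x \<bullet> i) * box_cutoff \<epsilon> a b x \<partial>lebesgue_on \<Omega>)
        = (\<integral>x. box_cutoff \<epsilon> a b x * (indicator (cbox a b) x * (g x \<bullet> i)) \<partial>lebesgue)" for g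
      unfolding integral_restrict_space[OF open_lebesgue]
    proof (rule Bochner_Integration.integral_cong[OF refl])
      fix x show "indicator \<Omega> x *\<^sub>R ((g x \<bullet> i) * box_cutoff \<epsilon> a b x) =
          box_cutoff \<epsilon> a b x * (indicator (cbox a b) x * (g x \<bullet> i))"
        using box_cutoff_eq_0[OF e, of x a b] subsetD[OF sub, of x] by (cases "x \<in> cbox a b") auto
    qed
    have "(\<integral>x. (g1 x \<bullet> i) * box_cutoff \<epsilon> a b x \<partial>lebesgue_on \<Omega>) =
          (\<integral>x. (g2 x \<bullet> i) * box_cutoff \<epsilon> a b x \<partial>lebesgue_on \<Omega>)"
    proof -
      have "- (\<integral>x. (g1 x \<bullet> i) * box_cutoff \<epsilon> a b x \<partial>lebesgue_on \<Omega>) =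
            - (\<integral>x. (g2 x \<bullet> i) * box_cutoff \<epsilon> a b x \<partial>lebesgue_on \<Omega>)"
        using w[unfolded has_weak_gradient_on_def, THEN conjunct2, THEN conjunct2,
            THEN bspec, OF box_cutoff_test[OF e sub], THEN bspec, OF i] by (rule trans[OF sym])
      then show ?thesis by simp
    qed
    then show "(\<integral>x. box_cutoff \<epsilon> a b x * h x \<partial>lebesgue) = 0"
      unfolding rw using Bochner_Integration.integral_diff[OF bint[OF int[OF w(1)]] bint[OF int[OF w(2)]]]
      by (simp add: h_def inner_diff_left algebra_simps)
    show "integrable lebesgue (\<lambda>x. box_cutoff \<epsilon> a b x * h x)" by (rule bint[OF h])
  qed
  have eq: "indicator (box a b) x * h x = indicator (box a b) x * ((g1 x - g2 x) \<bullet> i)" for x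
    using box_subset_cbox[of a b] by (auto simp: h_def indicator_def)
  show "integrable lebesgue (\<lambda>x. indicator (box a b) x * ((g1 x - g2 x) \<bullet> i))"
    using integrable_mult_indicator[OF _ h, of "box a b"] by (simp add: eq)
  have "(\<lambda>n. \<integral>x. box_cutoff (1 / Suc n) a b x * h x \<partial>lebesgue) \<longlonglongrightarrow>
        (\<integral>x. indicator (box a b) x * h x \<partial>lebesgue)"
  proof (rule integral_dominated_convergence[where w="\<lambda>x. norm (h x)"])
    show "AE x in lebesgue. (\<lambda>n. box_cutoff (1 / Suc n) a b x * h x) \<longlonglongrightarrow> indicator (box a b) x * h x"
      by (intro AE_I2 tendsto_intros box_cutoff_tendsto_indicator LIMSEQ_Suc[OF lim_1_over_n]) auto
    show "AE x in lebesgue. norm (box_cutoff (1 / Suc n) a b x * h x) \<le> norm (h x)" for n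
      using box_cutoff_bounds[of "1 / Suc n" a b] by (auto simp: abs_mult intro!: mult_left_le_one_le)
    show "(\<lambda>x. box_cutoff (1 / real (Suc n)) a b x * h x) \<in> borel_measurable lebesgue" for n
      using zi[of "1 / Suc n"] by (auto dest: borel_measurable_integrable)
  qed (use h in \<open>auto intro!: borel_measurable_times borel_measurable_indicator\<close>)
  moreover have "(\<integral>x. box_cutoff (1 / Suc n) a b x * h x \<partial>lebesgue) = 0" for n by (rule z) simp
  ultimately show "(\<integral>x. indicator (box a b) x * ((g1 x - g2 x) \<bullet> i) \<partial>lebesgue) = 0"
    unfolding eq by (simp add: LIMSEQ_const_iff)
qed

text \<open>\<open>weak_gradient\<close> is an arbitrary choice, so nothing can be computed from it
  directly. Uniqueness lets any explicit gradient replace it under an integral.\<close>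

lemma weak_gradient_unique:
  fixes \<Omega> :: "'a::euclidean_space set"
  assumes "open \<Omega>" "has_weak_gradient_on f g1 \<Omega>" "has_weak_gradient_on f g2 \<Omega>"
  shows "AE x in lebesgue. x \<in> \<Omega> \<longrightarrow> g1 x = g2 x"
proof -
  have on_box: "AE x in lebesgue. x \<in> cbox c d \<longrightarrow> g1 x = g2 x" if sub: "cbox c d \<subseteq> \<Omega>" for c d
  proof -
    have comp: "AE x in lebesgue. indicator (box c d) x * ((g1 x - g2 x) \<bullet> i) = 0" if i: "i \<in> Basis" for i
    proof (rule AE_zero_if_box_integrals_zero)
      show "integrable lebesgue (\<lambda>x. indicator (box c d) x * ((g1 x - g2 x) \<bullet> i))"
        by (rule weak_gradient_box_integral_eq(1)[OF assms(2,3) sub assms(1) i])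
      fix a b :: 'a
      \<comment> \<open>The truncated difference is tested on an arbitrary box; the intersection
        with the given box is again a box, whose closed version still lies in \<Omega>.\<close>
      obtain a' b' where ab: "box a b \<inter> box c d = box a' b'" "cbox a b \<inter> cbox c d = cbox a' b'"
        using that[OF box_Int_box Int_interval] .
      have "(\<integral>x. indicator (box a b) x * (indicator (box c d) x * ((g1 x - g2 x) \<bullet> i)) \<partial>lebesgue)
          = (\<integral>x. indicator (box a' b') x * ((g1 x - g2 x) \<bullet> i) \<partial>lebesgue)"
        by (rule Bochner_Integration.integral_cong) (auto simp: ab(1)[symmetric] indicator_def)
      also have "\<dots> = 0"
        by (rule weak_gradient_box_integral_eq(2)[OF assms(2,3) _ assms(1) i]) (use ab(2) sub in auto)
      finally show "(\<integral>x. indicator (box a b) x * (indicator (box c d) x * ((g1 x - g2 x) \<bullet> i)) \<partial>lebesgue) = 0" .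
    qed
    have ae1: "AE x in lebesgue. \<forall>i\<in>Basis. indicator (box c d) x * ((g1 x - g2 x) \<bullet> i) = 0"
      by (rule AE_finite_allI[OF finite_Basis comp])
    have ae2: "AE x in lebesgue. x \<notin> cbox c d - box c d"
      by (intro AE_not_in) (simp add: negligible_iff_null_sets[symmetric] negligible_frontier_interval)
    have eqI: "g1 x = g2 x"
      if "\<forall>i\<in>Basis. indicator (box c d) x * ((g1 x - g2 x) \<bullet> i) = 0"
        "x \<notin> cbox c d - box c d" "x \<in> cbox c d" for x
    proof -
      have "indicator (box c d) x = (1::real)" using that(2,3) by simp
      with that(1) have "\<forall>i\<in>Basis. (g1 x - g2 x) \<bullet> i = 0" by simp
      then have "g1 x - g2 x = 0" unfolding euclidean_all_zero_iff .
      then show ?thesis by simp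
    qed
    show ?thesis
      using ae1 ae2
    proof eventually_elim
      case (elim x)
      show ?case by (rule impI, rule eqI[OF elim])
    qed
  qed
  \<comment> \<open>An open set is a countable union of closed boxes, which keeps the exceptional
    set null.\<close>
  obtain D where D: "countable D" "D \<subseteq> Pow \<Omega>" "\<And>X. X \<in> D \<Longrightarrow> \<exists>a b. X = cbox a b" "\<Union>D = \<Omega>"
    by (rule open_countable_Union_open_cbox[OF assms(1)], rule that)
  have "AE x in lebesgue. x \<in> X \<longrightarrow> g1 x = g2 x" if X: "X \<in> D" for X
  proof -
    obtain a b where ab: "X = cbox a b" using D(3)[OF X] by blast
    have "X \<subseteq> \<Omega>" using subsetD[OF D(2) X] by simp
    then show ?thesis unfolding ab by (rule on_box)
  qed
  then have "AE x in lebesgue. \<forall>X\<in>D. x \<in> X \<longrightarrow> g1 x = g2 x"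
    by (rule AE_ball_countable'[OF _ D(1)])
  then show ?thesis
  proof eventually_elim
    case (elim x)
    show ?case
    proof
      assume "x \<in> \<Omega>"
      then have "x \<in> \<Union>D" unfolding D(4) .
      then obtain X where "X \<in> D" "x \<in> X" by (rule UnionE)
      then show "g1 x = g2 x" by (rule bspec[OF elim, THEN mp])
    qed
  qed
qed

section \<open>Dyadic energies and one-dimensional Sobolev functions\<close>

lemma integral_Cauchy_Schwarz:
  fixes u v :: "'a \<Rightarrow> real"
  assumes [measurable]: "u \<in> borel_measurable M" "v \<in> borel_measurable M"
    and u: "integrable M (\<lambda>x. (u x)\<^sup>2)" and v: "integrable M (\<lambda>x. (v x)\<^sup>2)"
  shows "integrable M (\<lambda>x. u x * v x)"
    and "(\<integral>x. u x * v x \<partial>M)\<^sup>2 \<le> (\<integral>x. (u x)\<^sup>2 \<partial>M) * (\<integral>x. (v x)\<^sup>2 \<partial>M)"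
proof -
  show i: "integrable M (\<lambda>x. u x * v x)"
  proof (rule Bochner_Integration.integrable_bound[of _ "\<lambda>x. (u x)\<^sup>2 + (v x)\<^sup>2"])
    have "\<bar>u x * v x\<bar> \<le> (u x)\<^sup>2 + (v x)\<^sup>2" for x
      
    proof -
      have "2 * \<bar>u x\<bar> * \<bar>v x\<bar> \<le> (u x)\<^sup>2 + (v x)\<^sup>2" using sum_squares_bound[of "\<bar>u x\<bar>" "\<bar>v x\<bar>"] by simp
      moreover have "0 \<le> \<bar>u x\<bar> * \<bar>v x\<bar>" by simp
      ultimately show ?thesis unfolding abs_mult by linarith
    qed
    then show "AE x in M. norm (u x * v x) \<le> norm ((u x)\<^sup>2 + (v x)\<^sup>2)" by simp
  qed (use u v in auto)
  have "(\<integral>\<^sup>+x. ennreal \<bar>u x\<bar> * ennreal \<bar>v x\<bar> \<partial>M)\<^sup>2 \<le>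
      (\<integral>\<^sup>+x. (ennreal \<bar>u x\<bar>)\<^sup>2 \<partial>M) * (\<integral>\<^sup>+x. (ennreal \<bar>v x\<bar>)\<^sup>2 \<partial>M)"
    by (rule Cauchy_Schwarz_nn_integral) auto
  also have "(\<integral>\<^sup>+x. (ennreal \<bar>u x\<bar>)\<^sup>2 \<partial>M) = ennreal (\<integral>x. (u x)\<^sup>2 \<partial>M)"
    by (subst nn_integral_eq_integral[OF u, symmetric]) (auto simp: ennreal_power)
  also have "(\<integral>\<^sup>+x. (ennreal \<bar>v x\<bar>)\<^sup>2 \<partial>M) = ennreal (\<integral>x. (v x)\<^sup>2 \<partial>M)"
    by (subst nn_integral_eq_integral[OF v, symmetric]) (auto simp: ennreal_power)
  also have "(\<integral>\<^sup>+x. ennreal \<bar>u x\<bar> * ennreal \<bar>v x\<bar> \<partial>M) = ennreal (\<integral>x. \<bar>u x * v x\<bar> \<partial>M)"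
    unfolding nn_integral_eq_integral[OF integrable_abs[OF i] AE_I2[OF abs_ge_zero], symmetric]
    by (simp add: ennreal_mult abs_mult)
  finally have "(\<integral>x. \<bar>u x * v x\<bar> \<partial>M)\<^sup>2 \<le> (\<integral>x. (u x)\<^sup>2 \<partial>M) * (\<integral>x. (v x)\<^sup>2 \<partial>M)"
    by (simp add: ennreal_power ennreal_mult[symmetric])
  moreover have "(\<integral>x. u x * v x \<partial>M)\<^sup>2 \<le> (\<integral>x. \<bar>u x * v x\<bar> \<partial>M)\<^sup>2"
    using integral_abs_bound[of M "\<lambda>x. u x * v x"] by (simp add: abs_le_square_iff[symmetric])
  ultimately show "(\<integral>x. u x * v x \<partial>M)\<^sup>2 \<le> (\<integral>x. (u x)\<^sup>2 \<partial>M) * (\<integral>x. (v x)\<^sup>2 \<partial>M)" by simp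
qed

section \<open>Step functions on uniform meshes of the unit interval\<close>

definition step_fun :: "nat \<Rightarrow> (nat \<Rightarrow> real) \<Rightarrow> real \<Rightarrow> real" where
  "step_fun N F t = (\<Sum>i<N. F i * indicator {real i / N..<(real i + 1) / N} t)"

lemma step_fun_measurable [measurable]: "step_fun N F \<in> borel_measurable borel"
  unfolding step_fun_def by measurable

text \<open>The cells are half-open, hence disjoint, and exactly one summand survives. Pointwise
  algebra of step functions thereby becomes algebra of their coefficients.\<close>

lemma step_fun_eq:
  assumes "i < N" "t \<in> {real i / N..<(real i + 1) / N}"
  shows "step_fun N F t = F i"
proof -
  have "step_fun N F t = (\<Sum>j<N. if j = i then F i else 0)"
    unfolding step_fun_def
  proof (rule sum.cong[OF refl])
    fix j assume "j \<in> {..<N}"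
    have ji: "j = i" if "t \<in> {real j / N..<(real j + 1) / N}"
    proof -
      have "real j / N < (real i + 1) / N" "real i / N < (real j + 1) / N"
        using that assms(2) unfolding atLeastLessThan_iff by linarith+
      then have "real j < real i + 1" "real i < real j + 1"
        using assms(1) by (simp_all add: divide_less_cancel)
      then show ?thesis by linarith
    qed
    show "F j * indicator {real j / N..<(real j + 1) / N} t = (if j = i then F i else 0)"
    proof (cases "j = i")
      case True then show ?thesis using assms(2) by (simp del: atLeastLessThan_iff)
    next
      case False
      then have "t \<notin> {real j / N..<(real j + 1) / N}" using ji by blast
      then show ?thesis using False by (simp del: atLeastLessThan_iff)
    qed
  qed
  then show ?thesis using assms by simp
qed

lemma step_fun_outside: "t \<notin> {0..<1} \<Longrightarrow> step_fun N F t = 0"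
proof -
  assume t: "t \<notin> {0..<1}"
  have "t \<notin> {real i / N..<(real i + 1) / N}" if "i < N" for i
  proof
    assume "t \<in> {real i / N..<(real i + 1) / N}"
    moreover have "(real i + 1) / N \<le> 1" "0 \<le> real i / N" using that by (auto simp: field_simps)
    ultimately have "0 \<le> t" "t < 1" unfolding atLeastLessThan_iff by linarith+
    then show False using t by simp
  qed
  then show ?thesis unfolding step_fun_def by (intro sum.neutral) auto
qed

lemma step_fun_piece:
  assumes "N > 0" "t \<in> {0..<1}"
  obtains i where "i < N" "t \<in> {real i / N..<(real i + 1) / N}"
proof
  let ?i = "nat \<lfloor>N * t\<rfloor>"
  have *: "real ?i \<le> N * t" "N * t < real ?i + 1" using assms by (auto simp: of_nat_nat)
  then show "t \<in> {real ?i / N..<(real ?i + 1) / N}" using assms by (auto simp: field_simps)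
  have "N * t < N" using assms by simp
  then show "?i < N" using * by linarith
qed

lemma step_fun_pointwise:
  assumes "N > 0" "t \<in> {0..<1}"
  shows "\<exists>i<N. \<forall>F. step_fun N F t = F i"
  by (rule step_fun_piece[OF assms]) (use step_fun_eq in blast)

text \<open>The condition \<open>h 0 0 = 0\<close> takes care of the points outside
  \<open>{0..<1}\<close>, where every step function vanishes.\<close>

lemma step_fun_compose2:
  assumes "\<And>i. H i = h (F i) (G i)" "h 0 0 = 0"
  shows "h (step_fun N F t) (step_fun N G t) = step_fun N H t"
proof (cases "t \<in> {0..<1} \<and> N > 0")
  case True
  then obtain i where "\<And>F. step_fun N F t = F i" using step_fun_pointwise[of N t] by blast
  then show ?thesis using assms(1) by simp
next
  case False
  then consider "t \<notin> {0..<1}" | "N = 0" by blast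
  then show ?thesis by cases (use assms in \<open>simp_all add: step_fun_outside, simp add: step_fun_def\<close>)
qed

text \<open>Cell \<open>j\<close> of the finer mesh lies in cell \<open>j div K\<close> of the
  coarser one.\<close>

lemma step_fun_refine:
  assumes "K > 0"
  shows "step_fun N F t = step_fun (N * K) (\<lambda>j. F (j div K)) t"
proof (cases "t \<in> {0..<1} \<and> N > 0")
  case True
  with assms have NK: "N * K > 0" by simp
  obtain j where j: "j < N * K" "t \<in> {real j / (N * K)..<(real j + 1) / (N * K)}"
    using step_fun_piece[OF NK] True by auto
  define i r where "i = j div K" and "r = j mod K"
  have ji: "j = i * K + r" and r: "r < K" using assms by (simp_all add: i_def r_def)
  have rj: "real j = real i * K + r" "real r + 1 \<le> K" using ji r by auto
  have iN: "i < N" using j(1) unfolding i_def by (simp add: less_mult_imp_div_less)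
  have "real i / N \<le> t"
  proof -
    have "real i / N = (real i * K) / (N * K)" using assms by simp
    also have "\<dots> \<le> real j / (N * K)" using rj by (intro divide_right_mono) auto
    finally show ?thesis using j(2) by auto
  qed
  moreover have "t < (real i + 1) / N"
  proof -
    have "(real j + 1) / (N * K) \<le> ((real i + 1) * K) / (N * K)" using rj by (intro divide_right_mono) (auto simp: algebra_simps)
    also have "\<dots> = (real i + 1) / N" using assms by simp
    finally show ?thesis using j(2) by auto
  qed
  ultimately have "step_fun N F t = F i" by (intro step_fun_eq iN) auto
  moreover have "step_fun (N * K) (\<lambda>j. F (j div K)) t = F i"
    using step_fun_eq[of j "N * K" t "\<lambda>j. F (j div K)"] j by (simp add: i_def)
  ultimately show ?thesis by simp
next
  case False
  then consider "t \<notin> {0..<1}" | "N = 0" by blast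
  then show ?thesis by cases (simp_all add: step_fun_outside, simp add: step_fun_def)
qed

lemma integral_step_fun:
  assumes "N > 0"
  shows "integrable lborel (step_fun N F)" "(\<integral>t. step_fun N F t \<partial>lborel) = (\<Sum>i<N. F i) / N"
proof -
  have "has_bochner_integral lborel (\<lambda>t. F i * indicator {real i / N..<(real i + 1) / N} t) (F i / N)" if "i < N" for i
  proof -
    have le: "real i / N \<le> (real i + 1) / N" by (rule divide_right_mono) auto
    have "emeasure lborel {real i / N..<(real i + 1) / N} = ennreal ((real i + 1) / N - real i / N)"
      by (rule emeasure_lborel_Ico[OF le])
    then have "has_bochner_integral lborel (indicator {real i / N..<(real i + 1) / N}) (measure lborel {real i / N..<(real i + 1) / N})"
      by (intro has_bochner_integral_real_indicator) simp_all
    also have "measure lborel {real i / N..<(real i + 1) / N} = 1 / N"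
      unfolding measure_lborel_Ico[OF le] by (simp add: add_divide_distrib)
    finally have "has_bochner_integral lborel (indicator {real i / N..<(real i + 1) / N} :: real \<Rightarrow> real) (1 / N)" .
    from has_bochner_integral_mult_right[OF this, of "F i"] show ?thesis by simp
  qed
  then have "has_bochner_integral lborel (step_fun N F) (\<Sum>i<N. F i / N)"
    unfolding step_fun_def[abs_def] by (intro has_bochner_integral_sum) auto
  then show "integrable lborel (step_fun N F)" "(\<integral>t. step_fun N F t \<partial>lborel) = (\<Sum>i<N. F i) / N"
    by (auto simp: has_bochner_integral_iff sum_divide_distrib)
qed

text \<open>The energy of the piecewise linear interpolation of \<open>f\<close> on the dyadic mesh of level \<open>m\<close>. It increases with \<open>m\<close>,
  and \<open>f\<close>, if continuous, is in \<open>H1 {0<..<1}\<close> iff it stays bounded, the limit then being the integral of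
  \<open>(f')\<^sup>2\<close>. Weak derivatives can thus be avoided in all limit arguments.\<close>

definition dyadic_energy :: "nat \<Rightarrow> (real \<Rightarrow> real) \<Rightarrow> real" where
  "dyadic_energy m f = 2 ^ m * (\<Sum>i<2^m. (f ((real i + 1) / 2 ^ m) - f (real i / 2 ^ m))\<^sup>2)"

definition dyadic_slope :: "nat \<Rightarrow> (real \<Rightarrow> real) \<Rightarrow> nat \<Rightarrow> real" where
  "dyadic_slope m f i = 2 ^ m * (f ((real i + 1) / 2 ^ m) - f (real i / 2 ^ m))"

abbreviation dyadic_deriv :: "nat \<Rightarrow> (real \<Rightarrow> real) \<Rightarrow> real \<Rightarrow> real" where
  "dyadic_deriv m f \<equiv> step_fun (2 ^ m) (dyadic_slope m f)"

text \<open>Inside one coarse cell the fine increments telescope to the coarse increment. In other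
  words, the coarse derivative is the conditional expectation of the finer one with respect to the
  coarse mesh.\<close>

lemma step_fun_times_dyadic_deriv:
  assumes "m \<le> l"
  shows "integrable lborel (\<lambda>t. step_fun (2 ^ m) G t * dyadic_deriv l f t)"
    and "(\<integral>t. step_fun (2 ^ m) G t * dyadic_deriv l f t \<partial>lborel) =
         (\<Sum>i<2^m. G i * (f ((real i + 1) / 2 ^ m) - f (real i / 2 ^ m)))"
proof -
  define K :: nat where "K = 2 ^ (l - m)"
  have K: "K > 0" and NK: "2 ^ l = 2 ^ m * K" and NKr: "(2::real) ^ l = 2 ^ m * real K"
    using assms by (simp_all add: K_def flip: power_add)
  have eq: "step_fun (2 ^ m) G t * dyadic_deriv l f t = step_fun (2 ^ l) (\<lambda>j. G (j div K) * dyadic_slope l f j) t" for t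
    unfolding step_fun_refine[OF K, of "2^m" G] NK
    by (rule step_fun_compose2[where h="(*)"]) auto
  show "integrable lborel (\<lambda>t. step_fun (2 ^ m) G t * dyadic_deriv l f t)"
    unfolding eq by (rule integral_step_fun) simp
  define \<phi> where "\<phi> j = f (real j / 2 ^ l)" for j :: nat
  have "(\<integral>t. step_fun (2 ^ m) G t * dyadic_deriv l f t \<partial>lborel) = (\<Sum>j<2^l. G (j div K) * dyadic_slope l f j) / 2 ^ l"
    unfolding eq by (subst integral_step_fun) simp_all
  also have "\<dots> = (\<Sum>j<2^m * K. G (j div K) * (\<phi> (Suc j) - \<phi> j))"
    unfolding NK[symmetric] by (simp add: sum_divide_distrib dyadic_slope_def \<phi>_def add.commute)
  also have "\<dots> = (\<Sum>i<2^m. \<Sum>j\<in>{i * K..<i * K + K}. G (j div K) * (\<phi> (Suc j) - \<phi> j))"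
    by (rule sum.nat_group[symmetric])
  also have "\<dots> = (\<Sum>i<2^m. G i * (f ((real i + 1) / 2 ^ m) - f (real i / 2 ^ m)))"
  proof (rule sum.cong[OF refl])
    fix i :: nat
    have "(\<Sum>j\<in>{i * K..<i * K + K}. G (j div K) * (\<phi> (Suc j) - \<phi> j)) = (\<Sum>j\<in>{i * K..<i * K + K}. G i * (\<phi> (Suc j) - \<phi> j))"
    proof (rule sum.cong[OF refl])
      fix j assume "j \<in> {i * K..<i * K + K}"
      then have "j div K = i" by (intro div_nat_eqI) (auto simp: algebra_simps)
      then show "G (j div K) * (\<phi> (Suc j) - \<phi> j) = G i * (\<phi> (Suc j) - \<phi> j)" by simp
    qed
    also have "\<dots> = G i * (\<phi> (i * K + K) - \<phi> (i * K))"
      by (simp add: sum_Suc_diff' flip: sum_distrib_left)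
    also have "\<phi> (i * K + K) = f ((real i + 1) / 2 ^ m)"
    proof -
      have "real (i * K + K) / 2 ^ l = (real i + 1) / 2 ^ m" using K unfolding NKr by (simp add: field_simps)
      then show ?thesis by (simp add: \<phi>_def)
    qed
    also have "\<phi> (i * K) = f (real i / 2 ^ m)"
    proof -
      have "real (i * K) / 2 ^ l = real i / 2 ^ m" using K unfolding NKr by simp
      then show ?thesis by (simp add: \<phi>_def)
    qed
    finally show "(\<Sum>j\<in>{i * K..<i * K + K}. G (j div K) * (\<phi> (Suc j) - \<phi> j)) =
        G i * (f ((real i + 1) / 2 ^ m) - f (real i / 2 ^ m))" .
  qed
  finally show "(\<integral>t. step_fun (2 ^ m) G t * dyadic_deriv l f t \<partial>lborel) =
         (\<Sum>i<2^m. G i * (f ((real i + 1) / 2 ^ m) - f (real i / 2 ^ m)))" .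
qed

lemma dyadic_deriv_inner:
  assumes "m \<le> l"
  shows "(\<integral>t. dyadic_deriv m f t * dyadic_deriv l f t \<partial>lborel) = dyadic_energy m f"
  unfolding step_fun_times_dyadic_deriv(2)[OF assms]
  by (simp add: dyadic_energy_def dyadic_slope_def sum_distrib_left power2_eq_square mult.assoc)

text \<open>Pythagoras: by \<open>dyadic_deriv_inner\<close> the coarse derivative is the orthogonal
  projection of the finer one. Monotonicity of the energies and the Cauchy property of the
  derivatives both rest on this identity.\<close>

lemma dyadic_deriv_diff:
  assumes "m \<le> l"
  shows "integrable lborel (\<lambda>t. (dyadic_deriv l f t - dyadic_deriv m f t)\<^sup>2)"
    and "(\<integral>t. (dyadic_deriv l f t - dyadic_deriv m f t)\<^sup>2 \<partial>lborel) = dyadic_energy l f - dyadic_energy m f"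
proof -
  have eq: "(dyadic_deriv l f t - dyadic_deriv m f t)\<^sup>2 =
     dyadic_deriv l f t * dyadic_deriv l f t - 2 * (dyadic_deriv m f t * dyadic_deriv l f t)
     + dyadic_deriv m f t * dyadic_deriv m f t" for t
    by (simp add: power2_eq_square algebra_simps)
  note i = step_fun_times_dyadic_deriv(1)[OF order_refl, of l "dyadic_slope l f" f]
    step_fun_times_dyadic_deriv(1)[OF assms, of "dyadic_slope m f" f]
    step_fun_times_dyadic_deriv(1)[OF order_refl, of m "dyadic_slope m f" f]
  show "integrable lborel (\<lambda>t. (dyadic_deriv l f t - dyadic_deriv m f t)\<^sup>2)"
    unfolding eq using i by simp
  show "(\<integral>t. (dyadic_deriv l f t - dyadic_deriv m f t)\<^sup>2 \<partial>lborel) = dyadic_energy l f - dyadic_energy m f"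
    unfolding eq using i by (simp add: dyadic_deriv_inner assms)
qed

lemma dyadic_energy_mono: "m \<le> l \<Longrightarrow> dyadic_energy m f \<le> dyadic_energy l f"
  using dyadic_deriv_diff(2)[of m l f]
    Bochner_Integration.integral_nonneg[of lborel "\<lambda>t. (dyadic_deriv l f t - dyadic_deriv m f t)\<^sup>2"] by simp

lemma dyadic_energy_nonneg: "0 \<le> dyadic_energy m f"
  by (simp add: dyadic_energy_def sum_nonneg)

text \<open>Cauchy--Schwarz against the indicator of an interval of length 1; it converts mean
  square convergence into convergence in mean.\<close>

lemma L1_le_L2_unit_interval:
  fixes h :: "real \<Rightarrow> real"
  assumes [measurable]: "h \<in> borel_measurable borel" and out: "\<And>t. t \<notin> {0..<1} \<Longrightarrow> h t = 0"
    and sq: "integrable lborel (\<lambda>t. (h t)\<^sup>2)"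
  shows "integrable lborel h" "(\<integral>t. \<bar>h t\<bar> \<partial>lborel)\<^sup>2 \<le> (\<integral>t. (h t)\<^sup>2 \<partial>lborel)"
proof -
  have ind: "(indicator {0..<1} t :: real)\<^sup>2 = indicator {0..<1} t" for t :: real by (simp add: indicator_def)
  have i: "integrable lborel (\<lambda>t. (indicator {0..<1::real} t :: real)\<^sup>2)" "(\<integral>t. (indicator {0..<1::real} t :: real)\<^sup>2 \<partial>lborel) = 1"
    unfolding ind by simp_all
  have eq: "\<bar>h t\<bar> * indicator {0..<1} t = \<bar>h t\<bar>" for t using out[of t] by (auto simp: indicator_def)
  have "integrable lborel (\<lambda>t. (\<bar>h t\<bar>)\<^sup>2)" using sq by simp
  note cs = integral_Cauchy_Schwarz[of "\<lambda>t. \<bar>h t\<bar>" lborel "indicator {0..<1}", OF _ _ this i(1), unfolded eq]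
  show "integrable lborel h" using cs(1) by (simp add: integrable_abs_iff)
  show "(\<integral>t. \<bar>h t\<bar> \<partial>lborel)\<^sup>2 \<le> (\<integral>t. (h t)\<^sup>2 \<partial>lborel)" using cs(2) i(2) by simp
qed

lemma interval_integral_Cauchy_Schwarz:
  fixes g :: "real \<Rightarrow> real"
  assumes [measurable]: "g \<in> borel_measurable borel" and sq: "integrable lborel (\<lambda>t. (g t)\<^sup>2)" and st: "s \<le> t"
  shows "integrable lborel (\<lambda>x. indicator {s..<t} x * g x)"
    and "(\<integral>x. indicator {s..<t} x * g x \<partial>lborel)\<^sup>2 \<le> (t - s) * (\<integral>x. indicator {s..<t} x * (g x)\<^sup>2 \<partial>lborel)"
proof -
  have ind: "(indicator {s..<t} x :: real)\<^sup>2 = indicator {s..<t} x" for x by (simp add: indicator_def)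
  have i: "integrable lborel (\<lambda>x. (indicator {s..<t} x :: real)\<^sup>2)" "(\<integral>x. (indicator {s..<t} x :: real)\<^sup>2 \<partial>lborel) = t - s"
    unfolding ind using st by simp_all
  have sq': "integrable lborel (\<lambda>x. (indicator {s..<t} x * g x)\<^sup>2)"
    using integrable_mult_indicator[OF _ sq, of "{s..<t}"] by (simp add: power_mult_distrib ind)
  have eq: "indicator {s..<t} x * (indicator {s..<t} x * g x) = indicator {s..<t} x * g x" for x
    by (simp add: indicator_def)
  note cs = integral_Cauchy_Schwarz[of "indicator {s..<t}" lborel "\<lambda>x. indicator {s..<t} x * g x", OF _ _ i(1) sq', unfolded eq i(2)]
  show "integrable lborel (\<lambda>x. indicator {s..<t} x * g x)" using cs(1) by simp
  show "(\<integral>x. indicator {s..<t} x * g x \<partial>lborel)\<^sup>2 \<le> (t - s) * (\<integral>x. indicator {s..<t} x * (g x)\<^sup>2 \<partial>lborel)"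
    using cs(2) by (simp add: power_mult_distrib ind)
qed

text \<open>The indicator of an interval from 0 to a dyadic point of level \<open>p\<close> is
  itself a step function of level \<open>p\<close>, so the pairing formula applies at every finer
  level and telescopes.\<close>

lemma integral_dyadic_deriv_upto:
  assumes "p \<le> m" "j \<le> 2 ^ p"
  shows "(\<integral>s. indicator {0..<real j / 2 ^ p} s * dyadic_deriv m f s \<partial>lborel) = f (real j / 2 ^ p) - f 0"
proof -
  have eq: "indicator {0..<real j / 2 ^ p} s * dyadic_deriv m f s =
      step_fun (2 ^ p) (\<lambda>i. if i < j then 1 else 0) s * dyadic_deriv m f s" for s
  proof (cases "s \<in> {0..<1}")
    case True
    obtain i where i: "i < 2 ^ p" "s \<in> {real i / real (2 ^ p)..<(real i + 1) / real (2 ^ p)}"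
      by (rule step_fun_piece[OF _ True, of "2 ^ p"]) auto
    have "s < real j / 2 ^ p \<longleftrightarrow> i < j"
    proof
      assume "s < real j / 2 ^ p"
      then have "real i / 2 ^ p < real j / 2 ^ p" using i(2) by simp
      then show "i < j" by (simp add: divide_less_cancel)
    next
      assume "i < j"
      then have "(real i + 1) / 2 ^ p \<le> real j / 2 ^ p" by (intro divide_right_mono) auto
      then show "s < real j / 2 ^ p" using i(2) by simp
    qed
    then have "indicator {0..<real j / 2 ^ p} s = (if i < j then 1 else 0 :: real)"
      using True by (simp add: indicator_def)
    then show ?thesis using step_fun_eq[OF i, of "\<lambda>i. if i < j then 1 else 0"] by simp
  qed (simp add: step_fun_outside)
  have "(\<integral>s. indicator {0..<real j / 2 ^ p} s * dyadic_deriv m f s \<partial>lborel) =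
     (\<Sum>i<2^p. (if i < j then 1 else 0) * (f ((real i + 1) / 2 ^ p) - f (real i / 2 ^ p)))"
    unfolding eq by (rule step_fun_times_dyadic_deriv(2)[OF assms(1)])
  also have "\<dots> = (\<Sum>i<j. f (real (Suc i) / 2 ^ p) - f (real i / 2 ^ p))"
  proof (rule sum.mono_neutral_cong_right)
    show "{..<j} \<subseteq> {..<2 ^ p}" using assms(2) by (simp add: lessThan_subset_iff)
    show "(if i < j then 1 else 0) * (f ((real i + 1) / 2 ^ p) - f (real i / 2 ^ p)) =
        f (real (Suc i) / 2 ^ p) - f (real i / 2 ^ p)" if "i \<in> {..<j}" for i
      using that by (simp add: add.commute[of 1])
  qed simp_all
  also have "\<dots> = f (real j / 2 ^ p) - f (real 0 / 2 ^ p)"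
    by (rule sum_lessThan_telescope)
  also have "\<dots> = f (real j / 2 ^ p) - f 0" by (simp only: of_nat_0 div_0)
  finally show ?thesis .
qed

text \<open>An absolutely continuous function with square integrable derivative. The representative
  \<open>g\<close> is Borel and vanishes off the unit interval, so that all integrals can be taken
  over \<open>lborel\<close>.\<close>

definition L2_primitive :: "(real \<Rightarrow> real) \<Rightarrow> (real \<Rightarrow> real) \<Rightarrow> bool" where
  "L2_primitive f g \<longleftrightarrow> g \<in> borel_measurable borel \<and> (\<forall>t. t \<notin> {0..<1} \<longrightarrow> g t = 0) \<and>
     integrable lborel (\<lambda>t. (g t)\<^sup>2) \<and>
     (\<forall>t\<in>{0..1}. f t = f 0 + (\<integral>s. indicator {0..<t} s * g s \<partial>lborel))"

lemma L2_primitive_diff: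
  assumes fg: "L2_primitive f g" and st: "0 \<le> s" "s \<le> t" "t \<le> 1"
  shows "f t - f s = (\<integral>x. indicator {s..<t} x * g x \<partial>lborel)"
    and "(f t - f s)\<^sup>2 \<le> (t - s) * (\<integral>x. indicator {s..<t} x * (g x)\<^sup>2 \<partial>lborel)"
    and "(f t - f s)\<^sup>2 \<le> (t - s) * (\<integral>x. (g x)\<^sup>2 \<partial>lborel)"
proof -
  have g: "g \<in> borel_measurable borel" and sq: "integrable lborel (\<lambda>t. (g t)\<^sup>2)"
    and f: "\<And>t. t \<in> {0..1} \<Longrightarrow> f t = f 0 + (\<integral>s. indicator {0..<t} s * g s \<partial>lborel)"
    using fg unfolding L2_primitive_def by blast+
  note cs = interval_integral_Cauchy_Schwarz[OF g sq]
  have "f t - f s = (\<integral>x. indicator {0..<t} x * g x \<partial>lborel) - (\<integral>x. indicator {0..<s} x * g x \<partial>lborel)"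
    using f[of s] f[of t] st by simp
  also have "\<dots> = (\<integral>x. indicator {0..<t} x * g x - indicator {0..<s} x * g x \<partial>lborel)"
    using cs(1)[of 0 t] cs(1)[of 0 s] st by simp
  also have "\<dots> = (\<integral>x. indicator {s..<t} x * g x \<partial>lborel)"
    by (rule Bochner_Integration.integral_cong) (use st in \<open>auto simp: indicator_def\<close>)
  finally show eq: "f t - f s = (\<integral>x. indicator {s..<t} x * g x \<partial>lborel)" .
  show le: "(f t - f s)\<^sup>2 \<le> (t - s) * (\<integral>x. indicator {s..<t} x * (g x)\<^sup>2 \<partial>lborel)"
    unfolding eq using cs(2)[OF st(2)] .
  have "(\<integral>x. indicator {s..<t} x * (g x)\<^sup>2 \<partial>lborel) \<le> (\<integral>x. (g x)\<^sup>2 \<partial>lborel)"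
    by (rule integral_mono) (use integrable_mult_indicator[OF _ sq, of "{s..<t}"] sq in \<open>auto simp: indicator_def\<close>)
  then have "(t - s) * (\<integral>x. indicator {s..<t} x * (g x)\<^sup>2 \<partial>lborel) \<le> (t - s) * (\<integral>x. (g x)\<^sup>2 \<partial>lborel)"
    using st by (intro mult_left_mono) auto
  with le show "(f t - f s)\<^sup>2 \<le> (t - s) * (\<integral>x. (g x)\<^sup>2 \<partial>lborel)" by linarith
qed

text \<open>Cauchy--Schwarz on each cell bounds the squared increment by the cell length times the
  local energy, and the cell length cancels the factor \<open>2 ^ m\<close>.\<close>

lemma dyadic_energy_le:
  assumes fg: "L2_primitive f g"
  shows "dyadic_energy m f \<le> (\<integral>x. (g x)\<^sup>2 \<partial>lborel)"
proof -
  have sq: "integrable lborel (\<lambda>t. (g t)\<^sup>2)" using fg unfolding L2_primitive_def by blast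
  let ?I = "\<lambda>i x. indicator {real i / 2 ^ m..<(real i + 1) / 2 ^ m} x * (g x)\<^sup>2"
  have "dyadic_energy m f \<le> 2 ^ m * (\<Sum>i<2^m. (1 / 2 ^ m) * (\<integral>x. ?I i x \<partial>lborel))"
    unfolding dyadic_energy_def
  proof (intro mult_left_mono sum_mono)
    fix i :: nat assume "i \<in> {..<2 ^ m}"
    then have "real i + 1 \<le> 2 ^ m" using less_iff_Suc_add[of i "2^m"] by (metis Suc_leI add.commute lessThan_iff of_nat_Suc of_nat_le_numeral_power_cancel_iff plus_1_eq_Suc)
    then have b: "0 \<le> real i / 2 ^ m" "real i / 2 ^ m \<le> (real i + 1) / 2 ^ m" "(real i + 1) / 2 ^ m \<le> 1"
      by (auto simp: divide_right_mono)
    have "(real i + 1) / 2 ^ m - real i / 2 ^ m = (1::real) / 2 ^ m" by (simp add: add_divide_distrib)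
    then show "(f ((real i + 1) / 2 ^ m) - f (real i / 2 ^ m))\<^sup>2 \<le> 1 / 2 ^ m * (\<integral>x. ?I i x \<partial>lborel)"
      using L2_primitive_diff(2)[OF fg b] by simp
  qed simp
  also have "\<dots> = (\<Sum>i<2^m. \<integral>x. ?I i x \<partial>lborel)" by (simp add: sum_distrib_left)
  also have "\<dots> = (\<integral>x. (\<Sum>i<2^m. ?I i x) \<partial>lborel)"
    by (rule Bochner_Integration.integral_sum[symmetric])
       (use integrable_mult_indicator[OF _ sq] in auto)
  also have "\<dots> \<le> (\<integral>x. (g x)\<^sup>2 \<partial>lborel)"
  proof (rule integral_mono)
    show "integrable lborel (\<lambda>x. \<Sum>i<2^m. ?I i x)"
      using integrable_mult_indicator[OF _ sq] by (intro Bochner_Integration.integrable_sum) auto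
    fix x :: real
    have "(\<Sum>i<2^m. indicator {real i / 2 ^ m..<(real i + 1) / 2 ^ m} x :: real) = step_fun (2 ^ m) (\<lambda>_. 1) x"
      by (simp add: step_fun_def)
    also have "\<dots> \<le> 1"
      using step_fun_pointwise[of "2 ^ m" x] step_fun_outside[of x "2^m" "\<lambda>_. 1"] by (cases "x \<in> {0..<1}") auto
    finally have "(\<Sum>i<2^m. indicator {real i / 2 ^ m..<(real i + 1) / 2 ^ m} x :: real) * (g x)\<^sup>2 \<le> 1 * (g x)\<^sup>2"
      by (rule mult_right_mono) simp
    then show "(\<Sum>i<2^m. ?I i x) \<le> (g x)\<^sup>2" by (simp add: sum_distrib_right)
  qed (rule sq)
  finally show ?thesis .
qed

text \<open>Bounded increasing energies make the dyadic derivatives Cauchy in mean square, hence in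
  mean. An almost everywhere convergent subsequence defines \<open>g\<close>; its primitive matches
  \<open>f - f 0\<close> at dyadic points, and continuity extends the match.\<close>

lemma dyadic_limit_exists:
  assumes cont: "continuous_on {0..1} f" and bnd: "\<And>m. dyadic_energy m f \<le> B"
  obtains g where "L2_primitive f g" "(\<lambda>m. dyadic_energy m f) \<longlonglongrightarrow> (\<integral>x. (g x)\<^sup>2 \<partial>lborel)"
proof -
  obtain E where E: "(\<lambda>m. dyadic_energy m f) \<longlonglongrightarrow> E" "\<And>m. dyadic_energy m f \<le> E"
    using incseq_convergent[of "\<lambda>m. dyadic_energy m f" B] bnd dyadic_energy_mono by (auto simp: incseq_def)
  let ?g = "\<lambda>m. dyadic_deriv m f"
  have out: "?g m t = 0" if "t \<notin> {0..<1}" for m t using that by (rule step_fun_outside)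
  have L1: "(\<integral>t. \<bar>?g l t - ?g m t\<bar> \<partial>lborel)\<^sup>2 \<le> E - dyadic_energy m f" if "m \<le> l" for l m
  proof -
    have "(\<integral>t. \<bar>?g l t - ?g m t\<bar> \<partial>lborel)\<^sup>2 \<le> (\<integral>t. (?g l t - ?g m t)\<^sup>2 \<partial>lborel)"
      by (rule L1_le_L2_unit_interval(2)) (use dyadic_deriv_diff(1)[OF that] out in auto)
    also have "\<dots> \<le> E - dyadic_energy m f" unfolding dyadic_deriv_diff(2)[OF that] using E(2) by simp
    finally show ?thesis .
  qed
  have small: "\<exists>N. \<forall>m\<ge>N. E - dyadic_energy m f < e" if "e > 0" for e
    using LIMSEQ_D[OF E(1) that] E(2) by (auto simp: abs_less_iff)
  have cauchy: "\<exists>N. \<forall>i\<ge>N. \<forall>j\<ge>N. (LINT t|lborel. norm (?g i t - ?g j t)) < e" if e: "e > 0" for e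
  proof -
    obtain N where N: "\<And>m. m \<ge> N \<Longrightarrow> E - dyadic_energy m f < e\<^sup>2" using small[of "e\<^sup>2"] e by auto
    have lt: "(LINT t|lborel. norm (?g i t - ?g j t)) < e" if "N \<le> j" "j \<le> i" for i j
    proof -
      have "(LINT t|lborel. norm (?g i t - ?g j t))\<^sup>2 < e\<^sup>2" using L1[OF that(2)] N[OF that(1)] unfolding real_norm_def by linarith
      then show ?thesis using e by (simp add: power_less_imp_less_base)
    qed
    have "(LINT t|lborel. norm (?g i t - ?g j t)) < e" if "N \<le> j" "N \<le> i" for i j
    proof (cases "j \<le> i")
      case True then show ?thesis using lt that by blast
    next
      case False
      then have "(LINT t|lborel. norm (?g j t - ?g i t)) < e" using lt that by simp
      moreover have "(\<lambda>t. norm (?g i t - ?g j t)) = (\<lambda>t. norm (?g j t - ?g i t))"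
        by (intro ext norm_minus_commute)
      ultimately show ?thesis by simp
    qed
    then show ?thesis by blast
  qed
  have int: "integrable lborel (?g m)" for m by (rule integral_step_fun) simp
  obtain r where r: "strict_mono r" "AE x in lborel. Cauchy (\<lambda>i. ?g (r i) x)"
    using cauchy_L1_AE_cauchy_subseq[of lborel ?g, OF int cauchy] by blast
  define g where "g t = lim (\<lambda>i. ?g (r i) t)" for t
  have g[measurable]: "g \<in> borel_measurable borel" unfolding g_def by (rule borel_measurable_lim_metric) simp
  have gout: "g t = 0" if "t \<notin> {0..<1}" for t unfolding g_def using out[OF that] by simp
  have glim: "AE t in lborel. (\<lambda>i. ?g (r i) t) \<longlonglongrightarrow> g t"
    using r(2) by eventually_elim (simp add: g_def Cauchy_convergent_iff convergent_LIMSEQ_iff)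
  have diff: "integrable lborel (\<lambda>t. (g t - ?g m t)\<^sup>2)" "(\<integral>t. (g t - ?g m t)\<^sup>2 \<partial>lborel) \<le> E - dyadic_energy m f" for m
  proof -
    \<comment> \<open>Shifting the index by \<open>m\<close> keeps all levels of the subsequence at
      least \<open>m\<close>, where the orthogonality formula holds; Fatou then passes the bound to
      \<open>g\<close>.\<close>
    have le: "m \<le> r (i + m)" for i using seq_suble[OF r(1), of "i + m"] by simp
    have 1: "integrable lborel (\<lambda>t. (?g (r (i + m)) t - ?g m t)\<^sup>2)" for i
      by (rule dyadic_deriv_diff(1)[OF le])
    have 2: "(\<integral>t. (?g (r (i + m)) t - ?g m t)\<^sup>2 \<partial>lborel) \<le> E - dyadic_energy m f" for i
      unfolding dyadic_deriv_diff(2)[OF le] using E(2) by simp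
    have 3: "AE t in lborel. (\<lambda>i. (?g (r (i + m)) t - ?g m t)\<^sup>2) \<longlonglongrightarrow> (g t - ?g m t)\<^sup>2"
      using glim
    proof eventually_elim
      case (elim t)
      show ?case by (intro tendsto_intros LIMSEQ_ignore_initial_segment[OF elim])
    qed
    show "integrable lborel (\<lambda>t. (g t - ?g m t)\<^sup>2)" "(\<integral>t. (g t - ?g m t)\<^sup>2 \<partial>lborel) \<le> E - dyadic_energy m f"
      using integrable_limit_bound[OF 1 _ _ 3 2] by auto
  qed
  have gsq: "integrable lborel (\<lambda>t. (g t)\<^sup>2)" and gE: "(\<integral>t. (g t)\<^sup>2 \<partial>lborel) \<le> E"
  proof -
    have 1: "integrable lborel (\<lambda>t. (?g (r i) t)\<^sup>2)" for i
      using step_fun_times_dyadic_deriv(1)[OF order_refl, of "r i" "dyadic_slope (r i) f" f] by (simp add: power2_eq_square)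
    have 2: "(\<integral>t. (?g (r i) t)\<^sup>2 \<partial>lborel) \<le> E" for i
      using dyadic_deriv_inner[OF order_refl, of "r i" f] E(2) by (simp add: power2_eq_square)
    have 3: "AE t in lborel. (\<lambda>i. (?g (r i) t)\<^sup>2) \<longlonglongrightarrow> (g t)\<^sup>2"
      using glim by eventually_elim (intro tendsto_intros)
    show "integrable lborel (\<lambda>t. (g t)\<^sup>2)" "(\<integral>t. (g t)\<^sup>2 \<partial>lborel) \<le> E"
      using integrable_limit_bound[OF 1 _ _ 3 2] by auto
  qed
  define F where "F t = (\<integral>s. indicator {0..<t} s * g s \<partial>lborel)" for t
  have dy: "F (real j / 2 ^ p) = f (real j / 2 ^ p) - f 0" if j: "j \<le> 2 ^ p" for j p
  proof -
    let ?t = "real j / 2 ^ p"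
    have t: "0 \<le> ?t" by simp
    have ig: "integrable lborel (\<lambda>s. indicator {0..<?t} s * g s)"
      by (rule interval_integral_Cauchy_Schwarz(1)[OF g gsq t])
    \<comment> \<open>At a dyadic point the integral of every finer derivative is exact, so the
      error is only the mean distance of that derivative from \<open>g\<close>.\<close>
    have "\<bar>F ?t - (f ?t - f 0)\<bar> \<le> sqrt (E - dyadic_energy m f)" if m: "p \<le> m" for m
    proof -
      have im: "integrable lborel (\<lambda>s. indicator {0..<?t} s * ?g m s)"
        using integrable_mult_indicator[OF _ int, of "{0..<?t}"] by simp
      have gL: "integrable lborel (\<lambda>t. g t - ?g m t)" "(\<integral>t. \<bar>g t - ?g m t\<bar> \<partial>lborel)\<^sup>2 \<le> (\<integral>t. (g t - ?g m t)\<^sup>2 \<partial>lborel)"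
        using L1_le_L2_unit_interval[of "\<lambda>t. g t - ?g m t"] diff(1) gout out by auto
      have "F ?t - (f ?t - f 0) = (\<integral>s. indicator {0..<?t} s * g s \<partial>lborel) - (\<integral>s. indicator {0..<?t} s * ?g m s \<partial>lborel)"
        unfolding F_def integral_dyadic_deriv_upto[OF m j] ..
      also have "\<dots> = (\<integral>s. indicator {0..<?t} s * g s - indicator {0..<?t} s * ?g m s \<partial>lborel)"
        using ig im by simp
      finally have "\<bar>F ?t - (f ?t - f 0)\<bar> = \<bar>\<integral>s. indicator {0..<?t} s * g s - indicator {0..<?t} s * ?g m s \<partial>lborel\<bar>"
        by (rule arg_cong)
      also have "\<dots> \<le> (\<integral>s. \<bar>indicator {0..<?t} s * g s - indicator {0..<?t} s * ?g m s\<bar> \<partial>lborel)"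
        by (rule integral_abs_bound)
      also have "\<dots> \<le> (\<integral>s. \<bar>g s - ?g m s\<bar> \<partial>lborel)"
      proof (rule integral_mono)
        show "\<bar>indicator {0..<?t} s * g s - indicator {0..<?t} s * ?g m s\<bar> \<le> \<bar>g s - ?g m s\<bar>" for s
          by (cases "s \<in> {0..<?t}") simp_all
      qed (intro integrable_abs Bochner_Integration.integrable_diff ig im gL(1))+
      also have "\<dots> \<le> sqrt (E - dyadic_energy m f)"
        by (rule real_le_rsqrt) (use gL(2) diff(2)[of m] in linarith)
      finally show ?thesis .
    qed
    moreover have "(\<lambda>m. sqrt (E - dyadic_energy m f)) \<longlonglongrightarrow> sqrt (E - E)"
      by (intro tendsto_intros E)
    ultimately have "\<bar>F ?t - (f ?t - f 0)\<bar> \<le> 0"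
      by (intro LIMSEQ_le_const[of _ 0]) auto
    then show ?thesis by simp
  qed
  have "f t = f 0 + F t" if t: "t \<in> {0..1}" for t
  proof -
    \<comment> \<open>The dyadic point of level \<open>m\<close> just below \<open>t\<close>, where
      the identity is already known.\<close>
    define \<tau> where "\<tau> m = real (nat \<lfloor>2 ^ m * t\<rfloor>) / 2 ^ m" for m :: nat
    have fl: "real (nat \<lfloor>2 ^ m * t\<rfloor>) \<le> 2 ^ m * t" "2 ^ m * t < real (nat \<lfloor>2 ^ m * t\<rfloor>) + 1" for m :: nat
      using t by (auto simp: of_nat_nat)
    have \<tau>: "\<tau> m \<le> t" "t - \<tau> m \<le> 1 / 2 ^ m" "0 \<le> \<tau> m" for m
    proof -
      show "\<tau> m \<le> t" unfolding \<tau>_def 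
      proof (subst pos_divide_le_eq)
        show "real (nat \<lfloor>2 ^ m * t\<rfloor>) \<le> t * 2 ^ m" using fl(1)[of m] by (metis mult.commute)
      qed simp
      have "t \<le> (real (nat \<lfloor>2 ^ m * t\<rfloor>) + 1) / 2 ^ m"
      proof (subst pos_le_divide_eq)
        show "t * 2 ^ m \<le> real (nat \<lfloor>2 ^ m * t\<rfloor>) + 1" using less_imp_le[OF fl(2)[of m]] by (metis mult.commute)
      qed simp
      then show "t - \<tau> m \<le> 1 / 2 ^ m" unfolding \<tau>_def add_divide_distrib by linarith
      show "0 \<le> \<tau> m" unfolding \<tau>_def by simp
    qed
    have nat: "nat \<lfloor>2 ^ m * t\<rfloor> \<le> 2 ^ m" for m :: nat
    proof -
      have "2 ^ m * t \<le> 2 ^ m" using t by simp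
      with fl(1)[of m] have "real (nat \<lfloor>2 ^ m * t\<rfloor>) \<le> 2 ^ m" by (rule order_trans)
      then have "real (nat \<lfloor>2 ^ m * t\<rfloor>) \<le> real (2 ^ m)" by (simp only: of_nat_power of_nat_numeral)
      then show ?thesis by (simp only: of_nat_le_iff)
    qed
    have tend: "\<tau> \<longlonglongrightarrow> t"
    proof (rule tendsto_sandwich[where f="\<lambda>m. t - (1/2) ^ m" and h="\<lambda>_. t"])
      show "(\<lambda>m. t - (1/2) ^ m) \<longlonglongrightarrow> t"
        using tendsto_diff[OF tendsto_const LIMSEQ_power_zero[of "1/2::real"], of t] by simp
      show "\<forall>\<^sub>F m in sequentially. t - (1 / 2) ^ m \<le> \<tau> m"
        using \<tau>(2) by (auto simp: power_one_over algebra_simps)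
    qed (use \<tau> in auto)
    have "(\<lambda>m. f (\<tau> m)) \<longlonglongrightarrow> f t"
    proof (rule continuous_on_tendsto_compose[OF cont tend t])
      have "\<tau> m \<in> {0..1}" for m using \<tau>(1,3)[of m] t unfolding atLeastAtMost_iff by linarith
      then show "\<forall>\<^sub>F m in sequentially. \<tau> m \<in> {0..1}" by (intro always_eventually allI)
    qed
    moreover have "(\<lambda>m. F (\<tau> m)) \<longlonglongrightarrow> F t"
    proof -
      have "norm (F (\<tau> m) - F t) \<le> sqrt (t - \<tau> m) * sqrt (\<integral>x. (g x)\<^sup>2 \<partial>lborel)" for m
      proof -
        have i: "integrable lborel (\<lambda>x. indicator {0..<t} x * g x)" "integrable lborel (\<lambda>x. indicator {0..<\<tau> m} x * g x)"
          using interval_integral_Cauchy_Schwarz(1)[OF g gsq] t \<tau>(3) by auto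
        have "F t - F (\<tau> m) = (\<integral>x. indicator {0..<t} x * g x - indicator {0..<\<tau> m} x * g x \<partial>lborel)"
          unfolding F_def using i by simp
        also have "\<dots> = (\<integral>x. indicator {\<tau> m..<t} x * g x \<partial>lborel)"
          using \<tau>(1,3)[of m] t by (intro Bochner_Integration.integral_cong) (auto simp: indicator_def)
        finally have "(F t - F (\<tau> m))\<^sup>2 \<le> (t - \<tau> m) * (\<integral>x. indicator {\<tau> m..<t} x * (g x)\<^sup>2 \<partial>lborel)"
          using interval_integral_Cauchy_Schwarz(2)[OF g gsq \<tau>(1)] by simp
        also have "\<dots> \<le> (t - \<tau> m) * (\<integral>x. (g x)\<^sup>2 \<partial>lborel)"
          using \<tau>(1) integrable_mult_indicator[OF _ gsq, of "{\<tau> m..<t}"] gsq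
          by (intro mult_left_mono integral_mono) (auto simp: indicator_def)
        finally have "\<bar>F t - F (\<tau> m)\<bar> \<le> sqrt ((t - \<tau> m) * (\<integral>x. (g x)\<^sup>2 \<partial>lborel))"
          by (simp add: real_le_rsqrt)
        then show ?thesis by (simp add: real_sqrt_mult abs_minus_commute)
      qed
      moreover have "(\<lambda>m. sqrt (t - \<tau> m) * sqrt (\<integral>x. (g x)\<^sup>2 \<partial>lborel)) \<longlonglongrightarrow> sqrt (t - t) * sqrt (\<integral>x. (g x)\<^sup>2 \<partial>lborel)"
        by (intro tendsto_intros tend)
      ultimately have "(\<lambda>m. F (\<tau> m) - F t) \<longlonglongrightarrow> 0"
        by (intro Lim_null_comparison[of "\<lambda>m. F (\<tau> m) - F t"]) auto
      then show ?thesis by (simp add: LIM_zero_iff)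
    qed
    moreover have "F (\<tau> m) = f (\<tau> m) - f 0" for m unfolding \<tau>_def by (rule dy[OF nat])
    ultimately have "(\<lambda>m. f (\<tau> m)) \<longlonglongrightarrow> f t" "(\<lambda>m. f (\<tau> m) - f 0) \<longlonglongrightarrow> F t" by simp_all
    from LIMSEQ_unique[OF tendsto_diff[OF this(1) tendsto_const] this(2)] show ?thesis by simp
  qed
  then have prim: "L2_primitive f g" using g gout gsq unfolding L2_primitive_def F_def by blast
  \<comment> \<open>The reverse bound comes from the cellwise estimate for primitives, so no energy
    is lost in the limit.\<close>
  have "E \<le> (\<integral>x. (g x)\<^sup>2 \<partial>lborel)"
    by (rule LIMSEQ_le_const2[OF E(1)]) (use dyadic_energy_le[OF prim] in blast)
  with gE have "E = (\<integral>x. (g x)\<^sup>2 \<partial>lborel)" by simp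
  with E(1) prim show ?thesis by (intro that) auto
qed

section \<open>Weak derivatives on the unit interval\<close>

lemma test_function_real:
  fixes \<phi> :: "real \<Rightarrow> real"
  assumes "\<phi> \<in> test_functions \<Omega>"
  defines "\<phi>' \<equiv> \<lambda>x. frechet_derivative \<phi> (at x) 1"
  shows "\<And>x. (\<phi> has_real_derivative \<phi>' x) (at x)" "continuous_on UNIV \<phi>'" "\<And>x. x \<notin> \<Omega> \<Longrightarrow> \<phi> x = 0"
proof -
  have C: "\<And>k. Ck k \<phi>" and cl: "closure {x. \<phi> x \<noteq> 0} \<subseteq> \<Omega>"
    using assms(1) by (auto simp: test_functions_def)
  fix x
  have d: "(\<phi> has_derivative frechet_derivative \<phi> (at x)) (at x)" by (rule Ck_SucD(1)[OF C])
  have "frechet_derivative \<phi> (at x) h = h * \<phi>' x" for h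
    using linear_cmul[OF has_derivative_linear[OF d], of h 1] by (simp add: \<phi>'_def)
  then have "frechet_derivative \<phi> (at x) = (*) (\<phi>' x)" by (auto simp: mult.commute)
  then show "(\<phi> has_real_derivative \<phi>' x) (at x)" using d by (simp add: has_field_derivative_def)
  show "continuous_on UNIV \<phi>'" using Ck_SucD(2)[OF C[of "Suc 0"], of 1] by (simp add: \<phi>'_def)
  show "x \<notin> \<Omega> \<Longrightarrow> \<phi> x = 0" using cl closure_subset[of "{x. \<phi> x \<noteq> 0}"] by blast
qed

lemma continuous_bounded_unit_interval:
  fixes f :: "real \<Rightarrow> real"
  assumes "continuous_on {0..1} f"
  obtains M where "0 \<le> M" "\<And>x. x \<in> {0..1} \<Longrightarrow> \<bar>f x\<bar> \<le> M"
proof -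
  obtain M where M: "\<forall>y\<in>f ` {0..1}. norm y \<le> M"
    using compact_imp_bounded[OF compact_continuous_image[OF assms compact_Icc]] unfolding bounded_iff by blast
  show ?thesis
  proof (rule that)
    show "\<bar>f x\<bar> \<le> max M 0" if "x \<in> {0..1}" for x
      using bspec[OF M imageI[OF that]] by simp
  qed simp
qed

lemma primitive_continuous:
  fixes g :: "real \<Rightarrow> real"
  assumes g: "g \<in> borel_measurable borel" "integrable lborel (\<lambda>t. (g t)\<^sup>2)"
  shows "continuous_on {0..} (\<lambda>t. \<integral>s. indicator {0..<t} s * g s \<partial>lborel)"
proof -
  define F where "F t = (\<integral>s. indicator {0..<t} s * g s \<partial>lborel)" for t
  define M where "M = (\<integral>x. (g x)\<^sup>2 \<partial>lborel)"
  have M0: "0 \<le> M" by (simp add: M_def)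
  have le: "(F t - F s)\<^sup>2 \<le> (t - s) * M" if st: "0 \<le> s" "s \<le> t" for s t
  proof -
    have "F t - F s = (\<integral>x. indicator {0..<t} x * g x - indicator {0..<s} x * g x \<partial>lborel)"
      unfolding F_def using interval_integral_Cauchy_Schwarz(1)[OF g, of 0] st by simp
    also have "\<dots> = (\<integral>x. indicator {s..<t} x * g x \<partial>lborel)"
      using st by (intro Bochner_Integration.integral_cong) (auto simp: indicator_def)
    finally have "(F t - F s)\<^sup>2 \<le> (t - s) * (\<integral>x. indicator {s..<t} x * (g x)\<^sup>2 \<partial>lborel)"
      using interval_integral_Cauchy_Schwarz(2)[OF g st(2)] by simp
    also have "\<dots> \<le> (t - s) * M" unfolding M_def
      using st integrable_mult_indicator[OF _ g(2), of "{s..<t}"] g(2)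
      by (intro mult_left_mono integral_mono) (auto simp: indicator_def)
    finally show ?thesis .
  qed
  have le': "\<bar>F t - F s\<bar> \<le> sqrt (\<bar>t - s\<bar> * M)" if "0 \<le> s" "0 \<le> t" for s t
    by (rule real_le_rsqrt) (use le[of s t] le[of t s] that in \<open>auto simp: power2_commute abs_if\<close>)
  have "continuous_on {0..} F"
    unfolding continuous_on_def
  proof
    fix t :: real assume t: "t \<in> {0..}"
    have lim: "((\<lambda>s. sqrt (\<bar>s - t\<bar> * M)) \<longlongrightarrow> sqrt (\<bar>t - t\<bar> * M)) (at t within {0..})"
      by (intro tendsto_intros)
    have "((\<lambda>s. F s - F t) \<longlongrightarrow> 0) (at t within {0..})"
      by (rule Lim_null_comparison[where g="\<lambda>s. sqrt (\<bar>s - t\<bar> * M)"])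
         (use le' t lim in \<open>auto simp: eventually_at_filter\<close>)
    then show "(F \<longlongrightarrow> F t) (at t within {0..})" by (simp add: LIM_zero_iff)
  qed
  then show ?thesis by (simp add: F_def[abs_def])
qed

lemma integral_lebesgue_on_unit_interval:
  fixes h :: "real \<Rightarrow> real"
  assumes "(\<lambda>t. indicator {0<..<1} t * h t) \<in> borel_measurable borel"
  shows "(\<integral>t. h t \<partial>lebesgue_on {0<..<1}) = (\<integral>t. indicator {0<..<1} t * h t \<partial>lborel)"
    and "integrable (lebesgue_on {0<..<1}) h \<longleftrightarrow> integrable lborel (\<lambda>t. indicator {0<..<1} t * h t)"
  using assms by (simp_all add: integral_restrict_space integrable_restrict_space integral_completion integrable_completion)

text \<open>Integration by parts by Fubini on the triangle \<open>0 \<le> s < t < 1\<close>: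
  exchanging the order leaves the integral of \<open>\<phi>'\<close> from \<open>s\<close> to 1,
  which is \<open>- \<phi> s\<close> because test functions vanish at 1.\<close>

lemma L2_primitive_weak_gradient:
  assumes fg: "L2_primitive f g"
  shows "has_weak_gradient_on f g {0<..<1}"
proof -
  have g[measurable]: "g \<in> borel_measurable borel" and sq: "integrable lborel (\<lambda>t. (g t)\<^sup>2)"
    and out: "\<And>t. t \<notin> {0..<1} \<Longrightarrow> g t = 0"
    using fg unfolding L2_primitive_def by blast+
  define F where "F t = (\<integral>s. indicator {0..<t} s * g s \<partial>lborel)" for t
  have f: "f t = f 0 + F t" if "t \<in> {0..1}" for t
    using fg that unfolding L2_primitive_def F_def by blast
  have Fc: "continuous_on {0..} F" unfolding F_def by (rule primitive_continuous[OF g sq])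
  have "continuous_on {0..1} (\<lambda>t. f 0 + F t)"
    by (intro continuous_intros continuous_on_subset[OF Fc]) auto
  then have fc: "continuous_on {0..1} f" by (rule continuous_on_eq) (rule f[symmetric])
  have gi: "integrable lborel g" using L1_le_L2_unit_interval(1)[OF g out sq] .
  have "f absolutely_integrable_on K" if K: "compact K" "K \<subseteq> {0<..<1}" for K :: "real set"
  proof -
    have "K \<subseteq> {0..1}" using K(2) by auto
    then have "integrable lborel (\<lambda>x. indicator K x *\<^sub>R f x)"
      by (intro borel_integrable_compact[OF K(1)] continuous_on_subset[OF fc])
    then show ?thesis unfolding set_integrable_def by (subst integrable_completion) auto
  qed
  moreover have "g absolutely_integrable_on K" if K: "compact K" "K \<subseteq> {0<..<1}" for K :: "real set"
  proof -
    have "K \<in> sets lborel" using borel_closed[OF compact_imp_closed[OF K(1)]] by simp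
    from integrable_mult_indicator[OF this gi] show ?thesis
      unfolding set_integrable_def by (subst integrable_completion) auto
  qed
  moreover have "(\<integral>x. f x * frechet_derivative \<phi> (at x) 1 \<partial>lebesgue_on {0<..<1}) = - (\<integral>x. (g x \<bullet> 1) * \<phi> x \<partial>lebesgue_on {0<..<1})"
    if \<phi>: "\<phi> \<in> test_functions {0<..<1}" for \<phi> :: "real \<Rightarrow> real"
  proof -
    define \<phi>' where "\<phi>' x = frechet_derivative \<phi> (at x) 1" for x
    note t = test_function_real[OF \<phi>, folded \<phi>'_def]
    have \<phi>'[measurable]: "\<phi>' \<in> borel_measurable borel" using t(2) by (rule borel_measurable_continuous_onI)
    have \<phi>m[measurable]: "\<phi> \<in> borel_measurable borel"
      using t(1) by (intro borel_measurable_continuous_onI DERIV_continuous_on) (auto intro: has_field_derivative_at_within)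
    obtain C where C0: "0 \<le> C" and C: "\<And>x. x \<in> {0..1} \<Longrightarrow> \<bar>\<phi>' x\<bar> \<le> C"
      by (rule continuous_bounded_unit_interval[OF continuous_on_subset[OF t(2) subset_UNIV]], rule that)
    have FTC: "(\<integral>t. indicator {s<..<1} t * \<phi>' t \<partial>lborel) = - \<phi> s" "integrable lborel (\<lambda>t. indicator {s<..<1} t * \<phi>' t)" if "s \<in> {0..<1}" for s
    proof -
      have eq: "AE t in lborel. indicator {s<..<1} t * \<phi>' t = \<phi>' t * indicator {s..1} t"
        using AE_lborel_singleton[of s] AE_lborel_singleton[of "1::real"] by eventually_elim (auto simp: indicator_def)
      have 1: "(\<integral>t. \<phi>' t * indicator {s..1} t \<partial>lborel) = \<phi> 1 - \<phi> s"
        by (rule integral_FTC_Icc_real) (use that t(1,2) in \<open>auto simp: continuous_on_eq_continuous_at\<close>)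
      have 2: "integrable lborel (\<lambda>t. \<phi>' t * indicator {s..1} t)"
        using borel_integrable_compact[OF compact_Icc continuous_on_subset[OF t(2)], of s 1] by (simp add: mult.commute)
      have "(\<integral>t. indicator {s<..<1} t * \<phi>' t \<partial>lborel) = \<phi> 1 - \<phi> s"
        unfolding 1[symmetric] by (rule integral_cong_AE[OF _ _ eq]) auto
      then show "(\<integral>t. indicator {s<..<1} t * \<phi>' t \<partial>lborel) = - \<phi> s" using t(3)[of 1] by simp
      show "integrable lborel (\<lambda>t. indicator {s<..<1} t * \<phi>' t)"
        using integrable_cong_AE[OF _ _ eq] 2 by simp
    qed
    \<comment> \<open>The triangle is built into the integrand, so Fubini can run over the whole
      plane; \<open>hle\<close> bounds the integrand by a product of integrable functions.\<close>
    define h where "h t s = indicator {0<..<1} t * \<phi>' t * (if 0 \<le> s \<and> s < t then 1 else 0) * g s" for t s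
    have hm[measurable]: "(\<lambda>(t, s). h t s) \<in> borel_measurable (lborel \<Otimes>\<^sub>M lborel)"
      unfolding h_def by measurable
    have hs: "h t s = (indicator {0<..<1} t * \<phi>' t) * (indicator {0..<t} s * g s)" for t s
      by (auto simp: h_def indicator_def)
    have hle: "\<bar>h t s\<bar> \<le> (C * indicator {0<..<1} t) * \<bar>g s\<bar>" for t s
      using C[of t] C0 by (auto simp: h_def indicator_def abs_mult intro!: mult_right_mono)
    have hi: "integrable lborel (h t)" for t
      using interval_integral_Cauchy_Schwarz(1)[OF g sq, of 0 t] by (cases "t \<ge> 0") (auto simp: hs[abs_def])
    have int: "integrable (lborel \<Otimes>\<^sub>M lborel) (\<lambda>(t, s). h t s)"
    proof (rule lborel_pair.Fubini_integrable)
      show "integrable lborel (\<lambda>t. \<integral>s. norm (case (t, s) of (t, s) \<Rightarrow> h t s) \<partial>lborel)"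
      proof (rule Bochner_Integration.integrable_bound)
        show "integrable lborel (\<lambda>t. (C * (\<integral>s. \<bar>g s\<bar> \<partial>lborel)) * indicator {0<..<1::real} t)" by simp
        have "(\<integral>s. \<bar>h t s\<bar> \<partial>lborel) \<le> C * (\<integral>s. \<bar>g s\<bar> \<partial>lborel) * indicator {0<..<1} t" for t
        proof -
          have "(\<integral>s. \<bar>h t s\<bar> \<partial>lborel) \<le> (\<integral>s. (C * indicator {0<..<1} t) * \<bar>g s\<bar> \<partial>lborel)"
            by (rule integral_mono) (use hi gi hle in auto)
          then show ?thesis by (simp add: mult_ac)
        qed
        then show "AE t in lborel. norm (\<integral>s. norm (case (t, s) of (t, s) \<Rightarrow> h t s) \<partial>lborel) \<le> norm (C * (\<integral>s. \<bar>g s\<bar> \<partial>lborel) * indicator {0<..<1} t)"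
          using C0 by (intro AE_I2) (simp add: order_trans[OF _ abs_ge_self])
      qed measurable
    qed (use hi in auto)
    have "(\<integral>t. (\<integral>s. h t s \<partial>lborel) \<partial>lborel) = (\<integral>s. (\<integral>t. h t s \<partial>lborel) \<partial>lborel)"
      using lborel_pair.Fubini_integral[of "\<lambda>t s. h t s"] int by simp
    moreover have "(\<integral>s. h t s \<partial>lborel) = indicator {0<..<1} t * (\<phi>' t * F t)" for t
      unfolding hs F_def by simp
    moreover have "(\<integral>t. h t s \<partial>lborel) = - (g s * \<phi> s)" for s
    proof (cases "s \<in> {0..<1}")
      case True
      have "h t s = (indicator {s<..<1} t * \<phi>' t) * g s" for t using True by (auto simp: h_def indicator_def)
      then show ?thesis using FTC[OF True] by simp
    next
      case False
      then show ?thesis using out by (simp add: h_def)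
    qed
    ultimately have eq: "(\<integral>t. indicator {0<..<1} t * (\<phi>' t * F t) \<partial>lborel) = - (\<integral>s. g s * \<phi> s \<partial>lborel)"
      by simp
    have F_int: "integrable lborel (\<lambda>t. indicator {0<..<1} t * (\<phi>' t * F t))"
      using lborel_pair.integrable_fst'[OF int] by (simp add: \<open>\<And>t. (\<integral>s. h t s \<partial>lborel) = indicator {0<..<1} t * (\<phi>' t * F t)\<close>)
    have split: "indicator {0<..<1} t * (f t * \<phi>' t) = f 0 * (indicator {0<..<1} t * \<phi>' t) + indicator {0<..<1} t * (\<phi>' t * F t)" for t
      using f[of t] by (auto simp: indicator_def algebra_simps)
    have meas: "(\<lambda>t. indicator {0<..<1} t * (f t * \<phi>' t)) \<in> borel_measurable borel"
      unfolding split using borel_measurable_integrable[OF F_int] by measurable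
    have "(\<integral>x. f x * \<phi>' x \<partial>lebesgue_on {0<..<1}) = (\<integral>t. indicator {0<..<1} t * (f t * \<phi>' t) \<partial>lborel)"
      by (rule integral_lebesgue_on_unit_interval(1)[OF meas])
    also have "\<dots> = f 0 * (- \<phi> 0) + (- (\<integral>s. g s * \<phi> s \<partial>lborel))"
      unfolding split using FTC[of 0] F_int eq by simp
    also have "\<dots> = - (\<integral>s. g s * \<phi> s \<partial>lborel)" using t(3)[of 0] by simp
    also have "(\<integral>s. g s * \<phi> s \<partial>lborel) = (\<integral>t. indicator {0<..<1} t * (g t * \<phi> t) \<partial>lborel)"
      by (rule Bochner_Integration.integral_cong) (use t(3) in \<open>auto simp: indicator_def\<close>)
    also have "\<dots> = (\<integral>x. g x * \<phi> x \<partial>lebesgue_on {0<..<1})"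
      by (rule integral_lebesgue_on_unit_interval(1)[symmetric]) measurable
    finally show ?thesis by (simp add: \<phi>'_def)
  qed
  ultimately show ?thesis
    unfolding has_weak_gradient_on_def locally_integrable_on_def by simp
qed

text \<open>An approximate identity: the substitution \<open>x = a + (c / Suc n) * y\<close> moves
  the concentration into the argument of \<open>f\<close>. The sign \<open>c\<close> decides from
  which side the bump approaches \<open>a\<close>, which covers both flanks of a cut-off.\<close>

lemma integral_scaled_bump:
  fixes f s :: "real \<Rightarrow> real"
  assumes f: "continuous_on {0..1} f" and s: "continuous_on UNIV s" "\<And>y. y \<notin> {0..1} \<Longrightarrow> s y = 0"
    and a: "0 < a" "a < 1" and c: "\<bar>c\<bar> = 1"
  shows "(\<lambda>n. \<integral>x. indicator {0<..<1} x * f x * (s ((x - a) / (c / Suc n)) * Suc n) \<partial>lborel)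
     \<longlonglongrightarrow> f a * (\<integral>y. s y \<partial>lborel)"
proof -
  define k where "k x = indicator {0<..<1} x * f x" for x
  have km[measurable]: "k \<in> borel_measurable borel"
  proof -
    have "(\<lambda>x. indicator {0<..<1} x *\<^sub>R f x) \<in> borel_measurable borel"
      by (intro borel_measurable_continuous_on_indicator continuous_on_subset[OF f]) auto
    then show ?thesis by (simp add: k_def[abs_def])
  qed
  have sm[measurable]: "s \<in> borel_measurable borel" by (rule borel_measurable_continuous_onI[OF s(1)])
  obtain M where M0: "0 \<le> M" and M: "\<And>x. x \<in> {0..1} \<Longrightarrow> \<bar>f x\<bar> \<le> M"
    by (rule continuous_bounded_unit_interval[OF f], rule that)
  have kM: "\<bar>k x\<bar> \<le> M" for x using M[of x] M0 by (auto simp: k_def indicator_def)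
  have si: "integrable lborel s"
  proof -
    have "integrable lborel (\<lambda>x. indicator {0..1} x *\<^sub>R s x)"
      by (rule borel_integrable_compact) (auto intro: continuous_on_subset[OF s(1)])
    also have "(\<lambda>x. indicator {0..1} x *\<^sub>R s x) = s" using s(2) by (auto simp: indicator_def fun_eq_iff)
    finally show ?thesis .
  qed
  have eq: "(\<integral>x. indicator {0<..<1} x * f x * (s ((x - a) / (c / Suc n)) * Suc n) \<partial>lborel) =
      (\<integral>y. k (a + (c / Suc n) * y) * s y \<partial>lborel)" for n
  proof -
    have c0: "c / Suc n \<noteq> 0" using c by auto
    have "(\<integral>x. k x * (s ((x - a) / (c / Suc n)) * Suc n) \<partial>lborel) =
       \<bar>c / Suc n\<bar> *\<^sub>R (\<integral>y. k (a + (c / Suc n) * y) * (s ((a + (c / Suc n) * y - a) / (c / Suc n)) * Suc n) \<partial>lborel)"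
      by (rule lborel_integral_real_affine[OF c0])
    also have "\<dots> = \<bar>c / Suc n\<bar> *\<^sub>R (\<integral>y. Suc n * (k (a + (c / Suc n) * y) * s y) \<partial>lborel)"
      using c0 by (simp add: mult_ac)
    also have "\<dots> = (\<integral>y. k (a + (c / Suc n) * y) * s y \<partial>lborel)"
      using c by (simp add: abs_divide)
    finally show ?thesis by (simp only: k_def)
  qed
  have "(\<lambda>n. \<integral>y. k (a + (c / Suc n) * y) * s y \<partial>lborel) \<longlonglongrightarrow> (\<integral>y. f a * s y \<partial>lborel)"
  proof (rule integral_dominated_convergence[where w="\<lambda>y. M * \<bar>s y\<bar>"])
    show "AE y in lborel. (\<lambda>n. k (a + (c / Suc n) * y) * s y) \<longlonglongrightarrow> f a * s y"
    proof (rule AE_I2)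
      fix y
      have "(\<lambda>n. c * y * (1 / Suc n)) \<longlonglongrightarrow> c * y * 0"
        by (intro tendsto_intros LIMSEQ_Suc[OF lim_1_over_n])
      then have "(\<lambda>n. a + c * y * (1 / Suc n)) \<longlonglongrightarrow> a + 0" by (intro tendsto_intros) simp
      then have lim: "(\<lambda>n. a + (c / Suc n) * y) \<longlonglongrightarrow> a" by (simp add: field_simps)
      have "isCont f a" using continuous_on_interior[OF f, of a] a by simp
      moreover have "eventually (\<lambda>x. f x = k x) (nhds a)"
        by (rule eventually_mono[OF eventually_nhds_in_open[of "{0<..<1}" a]]) (use a in \<open>auto simp: k_def\<close>)
      ultimately have "isCont k a" by (simp add: isCont_cong)
      from isCont_tendsto_compose[OF this lim] have "(\<lambda>n. k (a + (c / Suc n) * y)) \<longlonglongrightarrow> f a"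
        using a by (simp add: k_def)
      then show "(\<lambda>n. k (a + (c / Suc n) * y) * s y) \<longlonglongrightarrow> f a * s y" by (intro tendsto_intros)
    qed
    show "AE y in lborel. norm (k (a + (c / Suc n) * y) * s y) \<le> M * \<bar>s y\<bar>" for n
      using kM by (intro AE_I2) (simp add: abs_mult mult_right_mono)
    show "integrable lborel (\<lambda>y. M * \<bar>s y\<bar>)" using si by simp
  qed measurable
  then show ?thesis unfolding eq by simp
qed

text \<open>The test functions are cut-offs of \<open>(a, b)\<close> with shrinking flanks. Their
  derivative is a bump at \<open>a\<close> minus a bump at \<open>b\<close>, so the pairing with
  \<open>f\<close> tends to \<open>f a - f b\<close>, while the other side tends to minus the
  integral of \<open>g\<close> over \<open>(a, b)\<close>.\<close>

lemma weak_gradient_L2_primitive: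
  assumes f: "continuous_on {0..1} f" and w: "has_weak_gradient_on f g1 {0<..<1}"
    and L2: "g1 \<in> Lp_space (lebesgue_on {0<..<1}) 2"
  obtains g where "L2_primitive f g"
proof -
  define g2 where "g2 t = indicator {0<..<1} t * g1 t" for t
  have g2L: "g2 \<in> borel_measurable lebesgue" "integrable lebesgue (\<lambda>t. (g2 t)\<^sup>2)"
  proof -
    have "g1 \<in> borel_measurable (lebesgue_on {0<..<1})" "integrable (lebesgue_on {0<..<1}) (\<lambda>t. (g1 t)\<^sup>2)"
      using L2 by (simp_all add: Lp_space_def powr_numeral)
    then have "(\<lambda>t. indicator {0<..<1} t *\<^sub>R g1 t) \<in> borel_measurable lebesgue"
       "integrable lebesgue (\<lambda>t. indicator {0<..<1} t *\<^sub>R (g1 t)\<^sup>2)"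
      by (simp_all add: borel_measurable_restrict_space_iff integrable_restrict_space)
    moreover have "(g2 t)\<^sup>2 = indicator {0<..<1} t *\<^sub>R (g1 t)\<^sup>2" for t by (simp add: g2_def indicator_def)
    ultimately show "g2 \<in> borel_measurable lebesgue" "integrable lebesgue (\<lambda>t. (g2 t)\<^sup>2)"
      by (simp_all add: g2_def[abs_def])
  qed
  obtain g3 where g3[measurable]: "g3 \<in> borel_measurable lborel" and eq3: "AE x in lborel. g2 x = g3 x"
    using completion_ex_borel_measurable_real[OF g2L(1)] by blast
  define g where "g t = indicator {0<..<1} t * g3 t" for t
  have g[measurable]: "g \<in> borel_measurable borel" unfolding g_def using g3 by measurable
  have out: "g t = 0" if "t \<notin> {0..<1}" for t using that by (auto simp: g_def indicator_def)
  have eq: "AE x in lebesgue. g2 x = g x"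
    using AE_completion[OF eq3]
  proof eventually_elim
    case (elim x)
    then show ?case by (cases "x \<in> {0<..<1}") (simp_all add: g_def g2_def)
  qed
  have sq: "integrable lborel (\<lambda>t. (g t)\<^sup>2)"
  proof -
    have "integrable lebesgue (\<lambda>t. (g t)\<^sup>2)"
    proof (rule integrable_cong_AE_imp[OF g2L(2)])
      show "(\<lambda>t. (g t)\<^sup>2) \<in> borel_measurable lebesgue" by (rule measurable_completion) measurable
      show "AE t in lebesgue. (g2 t)\<^sup>2 = (g t)\<^sup>2" using eq by eventually_elim simp
    qed
    then show ?thesis by (subst (asm) integrable_completion) auto
  qed
  have gi: "integrable lborel g" by (rule L1_le_L2_unit_interval(1)[OF g out sq])
  \<comment> \<open>The derivative of \<open>smooth_step\<close> is the bump: it is supported in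
    \<open>{0..1}\<close> and has integral 1.\<close>
  define s where "s x = frechet_derivative smooth_step (at x) 1" for x
  have sder: "(smooth_step has_real_derivative s x) (at x)" for x
  proof -
    have d: "(smooth_step has_derivative frechet_derivative smooth_step (at x)) (at x)"
      by (rule Ck_SucD(1)[OF Ck_smooth_step])
    have "frechet_derivative smooth_step (at x) h = h * s x" for h
      using linear_cmul[OF has_derivative_linear[OF d], of h 1] by (simp add: s_def)
    then have "frechet_derivative smooth_step (at x) = (*) (s x)" by (auto simp: mult.commute)
    then show ?thesis using d by (simp add: has_field_derivative_def)
  qed
  have sc: "continuous_on UNIV s" using Ck_SucD(2)[OF Ck_smooth_step[of "Suc 0"], of 1] by (simp add: s_def[abs_def])
  have s0: "s y = 0" if "y \<notin> {0..1}" for y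
  proof -
    have "\<exists>c S. open S \<and> y \<in> S \<and> (\<forall>x\<in>S. smooth_step x = c)"
    proof (cases "y < 0")
      case True
      then show ?thesis using smooth_step_0 by (intro exI[of _ 0] exI[of _ "{..<0}"]) auto
    next
      case False
      then show ?thesis using smooth_step_1 that by (intro exI[of _ 1] exI[of _ "{1<..}"]) auto
    qed
    then obtain c S where S: "open S" "y \<in> S" "\<And>x. x \<in> S \<Longrightarrow> smooth_step x = c" by blast
    have ev: "eventually (\<lambda>x. smooth_step x = c) (nhds y)"
      using eventually_nhds_in_open[OF S(1,2)] by (rule eventually_mono) (rule S(3))
    have "(smooth_step has_real_derivative 0) (at y)"
      by (subst DERIV_cong_ev[OF refl ev refl]) simp
    then show ?thesis using DERIV_unique sder by blast
  qed
  have s1: "(\<integral>y. s y \<partial>lborel) = 1"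
  proof -
    have "(\<integral>y. s y * indicator {0..1} y \<partial>lborel) = smooth_step 1 - smooth_step 0"
      by (rule integral_FTC_Icc_real) (use sder sc in \<open>auto simp: continuous_on_eq_continuous_at\<close>)
    moreover have "s y * indicator {0..1} y = s y" for y using s0[of y] by (auto simp: indicator_def)
    ultimately show ?thesis by (simp add: smooth_step_0 smooth_step_1)
  qed
  have main: "f b - f a = (\<integral>x. indicator {a<..<b} x * g x \<partial>lborel)" if ab: "0 < a" "a < b" "b < 1" for a b
  proof -
    define \<phi> where "\<phi> n = box_cutoff (1 / Suc n) a b" for n
    have \<phi>t: "\<phi> n \<in> test_functions {0<..<1}" for n
      unfolding \<phi>_def by (rule box_cutoff_test) (use ab in auto)
    have \<phi>m[measurable]: "\<phi> n \<in> borel_measurable borel" for n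
      unfolding \<phi>_def using Ck_box_cutoff[of 0] by (intro borel_measurable_continuous_onI) simp
    have weak: "(\<integral>x. f x * frechet_derivative (\<phi> n) (at x) 1 \<partial>lebesgue_on {0<..<1}) = - (\<integral>x. g x * \<phi> n x \<partial>lborel)" for n
    proof -
      have "(\<integral>x. f x * frechet_derivative (\<phi> n) (at x) 1 \<partial>lebesgue_on {0<..<1}) = - (\<integral>x. g1 x * \<phi> n x \<partial>lebesgue_on {0<..<1})"
        using w \<phi>t[of n] unfolding has_weak_gradient_on_def by simp
      also have "(\<integral>x. g1 x * \<phi> n x \<partial>lebesgue_on {0<..<1}) = (\<integral>x. g2 x * \<phi> n x \<partial>lebesgue)"
        by (subst integral_restrict_space) (auto simp: g2_def mult_ac)
      also have "\<dots> = (\<integral>x. g x * \<phi> n x \<partial>lebesgue)"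
      proof (rule integral_cong_AE)
        show "AE x in lebesgue. g2 x * \<phi> n x = g x * \<phi> n x" using eq by eventually_elim simp
        show "(\<lambda>x. g2 x * \<phi> n x) \<in> borel_measurable lebesgue"
          by (intro borel_measurable_times g2L(1) measurable_completion) measurable
        show "(\<lambda>x. g x * \<phi> n x) \<in> borel_measurable lebesgue" by (rule measurable_completion) measurable
      qed
      also have "\<dots> = (\<integral>x. g x * \<phi> n x \<partial>lborel)" by (rule integral_completion) measurable
      finally show ?thesis .
    qed
    have R: "(\<lambda>n. \<integral>x. g x * \<phi> n x \<partial>lborel) \<longlonglongrightarrow> (\<integral>x. g x * indicator (box a b) x \<partial>lborel)"
    proof (rule integral_dominated_convergence[where w="\<lambda>x. norm (g x)"])
      show "AE x in lborel. (\<lambda>n. g x * \<phi> n x) \<longlonglongrightarrow> g x * indicator (box a b) x"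
        unfolding \<phi>_def
        by (intro AE_I2 tendsto_intros box_cutoff_tendsto_indicator LIMSEQ_Suc[OF lim_1_over_n]) auto
      show "AE x in lborel. norm (g x * \<phi> n x) \<le> norm (g x)" for n
        using box_cutoff_bounds[of "1 / Suc n" a b] by (auto simp: abs_mult \<phi>_def intro!: mult_right_le_one_le)
    qed (use gi in auto)
    \<comment> \<open>Beyond \<open>N\<close> the flanks of width \<open>1 / Suc n\<close> are
      disjoint, so at every point one of the two factors is 1 and their product equals their sum
      minus 1.\<close>
    obtain N :: nat where N: "2 / (b - a) < N" using reals_Archimedean2 by blast
    have L: "eventually (\<lambda>n. (\<integral>x. f x * frechet_derivative (\<phi> n) (at x) 1 \<partial>lebesgue_on {0<..<1}) =
       (\<integral>x. indicator {0<..<1} x * f x * (s ((x - a) / (1 / Suc n)) * Suc n) \<partial>lborel) -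
       (\<integral>x. indicator {0<..<1} x * f x * (s ((x - b) / (-1 / Suc n)) * Suc n) \<partial>lborel)) sequentially"
      using eventually_ge_at_top[of N]
    proof eventually_elim
      case (elim n)
      then have n: "2 < (b - a) * Suc n"
      proof -
        have "2 < (b - a) * N" using N ab by (simp add: field_simps)
        also have "\<dots> \<le> (b - a) * Suc n" using elim ab by (intro mult_left_mono) auto
        finally show ?thesis .
      qed
      have \<phi>eq: "\<phi> n x = smooth_step ((x - a) * Suc n) + smooth_step ((b - x) * Suc n) - 1" for x
      proof -
        have "(x - a) * Suc n \<ge> 1 \<or> (b - x) * Suc n \<ge> 1"
        proof (rule ccontr)
          assume "\<not> ?thesis"
          then have "(x - a) * Suc n + (b - x) * Suc n < 2" by linarith
          also have "(x - a) * Suc n + (b - x) * Suc n = (b - a) * Suc n" by (simp add: algebra_simps)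
          finally show False using n by simp
        qed
        then show ?thesis by (auto simp: \<phi>_def box_cutoff_def cutoff_def smooth_step_1)
      qed
      have der: "frechet_derivative (\<phi> n) (at x) 1 = s ((x - a) * Suc n) * Suc n - s ((b - x) * Suc n) * Suc n" for x
      proof -
        have "((\<lambda>x. smooth_step ((x - a) * Suc n)) has_real_derivative s ((x - a) * Suc n) * Suc n) (at x)"
          by (rule DERIV_chain2[OF sder]) (auto intro!: derivative_eq_intros)
        moreover have "((\<lambda>x. smooth_step ((b - x) * Suc n)) has_real_derivative s ((b - x) * Suc n) * (- Suc n)) (at x)"
          by (rule DERIV_chain2[OF sder]) (auto intro!: derivative_eq_intros)
        ultimately have "((\<lambda>x. smooth_step ((x - a) * Suc n) + smooth_step ((b - x) * Suc n) - 1) has_real_derivative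
           s ((x - a) * Suc n) * Suc n + s ((b - x) * Suc n) * (- Suc n) - 0) (at x)"
          by (intro DERIV_diff DERIV_add DERIV_const)
        then have "(\<phi> n has_real_derivative s ((x - a) * Suc n) * Suc n + s ((b - x) * Suc n) * (- Suc n)) (at x)"
          unfolding \<phi>eq[abs_def] by simp
        then have "(*) (s ((x - a) * Suc n) * Suc n + s ((b - x) * Suc n) * (- Suc n)) = frechet_derivative (\<phi> n) (at x)"
          unfolding has_field_derivative_def by (rule frechet_derivative_at)
        from fun_cong[OF this, of 1] have "frechet_derivative (\<phi> n) (at x) 1 =
            s ((x - a) * Suc n) * Suc n + s ((b - x) * Suc n) * (- Suc n)" by (simp only: mult_1_right)
        then show ?thesis by (simp only: mult_minus_right add_uminus_conv_diff)
      qed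
      have int: "integrable lborel (\<lambda>x. indicator {0<..<1} x * f x * k x)" if k: "continuous_on UNIV k" for k :: "real \<Rightarrow> real"
      proof -
        have "integrable lborel (\<lambda>x. indicator {0..1} x *\<^sub>R (f x * k x))"
          by (rule borel_integrable_compact[OF compact_Icc continuous_on_mult[OF f continuous_on_subset[OF k subset_UNIV]]])
        from integrable_mult_indicator[OF _ this, of "{0<..<1}"]
        have "integrable lborel (\<lambda>x. indicator {0<..<1} x *\<^sub>R (indicator {0..1} x *\<^sub>R (f x * k x)))" by simp
        moreover have "indicator {0<..<1} x *\<^sub>R (indicator {0..1} x *\<^sub>R (f x * k x)) = indicator {0<..<1} x * f x * k x" for x
          by (cases "x \<in> {0<..<1}") simp_all
        ultimately show ?thesis by (simp only:)
      qed
      have ca: "continuous_on UNIV (\<lambda>x. s ((x - a) * Suc n) * Suc n)" "continuous_on UNIV (\<lambda>x. s ((b - x) * Suc n) * Suc n)"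
        by (auto intro!: continuous_intros continuous_on_compose2[OF sc])
      have "(\<integral>x. f x * frechet_derivative (\<phi> n) (at x) 1 \<partial>lebesgue_on {0<..<1}) =
         (\<integral>x. indicator {0<..<1} x * f x * (s ((x - a) * Suc n) * Suc n) - indicator {0<..<1} x * f x * (s ((b - x) * Suc n) * Suc n) \<partial>lborel)"
        unfolding der
        by (subst integral_lebesgue_on_unit_interval(1))
           (use borel_measurable_integrable[OF int[OF ca(1)]] borel_measurable_integrable[OF int[OF ca(2)]] in
             \<open>simp_all add: right_diff_distrib mult.assoc\<close>)
      also have "\<dots> = (\<integral>x. indicator {0<..<1} x * f x * (s ((x - a) * Suc n) * Suc n) \<partial>lborel) -
         (\<integral>x. indicator {0<..<1} x * f x * (s ((b - x) * Suc n) * Suc n) \<partial>lborel)"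
        by (rule Bochner_Integration.integral_diff[OF int[OF ca(1)] int[OF ca(2)]])
      finally show ?case by (simp add: left_diff_distrib)
    qed
    have "(\<lambda>n. (\<integral>x. indicator {0<..<1} x * f x * (s ((x - a) / (1 / Suc n)) * Suc n) \<partial>lborel) -
       (\<integral>x. indicator {0<..<1} x * f x * (s ((x - b) / (-1 / Suc n)) * Suc n) \<partial>lborel)) \<longlonglongrightarrow>
       f a * (\<integral>y. s y \<partial>lborel) - f b * (\<integral>y. s y \<partial>lborel)"
      by (intro tendsto_diff integral_scaled_bump[OF f sc s0]) (use ab in auto)
    then have "(\<lambda>n. \<integral>x. f x * frechet_derivative (\<phi> n) (at x) 1 \<partial>lebesgue_on {0<..<1}) \<longlonglongrightarrow> f a - f b"
      unfolding s1 by (subst tendsto_cong[OF L]) simp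
    then have "(\<lambda>n. - (\<integral>x. g x * \<phi> n x \<partial>lborel)) \<longlonglongrightarrow> f a - f b" unfolding weak .
    from LIMSEQ_unique[OF this tendsto_minus[OF R]] show ?thesis by (simp add: mult.commute box_real)
  qed
  define F where "F t = (\<integral>s. indicator {0..<t} s * g s \<partial>lborel)" for t
  have Fc: "continuous_on {0..1} F"
    unfolding F_def by (rule continuous_on_subset[OF primitive_continuous[OF g sq]]) auto
  have F_diff: "F b - F a = (\<integral>x. indicator {a<..<b} x * g x \<partial>lborel)" if "0 \<le> a" "a \<le> b" for a b
  proof -
    have i: "integrable lborel (\<lambda>x. indicator {0..<b} x * g x)" "integrable lborel (\<lambda>x. indicator {0..<a} x * g x)"
      using interval_integral_Cauchy_Schwarz(1)[OF g sq, of 0] that by auto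
    have "F b - F a = (\<integral>x. indicator {0..<b} x * g x - indicator {0..<a} x * g x \<partial>lborel)"
      unfolding F_def using i by simp
    also have "\<dots> = (\<integral>x. indicator {a<..<b} x * g x \<partial>lborel)"
    proof (rule integral_cong_AE)
      show "AE x in lborel. indicator {0..<b} x * g x - indicator {0..<a} x * g x = indicator {a<..<b} x * g x"
        using AE_lborel_singleton[of a] by eventually_elim (use that in \<open>auto simp: indicator_def\<close>)
    qed auto
    finally show ?thesis .
  qed
  have const: "f b - F b = f a - F a" if "0 < a" "a < b" "b < 1" for a b
    using main[OF that] F_diff[OF less_imp_le[OF that(1)] less_imp_le[OF that(2)]] by linarith
  have k: "f t - F t = f (1/2) - F (1/2)" if t: "t \<in> {0<..<1}" for t
  proof -
    consider "t < 1/2" | "t = 1/2" | "1/2 < t" by linarith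
    then show ?thesis
    proof cases
      case 1 then show ?thesis using const[of t "1/2"] t by simp
    next
      case 2 then show ?thesis by (simp only:)
    next
      case 3 then show ?thesis using const[of "1/2" t] t by simp
    qed
  qed
  have cl: "closure {0<..<1::real} = {0..1}" by simp
  \<comment> \<open>Cut-offs supported inside the open interval only give constancy there;
    continuity adds the end points, and the value at 0 identifies the constant.\<close>
  have k': "f t - F t = f (1/2) - F (1/2)" if "t \<in> {0..1}" for t
  proof (rule continuous_constant_on_closure[where S="{0<..<1}" and f="\<lambda>t. f t - F t" and x=t])
    show "continuous_on (closure {0<..<1}) (\<lambda>t. f t - F t)"
      unfolding cl by (intro continuous_on_diff f Fc)
    show "t \<in> closure {0<..<1}" unfolding cl by (rule that)
  qed (rule k)
  have "f t = f 0 + F t" if "t \<in> {0..1}" for t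
  proof -
    have "F 0 = 0" by (simp add: F_def)
    then show ?thesis using k'[OF that] k'[of 0] by simp
  qed
  then have "L2_primitive f g" unfolding L2_primitive_def F_def using g out sq by blast
  then show ?thesis by (rule that)
qed

lemma H1_unit_interval_iff:
  assumes f: "continuous_on {0..1} f"
  shows "f \<in> H1 {0<..<1} \<longleftrightarrow> (\<exists>B. \<forall>m. dyadic_energy m f \<le> B)"
proof
  assume "f \<in> H1 {0<..<1}"
  then obtain g1 where "g1 \<in> Lp_space (lebesgue_on {0<..<1}) 2" "has_weak_gradient_on f g1 {0<..<1}"
    by (auto simp: H1_def)
  then obtain g where "L2_primitive f g" using weak_gradient_L2_primitive[OF f] by blast
  then show "\<exists>B. \<forall>m. dyadic_energy m f \<le> B" using dyadic_energy_le by blast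
next
  assume "\<exists>B. \<forall>m. dyadic_energy m f \<le> B"
  then obtain B where "\<And>m. dyadic_energy m f \<le> B" by blast
  then obtain g where g: "L2_primitive f g" using dyadic_limit_exists[OF f] by blast
  have gm[measurable]: "g \<in> borel_measurable borel" and sq: "integrable lborel (\<lambda>t. (g t)\<^sup>2)"
    using g unfolding L2_primitive_def by blast+
  have gL: "g \<in> Lp_space (lebesgue_on {0<..<1}) 2"
  proof -
    have "g \<in> borel_measurable (lebesgue_on {0<..<1})"
      by (rule measurable_restrict_space1, rule measurable_completion) measurable
    moreover have "integrable (lebesgue_on {0<..<1}) (\<lambda>t. (g t)\<^sup>2)"
      by (subst integral_lebesgue_on_unit_interval(2))
         (use integrable_mult_indicator[OF _ sq, of "{0<..<1}"] in \<open>simp_all, measurable\<close>)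
    ultimately show ?thesis by (simp add: Lp_space_def powr_numeral)
  qed
  have fL: "f \<in> Lp_space (lebesgue_on {0<..<1}) 2"
  proof -
    have fi: "integrable lborel (\<lambda>t. indicator {0<..<1} t *\<^sub>R k t)" if "continuous_on {0..1} k" for k :: "real \<Rightarrow> real"
    proof -
      have "integrable lborel (\<lambda>t. indicator {0<..<1} t *\<^sub>R (indicator {0..1} t *\<^sub>R k t))"
        by (intro integrable_mult_indicator borel_integrable_compact that) auto
      moreover have "indicator {0<..<1} t *\<^sub>R (indicator {0..1} t *\<^sub>R k t) = indicator {0<..<1} t *\<^sub>R k t" for t
        by (cases "t \<in> {0<..<1}") simp_all
      ultimately show ?thesis by (simp only:)
    qed
    have "integrable (lebesgue_on {0<..<1}) k" if k: "continuous_on {0..1} k" for k :: "real \<Rightarrow> real"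
    proof -
      have "integrable lborel (\<lambda>t. indicator {0<..<1} t * k t)" using fi[OF k] by simp
      then show ?thesis
        using integral_lebesgue_on_unit_interval(2)[of k] borel_measurable_integrable by fastforce
    qed
    from this[OF f] this[OF continuous_on_power[OF f, of 2]] show ?thesis
      by (simp add: Lp_space_def powr_numeral)
  qed
  show "f \<in> H1 {0<..<1}" using gL fL L2_primitive_weak_gradient[OF g] by (auto simp: H1_def)
qed

text \<open>The chosen gradient agrees almost everywhere with the Borel derivative, and completeness
  of Lebesgue measure transfers measurability as well as integrals. The last claim is the Holder
  bound of exponent 1/2 behind the pointwise estimates on edges.\<close>

lemma weak_gradient_unit_interval:
  assumes f: "continuous_on {0..1} f" and B: "\<And>m. dyadic_energy m f \<le> B"
  defines "w \<equiv> weak_gradient {0<..<1} f"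
  shows "w \<in> borel_measurable (lebesgue_on {0<..<1})" "integrable (lebesgue_on {0<..<1}) (\<lambda>t. (w t)\<^sup>2)"
    and "(\<lambda>m. dyadic_energy m f) \<longlonglongrightarrow> (\<integral>t. (w t)\<^sup>2 \<partial>lebesgue_on {0<..<1})"
    and "\<And>s t. s \<in> {0..1} \<Longrightarrow> t \<in> {0..1} \<Longrightarrow> (f t - f s)\<^sup>2 \<le> \<bar>t - s\<bar> * (\<integral>t. (w t)\<^sup>2 \<partial>lebesgue_on {0<..<1})"
proof -
  obtain g where g: "L2_primitive f g" and lim: "(\<lambda>m. dyadic_energy m f) \<longlonglongrightarrow> (\<integral>x. (g x)\<^sup>2 \<partial>lborel)"
    using dyadic_limit_exists[OF f B] by blast
  have gm[measurable]: "g \<in> borel_measurable borel" and sq: "integrable lborel (\<lambda>t. (g t)\<^sup>2)"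
    and out: "\<And>t. t \<notin> {0..<1} \<Longrightarrow> g t = 0"
    using g unfolding L2_primitive_def by blast+
  have gw: "has_weak_gradient_on f g {0<..<1}" by (rule L2_primitive_weak_gradient[OF g])
  have ww: "has_weak_gradient_on f w {0<..<1}"
    unfolding w_def weak_gradient_def by (rule someI[where P="\<lambda>g. has_weak_gradient_on f g {0<..<1}", OF gw])
  have ae1: "AE x in lebesgue. x \<in> {0<..<1} \<longrightarrow> g x = w x"
    by (rule weak_gradient_unique[OF _ gw ww]) simp
  then have ae: "AE x in lebesgue_on {0<..<1}. g x = w x"
    by (simp add: AE_restrict_space_iff)
  have g': "g \<in> borel_measurable (lebesgue_on {0<..<1})"
    by (rule measurable_restrict_space1, rule measurable_completion) measurable
  have ind: "AE t in lborel. indicator {0<..<1} t * (g t)\<^sup>2 = (g t)\<^sup>2"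
    using AE_lborel_singleton[of "0::real"]
  proof eventually_elim
    case (elim t)
    then show ?case using out[of t] by (cases "t \<in> {0<..<1}") auto
  qed
  have gi: "integrable (lebesgue_on {0<..<1}) (\<lambda>t. (g t)\<^sup>2)"
    by (subst integral_lebesgue_on_unit_interval(2))
       (use integrable_mult_indicator[OF _ sq, of "{0<..<1}"] in \<open>simp_all, measurable\<close>)
  have gI: "(\<integral>t. (g t)\<^sup>2 \<partial>lebesgue_on {0<..<1}) = (\<integral>t. (g t)\<^sup>2 \<partial>lborel)"
  proof -
    have "(\<integral>t. (g t)\<^sup>2 \<partial>lebesgue_on {0<..<1}) = (\<integral>t. indicator {0<..<1} t * (g t)\<^sup>2 \<partial>lborel)"
      by (rule integral_lebesgue_on_unit_interval(1)) measurable
    also have "\<dots> = (\<integral>t. (g t)\<^sup>2 \<partial>lborel)" by (rule integral_cong_AE[OF _ _ ind]) auto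
    finally show ?thesis .
  qed
  show wm: "w \<in> borel_measurable (lebesgue_on {0<..<1})"
  proof -
    have "(\<lambda>x. indicator {0<..<1} x *\<^sub>R w x) \<in> borel_measurable lebesgue"
    proof (rule borel_measurable_AE)
      show "(\<lambda>x. indicator {0<..<1} x *\<^sub>R g x) \<in> borel_measurable lebesgue"
        by (rule measurable_completion) measurable
      show "AE x in lebesgue. indicator {0<..<1} x *\<^sub>R g x = indicator {0<..<1} x *\<^sub>R w x"
        using ae1 by eventually_elim (simp add: indicator_def)
    qed
    then show ?thesis by (subst borel_measurable_restrict_space_iff) simp_all
  qed
  show "integrable (lebesgue_on {0<..<1}) (\<lambda>t. (w t)\<^sup>2)"
    by (rule integrable_cong_AE_imp[OF gi]) (use wm ae in \<open>auto elim: eventually_mono\<close>)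
  have wI: "(\<integral>t. (w t)\<^sup>2 \<partial>lebesgue_on {0<..<1}) = (\<integral>t. (g t)\<^sup>2 \<partial>lborel)"
    unfolding gI[symmetric] by (rule integral_cong_AE) (use wm g' ae in \<open>auto elim: eventually_mono\<close>)
  show "(\<lambda>m. dyadic_energy m f) \<longlonglongrightarrow> (\<integral>t. (w t)\<^sup>2 \<partial>lebesgue_on {0<..<1})"
    unfolding wI by (rule lim)
  have "(f t - f s)\<^sup>2 \<le> \<bar>t - s\<bar> * (\<integral>t. (g t)\<^sup>2 \<partial>lborel)" if "0 \<le> s" "s \<le> t" "t \<le> 1" for s t
    using L2_primitive_diff(3)[OF g that] that(2) by simp
  note le = this
  show "(f t - f s)\<^sup>2 \<le> \<bar>t - s\<bar> * (\<integral>t. (w t)\<^sup>2 \<partial>lebesgue_on {0<..<1})"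
    if st: "s \<in> {0..1}" "t \<in> {0..1}" for s t
  proof (cases "s \<le> t")
    case True
    then show ?thesis unfolding wI by (intro le) (use st in auto)
  next
    case False
    then have "(f s - f t)\<^sup>2 \<le> \<bar>s - t\<bar> * (\<integral>t. (g t)\<^sup>2 \<partial>lborel)" by (intro le) (use st in auto)
    then show ?thesis unfolding wI power2_commute[of "f t"] abs_minus_commute[of t] .
  qed
qed

section \<open>Energies on the metric graph\<close>

abbreviation unit_lebesgue :: "real measure" where
  "unit_lebesgue \<equiv> lebesgue_on {0<..<1}"

lemma emeasure_unit_lebesgue: "emeasure unit_lebesgue (space unit_lebesgue) = 1"
  by (simp add: space_restrict_space emeasure_restrict_space)

lemma finite_measure_unit_lebesgue: "finite_measure unit_lebesgue"
  by (rule finite_measureI) (simp only: emeasure_unit_lebesgue, simp)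

lemma sigma_finite_unit_lebesgue: "sigma_finite_measure unit_lebesgue"
  by (rule finite_measure.axioms(1)[OF finite_measure_unit_lebesgue])

lemma countable_vertices: "countable (vertices :: (real^'n) set)"
proof -
  have "vertices \<subseteq> range (\<lambda>f::'n \<Rightarrow> int. \<chi> i. real_of_int (f i))"
  proof
    fix x :: "real^'n" assume "x \<in> vertices"
    then have "x = (\<chi> i. real_of_int \<lfloor>x $ i\<rfloor>)" by (simp add: vec_eq_iff vertices_def)
    then show "x \<in> range (\<lambda>f::'n \<Rightarrow> int. \<chi> i. real_of_int (f i))" by (rule range_eqI[where x="\<lambda>i. \<lfloor>x $ i\<rfloor>"])
  qed
  then show ?thesis by (rule countable_subset) (intro countable_image countableI_type)
qed

lemma countable_edges: "countable (edges :: ((real^'n) \<times> 'n) set)"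
  unfolding edges_def by (intro countable_SIGMA countable_vertices) auto

lemma edge_point_in_grid: "e \<in> edges \<Longrightarrow> t \<in> {0..1} \<Longrightarrow> edge_point e t \<in> grid"
  unfolding grid_def by blast

lemma continuous_on_edge:
  assumes "continuous_on grid u" "e \<in> edges"
  shows "continuous_on {0..1} (\<lambda>t. u (edge_point e t))"
  by (rule continuous_on_compose2[OF assms(1)])
     (use edge_point_in_grid[OF assms(2)] in \<open>auto simp: edge_point_def intro!: continuous_intros\<close>)

text \<open>The edge set is countable and carries all subsets as measurable sets, so measurability
  can be checked edge by edge.\<close>

lemma borel_measurable_arclength_iff:
  fixes f :: "((real^'n) \<times> 'n) \<times> real \<Rightarrow> real"
  shows "f \<in> borel_measurable arclength \<longleftrightarrow> (\<forall>e\<in>edges. (\<lambda>t. f (e, t)) \<in> borel_measurable unit_lebesgue)"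
proof
  assume "f \<in> borel_measurable arclength"
  then show "\<forall>e\<in>edges. (\<lambda>t. f (e, t)) \<in> borel_measurable unit_lebesgue"
    unfolding arclength_def by (auto intro!: measurable_compose[OF measurable_Pair1'])
next
  assume "\<forall>e\<in>edges. (\<lambda>t. f (e, t)) \<in> borel_measurable unit_lebesgue"
  then show "f \<in> borel_measurable arclength"
    unfolding arclength_def by (intro measurable_pair_measure_countable1[OF countable_edges]) auto
qed

lemma nn_integral_arclength:
  fixes f :: "((real^'n) \<times> 'n) \<times> real \<Rightarrow> real"
  assumes "f \<in> borel_measurable arclength"
  shows "(\<integral>\<^sup>+z. ennreal (f z) \<partial>arclength) = (\<integral>\<^sup>+e. \<integral>\<^sup>+t. ennreal (f (e, t)) \<partial>unit_lebesgue \<partial>count_space edges)"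
  using sigma_finite_measure.nn_integral_fst[OF sigma_finite_unit_lebesgue, of "\<lambda>z. ennreal (f z)" "count_space edges"] assms
  unfolding arclength_def by simp

definition edges_upto :: "nat \<Rightarrow> ((real^'n) \<times> 'n) set" where
  "edges_upto j = {e \<in> edges. to_nat_on edges e < j}"

lemma finite_edges_upto: "finite (edges_upto j :: ((real^'n) \<times> 'n) set)"
proof (rule finite_imageD)
  show "finite (to_nat_on edges ` (edges_upto j :: ((real^'n) \<times> 'n) set))"
    by (rule finite_subset[of _ "{..<j}"]) (auto simp: edges_upto_def)
  show "inj_on (to_nat_on edges) (edges_upto j :: ((real^'n) \<times> 'n) set)"
    by (rule inj_on_subset[OF inj_on_to_nat_on[OF countable_edges]]) (auto simp: edges_upto_def)
qed

lemma edges_upto_mono: "i \<le> j \<Longrightarrow> edges_upto i \<subseteq> edges_upto j"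
  by (auto simp: edges_upto_def)

lemma edges_upto_subset: "edges_upto j \<subseteq> edges"
  by (auto simp: edges_upto_def)

lemma in_edges_upto: "e \<in> edges \<Longrightarrow> to_nat_on edges e < j \<Longrightarrow> e \<in> edges_upto j"
  by (auto simp: edges_upto_def)

text \<open>One index bounds both the edges and the mesh. The result is a finite quadratic form in
  finitely many point values, continuous under pointwise convergence, and increasing to
  \<open>dirichlet u\<close> for \<open>u\<close> in \<open>H1_grid\<close>.\<close>

definition grid_energy :: "nat \<Rightarrow> (real^'n \<Rightarrow> real) \<Rightarrow> real" where
  "grid_energy j u = (\<Sum>e\<in>edges_upto j. dyadic_energy j (\<lambda>t. u (edge_point e t)))"

lemma grid_energy_mono: "i \<le> j \<Longrightarrow> grid_energy i u \<le> grid_energy j u"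
proof -
  assume ij: "i \<le> j"
  have "grid_energy i u \<le> (\<Sum>e\<in>edges_upto i. dyadic_energy j (\<lambda>t. u (edge_point e t)))"
    unfolding grid_energy_def by (intro sum_mono dyadic_energy_mono ij)
  also have "\<dots> \<le> grid_energy j u"
    unfolding grid_energy_def
    by (intro sum_mono2 finite_edges_upto edges_upto_mono ij dyadic_energy_nonneg)
  finally show ?thesis .
qed

lemma grid_energy_nonneg: "0 \<le> grid_energy j u"
  unfolding grid_energy_def by (intro sum_nonneg dyadic_energy_nonneg)

lemma dyadic_energy_le_grid_energy:
  assumes "e \<in> edges"
  shows "dyadic_energy m (\<lambda>t. u (edge_point e t)) \<le> grid_energy (max m (Suc (to_nat_on edges e))) u"
proof -
  let ?j = "max m (Suc (to_nat_on edges e))"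
  have "dyadic_energy m (\<lambda>t. u (edge_point e t)) \<le> dyadic_energy ?j (\<lambda>t. u (edge_point e t))"
    by (rule dyadic_energy_mono) simp
  also have "\<dots> \<le> grid_energy ?j u" unfolding grid_energy_def
    by (rule member_le_sum[OF in_edges_upto[OF assms]]) (auto intro: dyadic_energy_nonneg finite_edges_upto)
  finally show ?thesis .
qed

definition edge_energy :: "(real^'n \<Rightarrow> real) \<Rightarrow> (real^'n) \<times> 'n \<Rightarrow> real" where
  "edge_energy u e = (\<integral>t. (edge_deriv u (e, t))\<^sup>2 \<partial>unit_lebesgue)"

definition dirichlet :: "(real^'n \<Rightarrow> real) \<Rightarrow> real" where
  "dirichlet u = (\<integral>z. (edge_deriv u z)\<^sup>2 \<partial>arclength)"

definition mass :: "real \<Rightarrow> (real^'n \<Rightarrow> real) \<Rightarrow> real" where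
  "mass p u = (\<integral>z. \<bar>on_edges u z\<bar> powr p \<partial>arclength)"

lemma edge_energy_nonneg: "0 \<le> edge_energy u e"
  by (simp add: edge_energy_def)

lemma dirichlet_nonneg: "0 \<le> dirichlet u"
  by (simp add: dirichlet_def)

lemma mass_nonneg: "0 \<le> mass p u"
  by (simp add: mass_def)

context
  fixes u :: "real^'n \<Rightarrow> real"
  assumes cont: "continuous_on grid u"
    and bnd: "\<And>e. e \<in> edges \<Longrightarrow> \<exists>B. \<forall>m. dyadic_energy m (\<lambda>t. u (edge_point e t)) \<le> B"
begin

lemma edge_deriv_section:
  assumes e: "e \<in> edges"
  shows "(\<lambda>t. edge_deriv u (e, t)) \<in> borel_measurable unit_lebesgue"
    and "integrable unit_lebesgue (\<lambda>t. (edge_deriv u (e, t))\<^sup>2)"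
    and "(\<lambda>m. dyadic_energy m (\<lambda>t. u (edge_point e t))) \<longlonglongrightarrow> edge_energy u e"
    and "\<And>s t. s \<in> {0..1} \<Longrightarrow> t \<in> {0..1} \<Longrightarrow>
          (u (edge_point e t) - u (edge_point e s))\<^sup>2 \<le> \<bar>t - s\<bar> * edge_energy u e"
proof -
  obtain B where B: "\<And>m. dyadic_energy m (\<lambda>t. u (edge_point e t)) \<le> B" using bnd[OF e] by blast
  note w = weak_gradient_unit_interval[OF continuous_on_edge[OF cont e] B]
  have ed: "edge_deriv u (e, t) = weak_gradient {0<..<1} (\<lambda>t. u (edge_point e t)) t" for t
    by (simp add: edge_deriv_def)
  show "(\<lambda>t. edge_deriv u (e, t)) \<in> borel_measurable unit_lebesgue"
    unfolding ed by (rule w(1))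
  show "integrable unit_lebesgue (\<lambda>t. (edge_deriv u (e, t))\<^sup>2)"
    unfolding ed by (rule w(2))
  show "(\<lambda>m. dyadic_energy m (\<lambda>t. u (edge_point e t))) \<longlonglongrightarrow> edge_energy u e"
    unfolding edge_energy_def ed by (rule w(3))
  show "(u (edge_point e t) - u (edge_point e s))\<^sup>2 \<le> \<bar>t - s\<bar> * edge_energy u e"
    if "s \<in> {0..1}" "t \<in> {0..1}" for s t
    unfolding edge_energy_def ed by (rule w(4)[OF that])
qed

lemma edge_deriv_measurable: "edge_deriv u \<in> borel_measurable arclength"
  using edge_deriv_section(1) by (simp add: borel_measurable_arclength_iff)

lemma nn_integral_edge_deriv:
  "(\<integral>\<^sup>+z. ennreal ((edge_deriv u z)\<^sup>2) \<partial>arclength) = (\<integral>\<^sup>+e. ennreal (edge_energy u e) \<partial>count_space edges)"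
proof -
  have "(\<lambda>z. (edge_deriv u z)\<^sup>2) \<in> borel_measurable arclength" using edge_deriv_measurable by simp
  then have "(\<integral>\<^sup>+z. ennreal ((edge_deriv u z)\<^sup>2) \<partial>arclength) =
      (\<integral>\<^sup>+e. \<integral>\<^sup>+t. ennreal ((edge_deriv u (e, t))\<^sup>2) \<partial>unit_lebesgue \<partial>count_space edges)"
    by (rule nn_integral_arclength)
  also have "\<dots> = (\<integral>\<^sup>+e. ennreal (edge_energy u e) \<partial>count_space edges)"
  proof (rule nn_integral_cong)
    fix e :: "(real^'n) \<times> 'n" assume "e \<in> space (count_space edges)"
    then have "e \<in> edges" by simp
    then show "(\<integral>\<^sup>+t. ennreal ((edge_deriv u (e, t))\<^sup>2) \<partial>unit_lebesgue) = ennreal (edge_energy u e)"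
      unfolding edge_energy_def by (intro nn_integral_eq_integral edge_deriv_section(2)) auto
  qed
  finally show ?thesis .
qed

text \<open>Monotone convergence along the diagonal in edges and mesh: on a fixed edge the truncated
  dyadic energies increase to \<open>edge_energy u e\<close>.\<close>

lemma nn_integral_edge_energy:
  "(\<integral>\<^sup>+e. ennreal (edge_energy u e) \<partial>count_space edges) = (SUP j. ennreal (grid_energy j u))"
proof -
  define h where "h j e = ennreal (indicator (edges_upto j) e * dyadic_energy j (\<lambda>t. u (edge_point e t)))" for j e
  have inc: "incseq h"
  proof (intro incseq_SucI le_funI)
    fix j e
    have "indicator (edges_upto j) e * dyadic_energy j (\<lambda>t. u (edge_point e t)) \<le>
          indicator (edges_upto (Suc j)) e * dyadic_energy (Suc j) (\<lambda>t. u (edge_point e t))"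
      using edges_upto_mono[of j "Suc j"] dyadic_energy_mono[of j "Suc j"] dyadic_energy_nonneg
      by (intro mult_mono) (auto simp: indicator_def)
    then show "h j e \<le> h (Suc j) e" unfolding h_def by (rule ennreal_leI)
  qed
  have sup: "(SUP j. h j e) = ennreal (edge_energy u e)" if e: "e \<in> edges" for e
  proof (rule LIMSEQ_unique[OF LIMSEQ_SUP])
    show "incseq (\<lambda>j. h j e)" using inc unfolding incseq_def le_fun_def by blast
    have "(\<lambda>j. indicator (edges_upto j) e * dyadic_energy j (\<lambda>t. u (edge_point e t))) \<longlonglongrightarrow> edge_energy u e"
    proof (rule Lim_transform_eventually[OF edge_deriv_section(3)[OF e]])
      show "\<forall>\<^sub>F j in sequentially. dyadic_energy j (\<lambda>t. u (edge_point e t)) =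
          indicator (edges_upto j) e * dyadic_energy j (\<lambda>t. u (edge_point e t))"
        using eventually_gt_at_top[of "to_nat_on edges e"]
        by eventually_elim (simp add: in_edges_upto[OF e])
    qed
    then show "(\<lambda>j. h j e) \<longlonglongrightarrow> ennreal (edge_energy u e)" unfolding h_def by (rule tendsto_ennrealI)
  qed
  have "(\<integral>\<^sup>+e. ennreal (edge_energy u e) \<partial>count_space edges) = (\<integral>\<^sup>+e. (SUP j. h j e) \<partial>count_space edges)"
    by (rule nn_integral_cong) (simp add: sup)
  also have "\<dots> = (SUP j. \<integral>\<^sup>+e. h j e \<partial>count_space edges)"
    by (rule nn_integral_monotone_convergence_SUP[OF inc]) simp
  also have "\<dots> = (SUP j. ennreal (grid_energy j u))"
  proof (rule SUP_cong[OF refl])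
    fix j
    have "(\<integral>\<^sup>+e. h j e \<partial>count_space edges) = (\<Sum>e\<in>edges_upto j. h j e)"
      by (rule nn_integral_count_space') (auto simp: h_def finite_edges_upto edges_upto_subset)
    also have "\<dots> = (\<Sum>e\<in>edges_upto j. ennreal (dyadic_energy j (\<lambda>t. u (edge_point e t))))"
      by (rule sum.cong) (simp_all add: h_def)
    also have "\<dots> = ennreal (grid_energy j u)"
      unfolding grid_energy_def by (rule sum_ennreal) (rule dyadic_energy_nonneg)
    finally show "(\<integral>\<^sup>+e. h j e \<partial>count_space edges) = ennreal (grid_energy j u)" .
  qed
  finally show ?thesis .
qed

end

text \<open>A bound on finite energies replaces both derivative conditions in the definition, so
  that membership of multiples, differences and pointwise limits can be read off point
  values.\<close>

lemma H1_grid_iff: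
  fixes u :: "real^'n \<Rightarrow> real"
  shows "u \<in> H1_grid \<longleftrightarrow> continuous_on grid u \<and> integrable arclength (\<lambda>z. (on_edges u z)\<^sup>2) \<and>
     (\<exists>B. \<forall>j. grid_energy j u \<le> B)"
proof
  assume u: "u \<in> H1_grid"
  then have c: "continuous_on grid u" by (simp add: H1_grid_def)
  have bnd: "\<exists>B. \<forall>m. dyadic_energy m (\<lambda>t. u (edge_point e t)) \<le> B" if "e \<in> edges" for e
    using u that H1_unit_interval_iff[OF continuous_on_edge[OF c that]] by (auto simp: H1_grid_def)
  have d: "integrable arclength (\<lambda>z. (edge_deriv u z)\<^sup>2)" and m: "integrable arclength (\<lambda>z. (on_edges u z)\<^sup>2)"
    using u by (auto simp: H1_grid_def Lp_space_def powr_numeral)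
  have eq: "(SUP j. ennreal (grid_energy j u)) = ennreal (dirichlet u)"
  proof -
    have "(SUP j. ennreal (grid_energy j u)) = (\<integral>\<^sup>+e. ennreal (edge_energy u e) \<partial>count_space edges)"
      by (rule nn_integral_edge_energy[OF c bnd, symmetric])
    also have "\<dots> = (\<integral>\<^sup>+z. ennreal ((edge_deriv u z)\<^sup>2) \<partial>arclength)"
      by (rule nn_integral_edge_deriv[OF c bnd, symmetric])
    also have "\<dots> = ennreal (dirichlet u)"
      unfolding dirichlet_def by (rule nn_integral_eq_integral[OF d]) simp
    finally show ?thesis .
  qed
  have "grid_energy j u \<le> dirichlet u" for j
  proof -
    have "ennreal (grid_energy j u) \<le> ennreal (dirichlet u)"
      unfolding eq[symmetric] by (rule SUP_upper) simp
    then show ?thesis by (simp add: ennreal_le_iff dirichlet_nonneg)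
  qed
  with c m show "continuous_on grid u \<and> integrable arclength (\<lambda>z. (on_edges u z)\<^sup>2) \<and> (\<exists>B. \<forall>j. grid_energy j u \<le> B)"
    by blast
next
  assume "continuous_on grid u \<and> integrable arclength (\<lambda>z. (on_edges u z)\<^sup>2) \<and> (\<exists>B. \<forall>j. grid_energy j u \<le> B)"
  then obtain B where c: "continuous_on grid u" and m: "integrable arclength (\<lambda>z. (on_edges u z)\<^sup>2)"
    and B: "\<And>j. grid_energy j u \<le> B" by blast
  have bnd: "\<exists>B. \<forall>m. dyadic_energy m (\<lambda>t. u (edge_point e t)) \<le> B" if "e \<in> edges" for e
    using dyadic_energy_le_grid_energy[OF that, of _ u] B order_trans by blast
  have H1: "(\<lambda>t. u (edge_point e t)) \<in> H1 {0<..<1}" if "e \<in> edges" for e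
    using bnd[OF that] H1_unit_interval_iff[OF continuous_on_edge[OF c that]] by simp
  have om: "on_edges u \<in> borel_measurable arclength"
  proof -
    have "(\<lambda>t. u (edge_point e t)) \<in> borel_measurable unit_lebesgue" if "e \<in> edges" for e
      using H1[OF that] by (simp add: H1_def Lp_space_def)
    then show ?thesis by (simp add: borel_measurable_arclength_iff on_edges_def)
  qed
  have "(\<integral>\<^sup>+z. ennreal ((edge_deriv u z)\<^sup>2) \<partial>arclength) \<le> ennreal B"
  proof -
    have "(\<integral>\<^sup>+z. ennreal ((edge_deriv u z)\<^sup>2) \<partial>arclength) = (SUP j. ennreal (grid_energy j u))"
      by (rule trans[OF nn_integral_edge_deriv[OF c bnd] nn_integral_edge_energy[OF c bnd]])
    also have "\<dots> \<le> ennreal B" by (rule SUP_least) (rule ennreal_leI[OF B])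
    finally show ?thesis .
  qed
  then have "integrable arclength (\<lambda>z. (edge_deriv u z)\<^sup>2)"
    using edge_deriv_measurable[OF c bnd] by (intro integrableI_nonneg) (auto simp: le_less_trans)
  then have "edge_deriv u \<in> Lp_space arclength 2"
    using edge_deriv_measurable[OF c bnd] by (simp add: Lp_space_def powr_numeral)
  then show "u \<in> H1_grid" using c H1 m om by (simp add: H1_grid_def Lp_space_def powr_numeral)
qed

context
  fixes u :: "real^'n \<Rightarrow> real"
  assumes u: "u \<in> H1_grid"
begin

lemma H1_grid_bounded_edges:
  "e \<in> edges \<Longrightarrow> \<exists>B. \<forall>m. dyadic_energy m (\<lambda>t. u (edge_point e t)) \<le> B"
proof -
  assume e: "e \<in> edges"
  obtain B where B: "\<And>j. grid_energy j u \<le> B" using u unfolding H1_grid_iff by blast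
  have "dyadic_energy m (\<lambda>t. u (edge_point e t)) \<le> B" for m
    by (rule order_trans[OF dyadic_energy_le_grid_energy[OF e] B])
  then show ?thesis by blast
qed

lemma H1_grid_continuous: "continuous_on grid u"
  using u unfolding H1_grid_def by blast

lemma nn_integral_edge_energy_eq: "(\<integral>\<^sup>+e. ennreal (edge_energy u e) \<partial>count_space edges) = ennreal (dirichlet u)"
proof -
  have "edge_deriv u \<in> Lp_space arclength 2" using u unfolding H1_grid_def by blast
  then have i: "integrable arclength (\<lambda>z. (edge_deriv u z)\<^sup>2)" by (simp add: Lp_space_def powr_numeral)
  have "(\<integral>\<^sup>+e. ennreal (edge_energy u e) \<partial>count_space edges) = (\<integral>\<^sup>+z. ennreal ((edge_deriv u z)\<^sup>2) \<partial>arclength)"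
    by (rule nn_integral_edge_deriv[OF H1_grid_continuous H1_grid_bounded_edges, symmetric])
  also have "\<dots> = ennreal (dirichlet u)"
    unfolding dirichlet_def by (rule nn_integral_eq_integral[OF i]) simp
  finally show ?thesis .
qed

lemma edge_energy_le_dirichlet: "e \<in> edges \<Longrightarrow> edge_energy u e \<le> dirichlet u"
proof -
  assume e: "e \<in> edges"
  have "ennreal (edge_energy u e) \<le> (\<integral>\<^sup>+e. ennreal (edge_energy u e) \<partial>count_space edges)"
    using nn_integral_ge_point[OF e, of "\<lambda>e. ennreal (edge_energy u e)"] .
  then show ?thesis unfolding nn_integral_edge_energy_eq by (simp add: ennreal_le_iff dirichlet_nonneg)
qed

lemma grid_energy_tendsto: "(\<lambda>j. grid_energy j u) \<longlonglongrightarrow> dirichlet u"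
proof -
  have "incseq (\<lambda>j. ennreal (grid_energy j u))"
    by (intro incseq_SucI ennreal_leI grid_energy_mono) simp
  from LIMSEQ_SUP[OF this] have "(\<lambda>j. ennreal (grid_energy j u)) \<longlonglongrightarrow> ennreal (dirichlet u)"
    using nn_integral_edge_energy[OF H1_grid_continuous H1_grid_bounded_edges] nn_integral_edge_energy_eq by simp
  then show ?thesis by (simp add: tendsto_ennreal_iff grid_energy_nonneg dirichlet_nonneg)
qed

lemma grid_energy_le_dirichlet: "grid_energy j u \<le> dirichlet u"
  by (rule LIMSEQ_le_const[OF grid_energy_tendsto]) (use grid_energy_mono in blast)

lemma edge_holder:
  assumes "e \<in> edges" "s \<in> {0..1}" "t \<in> {0..1}"
  shows "(u (edge_point e t) - u (edge_point e s))\<^sup>2 \<le> \<bar>t - s\<bar> * edge_energy u e"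
  by (rule edge_deriv_section(4)[OF H1_grid_continuous H1_grid_bounded_edges assms])

lemma on_edges_measurable: "on_edges u \<in> borel_measurable arclength"
  and on_edges_square_integrable: "integrable arclength (\<lambda>z. (on_edges u z)\<^sup>2)"
proof -
  have "on_edges u \<in> Lp_space arclength 2" using u unfolding H1_grid_def by blast
  then show "on_edges u \<in> borel_measurable arclength" "integrable arclength (\<lambda>z. (on_edges u z)\<^sup>2)"
    by (simp_all add: Lp_space_def powr_numeral)
qed

lemma edge_section_measurable: "e \<in> edges \<Longrightarrow> (\<lambda>t. u (edge_point e t)) \<in> borel_measurable unit_lebesgue"
  using on_edges_measurable unfolding borel_measurable_arclength_iff by (simp add: on_edges_def)

end

section \<open>Multilinear interpolation of lattice functions\<close>

definition corner :: "'n set \<Rightarrow> real^'n" where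
  "corner S = (\<chi> i. if i \<in> S then 1 else 0)"

definition lattice_floor :: "real^'n \<Rightarrow> real^'n" where
  "lattice_floor x = (\<chi> i. real_of_int \<lfloor>x $ i\<rfloor>)"

definition unit_cube :: "(real^'n) set" where
  "unit_cube = {y. \<forall>i. 0 \<le> y $ i \<and> y $ i < 1}"

text \<open>The multilinear weight of the corner \<open>S\<close> of a cube with coordinate
  directions \<open>A\<close>. General \<open>A\<close> covers the faces orthogonal to a direction
  \<open>i\<close>, where \<open>A = - {i}\<close>.\<close>

definition corner_weight :: "'n set \<Rightarrow> 'n set \<Rightarrow> real^'n \<Rightarrow> real" where
  "corner_weight A S y = (\<Prod>i\<in>S. y $ i) * (\<Prod>i\<in>A - S. 1 - y $ i)"

definition interpolation :: "(real^'n \<Rightarrow> real) \<Rightarrow> real^'n \<Rightarrow> real" where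
  "interpolation a x = (\<Sum>S\<in>Pow UNIV. corner_weight UNIV S (x - lattice_floor x) * a (lattice_floor x + corner S))"

text \<open>Differentiating the multilinear formula in coordinate \<open>i\<close> leaves the
  weights of the face and turns values into differences along the edges parallel to
  \<open>i\<close>, which the Dirichlet energy controls.\<close>

definition interpolation_partial :: "(real^'n \<Rightarrow> real) \<Rightarrow> 'n \<Rightarrow> real^'n \<Rightarrow> real" where
  "interpolation_partial a i x = (\<Sum>S\<in>Pow (- {i}). corner_weight (- {i}) S (x - lattice_floor x) *
     (a (lattice_floor x + corner S + axis i 1) - a (lattice_floor x + corner S)))"

definition interpolation_gradient :: "(real^'n \<Rightarrow> real) \<Rightarrow> real^'n \<Rightarrow> real^'n" where
  "interpolation_gradient a x = (\<chi> i. interpolation_partial a i x)"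

lemma lattice_floor_vertices: "lattice_floor x \<in> vertices"
  by (simp add: lattice_floor_def vertices_def)

lemma corner_vertices: "corner S \<in> vertices"
  by (simp add: corner_def vertices_def)

lemma vertices_add: "k \<in> vertices \<Longrightarrow> m \<in> vertices \<Longrightarrow> k + m \<in> vertices"
  by (simp add: vertices_def)

lemma vertices_diff: "k \<in> vertices \<Longrightarrow> m \<in> vertices \<Longrightarrow> k - m \<in> vertices"
  by (simp add: vertices_def)

lemma frac_in_unit_cube: "x - lattice_floor x \<in> unit_cube"
  by (simp add: unit_cube_def lattice_floor_def) linarith

lemma lattice_floor_add:
  assumes "k \<in> vertices" "y \<in> unit_cube"
  shows "lattice_floor (k + y) = k"
proof -
  have "real_of_int \<lfloor>k $ i + y $ i\<rfloor> = k $ i" for i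
  proof -
    have "k $ i \<in> \<int>" "0 \<le> y $ i" "y $ i < 1" using assms by (auto simp: vertices_def unit_cube_def)
    then obtain n where n: "k $ i = real_of_int n" by (auto elim: Ints_cases)
    have "\<lfloor>k $ i + y $ i\<rfloor> = n" unfolding n using \<open>0 \<le> y $ i\<close> \<open>y $ i < 1\<close> by (intro floor_unique) auto
    then show ?thesis using n by simp
  qed
  then show ?thesis by (simp add: lattice_floor_def vec_eq_iff)
qed

lemma corner_weight_nonneg: "y \<in> unit_cube \<Longrightarrow> 0 \<le> corner_weight A S y"
  unfolding corner_weight_def unit_cube_def
  by (intro mult_nonneg_nonneg prod_nonneg) (auto simp: less_imp_le)

text \<open>Expansion of the product of the factors \<open>y $ i + (1 - y $ i)\<close>.\<close>

lemma sum_corner_weight: "finite A \<Longrightarrow> (\<Sum>S\<in>Pow A. corner_weight A S y) = 1"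
  using prod_add[of A "\<lambda>i. y $ i" "\<lambda>i. 1 - y $ i"] by (simp add: corner_weight_def)

text \<open>The variance with respect to the weights is nonnegative.\<close>

lemma jensen_square:
  fixes w c :: "'s \<Rightarrow> real"
  assumes "\<And>s. s \<in> I \<Longrightarrow> 0 \<le> w s" "(\<Sum>s\<in>I. w s) = 1"
  shows "(\<Sum>s\<in>I. w s * c s)\<^sup>2 \<le> (\<Sum>s\<in>I. w s * (c s)\<^sup>2)"
proof -
  define m where "m = (\<Sum>s\<in>I. w s * c s)"
  have "0 \<le> (\<Sum>s\<in>I. w s * (c s - m)\<^sup>2)" using assms(1) by (intro sum_nonneg) simp
  also have "\<dots> = (\<Sum>s\<in>I. w s * (c s)\<^sup>2 - 2 * m * (w s * c s) + m\<^sup>2 * w s)"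
    by (rule sum.cong) (simp_all add: power2_eq_square algebra_simps)
  also have "\<dots> = (\<Sum>s\<in>I. w s * (c s)\<^sup>2) - 2 * m * m + m\<^sup>2 * 1"
    unfolding sum.distrib sum_subtractf sum_distrib_left[symmetric] m_def[symmetric] assms(2) ..
  finally show ?thesis unfolding m_def[symmetric] by (simp add: power2_eq_square)
qed

lemma sum_Pow_insert:
  fixes f :: "'s set \<Rightarrow> real"
  assumes "finite A" "i \<notin> A"
  shows "(\<Sum>S\<in>Pow (insert i A). f S) = (\<Sum>S\<in>Pow A. f S + f (insert i S))"
proof -
  have "(\<Sum>S\<in>Pow (insert i A). f S) = (\<Sum>S\<in>Pow A. f S) + (\<Sum>S\<in>insert i ` Pow A. f S)"
    unfolding Pow_insert by (rule sum.union_disjoint) (use assms in auto)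
  also have "(\<Sum>S\<in>insert i ` Pow A. f S) = (\<Sum>S\<in>Pow A. f (insert i S))"
    by (rule sum.reindex_cong[where l="insert i"]) (use assms(2) in \<open>auto simp: inj_on_def\<close>)
  finally show ?thesis by (simp add: sum.distrib)
qed

lemma corner_weight_insert:
  assumes "finite A" "i \<notin> A" "S \<subseteq> A"
  shows "corner_weight (insert i A) S y = (1 - y $ i) * corner_weight A S y"
    and "corner_weight (insert i A) (insert i S) y = y $ i * corner_weight A S y"
proof -
  have 1: "insert i A - S = insert i (A - S)" "insert i A - insert i S = A - S" using assms by auto
  have 2: "finite S" "i \<notin> S" "finite (A - S)" "i \<notin> A - S" using assms finite_subset by auto
  show "corner_weight (insert i A) S y = (1 - y $ i) * corner_weight A S y"
    unfolding corner_weight_def 1 prod.insert[OF 2(3,4)] by (simp only: mult.left_commute)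
  show "corner_weight (insert i A) (insert i S) y = y $ i * corner_weight A S y"
    unfolding corner_weight_def 1 prod.insert[OF 2(1,2)] by (simp only: mult.assoc)
qed

section \<open>Restriction of the interpolation to coordinate lines\<close>

definition linear_interpolation :: "(int \<Rightarrow> real) \<Rightarrow> real \<Rightarrow> real" where
  "linear_interpolation c s = c \<lfloor>s\<rfloor> + (s - \<lfloor>s\<rfloor>) * (c (\<lfloor>s\<rfloor> + 1) - c \<lfloor>s\<rfloor>)"

lemma linear_interpolation_affine:
  assumes "real_of_int n \<le> s" "s \<le> real_of_int n + 1"
  shows "linear_interpolation c s = c n + (s - n) * (c (n + 1) - c n)"
proof (cases "s < real_of_int n + 1")
  case True
  then have "\<lfloor>s\<rfloor> = n" using assms by (intro floor_unique) auto
  then show ?thesis by (simp add: linear_interpolation_def)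
next
  case False
  then have s: "s = real_of_int (n + 1)" using assms by simp
  then have "\<lfloor>s\<rfloor> = n + 1" by simp
  then show ?thesis by (simp add: linear_interpolation_def s)
qed

text \<open>An interval of length at most 1 meets at most two adjacent cells up to end points, so at
  most two affine pieces have to be joined.\<close>

lemma linear_interpolation_lipschitz_le:
  assumes M: "\<And>n. \<bar>c (n + 1) - c n\<bar> \<le> M" and st: "s \<le> t" "t \<le> s + 1"
  shows "\<bar>linear_interpolation c t - linear_interpolation c s\<bar> \<le> M * (t - s)"
proof -
  let ?L = "linear_interpolation c"
  define n where "n = \<lfloor>s\<rfloor>"
  have n: "real_of_int n \<le> s" "s < real_of_int n + 1" by (auto simp: n_def)
  have seg: "\<bar>?L b - ?L a\<bar> \<le> M * (b - a)" if "real_of_int m \<le> a" "a \<le> b" "b \<le> real_of_int m + 1" for a b m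
  proof -
    have "?L b - ?L a = (b - a) * (c (m + 1) - c m)"
      using linear_interpolation_affine[of m a c] linear_interpolation_affine[of m b c] that by (simp add: algebra_simps)
    then have "\<bar>?L b - ?L a\<bar> = (b - a) * \<bar>c (m + 1) - c m\<bar>" using that by (simp add: abs_mult)
    also have "\<dots> \<le> (b - a) * M" using that M by (intro mult_left_mono) auto
    finally show ?thesis by (simp only: mult.commute)
  qed
  show ?thesis
  proof (cases "t \<le> real_of_int n + 1")
    case True then show ?thesis using seg[of n s t] n st by simp
  next
    case False
    have "\<bar>?L (real_of_int n + 1) - ?L s\<bar> \<le> M * (real_of_int n + 1 - s)" using seg[of n s "real_of_int n + 1"] n by simp
    moreover have "\<bar>?L t - ?L (real_of_int n + 1)\<bar> \<le> M * (t - (real_of_int n + 1))"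
      using seg[of "n + 1" "real_of_int n + 1" t] n False st by simp
    ultimately have "\<bar>?L t - ?L s\<bar> \<le> M * (real_of_int n + 1 - s) + M * (t - (real_of_int n + 1))" by linarith
    also have "\<dots> = M * (t - s)" by (simp add: algebra_simps)
    finally show ?thesis .
  qed
qed

text \<open>The values at integer positions \<open>n\<close> of the interpolation along the line
  through \<open>x\<close> in direction \<open>i\<close>. The offset by the floor makes the family
  depend on the line only, as \<open>slice_translate\<close> records.\<close>

definition slice :: "(real^'n \<Rightarrow> real) \<Rightarrow> 'n \<Rightarrow> real^'n \<Rightarrow> int \<Rightarrow> real" where
  "slice a i x n = (\<Sum>S\<in>Pow (- {i}). corner_weight (- {i}) S (x - lattice_floor x) *
     a (lattice_floor x + axis i (of_int n - of_int \<lfloor>x $ i\<rfloor>) + corner S))"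

lemma corner_insert: "i \<notin> S \<Longrightarrow> corner (insert i S) = corner S + axis i 1"
  by (auto simp: corner_def axis_def vec_eq_iff)

lemma axis_zero: "axis i 0 = (0 :: real^'n)"
  by (simp add: axis_def vec_eq_iff)

text \<open>Subsets are paired as \<open>S\<close> and \<open>insert i S\<close>; each pair
  contributes an affine function of coordinate \<open>i\<close>.\<close>

lemma interpolation_slice:
  "interpolation a x = linear_interpolation (slice a i x) (x $ i)"
proof -
  let ?k = "lattice_floor x" and ?y = "x - lattice_floor x" and ?A = "- {i}"
  have U: "UNIV = insert i ?A" by auto
  have A: "finite ?A" "i \<notin> ?A" by auto
  have yi: "?y $ i = x $ i - \<lfloor>x $ i\<rfloor>" by (simp add: lattice_floor_def)
  have s0: "slice a i x \<lfloor>x $ i\<rfloor> = (\<Sum>S\<in>Pow ?A. corner_weight ?A S ?y * a (?k + corner S))"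
    by (simp add: slice_def axis_zero)
  have s1: "slice a i x (\<lfloor>x $ i\<rfloor> + 1) = (\<Sum>S\<in>Pow ?A. corner_weight ?A S ?y * a (?k + corner (insert i S)))"
    unfolding slice_def
  proof (rule sum.cong[OF refl])
    fix S assume "S \<in> Pow ?A"
    then have "i \<notin> S" by auto
    then show "corner_weight ?A S ?y * a (?k + axis i (of_int (\<lfloor>x $ i\<rfloor> + 1) - of_int \<lfloor>x $ i\<rfloor>) + corner S) =
        corner_weight ?A S ?y * a (?k + corner (insert i S))"
      by (simp add: corner_insert add_ac)
  qed
  have "interpolation a x = (\<Sum>S\<in>Pow (insert i ?A). corner_weight (insert i ?A) S ?y * a (?k + corner S))"
    unfolding interpolation_def U[symmetric] ..
  also have "\<dots> = (\<Sum>S\<in>Pow ?A. corner_weight (insert i ?A) S ?y * a (?k + corner S) +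
        corner_weight (insert i ?A) (insert i S) ?y * a (?k + corner (insert i S)))"
    by (rule sum_Pow_insert[OF A])
  also have "\<dots> = (\<Sum>S\<in>Pow ?A. (1 - ?y $ i) * (corner_weight ?A S ?y * a (?k + corner S)) +
        ?y $ i * (corner_weight ?A S ?y * a (?k + corner (insert i S))))"
    by (rule sum.cong[OF refl]) (simp only: Pow_iff corner_weight_insert[OF A] mult.assoc)
  also have "\<dots> = (1 - ?y $ i) * slice a i x \<lfloor>x $ i\<rfloor> + ?y $ i * slice a i x (\<lfloor>x $ i\<rfloor> + 1)"
    unfolding s0 s1 sum.distrib sum_distrib_left ..
  also have "\<dots> = linear_interpolation (slice a i x) (x $ i)"
    unfolding linear_interpolation_def yi by (simp add: algebra_simps)
  finally show ?thesis .
qed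

lemma slice_translate: "slice a i (x + axis i h) = slice a i x"
proof
  fix n
  have comp: "(x + axis i h) $ j = x $ j" if "j \<noteq> i" for j using that by (simp add: axis_def)
  have "lattice_floor (x + axis i h) + axis i (of_int n - of_int \<lfloor>(x + axis i h) $ i\<rfloor>) =
        lattice_floor x + axis i (of_int n - of_int \<lfloor>x $ i\<rfloor>)"
    by (simp add: vec_eq_iff lattice_floor_def axis_def)
  moreover have "corner_weight (- {i}) S (x + axis i h - lattice_floor (x + axis i h)) =
     corner_weight (- {i}) S (x - lattice_floor x)" if "S \<in> Pow (- {i})" for S
    unfolding corner_weight_def
  proof (intro arg_cong2[where f="(*)"] prod.cong refl)
    fix j assume "j \<in> S"
    then have "j \<noteq> i" using that by auto
    then show "(x + axis i h - lattice_floor (x + axis i h)) $ j = (x - lattice_floor x) $ j"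
      by (simp add: lattice_floor_def axis_def)
  next
    fix j assume "j \<in> - {i} - S"
    then have "j \<noteq> i" by auto
    then show "1 - (x + axis i h - lattice_floor (x + axis i h)) $ j = 1 - (x - lattice_floor x) $ j"
      by (simp add: lattice_floor_def axis_def)
  qed
  ultimately show "slice a i (x + axis i h) n = slice a i x n"
    unfolding slice_def by (intro sum.cong refl) simp
qed

lemma slice_step: "slice a i x (\<lfloor>x $ i\<rfloor> + 1) - slice a i x \<lfloor>x $ i\<rfloor> = interpolation_partial a i x"
  unfolding slice_def interpolation_partial_def sum_subtractf[symmetric]
  by (rule sum.cong[OF refl]) (simp add: algebra_simps axis_zero)

lemma slice_bound:
  assumes "\<And>k. k \<in> vertices \<Longrightarrow> \<bar>a k\<bar> \<le> M"
  shows "\<bar>slice a i x n\<bar> \<le> M"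
proof -
  have ax: "axis i (of_int n - of_int \<lfloor>x $ i\<rfloor>) \<in> vertices" by (simp add: vertices_def axis_def)
  have "\<bar>slice a i x n\<bar> \<le> (\<Sum>S\<in>Pow (- {i}). \<bar>corner_weight (- {i}) S (x - lattice_floor x) *
     a (lattice_floor x + axis i (of_int n - of_int \<lfloor>x $ i\<rfloor>) + corner S)\<bar>)"
    unfolding slice_def by (rule sum_abs)
  also have "\<dots> \<le> (\<Sum>S\<in>Pow (- {i}). corner_weight (- {i}) S (x - lattice_floor x) * M)"
  proof (rule sum_mono)
    fix S
    have "0 \<le> corner_weight (- {i}) S (x - lattice_floor x)" by (rule corner_weight_nonneg[OF frac_in_unit_cube])
    moreover have "\<bar>a (lattice_floor x + axis i (of_int n - of_int \<lfloor>x $ i\<rfloor>) + corner S)\<bar> \<le> M"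
      by (intro assms vertices_add lattice_floor_vertices ax corner_vertices)
    ultimately show "\<bar>corner_weight (- {i}) S (x - lattice_floor x) *
       a (lattice_floor x + axis i (of_int n - of_int \<lfloor>x $ i\<rfloor>) + corner S)\<bar> \<le> corner_weight (- {i}) S (x - lattice_floor x) * M"
      by (simp add: abs_mult mult_left_mono)
  qed
  also have "\<dots> = M" unfolding sum_distrib_right[symmetric] by (subst sum_corner_weight) auto
  finally show ?thesis .
qed

text \<open>A bound on difference quotients uniform in the step, which later serves as majorant for
  the weak gradient.\<close>

lemma interpolation_increment_bound:
  assumes M: "\<And>k. k \<in> vertices \<Longrightarrow> \<bar>a k\<bar> \<le> M" and h: "\<bar>h\<bar> \<le> 1"
  shows "\<bar>interpolation a (x + axis i h) - interpolation a x\<bar> \<le> 2 * M * \<bar>h\<bar>"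
proof -
  let ?c = "slice a i x"
  have c: "\<bar>?c (n + 1) - ?c n\<bar> \<le> 2 * M" for n
    using slice_bound[where a=a and i=i and x=x and n=n, OF M] slice_bound[where a=a and i=i and x=x and n="n + 1", OF M] by linarith
  have eq: "interpolation a (x + axis i h) = linear_interpolation ?c (x $ i + h)" "interpolation a x = linear_interpolation ?c (x $ i)"
    using interpolation_slice[of a "x + axis i h" i] interpolation_slice[of a x i] by (simp_all add: slice_translate)
  show ?thesis
  proof (cases "h \<ge> 0")
    case True
    then show ?thesis unfolding eq
      using linear_interpolation_lipschitz_le[of ?c "2 * M" "x $ i" "x $ i + h", OF c] h by simp
  next
    case False
    then show ?thesis unfolding eq
      using linear_interpolation_lipschitz_le[of ?c "2 * M" "x $ i + h" "x $ i", OF c] h by (simp add: abs_minus_commute)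
  qed
qed

lemma interpolation_increment_exact:
  assumes "\<lfloor>x $ i + h\<rfloor> = \<lfloor>x $ i\<rfloor>"
  shows "interpolation a (x + axis i h) - interpolation a x = h * interpolation_partial a i x"
proof -
  let ?c = "slice a i x"
  have eq: "interpolation a (x + axis i h) = linear_interpolation ?c (x $ i + h)" "interpolation a x = linear_interpolation ?c (x $ i)"
    using interpolation_slice[of a "x + axis i h" i] interpolation_slice[of a x i] by (simp_all add: slice_translate)
  show ?thesis unfolding eq linear_interpolation_def assms slice_step[symmetric] by (simp add: algebra_simps)
qed

section \<open>Measurability and the tiling of space by unit cubes\<close>

lemma frac_measurable [measurable]: "(\<lambda>x::real^'n. (x - lattice_floor x) $ i) \<in> borel_measurable borel"
  unfolding lattice_floor_def by simp

text \<open>The target is a countable discrete space, so preimages of single vertices suffice, and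
  every lattice function of the floor becomes Borel.\<close>

lemma lattice_floor_measurable [measurable]:
  "(lattice_floor :: real^'n \<Rightarrow> real^'n) \<in> measurable borel (count_space vertices)"
proof (subst measurable_count_space_eq_countable[OF countable_vertices], intro conjI ballI)
  show "lattice_floor \<in> space borel \<rightarrow> vertices" using lattice_floor_vertices by auto
  fix k :: "real^'n"
  have "lattice_floor -` {k} \<inter> space borel = {x::real^'n. \<forall>i\<in>UNIV. real_of_int \<lfloor>x $ i\<rfloor> = k $ i}"
    by (auto simp: lattice_floor_def vec_eq_iff)
  also have "\<dots> \<in> sets borel"
    by measurable
  finally show "lattice_floor -` {k} \<inter> space borel \<in> sets (borel :: (real^'n) measure)" .
qed

lemma lattice_value_measurable [measurable]: "(\<lambda>x::real^'n. a (lattice_floor x + m) :: real) \<in> borel_measurable borel"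
  by (rule measurable_compose[OF lattice_floor_measurable]) simp

lemma corner_weight_measurable [measurable]:
  "(\<lambda>x::real^'n. corner_weight A S (x - lattice_floor x)) \<in> borel_measurable borel"
  unfolding corner_weight_def by measurable

lemma interpolation_measurable [measurable]: "interpolation (a :: real^'n \<Rightarrow> real) \<in> borel_measurable borel"
  unfolding interpolation_def by measurable

lemma interpolation_partial_measurable [measurable]:
  "interpolation_partial (a :: real^'n \<Rightarrow> real) i \<in> borel_measurable borel"
  unfolding interpolation_partial_def add.assoc by measurable

lemma unit_cube_measurable [measurable]: "(unit_cube :: (real^'n) set) \<in> sets borel"
proof -
  have "unit_cube = {y::real^'n. \<forall>i\<in>UNIV. 0 \<le> y $ i \<and> y $ i < 1}" by (auto simp: unit_cube_def)
  also have "\<dots> \<in> sets borel" by measurable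
  finally show ?thesis .
qed

lemma emeasure_unit_cube: "emeasure lborel (unit_cube :: (real^'n) set) = 1"
proof -
  have b: "box 0 1 \<subseteq> (unit_cube :: (real^'n) set)" "(unit_cube :: (real^'n) set) \<subseteq> cbox 0 1"
    by (auto simp: unit_cube_def mem_box_cart less_imp_le)
  have one: "(1::real^'n) \<bullet> b = 1" if "b \<in> Basis" for b
    using that by (auto simp: Basis_vec_def inner_axis)
  have *: "emeasure lborel (box 0 (1::real^'n)) = 1" "emeasure lborel (cbox 0 (1::real^'n)) = 1"
    using one by (subst emeasure_lborel_box emeasure_lborel_cbox; simp)+
  have "emeasure lborel (unit_cube :: (real^'n) set) \<le> 1"
    unfolding *(2)[symmetric] by (rule emeasure_mono[OF b(2)]) simp
  moreover have "1 \<le> emeasure lborel (unit_cube :: (real^'n) set)"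
    unfolding *(1)[symmetric] by (rule emeasure_mono[OF b(1)]) simp
  ultimately show ?thesis by (rule antisym)
qed

lemma nn_integral_lborel_translate:
  fixes F :: "'a::euclidean_space \<Rightarrow> ennreal"
  assumes [measurable]: "F \<in> borel_measurable borel"
  shows "(\<integral>\<^sup>+x. F (c + x) \<partial>lborel) = (\<integral>\<^sup>+x. F x \<partial>lborel)"
  by (subst (2) lborel_distr_plus[symmetric, of c]) (simp add: nn_integral_distr)

text \<open>Every point lies in exactly one cube \<open>k + unit_cube\<close>, the one with
  \<open>k = lattice_floor x\<close>. Tonelli and translation invariance turn the integral over
  space into an average over offsets \<open>y\<close> of lattice sums.\<close>

lemma nn_integral_tiling:
  fixes F :: "real^'n \<Rightarrow> ennreal"
  assumes [measurable]: "F \<in> borel_measurable borel"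
  shows "(\<integral>\<^sup>+x. F x \<partial>lborel) = (\<integral>\<^sup>+y. indicator unit_cube y * (\<integral>\<^sup>+k. F (k + y) \<partial>count_space vertices) \<partial>lborel)"
proof -
  have part: "F x = (\<integral>\<^sup>+k. indicator unit_cube (x - k) * F x \<partial>count_space vertices)" for x
  proof -
    have "indicator unit_cube (x - k) * F x = F x * indicator {lattice_floor x} k" if "k \<in> vertices" for k
    proof (cases "x - k \<in> unit_cube")
      case True
      then have "lattice_floor x = k" using lattice_floor_add[OF that True] by simp
      then show ?thesis using True by simp
    next
      case False
      then have "k \<noteq> lattice_floor x" using frac_in_unit_cube[of x] by auto
      then show ?thesis using False by simp
    qed
    then have "(\<integral>\<^sup>+k. indicator unit_cube (x - k) * F x \<partial>count_space vertices) = (\<integral>\<^sup>+k. F x * indicator {lattice_floor x} k \<partial>count_space vertices)"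
      by (intro nn_integral_cong) simp
    also have "\<dots> = F x"
      using lattice_floor_vertices[of x] by (simp add: nn_integral_cmult_indicator)
    finally show ?thesis ..
  qed
  have "(\<integral>\<^sup>+x. F x \<partial>lborel) = (\<integral>\<^sup>+x. \<integral>\<^sup>+k. indicator unit_cube (x - k) * F x \<partial>count_space vertices \<partial>lborel)"
    using part by (intro nn_integral_cong) simp
  also have "\<dots> = (\<integral>\<^sup>+k. \<integral>\<^sup>+x. indicator unit_cube (x - k) * F x \<partial>lborel \<partial>count_space vertices)"
    by (rule nn_integral_count_space_nn_integral[OF countable_vertices]) measurable
  also have "\<dots> = (\<integral>\<^sup>+k. \<integral>\<^sup>+y. indicator unit_cube y * F (k + y) \<partial>lborel \<partial>count_space vertices)"
  proof (rule nn_integral_cong)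
    fix k :: "real^'n"
    have "(\<integral>\<^sup>+x. indicator unit_cube (x - k) * F x \<partial>lborel) = (\<integral>\<^sup>+y. indicator unit_cube (k + y - k) * F (k + y) \<partial>lborel)"
      by (rule nn_integral_lborel_translate[symmetric]) measurable
    then show "(\<integral>\<^sup>+x. indicator unit_cube (x - k) * F x \<partial>lborel) = (\<integral>\<^sup>+y. indicator unit_cube y * F (k + y) \<partial>lborel)"
      by simp
  qed
  also have "\<dots> = (\<integral>\<^sup>+y. \<integral>\<^sup>+k. indicator unit_cube y * F (k + y) \<partial>count_space vertices \<partial>lborel)"
    by (rule nn_integral_count_space_nn_integral[OF countable_vertices, symmetric]) measurable
  also have "\<dots> = (\<integral>\<^sup>+y. indicator unit_cube y * (\<integral>\<^sup>+k. F (k + y) \<partial>count_space vertices) \<partial>lborel)"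
    by (intro nn_integral_cong nn_integral_cmult) simp
  finally show ?thesis .
qed

text \<open>The cube has volume 1, so a bound uniform in the offset passes to the integral
  unchanged.\<close>

lemma nn_integral_tiling_le:
  fixes F :: "real^'n \<Rightarrow> ennreal"
  assumes [measurable]: "F \<in> borel_measurable borel"
    and C: "\<And>y. y \<in> unit_cube \<Longrightarrow> (\<integral>\<^sup>+k. F (k + y) \<partial>count_space vertices) \<le> C"
  shows "(\<integral>\<^sup>+x. F x \<partial>lborel) \<le> C"
proof -
  have "(\<integral>\<^sup>+x. F x \<partial>lborel) \<le> (\<integral>\<^sup>+y. C * indicator (unit_cube :: (real^'n) set) y \<partial>lborel)"
    unfolding nn_integral_tiling[OF assms(1)] by (rule nn_integral_mono) (use C in \<open>auto simp: indicator_def\<close>)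
  also have "\<dots> = C"
    using nn_integral_cmult_indicator[of "unit_cube :: (real^'n) set" lborel C] by (simp add: emeasure_unit_cube)
  finally show ?thesis .
qed

lemma nn_integral_vertices_translate:
  fixes f :: "real^'n \<Rightarrow> ennreal"
  assumes "m \<in> vertices"
  shows "(\<integral>\<^sup>+k. f (k + m) \<partial>count_space vertices) = (\<integral>\<^sup>+k. f k \<partial>count_space vertices)"
proof (rule nn_integral_bij_count_space)
  show "bij_betw (\<lambda>k. k + m) vertices vertices"
    by (rule bij_betw_byWitness[where f'="\<lambda>k. k - m"])
       (use assms vertices_add vertices_diff in auto)
qed

lemma interpolation_cell:
  assumes "k \<in> vertices" "y \<in> unit_cube"
  shows "interpolation a (k + y) = (\<Sum>S\<in>Pow UNIV. corner_weight UNIV S y * a (k + corner S))"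
    and "interpolation_partial a i (k + y) = (\<Sum>S\<in>Pow (- {i}). corner_weight (- {i}) S y * (a (k + corner S + axis i 1) - a (k + corner S)))"
  unfolding interpolation_def interpolation_partial_def lattice_floor_add[OF assms] by simp_all

text \<open>Jensen's inequality for the corner weights, which sum to 1, and an exchange of sums. The
  constant stays 1, and this matters because the final comparison with Euclidean space has to be
  sharp.\<close>

lemma nn_integral_weighted_squares_le:
  fixes a :: "'s \<Rightarrow> real^'n \<Rightarrow> real"
  assumes "finite A" and y: "y \<in> unit_cube"
    and C: "\<And>S. S \<in> Pow A \<Longrightarrow> (\<integral>\<^sup>+k. ennreal ((c S k)\<^sup>2) \<partial>count_space vertices) \<le> C"
  shows "(\<integral>\<^sup>+k. ennreal ((\<Sum>S\<in>Pow A. corner_weight A S y * c S k)\<^sup>2) \<partial>count_space (vertices :: (real^'n) set)) \<le> C"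
proof -
  let ?w = "\<lambda>S. corner_weight A S y"
  have w: "0 \<le> ?w S" for S by (rule corner_weight_nonneg[OF y])
  have "(\<integral>\<^sup>+k. ennreal ((\<Sum>S\<in>Pow A. ?w S * c S k)\<^sup>2) \<partial>count_space vertices) \<le>
        (\<integral>\<^sup>+k. (\<Sum>S\<in>Pow A. ennreal (?w S) * ennreal ((c S k)\<^sup>2)) \<partial>count_space vertices)"
  proof (rule nn_integral_mono)
    fix k
    have "ennreal ((\<Sum>S\<in>Pow A. ?w S * c S k)\<^sup>2) \<le> ennreal (\<Sum>S\<in>Pow A. ?w S * (c S k)\<^sup>2)"
      by (intro ennreal_leI jensen_square w sum_corner_weight assms(1))
    also have "\<dots> = (\<Sum>S\<in>Pow A. ennreal (?w S * (c S k)\<^sup>2))"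
      by (rule sum_ennreal[symmetric]) (simp add: w)
    also have "\<dots> = (\<Sum>S\<in>Pow A. ennreal (?w S) * ennreal ((c S k)\<^sup>2))"
      by (rule sum.cong) (simp_all add: ennreal_mult w)
    finally show "ennreal ((\<Sum>S\<in>Pow A. ?w S * c S k)\<^sup>2) \<le> (\<Sum>S\<in>Pow A. ennreal (?w S) * ennreal ((c S k)\<^sup>2))" .
  qed
  also have "\<dots> = (\<Sum>S\<in>Pow A. ennreal (?w S) * (\<integral>\<^sup>+k. ennreal ((c S k)\<^sup>2) \<partial>count_space vertices))"
    by (subst nn_integral_sum) (simp_all add: nn_integral_cmult)
  also have "\<dots> \<le> (\<Sum>S\<in>Pow A. ennreal (?w S) * C)"
    by (intro sum_mono mult_left_mono C) auto
  also have "\<dots> = ennreal (\<Sum>S\<in>Pow A. ?w S) * C"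
    by (simp add: sum_distrib_right[symmetric] sum_ennreal w)
  also have "\<dots> = C" by (simp add: sum_corner_weight assms(1))
  finally show ?thesis .
qed

lemma interpolation_square_le:
  fixes a :: "real^'n \<Rightarrow> real"
  assumes "(\<integral>\<^sup>+k. ennreal ((a k)\<^sup>2) \<partial>count_space vertices) \<le> C"
  shows "(\<integral>\<^sup>+x. ennreal ((interpolation a x)\<^sup>2) \<partial>lborel) \<le> C"
proof (rule nn_integral_tiling_le)
  fix y :: "real^'n" assume y: "y \<in> unit_cube"
  have "(\<integral>\<^sup>+k. ennreal ((interpolation a (k + y))\<^sup>2) \<partial>count_space vertices) =
        (\<integral>\<^sup>+k. ennreal ((\<Sum>S\<in>Pow UNIV. corner_weight UNIV S y * a (k + corner S))\<^sup>2) \<partial>count_space vertices)"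
    by (rule nn_integral_cong) (simp add: interpolation_cell[OF _ y])
  also have "\<dots> \<le> C"
  proof (rule nn_integral_weighted_squares_le[OF finite y])
    fix S :: "'n set"
    show "(\<integral>\<^sup>+k. ennreal ((a (k + corner S))\<^sup>2) \<partial>count_space vertices) \<le> C"
      using nn_integral_vertices_translate[OF corner_vertices, of "\<lambda>k. ennreal ((a k)\<^sup>2)" S] assms by simp
  qed
  finally show "(\<integral>\<^sup>+k. ennreal ((interpolation a (k + y))\<^sup>2) \<partial>count_space vertices) \<le> C" .
qed measurable

section \<open>Energy estimates for the interpolation\<close>

definition direction_energy :: "(real^'n \<Rightarrow> real) \<Rightarrow> 'n \<Rightarrow> ennreal" where
  "direction_energy a i = (\<integral>\<^sup>+k. ennreal ((a (k + axis i 1) - a k)\<^sup>2) \<partial>count_space vertices)"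

lemma interpolation_partial_square_le:
  fixes a :: "real^'n \<Rightarrow> real"
  shows "(\<integral>\<^sup>+x. ennreal ((interpolation_partial a i x)\<^sup>2) \<partial>lborel) \<le> direction_energy a i"
proof (rule nn_integral_tiling_le)
  fix y :: "real^'n" assume y: "y \<in> unit_cube"
  have "(\<integral>\<^sup>+k. ennreal ((interpolation_partial a i (k + y))\<^sup>2) \<partial>count_space vertices) =
        (\<integral>\<^sup>+k. ennreal ((\<Sum>S\<in>Pow (- {i}). corner_weight (- {i}) S y * (a (k + corner S + axis i 1) - a (k + corner S)))\<^sup>2) \<partial>count_space vertices)"
    by (rule nn_integral_cong) (simp add: interpolation_cell(2)[OF _ y])
  also have "\<dots> \<le> direction_energy a i"
  proof (rule nn_integral_weighted_squares_le[OF finite y])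
    fix S :: "'n set"
    show "(\<integral>\<^sup>+k. ennreal ((a (k + corner S + axis i 1) - a (k + corner S))\<^sup>2) \<partial>count_space vertices) \<le> direction_energy a i"
      using nn_integral_vertices_translate[OF corner_vertices, of "\<lambda>k. ennreal ((a (k + axis i 1) - a k)\<^sup>2)" S]
      by (simp add: direction_energy_def)
  qed
  finally show "(\<integral>\<^sup>+k. ennreal ((interpolation_partial a i (k + y))\<^sup>2) \<partial>count_space vertices) \<le> direction_energy a i" .
qed measurable

text \<open>The corner is reached one coordinate step at a time, and each step costs the inequality
  \<open>(p + r)^2 \<le> 2 * p^2 + 2 * r^2\<close>. The crude power of 4 is harmless, since it only
  multiplies an error that vanishes with the energy.\<close>

lemma corner_difference_energy:
  fixes a :: "real^'n \<Rightarrow> real"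
  assumes E: "(\<Sum>i\<in>UNIV. direction_energy a i) \<le> E"
  shows "(\<integral>\<^sup>+k. ennreal ((a (k + corner S) - a k)\<^sup>2) \<partial>count_space vertices) \<le> 4 ^ card S * E"
  using finite[of S]
proof (induction S rule: finite_induct)
  case empty
  have "corner {} = (0 :: real^'n)" by (simp add: corner_def vec_eq_iff)
  then show ?case by simp
next
  case (insert i S)
  have le: "direction_energy a i \<le> E"
    by (rule order_trans[OF member_le_sum[of i UNIV "direction_energy a"] E]) auto
  have "(\<integral>\<^sup>+k. ennreal ((a (k + corner (insert i S)) - a k)\<^sup>2) \<partial>count_space vertices) \<le>
        (\<integral>\<^sup>+k. 2 * ennreal ((a (k + corner S + axis i 1) - a (k + corner S))\<^sup>2) + 2 * ennreal ((a (k + corner S) - a k)\<^sup>2) \<partial>count_space vertices)"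
  proof (rule nn_integral_mono)
    fix k :: "real^'n"
    define p where "p = a (k + corner S + axis i 1) - a (k + corner S)"
    define r where "r = a (k + corner S) - a k"
    have "(p + r)\<^sup>2 \<le> 2 * p\<^sup>2 + 2 * r\<^sup>2"
      using sum_squares_bound[of p r] by (simp add: power2_sum)
    then have "ennreal ((p + r)\<^sup>2) \<le> 2 * ennreal (p\<^sup>2) + 2 * ennreal (r\<^sup>2)"
    proof -
      assume "(p + r)\<^sup>2 \<le> 2 * p\<^sup>2 + 2 * r\<^sup>2"
      then have "ennreal ((p + r)\<^sup>2) \<le> ennreal (2 * p\<^sup>2 + 2 * r\<^sup>2)" by (rule ennreal_leI)
      also have "\<dots> = ennreal (2 * p\<^sup>2) + ennreal (2 * r\<^sup>2)" by (rule ennreal_plus) simp_all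
      also have "\<dots> = 2 * ennreal (p\<^sup>2) + 2 * ennreal (r\<^sup>2)" by (simp add: ennreal_mult)
      finally show ?thesis .
    qed
    moreover have "a (k + corner (insert i S)) - a k = p + r"
      by (simp add: p_def r_def corner_insert[OF insert(2)] add_ac)
    ultimately show "ennreal ((a (k + corner (insert i S)) - a k)\<^sup>2) \<le>
      2 * ennreal ((a (k + corner S + axis i 1) - a (k + corner S))\<^sup>2) + 2 * ennreal ((a (k + corner S) - a k)\<^sup>2)"
      by (simp add: p_def r_def)
  qed
  also have "\<dots> = 2 * (\<integral>\<^sup>+k. ennreal ((a (k + corner S + axis i 1) - a (k + corner S))\<^sup>2) \<partial>count_space vertices) +
      2 * (\<integral>\<^sup>+k. ennreal ((a (k + corner S) - a k)\<^sup>2) \<partial>count_space vertices)"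
    by (simp add: nn_integral_add nn_integral_cmult)
  also have "(\<integral>\<^sup>+k. ennreal ((a (k + corner S + axis i 1) - a (k + corner S))\<^sup>2) \<partial>count_space vertices) = direction_energy a i"
    using nn_integral_vertices_translate[OF corner_vertices, of "\<lambda>k. ennreal ((a (k + axis i 1) - a k)\<^sup>2)" S]
    by (simp add: direction_energy_def)
  also have "2 * direction_energy a i + 2 * (\<integral>\<^sup>+k. ennreal ((a (k + corner S) - a k)\<^sup>2) \<partial>count_space vertices)
     \<le> 2 * (4 ^ card S * E) + 2 * (4 ^ card S * E)"
  proof (intro add_mono mult_left_mono insert.IH)
    have "1 * E \<le> 4 ^ card S * E" by (rule mult_right_mono) (simp_all add: one_le_power)
    then have "E \<le> 4 ^ card S * E" by (simp only: mult_1)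
    with le show "direction_energy a i \<le> 4 ^ card S * E" by (rule order_trans)
  qed auto
  also have "\<dots> = 4 ^ card (insert i S) * E"
    using insert(1,2) by (simp add: mult.assoc flip: distrib_right mult_2)
  finally show ?case .
qed

text \<open>Since the weights sum to 1, the error at a fixed offset is a weighted mean of corner
  differences.\<close>

lemma interpolation_error_square_le:
  fixes a :: "real^'n \<Rightarrow> real"
  assumes E: "(\<Sum>i\<in>UNIV. direction_energy a i) \<le> E" and y: "y \<in> unit_cube"
  shows "(\<integral>\<^sup>+k. ennreal ((interpolation a (k + y) - a k)\<^sup>2) \<partial>count_space vertices) \<le> 4 ^ CARD('n) * E"
proof -
  have "interpolation a (k + y) - a k = (\<Sum>S\<in>Pow UNIV. corner_weight UNIV S y * (a (k + corner S) - a k))"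
    if "k \<in> vertices" for k
  proof -
    have "(\<Sum>S\<in>Pow UNIV. corner_weight UNIV S y * a k) = a k"
      unfolding sum_distrib_right[symmetric] by (subst sum_corner_weight) auto
    then show ?thesis unfolding interpolation_cell(1)[OF that y] right_diff_distrib sum_subtractf by simp
  qed
  then have "(\<integral>\<^sup>+k. ennreal ((interpolation a (k + y) - a k)\<^sup>2) \<partial>count_space vertices) =
    (\<integral>\<^sup>+k. ennreal ((\<Sum>S\<in>Pow UNIV. corner_weight UNIV S y * (a (k + corner S) - a k))\<^sup>2) \<partial>count_space vertices)"
    by (intro nn_integral_cong) simp
  also have "\<dots> \<le> 4 ^ CARD('n) * E"
  proof (rule nn_integral_weighted_squares_le[OF finite y])
    fix S :: "'n set"
    have "(4::ennreal) ^ card S \<le> 4 ^ CARD('n)"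
      by (rule power_increasing) (auto intro: card_mono)
    then have "4 ^ card S * E \<le> 4 ^ CARD('n) * E" by (rule mult_right_mono) simp
    with corner_difference_energy[OF E] show "(\<integral>\<^sup>+k. ennreal ((a (k + corner S) - a k)\<^sup>2) \<partial>count_space vertices) \<le> 4 ^ CARD('n) * E"
      by (rule order_trans)
  qed
  finally show ?thesis .
qed

text \<open>The data for dominated convergence of difference quotients: the mean value theorem
  bounds them by the sup of the derivative, and steps of length at most 1 enlarge the radius of the
  support by at most 1.\<close>

lemma test_function_direction:
  fixes \<phi> :: "'a::euclidean_space \<Rightarrow> real"
  assumes \<phi>: "\<phi> \<in> test_functions UNIV" and b: "b \<in> Basis"
  defines "\<phi>' \<equiv> \<lambda>x. frechet_derivative \<phi> (at x) b"
  obtains R C where "0 \<le> C" "\<And>x. R < norm x \<Longrightarrow> \<phi> x = 0" "\<And>x. \<bar>\<phi> x\<bar> \<le> C"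
    "\<And>x h. 0 < h \<Longrightarrow> h \<le> 1 \<Longrightarrow> \<bar>(\<phi> (x + h *\<^sub>R b) - \<phi> x) / h\<bar> \<le> C * indicator (cball 0 (R + 1)) x"
    "\<And>x. (\<lambda>n. (\<phi> (x + (1 / Suc n) *\<^sub>R b) - \<phi> x) / (1 / Suc n)) \<longlonglongrightarrow> \<phi>' x"
    "\<phi> \<in> borel_measurable borel" "\<phi>' \<in> borel_measurable borel"
proof -
  have C: "\<And>k. Ck k \<phi>" and cpt: "compact (closure {x. \<phi> x \<noteq> 0})"
    using \<phi> by (auto simp: test_functions_def)
  have c0: "continuous_on UNIV \<phi>" using C[of 0] by simp
  have c1: "continuous_on UNIV \<phi>'" using Ck_SucD(2)[OF C[of "Suc 0"] b] by (simp add: \<phi>'_def)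
  have d: "(\<phi> has_derivative frechet_derivative \<phi> (at x)) (at x)" for x by (rule Ck_SucD(1)[OF C])
  have line: "((\<lambda>s. \<phi> (x + s *\<^sub>R b)) has_real_derivative \<phi>' (x + s *\<^sub>R b)) (at s)" for x s
  proof -
    have "((\<lambda>s. x + s *\<^sub>R b) has_derivative (\<lambda>h. h *\<^sub>R b)) (at s)"
      by (auto intro!: derivative_eq_intros)
    from has_derivative_compose[OF this d]
    have "((\<lambda>s. \<phi> (x + s *\<^sub>R b)) has_derivative (\<lambda>h. frechet_derivative \<phi> (at (x + s *\<^sub>R b)) (h *\<^sub>R b))) (at s)" .
    moreover have "(\<lambda>h. frechet_derivative \<phi> (at (x + s *\<^sub>R b)) (h *\<^sub>R b)) = (*) (\<phi>' (x + s *\<^sub>R b))"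
      using linear_cmul[OF has_derivative_linear[OF d]] by (auto simp: \<phi>'_def mult.commute)
    ultimately show ?thesis by (simp add: has_field_derivative_def)
  qed
  obtain R0 where R0: "\<And>x. x \<in> closure {x. \<phi> x \<noteq> 0} \<Longrightarrow> norm x \<le> R0"
    using compact_imp_bounded[OF cpt] unfolding bounded_iff by blast
  define R where "R = max R0 0"
  have out: "\<phi> x = 0" if "R < norm x" for x
    using R0[of x] closure_subset[of "{x. \<phi> x \<noteq> 0}"] that by (force simp: R_def)
  \<comment> \<open>The radius \<open>R + 2\<close> covers all intermediate points of steps of
    length at most 1 that start in the ball of radius \<open>R + 1\<close>.\<close>
  have bd: "\<exists>M. \<forall>x\<in>cball 0 (R + 2). norm (f x) \<le> M" if "continuous_on UNIV f" for f :: "'a \<Rightarrow> real"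
    using compact_imp_bounded[OF compact_continuous_image[OF continuous_on_subset[OF that subset_UNIV] compact_cball]]
    unfolding bounded_iff by blast
  obtain M0 where M0: "\<And>x. x \<in> cball 0 (R + 2) \<Longrightarrow> \<bar>\<phi> x\<bar> \<le> M0" using bd[OF c0] unfolding real_norm_def by blast
  obtain M1 where M1: "\<And>x. x \<in> cball 0 (R + 2) \<Longrightarrow> \<bar>\<phi>' x\<bar> \<le> M1" using bd[OF c1] unfolding real_norm_def by blast
  define K where "K = max 0 (max M0 M1)"
  show thesis
  proof (rule that)
    show "0 \<le> K" by (simp add: K_def)
    show "\<phi> x = 0" if "R < norm x" for x by (rule out[OF that])
    show "\<bar>\<phi> x\<bar> \<le> K" for x
    proof (cases "R < norm x")
      case True then show ?thesis using out[OF True] by (simp add: K_def)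
    next
      case False
      then have "\<bar>\<phi> x\<bar> \<le> M0" by (intro M0) simp
      then show ?thesis by (simp add: K_def)
    qed
    show "\<bar>(\<phi> (x + h *\<^sub>R b) - \<phi> x) / h\<bar> \<le> K * indicator (cball 0 (R + 1)) x" if h: "0 < h" "h \<le> 1" for x h
    proof (cases "x \<in> cball 0 (R + 1)")
      case True
      obtain s where s: "0 < s" "s < h" "\<phi> (x + h *\<^sub>R b) - \<phi> (x + 0 *\<^sub>R b) = (h - 0) * \<phi>' (x + s *\<^sub>R b)"
        using MVT2[of 0 h "\<lambda>s. \<phi> (x + s *\<^sub>R b)" "\<lambda>s. \<phi>' (x + s *\<^sub>R b)"] h(1) line by blast
      have "norm (x + s *\<^sub>R b) \<le> norm x + s" using norm_triangle_ineq[of x "s *\<^sub>R b"] s(1) b by simp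
      then have "\<bar>\<phi>' (x + s *\<^sub>R b)\<bar> \<le> M1" using True s h by (intro M1) simp
      moreover have "(\<phi> (x + h *\<^sub>R b) - \<phi> x) / h = \<phi>' (x + s *\<^sub>R b)" using s(3) h by simp
      ultimately show ?thesis using True by (simp add: K_def)
    next
      case False
      then have x: "R + 1 < norm x" by simp
      have "norm x \<le> norm (x + h *\<^sub>R b) + h" using norm_triangle_ineq4[of "x + h *\<^sub>R b" "h *\<^sub>R b"] h b by simp
      then have "\<phi> (x + h *\<^sub>R b) = 0" "\<phi> x = 0" using x h by (auto intro!: out)
      then show ?thesis using False by simp
    qed
    show "(\<lambda>n. (\<phi> (x + (1 / Suc n) *\<^sub>R b) - \<phi> x) / (1 / Suc n)) \<longlonglongrightarrow> \<phi>' x" for x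
    proof -
      have "((\<lambda>h. (\<phi> (x + (0 + h) *\<^sub>R b) - \<phi> (x + 0 *\<^sub>R b)) / h) \<longlongrightarrow> \<phi>' (x + 0 *\<^sub>R b)) (at 0)"
        using line[of x 0] unfolding DERIV_def .
      then have lim: "((\<lambda>h. (\<phi> (x + h *\<^sub>R b) - \<phi> x) / h) \<longlongrightarrow> \<phi>' x) (at 0)" by simp
      have "filterlim (\<lambda>n. 1 / real (Suc n)) (at 0) sequentially"
        unfolding filterlim_at using LIMSEQ_Suc[OF lim_1_over_n[where 'a=real]] by (simp add: eventually_sequentially)
      from filterlim_compose[OF lim this] show ?thesis .
    qed
    show "\<phi> \<in> borel_measurable borel" "\<phi>' \<in> borel_measurable borel"
      using c0 c1 by (auto intro: borel_measurable_continuous_onI)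
  qed
qed

section \<open>The weak gradient of the interpolation\<close>

lemma integral_lborel_translate:
  fixes F :: "'a::euclidean_space \<Rightarrow> real"
  assumes [measurable]: "F \<in> borel_measurable borel"
  shows "(\<integral>x. F (c + x) \<partial>lborel) = (\<integral>x. F x \<partial>lborel)"
    and "integrable lborel (\<lambda>x. F (c + x)) \<longleftrightarrow> integrable lborel F"
proof -
  have "(\<integral>x. F x \<partial>distr lborel borel ((+) c)) = (\<integral>x. F (c + x) \<partial>lborel)"
    by (rule integral_distr) simp_all
  then show "(\<integral>x. F (c + x) \<partial>lborel) = (\<integral>x. F x \<partial>lborel)" by (simp only: lborel_distr_plus)
  have "integrable (distr lborel borel ((+) c)) F \<longleftrightarrow> integrable lborel (\<lambda>x. F (c + x))"
    by (rule integrable_distr_eq) simp_all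
  then show "integrable lborel (\<lambda>x. F (c + x)) \<longleftrightarrow> integrable lborel F" by (simp only: lborel_distr_plus)
qed

lemma AE_not_integer_coordinate: "AE x in lborel. (x :: real^'n) $ i \<noteq> of_int \<lfloor>x $ i\<rfloor>"
proof -
  have "AE x in lborel. \<forall>n::int. (x :: real^'n) \<bullet> axis i 1 \<noteq> of_int n"
    unfolding AE_all_countable by (intro allI AE_lborel_inner_neq) (auto simp: Basis_vec_def)
  then show ?thesis by eventually_elim (metis inner_axis inner_real_def mult.right_neutral)
qed

lemma bounded_measurable_locally_integrable:
  fixes f :: "real^'n \<Rightarrow> 'b::euclidean_space"
  assumes "f \<in> borel_measurable borel" "\<And>x. norm (f x) \<le> B"
  shows "locally_integrable_on f UNIV"
  unfolding locally_integrable_on_def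
proof (intro allI impI)
  fix K :: "(real^'n) set" assume "compact K \<and> K \<subseteq> UNIV"
  then have K: "K \<in> sets lborel" "emeasure lborel K < \<infinity>"
    using emeasure_bounded_finite[of K] compact_imp_bounded borel_closed compact_imp_closed by auto
  have "integrable lborel (\<lambda>x. indicator K x *\<^sub>R f x)"
  proof (rule Bochner_Integration.integrable_bound)
    show "integrable lborel (\<lambda>x. B * indicator K x)" using K by simp
    show "(\<lambda>x. indicator K x *\<^sub>R f x) \<in> borel_measurable lborel" using K(1) assms(1) by simp
    show "AE x in lborel. norm (indicator K x *\<^sub>R f x) \<le> norm (B * indicator K x)"
      using assms(2) by (auto simp: indicator_def intro: order_trans[OF _ abs_ge_self])
  qed
  then show "f absolutely_integrable_on K"
    unfolding set_integrable_def by (subst integrable_completion) auto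
qed

lemma interpolation_gradient_measurable [measurable]: "interpolation_gradient (a :: real^'n \<Rightarrow> real) \<in> borel_measurable borel"
proof (subst borel_measurable_euclidean_space, rule ballI)
  fix b :: "real^'n" assume "b \<in> Basis"
  then obtain i where "b = axis i 1" by (auto simp: Basis_vec_def)
  then have "interpolation_gradient a x \<bullet> b = interpolation_partial a i x" for x
    by (simp add: interpolation_gradient_def inner_axis)
  then show "(\<lambda>x. interpolation_gradient a x \<bullet> b) \<in> borel_measurable borel" by simp
qed

context
  fixes a :: "real^'n \<Rightarrow> real" and M :: real
  assumes M: "\<And>k. k \<in> vertices \<Longrightarrow> \<bar>a k\<bar> \<le> M"
begin

lemma bound_nonneg: "0 \<le> M"
  using M[OF lattice_floor_vertices] abs_ge_zero order_trans by blast

lemma interpolation_abs_le: "\<bar>interpolation a x\<bar> \<le> M"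
proof -
  have "\<bar>interpolation a x\<bar> \<le> (\<Sum>S\<in>Pow UNIV. \<bar>corner_weight UNIV S (x - lattice_floor x) * a (lattice_floor x + corner S)\<bar>)"
    unfolding interpolation_def by (rule sum_abs)
  also have "\<dots> \<le> (\<Sum>S\<in>Pow UNIV. corner_weight UNIV S (x - lattice_floor x) * M)"
  proof (rule sum_mono)
    fix S :: "'n set"
    have "0 \<le> corner_weight UNIV S (x - lattice_floor x)" by (rule corner_weight_nonneg[OF frac_in_unit_cube])
    moreover have "\<bar>a (lattice_floor x + corner S)\<bar> \<le> M"
      by (intro M vertices_add lattice_floor_vertices corner_vertices)
    ultimately show "\<bar>corner_weight UNIV S (x - lattice_floor x) * a (lattice_floor x + corner S)\<bar> \<le> corner_weight UNIV S (x - lattice_floor x) * M"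
      by (simp add: abs_mult mult_left_mono)
  qed
  also have "\<dots> = M" unfolding sum_distrib_right[symmetric] by (subst sum_corner_weight) auto
  finally show ?thesis .
qed

lemma interpolation_partial_abs_le: "\<bar>interpolation_partial a i x\<bar> \<le> 2 * M"
  unfolding slice_step[symmetric]
  using slice_bound[where a=a and i=i and x=x and n="\<lfloor>x $ i\<rfloor>", OF M]
    slice_bound[where a=a and i=i and x=x and n="\<lfloor>x $ i\<rfloor> + 1", OF M] by linarith

text \<open>Off the lattice hyperplanes a short backward step stays in the same cell, where the
  increment is exactly linear; the quotient is therefore eventually constant.\<close>

lemma interpolation_backward_quotient:
  assumes "x $ i \<noteq> of_int \<lfloor>x $ i\<rfloor>"
  shows "(\<lambda>n. (interpolation a (x + axis i (- (1 / Suc n))) - interpolation a x) / (1 / Suc n)) \<longlonglongrightarrow> - interpolation_partial a i x"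
proof (rule tendsto_eventually)
  define r where "r = x $ i - of_int \<lfloor>x $ i\<rfloor>"
  have "0 < r" using assms by (simp add: r_def) linarith
  then have "\<forall>\<^sub>F n in sequentially. 1 / real (Suc n) < r"
    using order_tendstoD(2)[OF LIMSEQ_Suc[OF lim_1_over_n[where 'a=real]]] by blast
  then show "\<forall>\<^sub>F n in sequentially. (interpolation a (x + axis i (- (1 / Suc n))) - interpolation a x) / (1 / Suc n) = - interpolation_partial a i x"
  proof eventually_elim
    case (elim n)
    define h where "h = 1 / real (Suc n)"
    have h: "0 < h" "h < r" using elim by (simp_all add: h_def)
    have "\<lfloor>x $ i + - h\<rfloor> = \<lfloor>x $ i\<rfloor>"
      by (rule floor_unique) (use h r_def in linarith)+
    from interpolation_increment_exact[where a=a, OF this] show ?case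
      unfolding h_def[symmetric] using h by (simp add: field_simps)
  qed
qed

text \<open>Discrete integration by parts: translation invariance moves the forward quotient of the
  test function to a backward quotient of the interpolation. Both sides converge under a majorant,
  and the hyperplanes where the gradient may jump are null sets.\<close>

lemma interpolation_weak_gradient: "has_weak_gradient_on (interpolation a) (interpolation_gradient a) UNIV"
proof -
  note [measurable] = interpolation_measurable interpolation_partial_measurable
  have "locally_integrable_on (interpolation a) UNIV"
    by (rule bounded_measurable_locally_integrable[where B=M]) (use interpolation_abs_le in auto)
  moreover have "locally_integrable_on (interpolation_gradient a) UNIV"
  proof (rule bounded_measurable_locally_integrable[OF interpolation_gradient_measurable])
    fix x
    have "norm (interpolation_gradient a x) \<le> (\<Sum>i\<in>UNIV. \<bar>interpolation_gradient a x $ i\<bar>)" by (rule norm_le_l1_cart)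
    also have "\<dots> \<le> (\<Sum>i\<in>(UNIV::'n set). 2 * M)"
      by (rule sum_mono) (simp add: interpolation_gradient_def interpolation_partial_abs_le)
    finally show "norm (interpolation_gradient a x) \<le> (\<Sum>i\<in>(UNIV::'n set). 2 * M)" .
  qed
  moreover have "(\<integral>x. interpolation a x * frechet_derivative \<phi> (at x) b \<partial>lebesgue_on UNIV) =
     - (\<integral>x. (interpolation_gradient a x \<bullet> b) * \<phi> x \<partial>lebesgue_on UNIV)"
    if \<phi>: "\<phi> \<in> test_functions UNIV" and b: "b \<in> Basis" for \<phi> and b :: "real^'n"
  proof -
    obtain i where i: "b = axis i 1" using b by (auto simp: Basis_vec_def)
    define \<phi>' where "\<phi>' x = frechet_derivative \<phi> (at x) b" for x
    obtain R C where RC: "0 \<le> C" "\<And>x. R < norm x \<Longrightarrow> \<phi> x = 0" "\<And>x. \<bar>\<phi> x\<bar> \<le> C"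
      "\<And>x h. 0 < h \<Longrightarrow> h \<le> 1 \<Longrightarrow> \<bar>(\<phi> (x + h *\<^sub>R b) - \<phi> x) / h\<bar> \<le> C * indicator (cball 0 (R + 1)) x"
      "\<And>x. (\<lambda>n. (\<phi> (x + (1 / Suc n) *\<^sub>R b) - \<phi> x) / (1 / Suc n)) \<longlonglongrightarrow> \<phi>' x"
      and m[measurable]: "\<phi> \<in> borel_measurable borel" "\<phi>' \<in> borel_measurable borel"
      by (rule test_function_direction[OF \<phi> b, folded \<phi>'_def]) blast
    let ?v = "interpolation a" and ?h = "\<lambda>n. 1 / real (Suc n)"
    have ball: "integrable lborel (\<lambda>x::real^'n. K * indicator (cball 0 r) x)" for K r :: real
      using emeasure_bounded_finite[OF bounded_cball]
      by (intro integrable_mult_right integrable_real_indicator) simp_all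
    have \<phi>_int: "integrable lborel (\<lambda>x. k x * \<phi> x)" if [measurable]: "k \<in> borel_measurable borel" and k: "\<And>x. \<bar>k x\<bar> \<le> B" for k B
    proof (rule Bochner_Integration.integrable_bound[OF ball[of "B * C" R]])
      show "AE x in lborel. norm (k x * \<phi> x) \<le> norm (B * C * indicator (cball 0 R) x)"
      proof (rule AE_I2)
        fix x
        have "0 \<le> B" using k[of x] by linarith
        have "\<bar>k x\<bar> * \<bar>\<phi> x\<bar> \<le> B * C" by (intro mult_mono k RC(3)) (use \<open>0 \<le> B\<close> in auto)
        then show "norm (k x * \<phi> x) \<le> norm (B * C * indicator (cball 0 R) x)"
          using RC(2)[of x] \<open>0 \<le> B\<close> RC(1) by (cases "x \<in> cball 0 R") (auto simp: abs_mult)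
      qed
    qed measurable
    have L: "(\<lambda>n. \<integral>x. ?v x * ((\<phi> (x + ?h n *\<^sub>R b) - \<phi> x) / ?h n) \<partial>lborel) \<longlonglongrightarrow> (\<integral>x. ?v x * \<phi>' x \<partial>lborel)"
    proof (rule integral_dominated_convergence[OF _ _ ball[of "M * C" "R + 1"]])
      show "AE x in lborel. (\<lambda>n. ?v x * ((\<phi> (x + ?h n *\<^sub>R b) - \<phi> x) / ?h n)) \<longlonglongrightarrow> ?v x * \<phi>' x"
        by (intro AE_I2 tendsto_mult tendsto_const RC(5))
      show "AE x in lborel. norm (?v x * ((\<phi> (x + ?h n *\<^sub>R b) - \<phi> x) / ?h n)) \<le> M * C * indicator (cball 0 (R + 1)) x" for n
      proof (rule AE_I2)
        fix x
        have "\<bar>?v x\<bar> * \<bar>(\<phi> (x + ?h n *\<^sub>R b) - \<phi> x) / ?h n\<bar> \<le> M * (C * indicator (cball 0 (R + 1)) x)"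
          by (intro mult_mono interpolation_abs_le RC(4) bound_nonneg) auto
        then show "norm (?v x * ((\<phi> (x + ?h n *\<^sub>R b) - \<phi> x) / ?h n)) \<le> M * C * indicator (cball 0 (R + 1)) x"
          by (simp only: real_norm_def abs_mult mult.assoc)
      qed
    qed measurable
    have shift: "(\<integral>x. ?v x * ((\<phi> (x + ?h n *\<^sub>R b) - \<phi> x) / ?h n) \<partial>lborel) =
        (\<integral>x. ((?v (x + axis i (- ?h n)) - ?v x) / ?h n) * \<phi> x \<partial>lborel)" for n
    proof -
      let ?z = "axis i (- ?h n) :: real^'n"
      have hb: "?h n *\<^sub>R b = - ?z" by (simp add: i vec_eq_iff axis_def)
      have i1: "integrable lborel (\<lambda>x. ?v (?z + x) * \<phi> x)" and i2: "integrable lborel (\<lambda>x. ?v x * \<phi> x)"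
        using interpolation_abs_le by (auto intro!: \<phi>_int[where B=M])
      have tr: "(\<integral>x. ?v (?z + x) * \<phi> (- ?z + (?z + x)) \<partial>lborel) = (\<integral>x. ?v x * \<phi> (- ?z + x) \<partial>lborel)"
        by (rule integral_lborel_translate(1)) measurable
      have i3: "integrable lborel (\<lambda>x. ?v x * \<phi> (- ?z + x))"
        using integral_lborel_translate(2)[of "\<lambda>x. ?v x * \<phi> (- ?z + x)" ?z] i1 by simp
      have "(\<integral>x. ?v x * ((\<phi> (x + ?h n *\<^sub>R b) - \<phi> x) / ?h n) \<partial>lborel) = (\<integral>x. (?v x * \<phi> (- ?z + x) - ?v x * \<phi> x) / ?h n \<partial>lborel)"
        unfolding hb by (rule Bochner_Integration.integral_cong) (simp_all add: right_diff_distrib add.commute)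
      also have "\<dots> = ((\<integral>x. ?v x * \<phi> (- ?z + x) \<partial>lborel) - (\<integral>x. ?v x * \<phi> x \<partial>lborel)) / ?h n"
        unfolding integral_divide_zero using i3 i2 by simp
      also have "\<dots> = ((\<integral>x. ?v (?z + x) * \<phi> x \<partial>lborel) - (\<integral>x. ?v x * \<phi> x \<partial>lborel)) / ?h n"
        unfolding tr[symmetric] by simp
      also have "\<dots> = (\<integral>x. (?v (?z + x) * \<phi> x - ?v x * \<phi> x) / ?h n \<partial>lborel)"
        unfolding integral_divide_zero using i1 i2 by simp
      also have "\<dots> = (\<integral>x. ((?v (x + ?z) - ?v x) / ?h n) * \<phi> x \<partial>lborel)"
        by (rule Bochner_Integration.integral_cong) (simp_all add: left_diff_distrib add.commute)
      finally show ?thesis .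
    qed
    have Rl: "(\<lambda>n. \<integral>x. ((?v (x + axis i (- ?h n)) - ?v x) / ?h n) * \<phi> x \<partial>lborel) \<longlonglongrightarrow> (\<integral>x. - interpolation_partial a i x * \<phi> x \<partial>lborel)"
    proof (rule integral_dominated_convergence[where w="\<lambda>x. 2 * M * \<bar>\<phi> x\<bar>"])
      show "AE x in lborel. (\<lambda>n. ((?v (x + axis i (- ?h n)) - ?v x) / ?h n) * \<phi> x) \<longlonglongrightarrow> - interpolation_partial a i x * \<phi> x"
        using AE_not_integer_coordinate[of i]
        by eventually_elim (intro tendsto_mult tendsto_const interpolation_backward_quotient)
      show "AE x in lborel. norm (((?v (x + axis i (- ?h n)) - ?v x) / ?h n) * \<phi> x) \<le> 2 * M * \<bar>\<phi> x\<bar>" for n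
      proof (rule AE_I2)
        fix x
        have h: "0 < ?h n" "\<bar>- ?h n\<bar> \<le> 1" by simp_all
        have "\<bar>?v (x + axis i (- ?h n)) - ?v x\<bar> \<le> 2 * M * \<bar>- ?h n\<bar>"
          by (rule interpolation_increment_bound[OF M h(2)])
        then have "\<bar>?v (x + axis i (- ?h n)) - ?v x\<bar> / ?h n \<le> 2 * M"
          using h(1) by (subst pos_divide_le_eq) simp_all
        then have "\<bar>(?v (x + axis i (- ?h n)) - ?v x) / ?h n\<bar> \<le> 2 * M"
        proof -
          have "\<bar>z / d\<bar> = \<bar>z\<bar> / d" if "0 < d" for z d :: real using that by (simp add: abs_divide)
          from this[OF h(1)] show "\<bar>?v (x + axis i (- ?h n)) - ?v x\<bar> / ?h n \<le> 2 * M \<Longrightarrow> ?thesis" by (simp only:)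
        qed
        from mult_right_mono[OF this abs_ge_zero[of "\<phi> x"]]
        show "norm (((?v (x + axis i (- ?h n)) - ?v x) / ?h n) * \<phi> x) \<le> 2 * M * \<bar>\<phi> x\<bar>"
          by (simp only: real_norm_def abs_mult)
      qed
      show "integrable lborel (\<lambda>x. 2 * M * \<bar>\<phi> x\<bar>)"
        using \<phi>_int[of "\<lambda>_. 1" 1] by simp
    qed measurable
    have eq: "(\<integral>x. ?v x * \<phi>' x \<partial>lborel) = (\<integral>x. - interpolation_partial a i x * \<phi> x \<partial>lborel)"
      by (rule LIMSEQ_unique[OF L[unfolded shift] Rl])
    have "(\<integral>x. ?v x * \<phi>' x \<partial>lebesgue_on UNIV) = (\<integral>x. ?v x * \<phi>' x \<partial>lborel)"
      unfolding lebesgue_on_UNIV_eq by (rule integral_completion) measurable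
    also have "\<dots> = - (\<integral>x. interpolation_partial a i x * \<phi> x \<partial>lborel)" unfolding eq by simp
    also have "(\<integral>x. interpolation_partial a i x * \<phi> x \<partial>lborel) = (\<integral>x. interpolation_partial a i x * \<phi> x \<partial>lebesgue_on UNIV)"
      unfolding lebesgue_on_UNIV_eq by (rule integral_completion[symmetric]) measurable
    finally show ?thesis by (simp add: \<phi>'_def i interpolation_gradient_def inner_axis)
  qed
  ultimately show ?thesis unfolding has_weak_gradient_on_def by blast
qed

end

section \<open>Comparison of lattice sums with Euclidean integrals\<close>

lemma power2_powr_half: "((z::real)\<^sup>2) powr (r / 2) = \<bar>z\<bar> powr r"
proof -
  have "z\<^sup>2 = \<bar>z\<bar> powr 2" by (simp add: powr_numeral)
  then have "(z\<^sup>2) powr (r / 2) = \<bar>z\<bar> powr (2 * (r / 2))" by (simp only: powr_powr)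
  then show ?thesis by simp
qed

text \<open>No single term exceeds the total, so
  \<open>f k powr p \<le> s powr (p - 1) * f k\<close>. For counting measure the sum thereby
  controls all higher powers.\<close>

lemma nn_integral_powr_le:
  fixes f :: "'s \<Rightarrow> real"
  assumes nn: "\<And>k. k \<in> A \<Longrightarrow> 0 \<le> f k" and p: "1 \<le> p" and s: "0 \<le> s"
    and le: "(\<integral>\<^sup>+k. ennreal (f k) \<partial>count_space A) \<le> ennreal s"
  shows "(\<integral>\<^sup>+k. ennreal (f k powr p) \<partial>count_space A) \<le> ennreal (s powr p)"
proof -
  have pt: "f k \<le> s" if "k \<in> A" for k
  proof -
    have "ennreal (f k) \<le> ennreal s"
      using nn_integral_ge_point[OF that, of "\<lambda>k. ennreal (f k)"] le by (rule order_trans)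
    then show ?thesis using s by simp
  qed
  have "f k powr p \<le> s powr (p - 1) * f k" if k: "k \<in> A" for k
  proof (cases "f k = 0")
    case False
    then have "f k powr p = f k powr (p - 1) * f k" using nn[OF k] by (simp add: powr_diff)
    also have "\<dots> \<le> s powr (p - 1) * f k" using pt[OF k] nn[OF k] p by (intro mult_right_mono powr_mono2) auto
    finally show ?thesis .
  qed (use p in simp)
  then have "(\<integral>\<^sup>+k. ennreal (f k powr p) \<partial>count_space A) \<le> (\<integral>\<^sup>+k. ennreal (s powr (p - 1)) * ennreal (f k) \<partial>count_space A)"
    using nn by (intro nn_integral_mono) (simp add: ennreal_mult[symmetric] ennreal_leI)
  also have "\<dots> = ennreal (s powr (p - 1)) * (\<integral>\<^sup>+k. ennreal (f k) \<partial>count_space A)"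
    by (rule nn_integral_cmult) simp
  also have "\<dots> \<le> ennreal (s powr (p - 1)) * ennreal s" by (rule mult_left_mono[OF le]) simp
  also have "\<dots> = ennreal (s powr p)"
    using s by (cases "s = 0") (auto simp: ennreal_mult[symmetric] powr_diff p)
  finally show ?thesis .
qed

text \<open>The orbit of \<open>k\<close> under unit steps along \<open>i\<close> is infinite and
  carries a constant value, so a nonzero value would make the sum diverge.\<close>

lemma invariant_square_summable_zero:
  fixes a :: "real^'n \<Rightarrow> real"
  assumes sum: "(\<integral>\<^sup>+k. ennreal ((a k)\<^sup>2) \<partial>count_space vertices) \<le> ennreal C"
    and inv: "\<And>k. k \<in> vertices \<Longrightarrow> a (k + axis i 1) = a k" and k: "k \<in> vertices"
  shows "a k = 0"
proof (rule ccontr)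
  assume nz: "a k \<noteq> 0"
  define p where "p n = k + axis i (real n)" for n :: nat
  have pS: "p (Suc n) = p n + axis i 1" for n by (simp add: p_def vec_eq_iff axis_def)
  have pv: "p n \<in> vertices" for n using k by (simp add: p_def vertices_def axis_def)
  have "p 0 = k" by (simp add: p_def axis_zero)
  then have pa: "a (p n) = a k" for n by (induction n) (simp_all add: pS inv[OF pv])
  have pi: "p n $ i = k $ i + real n" for n by (simp add: p_def axis_def)
  have inj: "inj p"
  proof (rule injI)
    fix m n assume "p m = p n"
    then have "p m $ i = p n $ i" by (rule arg_cong)
    then show "m = n" by (simp add: pi)
  qed
  have "ennreal (real N * (a k)\<^sup>2) \<le> ennreal C" for N
  proof -
    have "ennreal (real N * (a k)\<^sup>2) = (\<Sum>x\<in>p ` {..<N}. ennreal ((a x)\<^sup>2))"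
      by (subst sum.reindex) (auto simp: pa inj_on_subset[OF inj] ennreal_mult ennreal_of_nat_eq_real_of_nat)
    also have "\<dots> = (\<Sum>x\<in>p ` {..<N}. ennreal ((a x)\<^sup>2) * indicator (p ` {..<N}) x)"
      by (rule sum.cong) simp_all
    also have "\<dots> = (\<integral>\<^sup>+x. ennreal ((a x)\<^sup>2) * indicator (p ` {..<N}) x \<partial>count_space vertices)"
      by (rule nn_integral_count_space'[symmetric]) (use pv in auto)
    also have "\<dots> \<le> (\<integral>\<^sup>+x. ennreal ((a x)\<^sup>2) \<partial>count_space vertices)"
      by (rule nn_integral_mono) (simp add: indicator_def)
    finally show ?thesis using sum by (rule order_trans)
  qed
  then have le: "real N * (a k)\<^sup>2 \<le> max C 0" for N
    unfolding ennreal_le_iff2 by (auto simp: le_max_iff_disj)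
  obtain N :: nat where "max C 0 / (a k)\<^sup>2 < real N" using reals_Archimedean2 by blast
  then have "max C 0 < real N * (a k)\<^sup>2" by (subst (asm) pos_divide_less_eq) (use nz in simp_all)
  with le[of N] show False by simp
qed

text \<open>Vanishing is known only almost everywhere, so suitable points are picked in boxes of
  positive measure that shrink to the vertex \<open>k\<close>; along them every corner weight except
  that of the empty set tends to 0.\<close>

lemma interpolation_partial_zero_imp:
  fixes a :: "real^'n \<Rightarrow> real"
  assumes ae: "AE x in lborel. interpolation_partial a i x = 0" and k: "k \<in> vertices"
  shows "a (k + axis i 1) = a k"
proof -
  let ?c = "\<lambda>S. a (k + corner S + axis i 1) - a (k + corner S)"
  have "\<exists>y. y \<in> box 0 ((1 / real (Suc n)) *\<^sub>R 1) \<and> interpolation_partial a i (k + y) = 0" for n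
  proof (rule ccontr)
    assume neg: "\<not> ?thesis"
    let ?B = "box k (k + (1 / real (Suc n)) *\<^sub>R 1)"
    have "AE x in lborel. x \<notin> ?B"
      using ae
    proof eventually_elim
      case (elim x)
      show ?case
      proof
        assume "x \<in> ?B"
        then have "x - k \<in> box 0 ((1 / real (Suc n)) *\<^sub>R 1)" by (auto simp: mem_box_cart algebra_simps)
        moreover have "interpolation_partial a i (k + (x - k)) = 0" using elim by simp
        ultimately show False using neg by blast
      qed
    qed
    then have "?B \<in> null_sets lborel" by (simp add: AE_iff_null_sets)
    then have "emeasure lborel ?B = 0" by auto
    moreover have "emeasure lborel ?B \<noteq> 0"
    proof -
      have pos: "(k + (1 / real (Suc n)) *\<^sub>R 1 - k) \<bullet> b = 1 / real (Suc n)" if "b \<in> Basis" for b :: "real^'n"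
        using that by (auto simp: Basis_vec_def inner_axis)
      then have le: "k \<bullet> b \<le> (k + (1 / real (Suc n)) *\<^sub>R 1) \<bullet> b" if "b \<in> Basis" for b :: "real^'n"
      proof -
        have "0 \<le> 1 / real (Suc n)" by simp
        then show ?thesis using pos[OF that] by (simp only: inner_diff_left)
      qed
      have "emeasure lborel ?B = ennreal (\<Prod>b\<in>Basis. (k + (1 / real (Suc n)) *\<^sub>R 1 - k) \<bullet> b)"
        by (rule emeasure_lborel_box[OF le])
      also have "(\<Prod>b\<in>Basis. (k + (1 / real (Suc n)) *\<^sub>R 1 - k) \<bullet> b) = (\<Prod>b\<in>(Basis :: (real^'n) set). 1 / real (Suc n))"
        by (rule prod.cong[OF refl pos])
      also have "ennreal \<dots> \<noteq> 0" by simp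
      finally show ?thesis .
    qed
    ultimately show False by simp
  qed
  then obtain y where y: "\<And>n. y n \<in> box 0 ((1 / real (Suc n)) *\<^sub>R 1)" "\<And>n. interpolation_partial a i (k + y n) = 0"
    by metis
  have yb: "0 < y n $ j" "y n $ j < 1 / real (Suc n)" for n j using y(1)[of n] by (auto simp: mem_box_cart)
  have ycube: "y n \<in> unit_cube" for n
  proof -
    have "1 / real (Suc n) \<le> 1" by simp
    then show ?thesis unfolding unit_cube_def using yb less_imp_le less_le_trans by blast
  qed
  have ylim: "(\<lambda>n. y n $ j) \<longlonglongrightarrow> 0" for j
    by (rule tendsto_sandwich[OF _ _ tendsto_const LIMSEQ_Suc[OF lim_1_over_n]])
       (use yb in \<open>auto intro!: always_eventually less_imp_le\<close>)
  have "(\<lambda>n. corner_weight (- {i}) S (y n)) \<longlonglongrightarrow> (if S = {} then 1 else 0)" for S :: "'n set"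
  proof -
    have "(\<lambda>n. corner_weight (- {i}) S (y n)) \<longlonglongrightarrow> (\<Prod>j\<in>S. 0) * (\<Prod>j\<in>- {i} - S. 1 - 0)"
      unfolding corner_weight_def by (intro tendsto_mult tendsto_prod tendsto_diff tendsto_const ylim)
    moreover have "(\<Prod>j\<in>S. 0) * (\<Prod>j\<in>- {i} - S. 1 - 0) = (if S = {} then 1 else (0::real))"
      by (cases "S = {}") (simp_all add: card_gt_0_iff)
    ultimately show ?thesis by (simp only:)
  qed
  then have "(\<lambda>n. \<Sum>S\<in>Pow (- {i}). corner_weight (- {i}) S (y n) * ?c S) \<longlonglongrightarrow> (\<Sum>S\<in>Pow (- {i}). (if S = {} then 1 else 0) * ?c S)"
    by (intro tendsto_sum tendsto_mult tendsto_const)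
  moreover have "(\<Sum>S\<in>Pow (- {i}). corner_weight (- {i}) S (y n) * ?c S) = 0" for n
    using interpolation_cell(2)[OF k ycube, of a i n] y(2)[of n] by simp
  ultimately have "(\<Sum>S\<in>Pow (- {i}). (if S = {} then 1 else 0) * ?c S) = 0"
    by (simp add: LIMSEQ_const_iff)
  also have "(\<Sum>S\<in>Pow (- {i}). (if S = {} then 1 else 0) * ?c S) = (\<Sum>S\<in>Pow (- {i}). if S = {} then ?c {} else 0)"
    by (rule sum.cong) auto
  also have "\<dots> = ?c {}" by simp
  also have "corner {} = (0 :: real^'n)" by (simp add: corner_def vec_eq_iff)
  finally show ?thesis by simp
qed

context
  fixes a :: "real^'n \<Rightarrow> real" and A E q :: real
  assumes A: "(\<integral>\<^sup>+k. ennreal ((a k)\<^sup>2) \<partial>count_space vertices) \<le> ennreal A" "0 \<le> A"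
    and E: "(\<Sum>i\<in>UNIV. direction_energy a i) \<le> ennreal E" "0 \<le> E"
    and q: "2 < q"
begin

lemma vertex_values_bounded: "k \<in> vertices \<Longrightarrow> \<bar>a k\<bar> \<le> sqrt A"
proof -
  assume k: "k \<in> vertices"
  have "ennreal ((a k)\<^sup>2) \<le> ennreal A"
    using nn_integral_ge_point[OF k, of "\<lambda>k. ennreal ((a k)\<^sup>2)"] A(1) by (rule order_trans)
  then have "(a k)\<^sup>2 \<le> A" using A(2) by simp
  then show ?thesis by (rule real_le_rsqrt[of "\<bar>a k\<bar>", simplified])
qed

lemma interpolation_L2: "integrable lborel (\<lambda>x. (interpolation a x)\<^sup>2)" "(\<integral>x. (interpolation a x)\<^sup>2 \<partial>lborel) \<le> A"
proof -
  note le = interpolation_square_le[OF A(1)]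
  show i: "integrable lborel (\<lambda>x. (interpolation a x)\<^sup>2)"
    by (rule integrableI_nonneg) (use le in \<open>auto simp: le_less_trans\<close>)
  show "(\<integral>x. (interpolation a x)\<^sup>2 \<partial>lborel) \<le> A"
    using le A(2) by (simp add: nn_integral_eq_integral[OF i])
qed

lemma interpolation_gradient_L2:
  "integrable lborel (\<lambda>x. (norm (interpolation_gradient a x))\<^sup>2)"
  "(\<integral>x. (norm (interpolation_gradient a x))\<^sup>2 \<partial>lborel) \<le> E"
proof -
  have eq: "(norm (interpolation_gradient a x))\<^sup>2 = (\<Sum>i\<in>UNIV. (interpolation_partial a i x)\<^sup>2)" for x
    by (simp add: norm_vec_def L2_set_def sum_nonneg interpolation_gradient_def)
  have le: "(\<integral>\<^sup>+x. ennreal ((norm (interpolation_gradient a x))\<^sup>2) \<partial>lborel) \<le> ennreal E"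
  proof -
    have "(\<integral>\<^sup>+x. ennreal ((norm (interpolation_gradient a x))\<^sup>2) \<partial>lborel) = (\<integral>\<^sup>+x. (\<Sum>i\<in>UNIV. ennreal ((interpolation_partial a i x)\<^sup>2)) \<partial>lborel)"
      unfolding eq by (simp add: sum_ennreal)
    also have "\<dots> = (\<Sum>i\<in>UNIV. (\<integral>\<^sup>+x. ennreal ((interpolation_partial a i x)\<^sup>2) \<partial>lborel))"
      by (rule nn_integral_sum) simp
    also have "\<dots> \<le> (\<Sum>i\<in>UNIV. direction_energy a i)" by (intro sum_mono interpolation_partial_square_le)
    finally show ?thesis using E(1) by (rule order_trans)
  qed
  show i: "integrable lborel (\<lambda>x. (norm (interpolation_gradient a x))\<^sup>2)"
  proof (rule integrableI_nonneg)
    show "(\<lambda>x. (norm (interpolation_gradient a x))\<^sup>2) \<in> borel_measurable lborel" unfolding eq by measurable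
    show "(\<integral>\<^sup>+x. ennreal ((norm (interpolation_gradient a x))\<^sup>2) \<partial>lborel) < \<infinity>"
      by (rule le_less_trans[OF le]) simp
  qed simp
  show "(\<integral>x. (norm (interpolation_gradient a x))\<^sup>2 \<partial>lborel) \<le> E"
    using le E(2) by (simp add: nn_integral_eq_integral[OF i])
qed

lemma interpolation_Lq_integrable: "integrable lborel (\<lambda>x. \<bar>interpolation a x\<bar> powr q)"
proof (rule Bochner_Integration.integrable_bound)
  show "integrable lborel (\<lambda>x. (sqrt A) powr (q - 2) * (interpolation a x)\<^sup>2)"
    using interpolation_L2(1) by simp
  show "AE x in lborel. norm (\<bar>interpolation a x\<bar> powr q) \<le> norm ((sqrt A) powr (q - 2) * (interpolation a x)\<^sup>2)"
  proof (rule AE_I2)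
    fix x
    let ?v = "\<bar>interpolation a x\<bar>"
    have b: "?v \<le> sqrt A" by (rule interpolation_abs_le) (rule vertex_values_bounded)
    have "?v powr q = ?v powr (q - 2) * ?v powr 2" by (subst powr_add[symmetric]) simp
    also have "\<dots> \<le> (sqrt A) powr (q - 2) * ?v powr 2"
      using b q by (intro mult_right_mono powr_mono2) auto
    finally show "norm (?v powr q) \<le> norm ((sqrt A) powr (q - 2) * (interpolation a x)\<^sup>2)"
      by (simp add: powr_numeral)
  qed
qed simp

lemma interpolation_H1: "interpolation a \<in> H1 UNIV"
proof -
  have "interpolation a \<in> Lp_space (lebesgue_on UNIV) 2"
    using interpolation_L2(1)
    by (simp add: Lp_space_def lebesgue_on_UNIV_eq measurable_completion powr_numeral integrable_completion)
  moreover have "interpolation_gradient a \<in> Lp_space (lebesgue_on UNIV) 2"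
    using interpolation_gradient_L2(1) interpolation_gradient_measurable[of a]
    by (simp add: Lp_space_def lebesgue_on_UNIV_eq measurable_completion powr_numeral integrable_completion)
  ultimately show ?thesis
    using interpolation_weak_gradient[where a=a, OF vertex_values_bounded] by (auto simp: H1_def)
qed

text \<open>Turning the quotient into a product inequality requires positive \<open>N2\<close> and
  \<open>D2\<close>; a vanishing gradient would make the lattice function invariant under unit steps
  and hence zero. Since both exponents are positive, \<open>N2\<close> and \<open>D2\<close> may
  then be raised to \<open>A\<close> and \<open>E\<close>.\<close>

lemma interpolation_GN:
  fixes \<kappa> :: real
  assumes \<kappa>: "\<And>v. v \<in> (nonzero_H1_space :: (real^'n \<Rightarrow> real) set) \<Longrightarrow> Q_space q v \<le> \<kappa>" "0 \<le> \<kappa>"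
    and \<alpha>: "\<alpha> = real CARD('n) + (2 - real CARD('n)) * (q / 2)" "0 < \<alpha>"
    and \<beta>: "\<beta> = (q / 2 - 1) * real CARD('n)"
  shows "(\<integral>x. \<bar>interpolation a x\<bar> powr q \<partial>lborel) \<le> \<kappa> * A powr (\<alpha> / 2) * E powr (\<beta> / 2)"
proof -
  let ?v = "interpolation a"
  have \<beta>0: "0 < \<beta>" unfolding \<beta> using q by simp
  have rhs: "0 \<le> \<kappa> * A powr (\<alpha> / 2) * E powr (\<beta> / 2)" using \<kappa>(2) by simp
  show ?thesis
  proof (cases "AE x in lebesgue. ?v x = 0")
    case True
    then have "AE x in lborel. ?v x = 0" by (simp add: AE_completion_iff)
    then have "(\<integral>x. \<bar>?v x\<bar> powr q \<partial>lborel) = 0"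
      by (intro integral_eq_zero_AE) (use q in \<open>auto elim: eventually_mono\<close>)
    then show ?thesis using rhs by simp
  next
    case False
    define N2 where "N2 = (\<integral>x. (?v x)\<^sup>2 \<partial>lborel)"
    define D2 where "D2 = (\<integral>x. (norm (interpolation_gradient a x))\<^sup>2 \<partial>lborel)"
    define Nq where "Nq = (\<integral>x. \<bar>?v x\<bar> powr q \<partial>lborel)"
    have nn: "0 \<le> N2" "0 \<le> D2" "0 \<le> Nq" by (simp_all add: N2_def D2_def Nq_def)
    let ?w = "weak_gradient UNIV ?v"
    have gw: "has_weak_gradient_on ?v (interpolation_gradient a) UNIV"
      by (rule interpolation_weak_gradient) (rule vertex_values_bounded)
    have ww: "has_weak_gradient_on ?v ?w UNIV"
      unfolding weak_gradient_def by (rule someI[where P="\<lambda>g. has_weak_gradient_on ?v g UNIV", OF gw])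
    have ae: "AE x in lebesgue. interpolation_gradient a x = ?w x"
      using weak_gradient_unique[OF open_UNIV gw ww] by simp
    have gm: "interpolation_gradient a \<in> borel_measurable lebesgue"
      by (rule measurable_completion) (simp add: interpolation_gradient_measurable)
    have wm: "?w \<in> borel_measurable lebesgue" by (rule borel_measurable_AE[OF gm ae])
    have LD: "Lp_norm lebesgue 2 ?w = sqrt D2"
    proof -
      have "(\<integral>x. norm (?w x) powr 2 \<partial>lebesgue) = (\<integral>x. (norm (interpolation_gradient a x))\<^sup>2 \<partial>lebesgue)"
        by (rule integral_cong_AE) (use gm wm ae in \<open>auto elim!: eventually_mono simp: powr_numeral\<close>)
      also have "\<dots> = D2" unfolding D2_def
        by (rule integral_completion) (use interpolation_gradient_measurable in simp)
      finally show ?thesis using nn by (simp add: Lp_norm_def powr_half_sqrt)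
    qed
    have L2: "Lp_norm lebesgue 2 ?v = sqrt N2"
      using nn(1) by (simp add: Lp_norm_def N2_def integral_completion powr_numeral powr_half_sqrt)
    have Lq: "Lp_norm lebesgue q ?v powr q = Nq"
      using nn(3) q by (simp add: Lp_norm_def Nq_def integral_completion powr_powr)
    have sq: "sqrt x powr r = x powr (r / 2)" if "0 \<le> x" for x r :: real
      using that by (simp add: powr_half_sqrt[symmetric] powr_powr)
    have Q: "Q_space q ?v = Nq / (N2 powr (\<alpha> / 2) * D2 powr (\<beta> / 2))"
      unfolding Q_space_def GN_quotient_def LD L2 Lq \<alpha>(1)[symmetric] \<beta>[symmetric]
      by (simp add: sq nn)
    have "?v \<in> nonzero_H1_space" using interpolation_H1 False by (simp add: nonzero_H1_space_def)
    from \<kappa>(1)[OF this] have le: "Nq / (N2 powr (\<alpha> / 2) * D2 powr (\<beta> / 2)) \<le> \<kappa>" unfolding Q .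
    have N2pos: "0 < N2"
    proof (rule ccontr)
      assume "\<not> 0 < N2"
      then have "N2 = 0" using nn by simp
      then have "AE x in lborel. (?v x)\<^sup>2 = 0"
        unfolding N2_def using integral_nonneg_eq_0_iff_AE[OF interpolation_L2(1)] by simp
      then have "AE x in lborel. ?v x = 0" by simp
      then show False using False by (simp add: AE_completion_iff)
    qed
    have D2pos: "0 < D2"
    proof (rule ccontr)
      assume "\<not> 0 < D2"
      then have "D2 = 0" using nn by simp
      then have "AE x in lborel. (norm (interpolation_gradient a x))\<^sup>2 = 0"
        unfolding D2_def using integral_nonneg_eq_0_iff_AE[OF interpolation_gradient_L2(1)] by simp
      then have z: "AE x in lborel. interpolation_partial a i x = 0" for i
        by eventually_elim (simp add: interpolation_gradient_def vec_eq_iff)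
      have "a k = 0" if "k \<in> vertices" for k
        by (rule invariant_square_summable_zero[OF A(1) interpolation_partial_zero_imp[OF z] that])
      then have "?v x = 0" for x
        unfolding interpolation_def by (simp add: vertices_add lattice_floor_vertices corner_vertices)
      then show False using False by simp
    qed
    have "Nq \<le> \<kappa> * (N2 powr (\<alpha> / 2) * D2 powr (\<beta> / 2))"
      using le N2pos D2pos by (simp add: pos_divide_le_eq)
    also have "\<dots> \<le> \<kappa> * (A powr (\<alpha> / 2) * E powr (\<beta> / 2))"
      using interpolation_L2(2) interpolation_gradient_L2(2) nn \<alpha>(2) \<beta>0 \<kappa>(2)
      by (intro mult_left_mono mult_mono powr_mono2) (simp_all add: N2_def D2_def)
    finally show ?thesis by (simp add: Nq_def mult.assoc)
  qed
qed

text \<open>For a fixed offset \<open>y\<close> the value at \<open>k\<close> is compared with the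
  interpolation at \<open>k + y\<close>, with an error controlled by the energy. Averaging over the
  cube turns the lattice sums into the integral, with a constant close to 1 for small
  \<open>l\<close>.\<close>

lemma vertex_Lq_le:
  assumes l: "0 < l" "l < 1"
  shows "(\<integral>\<^sup>+k. ennreal (\<bar>a k\<bar> powr q) \<partial>count_space vertices) \<le>
     ennreal ((1 - l) powr (1 - q) * (\<integral>x. \<bar>interpolation a x\<bar> powr q \<partial>lborel) + l powr (1 - q) * (4 ^ CARD('n) * E) powr (q / 2))"
proof -
  let ?c = "(1 - l) powr (1 - q)" and ?C = "l powr (1 - q)" and ?T = "(4 ^ CARD('n) * E) powr (q / 2)"
  let ?S = "\<integral>\<^sup>+k. ennreal (\<bar>a k\<bar> powr q) \<partial>count_space vertices"
  let ?F = "\<lambda>x. ennreal (\<bar>interpolation a x\<bar> powr q)"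
  have cell: "?S \<le> ennreal ?c * (\<integral>\<^sup>+k. ?F (k + y) \<partial>count_space vertices) + ennreal (?C * ?T)" if y: "y \<in> unit_cube" for y
  proof -
    have "(\<integral>\<^sup>+k. ennreal (((interpolation a (k + y) - a k)\<^sup>2) powr (q / 2)) \<partial>count_space vertices) \<le> ennreal ?T"
    proof (rule nn_integral_powr_le)
      show "(\<integral>\<^sup>+k. ennreal ((interpolation a (k + y) - a k)\<^sup>2) \<partial>count_space vertices) \<le> ennreal (4 ^ CARD('n) * E)"
        using interpolation_error_square_le[OF E(1) y] E(2) by (simp add: ennreal_mult ennreal_power[symmetric])
    qed (use q E(2) in auto)
    then have err: "(\<integral>\<^sup>+k. ennreal (\<bar>interpolation a (k + y) - a k\<bar> powr q) \<partial>count_space vertices) \<le> ennreal ?T"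
      unfolding power2_powr_half .
    have "?S \<le> (\<integral>\<^sup>+k. ennreal ?c * ?F (k + y) + ennreal ?C * ennreal (\<bar>interpolation a (k + y) - a k\<bar> powr q) \<partial>count_space vertices)"
    proof (rule nn_integral_mono)
      fix k
      have "\<bar>a k\<bar> powr q \<le> (\<bar>interpolation a (k + y)\<bar> + \<bar>interpolation a (k + y) - a k\<bar>) powr q"
        using q by (intro powr_mono2) auto
      also have "\<dots> \<le> ?c * \<bar>interpolation a (k + y)\<bar> powr q + ?C * \<bar>interpolation a (k + y) - a k\<bar> powr q"
        by (rule powr_add_le_weighted) (use l q in auto)
      finally have "ennreal (\<bar>a k\<bar> powr q) \<le> ennreal (?c * \<bar>interpolation a (k + y)\<bar> powr q + ?C * \<bar>interpolation a (k + y) - a k\<bar> powr q)"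
        by (rule ennreal_leI)
      then show "ennreal (\<bar>a k\<bar> powr q) \<le> ennreal ?c * ?F (k + y) + ennreal ?C * ennreal (\<bar>interpolation a (k + y) - a k\<bar> powr q)"
        by (simp add: ennreal_mult)
    qed
    also have "\<dots> = ennreal ?c * (\<integral>\<^sup>+k. ?F (k + y) \<partial>count_space vertices) + ennreal ?C * (\<integral>\<^sup>+k. ennreal (\<bar>interpolation a (k + y) - a k\<bar> powr q) \<partial>count_space vertices)"
      by (simp add: nn_integral_add nn_integral_cmult)
    also have "\<dots> \<le> ennreal ?c * (\<integral>\<^sup>+k. ?F (k + y) \<partial>count_space vertices) + ennreal ?C * ennreal ?T"
      by (intro add_left_mono mult_left_mono err) simp
    finally show ?thesis by (simp add: ennreal_mult)
  qed
  have "?S = (\<integral>\<^sup>+y. ?S * indicator (unit_cube :: (real^'n) set) y \<partial>lborel)"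
    using nn_integral_cmult_indicator[of "unit_cube :: (real^'n) set" lborel ?S] by (simp add: emeasure_unit_cube)
  also have "\<dots> \<le> (\<integral>\<^sup>+y. ennreal ?c * (indicator unit_cube y * (\<integral>\<^sup>+k. ?F (k + y) \<partial>count_space vertices)) +
      ennreal (?C * ?T) * indicator (unit_cube :: (real^'n) set) y \<partial>lborel)"
    by (rule nn_integral_mono) (use cell in \<open>auto simp: indicator_def\<close>)
  also have "\<dots> = ennreal ?c * (\<integral>\<^sup>+y. indicator unit_cube y * (\<integral>\<^sup>+k. ?F (k + y) \<partial>count_space vertices) \<partial>lborel) + ennreal (?C * ?T)"
  proof -
    have m: "(\<lambda>y. \<integral>\<^sup>+k. ?F (k + y) \<partial>count_space vertices) \<in> borel_measurable lborel"
    proof -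
      interpret sigma_finite_measure "count_space (vertices :: (real^'n) set)"
        by (rule sigma_finite_measure_count_space_countable[OF countable_vertices])
      show ?thesis
        by (rule borel_measurable_nn_integral, subst split_beta', rule measurable_compose_countable'[where g=snd and I=vertices]) (auto simp: countable_vertices)
    qed
    show ?thesis
      using m by (subst nn_integral_add) (auto simp: nn_integral_cmult nn_integral_cmult_indicator emeasure_unit_cube)
  qed
  also have "(\<integral>\<^sup>+y. indicator unit_cube y * (\<integral>\<^sup>+k. ?F (k + y) \<partial>count_space vertices) \<partial>lborel) = (\<integral>\<^sup>+x. ?F x \<partial>lborel)"
    by (rule nn_integral_tiling[symmetric]) measurable
  also have "\<dots> = ennreal (\<integral>x. \<bar>interpolation a x\<bar> powr q \<partial>lborel)"
    by (rule nn_integral_eq_integral[OF interpolation_Lq_integrable]) simp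
  finally show ?thesis by (simp add: ennreal_mult[symmetric] ennreal_plus[symmetric] del: ennreal_plus)
qed

end

section \<open>Functions of low energy\<close>

lemma nn_integral_edges:
  fixes f :: "(real^'n) \<times> 'n \<Rightarrow> ennreal"
  shows "(\<integral>\<^sup>+e. f e \<partial>count_space edges) = (\<Sum>i\<in>UNIV. \<integral>\<^sup>+k. f (k, i) \<partial>count_space vertices)"
proof -
  have eq: "count_space (edges :: ((real^'n) \<times> 'n) set) = count_space vertices \<Otimes>\<^sub>M count_space UNIV"
    unfolding edges_def by (rule pair_measure_countable[OF countable_vertices, symmetric]) simp
  interpret sigma_finite_measure "count_space (UNIV :: 'n set)"
    by (rule sigma_finite_measure_count_space_finite) simp
  have "(\<integral>\<^sup>+e. f e \<partial>count_space edges) = (\<integral>\<^sup>+k. \<integral>\<^sup>+i. f (k, i) \<partial>count_space UNIV \<partial>count_space vertices)"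
    unfolding eq by (rule nn_integral_fst[symmetric]) (simp flip: eq)
  then show ?thesis by (simp add: nn_integral_count_space_finite nn_integral_sum)
qed

lemma edge_point_endpoints [simp]: "edge_point (k, i) 0 = k" "edge_point (k, i) 1 = k + axis i 1"
  by (simp_all add: edge_point_def)

lemma pair_in_edges: "(k, i) \<in> edges \<longleftrightarrow> k \<in> vertices"
  by (simp add: edges_def)

lemma nn_integral_unit_const: "(\<integral>\<^sup>+t. c \<partial>unit_lebesgue) = c"
  unfolding nn_integral_const emeasure_unit_lebesgue by simp

lemma nn_integral_unit_affine:
  assumes "f \<in> borel_measurable unit_lebesgue"
  shows "(\<integral>\<^sup>+t. a * f t + b \<partial>unit_lebesgue) = a * (\<integral>\<^sup>+t. f t \<partial>unit_lebesgue) + b"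
proof -
  have "(\<integral>\<^sup>+t. a * f t + b \<partial>unit_lebesgue) = (\<integral>\<^sup>+t. a * f t \<partial>unit_lebesgue) + (\<integral>\<^sup>+t. b \<partial>unit_lebesgue)"
    using assms by (intro nn_integral_add) simp_all
  also have "(\<integral>\<^sup>+t. a * f t \<partial>unit_lebesgue) = a * (\<integral>\<^sup>+t. f t \<partial>unit_lebesgue)"
    by (rule nn_integral_cmult[OF assms])
  finally show ?thesis unfolding nn_integral_unit_const .
qed

lemma ennreal_affine:
  "0 \<le> a \<Longrightarrow> 0 \<le> b \<Longrightarrow> 0 \<le> x \<Longrightarrow> 0 \<le> y \<Longrightarrow> ennreal (a * x + b * y) = ennreal a * ennreal x + ennreal b * ennreal y"
  by (simp add: ennreal_mult)

lemma arclength_integrableI: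
  fixes f :: "((real^'n) \<times> 'n) \<times> real \<Rightarrow> real"
  assumes m: "f \<in> borel_measurable arclength" and nn: "\<And>z. 0 \<le> f z" and B: "0 \<le> B"
    and le: "(\<integral>\<^sup>+e. \<integral>\<^sup>+t. ennreal (f (e, t)) \<partial>unit_lebesgue \<partial>count_space edges) \<le> ennreal B"
  shows "integrable arclength f" "(\<integral>z. f z \<partial>arclength) \<le> B"
proof -
  have le': "(\<integral>\<^sup>+z. ennreal (f z) \<partial>arclength) \<le> ennreal B" using nn_integral_arclength[OF m] le by simp
  show i: "integrable arclength f"
    by (rule integrableI_nonneg[OF m]) (use nn le_less_trans[OF le'] in auto)
  show "(\<integral>z. f z \<partial>arclength) \<le> B"
    using le' nn_integral_eq_integral[OF i] nn B by simp
qed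

context
  fixes u :: "real^'n \<Rightarrow> real" and l :: real
  assumes u: "u \<in> H1_grid" and l: "0 < l" "l < 1"
begin

lemma vertex_difference_energy: "(\<Sum>i\<in>UNIV. direction_energy u i) \<le> ennreal (dirichlet u)"
proof -
  have "(\<Sum>i\<in>UNIV. direction_energy u i) \<le> (\<Sum>i\<in>UNIV. \<integral>\<^sup>+k. ennreal (edge_energy u (k, i)) \<partial>count_space vertices)"
    unfolding direction_energy_def
  proof (intro sum_mono nn_integral_mono ennreal_leI)
    fix i and k :: "real^'n" assume "k \<in> space (count_space vertices)"
    then have "(k, i) \<in> edges" by (simp add: pair_in_edges)
    from edge_holder[OF u this, of 0 1] show "(u (k + axis i 1) - u k)\<^sup>2 \<le> edge_energy u (k, i)" by simp
  qed
  also have "\<dots> = (\<integral>\<^sup>+e. ennreal (edge_energy u e) \<partial>count_space edges)"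
    by (rule nn_integral_edges[symmetric])
  also have "\<dots> = ennreal (dirichlet u)" by (rule nn_integral_edge_energy_eq[OF u])
  finally show ?thesis .
qed

text \<open>The edge has length 1, so the oscillation is at most the square root of its energy; the
  weighted inequality keeps the constant of the leading term near 1.\<close>

lemma edge_oscillation:
  assumes e: "e \<in> edges" and st: "s \<in> {0..1}" "t \<in> {0..1}" and p: "1 \<le> p"
  shows "\<bar>u (edge_point e t)\<bar> powr p \<le> (1 - l) powr (1 - p) * \<bar>u (edge_point e s)\<bar> powr p + l powr (1 - p) * edge_energy u e powr (p / 2)"
proof -
  let ?d = "sqrt (edge_energy u e)"
  have "(u (edge_point e t) - u (edge_point e s))\<^sup>2 \<le> \<bar>t - s\<bar> * edge_energy u e"
    by (rule edge_holder[OF u e st])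
  also have "\<dots> \<le> 1 * edge_energy u e"
    using st by (intro mult_right_mono edge_energy_nonneg) auto
  finally have "\<bar>u (edge_point e t) - u (edge_point e s)\<bar> \<le> ?d" by (simp add: real_le_rsqrt)
  then have "\<bar>u (edge_point e t)\<bar> powr p \<le> (\<bar>u (edge_point e s)\<bar> + ?d) powr p" using p by (intro powr_mono2) auto
  also have "\<dots> \<le> (1 - l) powr (1 - p) * \<bar>u (edge_point e s)\<bar> powr p + l powr (1 - p) * ?d powr p"
    by (rule powr_add_le_weighted) (use l p edge_energy_nonneg[of u e] in auto)
  also have "?d powr p = edge_energy u e powr (p / 2)"
    using edge_energy_nonneg[of u e] by (simp add: powr_half_sqrt[symmetric] powr_powr)
  finally show ?thesis .
qed

lemma edge_energy_powr_sum:
  assumes "2 \<le> p"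
  shows "(\<integral>\<^sup>+e. ennreal (edge_energy u e powr (p / 2)) \<partial>count_space edges) \<le> ennreal (dirichlet u powr (p / 2))"
  by (rule nn_integral_powr_le)
     (use assms edge_energy_nonneg dirichlet_nonneg nn_integral_edge_energy_eq[OF u] in auto)

text \<open>Each vertex is the starting point of exactly \<open>CARD('n)\<close> edges, so summing
  the comparison over all edges counts it that often. This is the source of the factor
  \<open>1 / d\<close> in the square mass of the interpolation.\<close>

lemma vertex_square_sum:
  "ennreal (real CARD('n)) * (\<integral>\<^sup>+k. ennreal ((u k)\<^sup>2) \<partial>count_space vertices) \<le>
     ennreal ((1 - l) powr (- 1) * mass 2 u + l powr (- 1) * dirichlet u)"
proof -
  let ?c = "(1 - l) powr (- 1)" and ?C = "l powr (- 1)"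
  have meas: "(\<lambda>z. \<bar>on_edges u z\<bar> powr 2) \<in> borel_measurable arclength" using on_edges_measurable[OF u] by simp
  have int: "integrable arclength (\<lambda>z. \<bar>on_edges u z\<bar> powr 2)"
    using on_edges_square_integrable[OF u] by (simp add: powr_numeral)
  have M: "(\<integral>\<^sup>+e. \<integral>\<^sup>+t. ennreal (\<bar>u (edge_point e t)\<bar> powr 2) \<partial>unit_lebesgue \<partial>count_space edges) = ennreal (mass 2 u)"
    using nn_integral_arclength[OF meas] nn_integral_eq_integral[OF int] by (simp add: mass_def on_edges_def)
  have "ennreal (real CARD('n)) * (\<integral>\<^sup>+k. ennreal ((u k)\<^sup>2) \<partial>count_space vertices) =
      (\<integral>\<^sup>+e. ennreal ((u (fst e))\<^sup>2) \<partial>count_space edges)"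
    by (simp add: nn_integral_edges ennreal_of_nat_eq_real_of_nat)
  also have "\<dots> \<le> (\<integral>\<^sup>+e. ennreal ?c * (\<integral>\<^sup>+t. ennreal (\<bar>u (edge_point e t)\<bar> powr 2) \<partial>unit_lebesgue) + ennreal ?C * ennreal (edge_energy u e) \<partial>count_space edges)"
  proof (rule nn_integral_mono)
    fix e :: "(real^'n) \<times> 'n" assume "e \<in> space (count_space edges)"
    then have e: "e \<in> edges" by simp
    have sm: "(\<lambda>t. ennreal (\<bar>u (edge_point e t)\<bar> powr 2)) \<in> borel_measurable unit_lebesgue"
      using edge_section_measurable[OF u e] by simp
    have e0: "edge_point e 0 = fst e" by (simp add: edge_point_def)
    have "ennreal ((u (fst e))\<^sup>2) = (\<integral>\<^sup>+t. ennreal ((u (fst e))\<^sup>2) \<partial>unit_lebesgue)" by (rule nn_integral_unit_const[symmetric])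
    also have "\<dots> \<le> (\<integral>\<^sup>+t. ennreal ?c * ennreal (\<bar>u (edge_point e t)\<bar> powr 2) + ennreal ?C * ennreal (edge_energy u e) \<partial>unit_lebesgue)"
    proof (rule nn_integral_mono)
      fix t assume "t \<in> space unit_lebesgue"
      then have t: "t \<in> {0..1}" by (simp add: space_restrict_space)
      have "(u (fst e))\<^sup>2 \<le> ?c * \<bar>u (edge_point e t)\<bar> powr 2 + ?C * edge_energy u e"
      proof -
        have "\<bar>u (fst e)\<bar> powr 2 = (u (fst e))\<^sup>2" "edge_energy u e powr (2 / 2) = edge_energy u e" "(1 - 2 :: real) = - 1"
          using edge_energy_nonneg[of u e] by (simp_all add: powr_numeral)
        note eqs = this
        have "0 \<in> {0..1::real}" "(1::real) \<le> 2" by simp_all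
        from edge_oscillation[OF e t this] show ?thesis unfolding e0 eqs .
      qed
      then have "ennreal ((u (fst e))\<^sup>2) \<le> ennreal (?c * \<bar>u (edge_point e t)\<bar> powr 2 + ?C * edge_energy u e)"
        by (rule ennreal_leI)
      then show "ennreal ((u (fst e))\<^sup>2) \<le> ennreal ?c * ennreal (\<bar>u (edge_point e t)\<bar> powr 2) + ennreal ?C * ennreal (edge_energy u e)"
        unfolding ennreal_affine[OF powr_ge_zero powr_ge_zero powr_ge_zero edge_energy_nonneg] .
    qed
    also have "\<dots> = ennreal ?c * (\<integral>\<^sup>+t. ennreal (\<bar>u (edge_point e t)\<bar> powr 2) \<partial>unit_lebesgue) + ennreal ?C * ennreal (edge_energy u e)"
      by (rule nn_integral_unit_affine[OF sm])
    finally show "ennreal ((u (fst e))\<^sup>2) \<le> ennreal ?c * (\<integral>\<^sup>+t. ennreal (\<bar>u (edge_point e t)\<bar> powr 2) \<partial>unit_lebesgue) + ennreal ?C * ennreal (edge_energy u e)" .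
  qed
  also have "\<dots> = ennreal ?c * ennreal (mass 2 u) + ennreal ?C * ennreal (dirichlet u)"
    unfolding M[symmetric] nn_integral_edge_energy_eq[OF u, symmetric]
    by (subst nn_integral_add) (simp_all only: nn_integral_cmult borel_measurable_count_space)
  also have "\<dots> = ennreal (?c * mass 2 u + ?C * dirichlet u)"
    by (rule ennreal_affine[symmetric]) (simp_all add: mass_nonneg dirichlet_nonneg)
  finally show ?thesis .
qed

text \<open>The same count in the opposite direction: each edge is compared with its starting
  vertex, and the lattice sum is met \<open>CARD('n)\<close> times.\<close>

lemma mass_le_vertex_sum:
  assumes q: "2 < q" and B: "0 \<le> B" "(\<integral>\<^sup>+k. ennreal (\<bar>u k\<bar> powr q) \<partial>count_space vertices) \<le> ennreal B"
  shows "integrable arclength (\<lambda>z. \<bar>on_edges u z\<bar> powr q)"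
    "mass q u \<le> (1 - l) powr (1 - q) * (real CARD('n) * B) + l powr (1 - q) * dirichlet u powr (q / 2)"
proof -
  let ?c = "(1 - l) powr (1 - q)" and ?C = "l powr (1 - q)"
  have meas: "(\<lambda>z. \<bar>on_edges u z\<bar> powr q) \<in> borel_measurable arclength" using on_edges_measurable[OF u] by simp
  have "(\<integral>\<^sup>+e. \<integral>\<^sup>+t. ennreal (\<bar>on_edges u (e, t)\<bar> powr q) \<partial>unit_lebesgue \<partial>count_space edges) \<le>
     (\<integral>\<^sup>+e. ennreal ?c * ennreal (\<bar>u (fst e)\<bar> powr q) + ennreal ?C * ennreal (edge_energy u e powr (q / 2)) \<partial>count_space edges)"
  proof (rule nn_integral_mono)
    fix e :: "(real^'n) \<times> 'n" assume "e \<in> space (count_space edges)"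
    then have e: "e \<in> edges" by simp
    have e0: "edge_point e 0 = fst e" by (simp add: edge_point_def)
    have "(\<integral>\<^sup>+t. ennreal (\<bar>on_edges u (e, t)\<bar> powr q) \<partial>unit_lebesgue) \<le>
       (\<integral>\<^sup>+t. ennreal ?c * ennreal (\<bar>u (fst e)\<bar> powr q) + ennreal ?C * ennreal (edge_energy u e powr (q / 2)) \<partial>unit_lebesgue)"
    proof (rule nn_integral_mono)
      fix t assume "t \<in> space unit_lebesgue"
      then have t: "t \<in> {0..1}" by (simp add: space_restrict_space)
      have "\<bar>on_edges u (e, t)\<bar> powr q \<le> ?c * \<bar>u (fst e)\<bar> powr q + ?C * edge_energy u e powr (q / 2)"
        using edge_oscillation[OF e _ t, of 0 q] q by (simp add: e0 on_edges_def)
      then have "ennreal (\<bar>on_edges u (e, t)\<bar> powr q) \<le> ennreal (?c * \<bar>u (fst e)\<bar> powr q + ?C * edge_energy u e powr (q / 2))"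
        by (rule ennreal_leI)
      then show "ennreal (\<bar>on_edges u (e, t)\<bar> powr q) \<le> ennreal ?c * ennreal (\<bar>u (fst e)\<bar> powr q) + ennreal ?C * ennreal (edge_energy u e powr (q / 2))"
        by (simp add: ennreal_mult)
    qed
    then show "(\<integral>\<^sup>+t. ennreal (\<bar>on_edges u (e, t)\<bar> powr q) \<partial>unit_lebesgue) \<le>
       ennreal ?c * ennreal (\<bar>u (fst e)\<bar> powr q) + ennreal ?C * ennreal (edge_energy u e powr (q / 2))"
      by (simp only: nn_integral_unit_const)
  qed
  also have "\<dots> = ennreal ?c * (\<integral>\<^sup>+e. ennreal (\<bar>u (fst e)\<bar> powr q) \<partial>count_space edges) +
      ennreal ?C * (\<integral>\<^sup>+e. ennreal (edge_energy u e powr (q / 2)) \<partial>count_space edges)"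
    by (subst nn_integral_add) (simp_all add: nn_integral_cmult)
  also have "(\<integral>\<^sup>+e. ennreal (\<bar>u (fst e)\<bar> powr q) \<partial>count_space edges) = ennreal (real CARD('n)) * (\<integral>\<^sup>+k. ennreal (\<bar>u k\<bar> powr q) \<partial>count_space vertices)"
    by (simp add: nn_integral_edges ennreal_of_nat_eq_real_of_nat)
  also have "ennreal ?c * (ennreal (real CARD('n)) * (\<integral>\<^sup>+k. ennreal (\<bar>u k\<bar> powr q) \<partial>count_space vertices)) +
      ennreal ?C * (\<integral>\<^sup>+e. ennreal (edge_energy u e powr (q / 2)) \<partial>count_space edges) \<le>
      ennreal ?c * (ennreal (real CARD('n)) * ennreal B) + ennreal ?C * ennreal (dirichlet u powr (q / 2))"
    using q by (intro add_mono mult_left_mono B edge_energy_powr_sum) auto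
  also have "\<dots> = ennreal (?c * (real CARD('n) * B) + ?C * dirichlet u powr (q / 2))"
    using B(1) by (simp add: ennreal_mult)
  finally have le: "(\<integral>\<^sup>+e. \<integral>\<^sup>+t. ennreal (\<bar>on_edges u (e, t)\<bar> powr q) \<partial>unit_lebesgue \<partial>count_space edges) \<le>
      ennreal (?c * (real CARD('n) * B) + ?C * dirichlet u powr (q / 2))" .
  have nn: "0 \<le> ?c * (real CARD('n) * B) + ?C * dirichlet u powr (q / 2)" using B(1) by simp
  show "integrable arclength (\<lambda>z. \<bar>on_edges u z\<bar> powr q)"
    by (rule arclength_integrableI(1)[OF meas _ nn le]) simp
  show "mass q u \<le> ?c * (real CARD('n) * B) + ?C * dirichlet u powr (q / 2)"
    unfolding mass_def by (rule arclength_integrableI(2)[OF meas _ nn le]) simp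
qed

text \<open>\<open>A\<close> bounds the square sum over vertices and is close to
  \<open>mass 2 u / CARD('n)\<close> if \<open>l\<close> is small and the energy smaller still.
  Passing from edges to vertices and from vertices to the interpolation costs a factor
  \<open>(1 - l) powr (1 - q)\<close> each, plus errors of order
  \<open>dirichlet u powr (q / 2)\<close>.\<close>

lemma low_energy_bound:
  fixes q \<alpha> \<beta> \<kappa> :: real
  defines "A \<equiv> ((1 - l) powr (- 1) * mass 2 u + l powr (- 1) * dirichlet u) / real CARD('n)"
  assumes q: "2 < q"
    and \<kappa>: "\<And>v. v \<in> (nonzero_H1_space :: (real^'n \<Rightarrow> real) set) \<Longrightarrow> Q_space q v \<le> \<kappa>" "0 \<le> \<kappa>"
    and \<alpha>: "\<alpha> = real CARD('n) + (2 - real CARD('n)) * (q / 2)" "0 < \<alpha>"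
    and \<beta>: "\<beta> = (q / 2 - 1) * real CARD('n)"
  shows "integrable arclength (\<lambda>z. \<bar>on_edges u z\<bar> powr q)"
    "mass q u \<le> (1 - l) powr (1 - q) * (real CARD('n) *
       ((1 - l) powr (1 - q) * (\<kappa> * A powr (\<alpha> / 2) * dirichlet u powr (\<beta> / 2)) + l powr (1 - q) * (4 ^ CARD('n) * dirichlet u) powr (q / 2)))
       + l powr (1 - q) * dirichlet u powr (q / 2)"
proof -
  have A0: "0 \<le> A" unfolding A_def using mass_nonneg[of 2 u] dirichlet_nonneg[of u] by simp
  have Ale: "(\<integral>\<^sup>+k. ennreal ((u k)\<^sup>2) \<partial>count_space vertices) \<le> ennreal A"
  proof -
    have "ennreal (real CARD('n)) * (\<integral>\<^sup>+k. ennreal ((u k)\<^sup>2) \<partial>count_space vertices) \<le> ennreal (real CARD('n)) * ennreal A"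
      using vertex_square_sum A0 by (simp add: ennreal_mult[symmetric] A_def)
    then show ?thesis by (subst (asm) ennreal_mult_le_mult_iff) auto
  qed
  note ctx = Ale A0 vertex_difference_energy dirichlet_nonneg q
  let ?I = "\<integral>x. \<bar>interpolation u x\<bar> powr q \<partial>lborel"
  let ?B = "(1 - l) powr (1 - q) * ?I + l powr (1 - q) * (4 ^ CARD('n) * dirichlet u) powr (q / 2)"
  have B: "(\<integral>\<^sup>+k. ennreal (\<bar>u k\<bar> powr q) \<partial>count_space vertices) \<le> ennreal ?B"
    by (rule vertex_Lq_le[OF ctx l])
  have B0: "0 \<le> ?B" by (intro add_nonneg_nonneg mult_nonneg_nonneg Bochner_Integration.integral_nonneg) auto
  show "integrable arclength (\<lambda>z. \<bar>on_edges u z\<bar> powr q)" by (rule mass_le_vertex_sum(1)[OF q B0 B])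
  have I: "?I \<le> \<kappa> * A powr (\<alpha> / 2) * dirichlet u powr (\<beta> / 2)"
    by (rule interpolation_GN[OF ctx \<kappa> \<alpha> \<beta>])
  have "mass q u \<le> (1 - l) powr (1 - q) * (real CARD('n) * ?B) + l powr (1 - q) * dirichlet u powr (q / 2)"
    by (rule mass_le_vertex_sum(2)[OF q B0 B])
  also have "\<dots> \<le> (1 - l) powr (1 - q) * (real CARD('n) *
       ((1 - l) powr (1 - q) * (\<kappa> * A powr (\<alpha> / 2) * dirichlet u powr (\<beta> / 2)) + l powr (1 - q) * (4 ^ CARD('n) * dirichlet u) powr (q / 2)))
       + l powr (1 - q) * dirichlet u powr (q / 2)"
    by (intro add_mono mult_left_mono order_refl I) auto
  finally show "mass q u \<le> (1 - l) powr (1 - q) * (real CARD('n) *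
       ((1 - l) powr (1 - q) * (\<kappa> * A powr (\<alpha> / 2) * dirichlet u powr (\<beta> / 2)) + l powr (1 - q) * (4 ^ CARD('n) * dirichlet u) powr (q / 2)))
       + l powr (1 - q) * dirichlet u powr (q / 2)" .
qed

end

text \<open>Without energy \<open>u\<close> is constant along every edge, hence invariant under unit
  steps; square summability over the vertices then forces it to vanish on the grid.\<close>

lemma dirichlet_pos:
  assumes u: "u \<in> (nonzero_H1_grid :: (real^'n \<Rightarrow> real) set)"
  shows "0 < dirichlet u"
proof (rule ccontr)
  have uH: "u \<in> H1_grid" using u by (simp add: nonzero_H1_grid_def)
  assume "\<not> 0 < dirichlet u"
  then have D: "dirichlet u = 0" using dirichlet_nonneg[of u] by simp
  have eq: "u (edge_point e t) = u (edge_point e s)" if e: "e \<in> edges" and st: "s \<in> {0..1}" "t \<in> {0..1}" for e s t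
  proof -
    have "edge_energy u e = 0" using edge_energy_le_dirichlet[OF uH e] edge_energy_nonneg[of u e] D by simp
    then show ?thesis using edge_holder[OF uH e st] by simp
  qed
  have "ennreal (real CARD('n)) * (\<integral>\<^sup>+k. ennreal ((u k)\<^sup>2) \<partial>count_space vertices) \<le>
     ennreal ((1 - 1/2) powr (- 1) * mass 2 u + (1/2) powr (- 1) * dirichlet u)"
    by (rule vertex_square_sum[OF uH]) auto
  moreover have "1 * (\<integral>\<^sup>+k. ennreal ((u k)\<^sup>2) \<partial>count_space (vertices :: (real^'n) set)) \<le>
      ennreal (real CARD('n)) * (\<integral>\<^sup>+k. ennreal ((u k)\<^sup>2) \<partial>count_space vertices)"
    by (rule mult_right_mono) (simp_all add: Suc_leI)
  ultimately have sum: "(\<integral>\<^sup>+k. ennreal ((u k)\<^sup>2) \<partial>count_space vertices) \<le> ennreal ((1 - 1/2) powr (- 1) * mass 2 u + (1/2) powr (- 1) * dirichlet u)"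
    by (simp only: mult_1 order_trans)
  fix i :: 'n
  have "u (k + axis i 1) = u k" if "k \<in> vertices" for k
    using eq[of "(k, i)" 0 1] that by (simp add: pair_in_edges)
  then have z: "u k = 0" if "k \<in> vertices" for k
    using invariant_square_summable_zero[OF sum _ that] by blast
  obtain x where x: "x \<in> grid" "u x \<noteq> 0" using u by (auto simp: nonzero_H1_grid_def)
  then obtain e t where e: "e \<in> edges" "t \<in> {0..1}" "x = edge_point e t" unfolding grid_def by blast
  obtain k j where kj: "e = (k, j)" by (cases e)
  have "u x = u k" using eq[OF e(1) _ e(2), of 0] e(3) kj by simp
  then show False using z e(1) x(2) kj by (simp add: pair_in_edges)
qed

section \<open>Scaling, differences and translations of graph functions\<close>

lemma dyadic_energy_scale: "dyadic_energy m (\<lambda>t. c * f t) = c\<^sup>2 * dyadic_energy m f"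
proof -
  have "(c * f x - c * f y)\<^sup>2 = c\<^sup>2 * (f x - f y)\<^sup>2" for x y
    by (simp add: right_diff_distrib[symmetric] power_mult_distrib)
  then show ?thesis unfolding dyadic_energy_def by (simp add: sum_distrib_left mult_ac)
qed

lemma grid_energy_scale: "grid_energy j (\<lambda>x. c * u x) = c\<^sup>2 * grid_energy j u"
  unfolding grid_energy_def dyadic_energy_scale by (simp add: sum_distrib_left)

text \<open>\<open>(1 + e) * p^2 + (1 + 1 / e) * r^2 - (p - r)^2\<close> is the square of
  \<open>sqrt e * p + r / sqrt e\<close>. The combination of energies is therefore itself an energy
  and increases with the mesh.\<close>

lemma dyadic_energy_identity:
  assumes "0 < e"
  shows "(1 + e) * dyadic_energy m f + (1 + 1 / e) * dyadic_energy m g - dyadic_energy m (\<lambda>t. f t - g t) =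
     dyadic_energy m (\<lambda>t. sqrt e * f t + (1 / sqrt e) * g t)"
proof -
  have id: "(1 + e) * p\<^sup>2 + (1 + 1 / e) * r\<^sup>2 - (p - r)\<^sup>2 = (sqrt e * p + (1 / sqrt e) * r)\<^sup>2" for p r
  proof -
    have "(sqrt e * p + (1 / sqrt e) * r)\<^sup>2 = (sqrt e)\<^sup>2 * p\<^sup>2 + (1 / sqrt e)\<^sup>2 * r\<^sup>2 + 2 * (sqrt e * (1 / sqrt e)) * (p * r)"
      unfolding power2_sum power_mult_distrib by (simp only: mult_ac)
    also have "(sqrt e)\<^sup>2 = e" using assms by simp
    also have "(1 / sqrt e)\<^sup>2 = 1 / e" using assms by (simp add: power_divide)
    also have "sqrt e * (1 / sqrt e) = 1" using assms by simp
    finally show ?thesis by (simp add: power2_diff algebra_simps)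
  qed
  let ?a = "\<lambda>i. (real i + 1) / 2 ^ m" and ?b = "\<lambda>i. real i / 2 ^ m"
  have "dyadic_energy m (\<lambda>t. sqrt e * f t + (1 / sqrt e) * g t) =
     2 ^ m * (\<Sum>i<2 ^ m. (1 + e) * (f (?a i) - f (?b i))\<^sup>2 + (1 + 1 / e) * (g (?a i) - g (?b i))\<^sup>2 - (f (?a i) - g (?a i) - (f (?b i) - g (?b i)))\<^sup>2)"
    unfolding dyadic_energy_def
  proof (intro arg_cong2[where f="(*)"] sum.cong refl)
    fix i
    have 1: "sqrt e * f (?a i) + 1 / sqrt e * g (?a i) - (sqrt e * f (?b i) + 1 / sqrt e * g (?b i)) =
        sqrt e * (f (?a i) - f (?b i)) + 1 / sqrt e * (g (?a i) - g (?b i))"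
      unfolding right_diff_distrib by linarith
    have 2: "f (?a i) - g (?a i) - (f (?b i) - g (?b i)) = (f (?a i) - f (?b i)) - (g (?a i) - g (?b i))" by linarith
    show "(sqrt e * f (?a i) + 1 / sqrt e * g (?a i) - (sqrt e * f (?b i) + 1 / sqrt e * g (?b i)))\<^sup>2 =
      (1 + e) * (f (?a i) - f (?b i))\<^sup>2 + (1 + 1 / e) * (g (?a i) - g (?b i))\<^sup>2 - (f (?a i) - g (?a i) - (f (?b i) - g (?b i)))\<^sup>2"
      unfolding 1 2 id ..
  qed
  also have "\<dots> = (1 + e) * dyadic_energy m f + (1 + 1 / e) * dyadic_energy m g - dyadic_energy m (\<lambda>t. f t - g t)"
    unfolding dyadic_energy_def sum_subtractf sum.distrib sum_distrib_left[symmetric] by (simp only: right_diff_distrib distrib_left mult.left_commute)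
  finally show ?thesis ..
qed

lemma grid_energy_identity:
  assumes "0 < e"
  shows "(1 + e) * grid_energy j u + (1 + 1 / e) * grid_energy j w - grid_energy j (\<lambda>x. u x - w x) =
     grid_energy j (\<lambda>x. sqrt e * u x + (1 / sqrt e) * w x)"
  unfolding grid_energy_def sum_distrib_left sum.distrib[symmetric] sum_subtractf[symmetric]
  by (rule sum.cong[OF refl]) (rule dyadic_energy_identity[OF assms])

lemma H1_grid_scale:
  assumes u: "u \<in> H1_grid"
  shows "(\<lambda>x. c * u x) \<in> H1_grid" and "dirichlet (\<lambda>x. c * u x) = c\<^sup>2 * dirichlet u"
    and "mass p (\<lambda>x. c * u x) = \<bar>c\<bar> powr p * mass p u"
proof -
  have on: "on_edges (\<lambda>x. c * u x) z = c * on_edges u z" for z by (cases z) (simp add: on_edges_def)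
  show H: "(\<lambda>x. c * u x) \<in> H1_grid"
    unfolding H1_grid_iff
  proof (intro conjI)
    show "continuous_on grid (\<lambda>x. c * u x)" using H1_grid_continuous[OF u] by (intro continuous_intros)
    show "integrable arclength (\<lambda>z. (on_edges (\<lambda>x. c * u x) z)\<^sup>2)"
      unfolding on power_mult_distrib using on_edges_square_integrable[OF u] by simp
    have "grid_energy j (\<lambda>x. c * u x) \<le> c\<^sup>2 * dirichlet u" for j
      unfolding grid_energy_scale by (intro mult_left_mono grid_energy_le_dirichlet[OF u]) simp
    then show "\<exists>B. \<forall>j. grid_energy j (\<lambda>x. c * u x) \<le> B" by blast
  qed
  have "(\<lambda>j. grid_energy j (\<lambda>x. c * u x)) \<longlonglongrightarrow> c\<^sup>2 * dirichlet u"
    unfolding grid_energy_scale by (intro tendsto_intros grid_energy_tendsto[OF u])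
  then show "dirichlet (\<lambda>x. c * u x) = c\<^sup>2 * dirichlet u" using LIMSEQ_unique grid_energy_tendsto[OF H] by blast
  show "mass p (\<lambda>x. c * u x) = \<bar>c\<bar> powr p * mass p u"
    unfolding mass_def on abs_mult powr_mult by simp
qed

text \<open>What the difference gains beyond level \<open>j\<close> is at most the weighted gain of
  \<open>u\<close> and \<open>w\<close>, because the combination in
  \<open>grid_energy_identity\<close> is increasing. This takes the place of weak convergence of
  derivatives: level \<open>j\<close> sees only finitely many point values, and for small
  \<open>e\<close> the gain of \<open>u\<close> has a coefficient close to 1.\<close>

lemma H1_grid_diff:
  assumes u: "u \<in> H1_grid" and w: "w \<in> H1_grid"
  shows "(\<lambda>x. u x - w x) \<in> H1_grid"
    and "0 < e \<Longrightarrow> dirichlet (\<lambda>x. u x - w x) \<le> grid_energy j (\<lambda>x. u x - w x) +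
      (1 + e) * (dirichlet u - grid_energy j u) + (1 + 1 / e) * (dirichlet w - grid_energy j w)"
proof -
  let ?d = "\<lambda>x. u x - w x"
  have on: "on_edges ?d z = on_edges u z - on_edges w z" for z by (cases z) (simp add: on_edges_def)
  show H: "?d \<in> H1_grid"
    unfolding H1_grid_iff
  proof (intro conjI)
    show "continuous_on grid ?d" by (intro continuous_intros H1_grid_continuous u w)
    show "integrable arclength (\<lambda>z. (on_edges ?d z)\<^sup>2)"
      unfolding on
    proof (rule Bochner_Integration.integrable_bound)
      show "integrable arclength (\<lambda>z. 2 * (on_edges u z)\<^sup>2 + 2 * (on_edges w z)\<^sup>2)"
        using on_edges_square_integrable[OF u] on_edges_square_integrable[OF w] by simp
      show "(\<lambda>z. (on_edges u z - on_edges w z)\<^sup>2) \<in> borel_measurable arclength"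
        using on_edges_measurable[OF u] on_edges_measurable[OF w] by simp
      have "(p - r)\<^sup>2 \<le> 2 * p\<^sup>2 + 2 * r\<^sup>2" for p r :: real
        using sum_squares_bound[of p "- r"] by (simp add: power2_diff)
      then show "AE z in arclength. norm ((on_edges u z - on_edges w z)\<^sup>2) \<le> norm (2 * (on_edges u z)\<^sup>2 + 2 * (on_edges w z)\<^sup>2)"
        by simp
    qed
    have "grid_energy j ?d \<le> 2 * dirichlet u + 2 * dirichlet w" for j
      using grid_energy_identity[of 1 j u w] grid_energy_nonneg[of j "\<lambda>x. sqrt 1 * u x + (1 / sqrt 1) * w x"]
        grid_energy_le_dirichlet[OF u, of j] grid_energy_le_dirichlet[OF w, of j] by simp
    then show "\<exists>B. \<forall>j. grid_energy j ?d \<le> B" by blast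
  qed
  assume e: "0 < e"
  have le: "grid_energy l ?d \<le> grid_energy j ?d + (1 + e) * (grid_energy l u - grid_energy j u) + (1 + 1 / e) * (grid_energy l w - grid_energy j w)"
    if "j \<le> l" for l
    using grid_energy_mono[OF that, of "\<lambda>x. sqrt e * u x + (1 / sqrt e) * w x"]
    unfolding grid_energy_identity[OF e, symmetric] right_diff_distrib by linarith
  show "dirichlet ?d \<le> grid_energy j ?d + (1 + e) * (dirichlet u - grid_energy j u) + (1 + 1 / e) * (dirichlet w - grid_energy j w)"
  proof (rule LIMSEQ_le[OF grid_energy_tendsto[OF H]])
    show "(\<lambda>l. grid_energy j ?d + (1 + e) * (grid_energy l u - grid_energy j u) + (1 + 1 / e) * (grid_energy l w - grid_energy j w)) \<longlonglongrightarrow>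
      grid_energy j ?d + (1 + e) * (dirichlet u - grid_energy j u) + (1 + 1 / e) * (dirichlet w - grid_energy j w)"
      by (intro tendsto_intros grid_energy_tendsto u w)
    show "\<exists>N. \<forall>l\<ge>N. grid_energy l ?d \<le> grid_energy j ?d + (1 + e) * (grid_energy l u - grid_energy j u) + (1 + 1 / e) * (grid_energy l w - grid_energy j w)"
      using le by blast
  qed
qed

section \<open>Lattice translations\<close>

context
  fixes k :: "real^'n"
  assumes k: "k \<in> vertices"
begin

lemma edge_point_translate: "edge_point (fst e + k, snd e) t = edge_point e t + k"
  by (simp add: edge_point_def)

lemma bij_edges_translate: "bij_betw (\<lambda>e. (fst e + k, snd e)) edges (edges :: ((real^'n) \<times> 'n) set)"
  by (rule bij_betw_byWitness[where f'="\<lambda>e. (fst e - k, snd e)"])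
     (use k vertices_add vertices_diff in \<open>auto simp: edges_def\<close>)

text \<open>For nonnegative functions the reindexing is done with \<open>nn_integral\<close>, where
  a bijection of the edge set acts without any integrability condition.\<close>

lemma integral_arclength_translate:
  fixes f g :: "((real^'n) \<times> 'n) \<times> real \<Rightarrow> real"
  assumes f: "f \<in> borel_measurable arclength" "\<And>z. 0 \<le> f z"
    and g: "\<And>e t. g (e, t) = f ((fst e + k, snd e), t)"
  shows "g \<in> borel_measurable arclength" "(\<integral>z. g z \<partial>arclength) = (\<integral>z. f z \<partial>arclength)"
    "integrable arclength g \<longleftrightarrow> integrable arclength f"
proof -
  have im: "(fst e + k, snd e) \<in> edges" if "e \<in> edges" for e :: "(real^'n) \<times> 'n"
    using bij_betwE[OF bij_edges_translate] that by blast
  show gm: "g \<in> borel_measurable arclength"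
    using f(1) im unfolding borel_measurable_arclength_iff g by blast
  have g0: "0 \<le> g z" for z using f(2) g by (cases z) simp
  have "(\<integral>\<^sup>+z. ennreal (g z) \<partial>arclength) = (\<integral>\<^sup>+e. \<integral>\<^sup>+t. ennreal (f ((fst e + k, snd e), t)) \<partial>unit_lebesgue \<partial>count_space edges)"
    unfolding nn_integral_arclength[OF gm] g ..
  also have "\<dots> = (\<integral>\<^sup>+e. \<integral>\<^sup>+t. ennreal (f (e, t)) \<partial>unit_lebesgue \<partial>count_space edges)"
    by (rule nn_integral_bij_count_space[OF bij_edges_translate, of "\<lambda>e. \<integral>\<^sup>+t. ennreal (f (e, t)) \<partial>unit_lebesgue"])
  also have "\<dots> = (\<integral>\<^sup>+z. ennreal (f z) \<partial>arclength)" by (rule nn_integral_arclength[OF f(1), symmetric])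
  finally have eq: "(\<integral>\<^sup>+z. ennreal (g z) \<partial>arclength) = (\<integral>\<^sup>+z. ennreal (f z) \<partial>arclength)" .
  show "(\<integral>z. g z \<partial>arclength) = (\<integral>z. f z \<partial>arclength)"
    using integral_eq_nn_integral[OF gm] integral_eq_nn_integral[OF f(1)] g0 f(2) eq by simp
  show "integrable arclength g \<longleftrightarrow> integrable arclength f"
    unfolding integrable_iff_bounded using gm f(1) g0 f(2) eq by simp
qed

lemma H1_grid_translate:
  assumes u: "u \<in> (H1_grid :: (real^'n \<Rightarrow> real) set)"
  defines "v \<equiv> \<lambda>x. u (x + k)"
  shows "v \<in> H1_grid" "dirichlet v = dirichlet u" "mass p v = mass p u"
    "\<And>e t. on_edges v (e, t) = on_edges u ((fst e + k, snd e), t)"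
proof -
  have on: "on_edges v (e, t) = on_edges u ((fst e + k, snd e), t)" for e t
    by (simp add: on_edges_def v_def edge_point_translate)
  show "on_edges v (e, t) = on_edges u ((fst e + k, snd e), t)" for e t by (rule on)
  have de: "edge_deriv v (e, t) = edge_deriv u ((fst e + k, snd e), t)" for e t
    by (simp add: edge_deriv_def v_def edge_point_translate)
  have im: "(fst e + k, snd e) \<in> edges" if "e \<in> edges" for e :: "(real^'n) \<times> 'n"
    using bij_betwE[OF bij_edges_translate] that by blast
  have uD: "continuous_on grid u" "\<And>e. e \<in> edges \<Longrightarrow> (\<lambda>t. u (edge_point e t)) \<in> H1 {0<..<1}"
    "on_edges u \<in> Lp_space arclength 2" "edge_deriv u \<in> Lp_space arclength 2"
    using u unfolding H1_grid_def by blast+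
  have m2: "on_edges u \<in> borel_measurable arclength" "edge_deriv u \<in> borel_measurable arclength"
    using uD(3,4) unfolding Lp_space_def by blast+
  have c: "continuous_on grid v"
    unfolding v_def
  proof (rule continuous_on_compose2[OF uD(1)])
    show "continuous_on grid (\<lambda>x. x + k)" by (intro continuous_intros)
    show "(\<lambda>x. x + k) ` grid \<subseteq> grid"
    proof
      fix y assume "y \<in> (\<lambda>x. x + k) ` grid"
      then obtain e t where e: "e \<in> edges" "t \<in> {0..1}" "y = edge_point e t + k" unfolding grid_def by blast
      then show "y \<in> grid" using edge_point_in_grid[OF im[OF e(1)] e(2)] unfolding edge_point_translate by simp
    qed
  qed
  have H1: "(\<lambda>t. v (edge_point e t)) \<in> H1 {0<..<1}" if "e \<in> edges" for e
    using uD(2)[OF im[OF that]] unfolding v_def edge_point_translate .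
  \<comment> \<open>Stated for a generic pair, so that it serves both the function and its
    derivative.\<close>
  have tr: "w \<in> borel_measurable arclength \<and> (\<integral>z. \<bar>w z\<bar> powr p \<partial>arclength) = (\<integral>z. \<bar>y z\<bar> powr p \<partial>arclength) \<and>
      (integrable arclength (\<lambda>z. \<bar>w z\<bar> powr p) \<longleftrightarrow> integrable arclength (\<lambda>z. \<bar>y z\<bar> powr p))"
    if y: "y \<in> borel_measurable arclength" and w: "\<And>e t. w (e, t) = y ((fst e + k, snd e), t)" for w y :: "((real^'n) \<times> 'n) \<times> real \<Rightarrow> real" and p
  proof (intro conjI)
    show "w \<in> borel_measurable arclength"
      using y im unfolding borel_measurable_arclength_iff w by blast
    have ym: "(\<lambda>z. \<bar>y z\<bar> powr p) \<in> borel_measurable arclength" using y by simp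
    show "(\<integral>z. \<bar>w z\<bar> powr p \<partial>arclength) = (\<integral>z. \<bar>y z\<bar> powr p \<partial>arclength)"
      by (rule integral_arclength_translate(2)[OF ym]) (simp_all add: w)
    show "integrable arclength (\<lambda>z. \<bar>w z\<bar> powr p) \<longleftrightarrow> integrable arclength (\<lambda>z. \<bar>y z\<bar> powr p)"
      by (rule integral_arclength_translate(3)[OF ym]) (simp_all add: w)
  qed
  note t1 = tr[OF m2(1) on] and t2 = tr[OF m2(2) de]
  have "on_edges v \<in> Lp_space arclength 2" "edge_deriv v \<in> Lp_space arclength 2"
    using uD(3,4) t1[of 2] t2[of 2] unfolding Lp_space_def real_norm_def by blast+
  then show "v \<in> H1_grid" using c H1 unfolding H1_grid_def by blast
  show "mass p v = mass p u" using t1[of p] unfolding mass_def by blast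
  show "dirichlet v = dirichlet u" using t2[of 2] unfolding dirichlet_def by (simp add: powr_numeral)
qed

end

section \<open>Sup bounds from the mass and energy of an edge\<close>

definition edge_mass :: "(real^'n \<Rightarrow> real) \<Rightarrow> (real^'n) \<times> 'n \<Rightarrow> real" where
  "edge_mass u e = (\<integral>t. (on_edges u (e, t))\<^sup>2 \<partial>unit_lebesgue)"

context
  fixes u :: "real^'n \<Rightarrow> real"
  assumes u: "u \<in> H1_grid"
begin

lemma edge_square_integrable:
  assumes e: "e \<in> edges"
  shows "integrable unit_lebesgue (\<lambda>t. (on_edges u (e, t))\<^sup>2)"
    and "edge_mass u e \<le> mass 2 u"
proof -
  have meas: "(\<lambda>z. (on_edges u z)\<^sup>2) \<in> borel_measurable arclength" using on_edges_measurable[OF u] by simp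
  have mass: "mass 2 u = (\<integral>z. (on_edges u z)\<^sup>2 \<partial>arclength)" by (simp add: mass_def powr_numeral)
  have sec: "(\<lambda>t. (on_edges u (e, t))\<^sup>2) \<in> borel_measurable unit_lebesgue"
    using edge_section_measurable[OF u e] by (simp add: on_edges_def)
  have "(\<integral>\<^sup>+t. ennreal ((on_edges u (e, t))\<^sup>2) \<partial>unit_lebesgue) \<le>
      (\<integral>\<^sup>+e. \<integral>\<^sup>+t. ennreal ((on_edges u (e, t))\<^sup>2) \<partial>unit_lebesgue \<partial>count_space edges)"
    using nn_integral_ge_point[OF e, of "\<lambda>e. \<integral>\<^sup>+t. ennreal ((on_edges u (e, t))\<^sup>2) \<partial>unit_lebesgue"] .
  also have "\<dots> = ennreal (mass 2 u)"
    unfolding nn_integral_arclength[OF meas, symmetric] mass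
    by (rule nn_integral_eq_integral[OF on_edges_square_integrable[OF u]]) simp
  finally have le: "(\<integral>\<^sup>+t. ennreal ((on_edges u (e, t))\<^sup>2) \<partial>unit_lebesgue) \<le> ennreal (mass 2 u)" .
  show i: "integrable unit_lebesgue (\<lambda>t. (on_edges u (e, t))\<^sup>2)"
    by (rule integrableI_nonneg[OF sec]) (use le_less_trans[OF le] in auto)
  show "edge_mass u e \<le> mass 2 u"
    using le unfolding edge_mass_def nn_integral_eq_integral[OF i AE_I2[OF zero_le_power2]]
    by (simp add: mass_nonneg)
qed

text \<open>The value at \<open>t\<close> is compared with the average over an interval of length
  \<open>r\<close> next to \<open>t\<close>. The free length balances mass against energy; it is
  taken as 1, as a small constant, or as the inverse square root of the energy.\<close>

lemma edge_sup_bound: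
  assumes e: "e \<in> edges" and t: "t \<in> {0..1}" and r: "0 < r" "r \<le> 1"
  shows "(u (edge_point e t))\<^sup>2 \<le> 2 * edge_mass u e / r + 2 * r * edge_energy u e"
proof -
  \<comment> \<open>The interval from \<open>a\<close> to \<open>a + r\<close> stays inside the unit
    interval, and its closure contains \<open>t\<close>.\<close>
  define a where "a = min t (1 - r)"
  have a: "0 \<le> a" "a + r \<le> 1" "a \<le> t" "t \<le> a + r" using t r by (auto simp: a_def)
  let ?J = "{a<..<a + r}"
  have J: "?J \<subseteq> {0<..<1}" using a by auto
  have mJ: "measure unit_lebesgue ?J = r"
    using J r by (subst measure_restrict_space) auto
  have Js: "?J \<in> sets unit_lebesgue"
    using J by (subst sets_restrict_space_iff) auto
  have Jsp: "?J \<inter> space unit_lebesgue = ?J" using J by (auto simp: space_restrict_space)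
  have fJ: "emeasure unit_lebesgue ?J < \<infinity>"
    using finite_measure.emeasure_finite[OF finite_measure_unit_lebesgue, of ?J] by (simp add: less_top)
  have iJ: "integrable unit_lebesgue (indicator ?J :: real \<Rightarrow> real)" "(\<integral>s. indicator ?J s \<partial>unit_lebesgue) = r"
    using integrable_real_indicator[OF Js fJ] mJ Jsp Bochner_Integration.integral_indicator[of unit_lebesgue ?J] by (simp_all only:)
  have "r * (u (edge_point e t))\<^sup>2 = (\<integral>s. (u (edge_point e t))\<^sup>2 * indicator ?J s \<partial>unit_lebesgue)"
    unfolding integral_mult_right_zero iJ(2) by (rule mult.commute)
  also have "\<dots> \<le> (\<integral>s. 2 * (on_edges u (e, s))\<^sup>2 + 2 * r * edge_energy u e * indicator ?J s \<partial>unit_lebesgue)"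
  proof (rule integral_mono)
    show "integrable unit_lebesgue (\<lambda>s. (u (edge_point e t))\<^sup>2 * indicator ?J s)"
      by (intro integrable_mult_right iJ(1))
    show "integrable unit_lebesgue (\<lambda>s. 2 * (on_edges u (e, s))\<^sup>2 + 2 * r * edge_energy u e * indicator ?J s)"
      by (intro Bochner_Integration.integrable_add integrable_mult_right iJ(1) edge_square_integrable(1)[OF e])
    fix s assume "s \<in> space unit_lebesgue"
    then have s: "s \<in> {0..1}" by (simp add: space_restrict_space)
    show "(u (edge_point e t))\<^sup>2 * indicator ?J s \<le> 2 * (on_edges u (e, s))\<^sup>2 + 2 * r * edge_energy u e * indicator ?J s"
    proof (cases "s \<in> ?J")
      case True
      define p where "p = u (edge_point e s)"
      define d where "d = u (edge_point e t) - p"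
      have "d\<^sup>2 \<le> \<bar>t - s\<bar> * edge_energy u e" unfolding d_def p_def by (rule edge_holder[OF u e s t])
      also have "\<bar>t - s\<bar> \<le> r" using True a by (simp add: abs_le_iff)
      then have "\<bar>t - s\<bar> * edge_energy u e \<le> r * edge_energy u e"
        by (rule mult_right_mono[OF _ edge_energy_nonneg[of u e]])
      finally have d: "d\<^sup>2 \<le> r * edge_energy u e" .
      have "(u (edge_point e t))\<^sup>2 = (p + d)\<^sup>2" by (simp add: d_def)
      also have "\<dots> \<le> 2 * p\<^sup>2 + 2 * d\<^sup>2" using sum_squares_bound[of p d] by (simp add: power2_sum)
      finally show ?thesis using d True by (simp add: on_edges_def p_def)
    next
      case False
      then show ?thesis by simp
    qed
  qed
  also have "\<dots> = 2 * edge_mass u e + 2 * r * edge_energy u e * r"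
    unfolding edge_mass_def
    by (subst Bochner_Integration.integral_add)
       (intro integrable_mult_right iJ(1) edge_square_integrable(1)[OF e], intro integrable_mult_right iJ(1), simp only: integral_mult_right_zero iJ(2))
  finally have "r * (u (edge_point e t))\<^sup>2 \<le> 2 * edge_mass u e + 2 * r * edge_energy u e * r" .
  then have "(u (edge_point e t))\<^sup>2 \<le> (2 * edge_mass u e + 2 * r * edge_energy u e * r) / r"
    using r(1) by (simp add: pos_le_divide_eq mult.commute)
  also have "\<dots> = 2 * edge_mass u e / r + 2 * r * edge_energy u e" using r(1) by (simp add: add_divide_distrib)
  finally show ?thesis .
qed

text \<open>Of the \<open>q\<close> powers, \<open>q - 2\<close> are estimated by the sup and the
  other two form the square mass.\<close>

lemma mass_le_sup:
  assumes S: "\<And>e t. e \<in> edges \<Longrightarrow> t \<in> {0..1} \<Longrightarrow> (u (edge_point e t))\<^sup>2 \<le> S" and q: "2 < q"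
  shows "integrable arclength (\<lambda>z. \<bar>on_edges u z\<bar> powr q)" "mass q u \<le> S powr ((q - 2) / 2) * mass 2 u"
proof -
  have pt: "\<bar>on_edges u z\<bar> powr q \<le> S powr ((q - 2) / 2) * (on_edges u z)\<^sup>2" if z: "z \<in> space arclength" for z
  proof -
    obtain e t where et: "z = (e, t)" by (cases z)
    have e: "e \<in> edges" "t \<in> {0..1}" using z by (auto simp: et arclength_def space_pair_measure space_restrict_space)
    let ?x = "on_edges u z"
    have "\<bar>?x\<bar> powr q = \<bar>?x\<bar> powr (q - 2) * \<bar>?x\<bar> powr 2" by (subst powr_add[symmetric]) simp
    also have "\<bar>?x\<bar> powr (q - 2) = (?x\<^sup>2) powr ((q - 2) / 2)" by (rule power2_powr_half[symmetric])
    also have "\<dots> * \<bar>?x\<bar> powr 2 \<le> S powr ((q - 2) / 2) * \<bar>?x\<bar> powr 2"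
      using S[OF e] q by (intro mult_right_mono powr_mono2) (auto simp: et on_edges_def)
    finally show ?thesis by (simp add: powr_numeral)
  qed
  have i: "integrable arclength (\<lambda>z. S powr ((q - 2) / 2) * (on_edges u z)\<^sup>2)"
    using on_edges_square_integrable[OF u] by simp
  show i': "integrable arclength (\<lambda>z. \<bar>on_edges u z\<bar> powr q)"
  proof (rule Bochner_Integration.integrable_bound[OF i])
    show "(\<lambda>z. \<bar>on_edges u z\<bar> powr q) \<in> borel_measurable arclength" using on_edges_measurable[OF u] by simp
    show "AE z in arclength. norm (\<bar>on_edges u z\<bar> powr q) \<le> norm (S powr ((q - 2) / 2) * (on_edges u z)\<^sup>2)"
      using pt by (intro AE_I2) simp
  qed
  have "mass q u \<le> (\<integral>z. S powr ((q - 2) / 2) * (on_edges u z)\<^sup>2 \<partial>arclength)"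
    unfolding mass_def by (rule integral_mono[OF i' i pt])
  also have "\<dots> = S powr ((q - 2) / 2) * mass 2 u" by (simp add: mass_def powr_numeral)
  finally show "mass q u \<le> S powr ((q - 2) / 2) * mass 2 u" .
qed

end

section \<open>Compactness\<close>

context
  fixes w :: "real^'n \<Rightarrow> real" and D :: real
  assumes holder: "\<And>e s t. e \<in> edges \<Longrightarrow> s \<in> {0..1} \<Longrightarrow> t \<in> {0..1} \<Longrightarrow>
      (w (edge_point e t) - w (edge_point e s))\<^sup>2 \<le> \<bar>t - s\<bar> * D"
begin

lemma holder_continuous_on_edge:
  assumes e: "e \<in> edges"
  shows "continuous_on (edge_point e ` {0..1}) w"
  unfolding continuous_on_iff
proof (intro ballI allI impI)
  fix x \<epsilon> :: "_" assume x: "x \<in> edge_point e ` {0..1}" and eps: "0 < (\<epsilon>::real)"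
  obtain s where s: "s \<in> {0..1}" "x = edge_point e s" using x by blast
  define \<delta> where "\<delta> = \<epsilon>\<^sup>2 / (\<bar>D\<bar> + 1)"
  have \<delta>: "0 < \<delta>" using eps by (simp add: \<delta>_def)
  have "dist (w y) (w x) < \<epsilon>" if y: "y \<in> edge_point e ` {0..1}" "dist y x < \<delta>" for y
  proof -
    obtain t where t: "t \<in> {0..1}" "y = edge_point e t" using y by blast
    have "y - x = (t - s) *\<^sub>R axis (snd e) 1" unfolding t(2) s(2) edge_point_def by (simp add: scaleR_diff_left)
    then have ts: "\<bar>t - s\<bar> < \<delta>" using y(2) by (simp add: dist_norm)
    have "(w y - w x)\<^sup>2 \<le> \<bar>t - s\<bar> * D" unfolding t(2) s(2) by (rule holder[OF e s(1) t(1)])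
    also have "\<dots> \<le> \<bar>t - s\<bar> * (\<bar>D\<bar> + 1)" by (intro mult_left_mono) auto
    also have "\<dots> < \<delta> * (\<bar>D\<bar> + 1)" using ts by (intro mult_strict_right_mono) auto
    also have "\<dots> = \<epsilon>\<^sup>2" by (simp add: \<delta>_def)
    finally have "\<bar>w y - w x\<bar>\<^sup>2 < \<epsilon>\<^sup>2" by simp
    then have "\<bar>w y - w x\<bar> < \<epsilon>" using eps by (intro power2_less_imp_less[of _ \<epsilon>]) auto
    then show ?thesis by (simp add: dist_real_def)
  qed
  then show "\<exists>d>0. \<forall>y\<in>edge_point e ` {0..1}. dist y x < d \<longrightarrow> dist (w y) (w x) < \<epsilon>" using \<delta> by blast
qed

lemma finite_edges_bounded: "finite {e \<in> (edges :: ((real^'n) \<times> 'n) set). norm (fst e) \<le> r}"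
proof -
  let ?I = "{k \<in> \<int>. \<bar>k\<bar> \<le> r}"
  let ?A = "{x :: real^'n. \<forall>i. x $ i \<in> ?I}"
  have "finite (UNIV \<rightarrow>\<^sub>E ?I :: ('n \<Rightarrow> real) set)" by (intro finite_PiE finite_abs_int_segment) auto
  then have "finite (($) ` ?A)" by (rule finite_subset[rotated]) auto
  then have "finite ?A" by (rule finite_imageD) (rule inj_onI, simp only: vec_nth_inject)
  then have "finite (?A \<times> (UNIV :: 'n set))" by simp
  moreover have "{e \<in> edges. norm (fst e) \<le> r} \<subseteq> ?A \<times> (UNIV :: 'n set)"
  proof
    fix e :: "(real^'n) \<times> 'n" assume e: "e \<in> {e \<in> edges. norm (fst e) \<le> r}"
    have "\<bar>fst e $ i\<bar> \<le> r" for i using component_le_norm_cart[of "fst e" i] e by auto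
    then show "e \<in> ?A \<times> UNIV" using e unfolding edges_def vertices_def by (cases e) auto
  qed
  ultimately show ?thesis by (rule finite_subset[rotated])
qed

text \<open>Continuity on each edge has to be pasted across vertices: near a point only finitely
  many closed edges occur.\<close>

lemma holder_continuous_on_grid: "continuous_on grid w"
  unfolding continuous_on_eq_continuous_within
proof
  fix x :: "real^'n" assume x: "x \<in> grid"
  \<comment> \<open>An edge has length 1, so one that meets the unit ball around \<open>x\<close>
    starts within distance \<open>norm x + 2\<close> of the origin.\<close>
  define F where "F = {e \<in> (edges :: ((real^'n) \<times> 'n) set). norm (fst e) \<le> norm x + 2}"
  define T where "T = (\<Union>e\<in>F. edge_point e ` {0..1} :: (real^'n) set)"
  have T: "continuous_on T w"
    unfolding T_def
  proof (rule continuous_on_closed_Union)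
    show "finite F" unfolding F_def by (rule finite_edges_bounded)
  next
    fix e :: "(real^'n) \<times> 'n" assume e: "e \<in> F"
    show "continuous_on (edge_point e ` {0..1}) w"
      by (rule holder_continuous_on_edge) (use e F_def in blast)
    have "compact (edge_point e ` {0..1})"
      unfolding edge_point_def by (intro compact_continuous_image continuous_intros) auto
    then show "closed (edge_point e ` {0..1})" by (rule compact_imp_closed)
  qed
  have sub: "grid \<inter> ball x 1 \<subseteq> T"
  proof
    fix y assume y: "y \<in> grid \<inter> ball x 1"
    then obtain e t where e: "e \<in> edges" "t \<in> {0..1}" "y = edge_point e t" unfolding grid_def by blast
    have "fst e = y - t *\<^sub>R axis (snd e) 1" unfolding e(3) edge_point_def by simp
    then have "norm (fst e) \<le> norm y + norm (t *\<^sub>R axis (snd e) (1::real))" using norm_triangle_ineq4 by metis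
    moreover have "norm (t *\<^sub>R axis (snd e) (1::real)) \<le> 1" using e(2) by simp
    moreover have "norm y \<le> norm x + 1" using y norm_triangle_ineq2[of y x] by (auto simp: dist_norm norm_minus_commute)
    ultimately have "norm (fst e) \<le> norm x + 2" by linarith
    then have "e \<in> F" using e(1) unfolding F_def by simp
    then show "y \<in> T" unfolding T_def using e by blast
  qed
  have "continuous_on (grid \<inter> ball x 1) w" by (rule continuous_on_subset[OF T sub])
  then have "continuous (at x within grid \<inter> ball x 1) w" using x unfolding continuous_on_eq_continuous_within by simp
  moreover have "at x within grid \<inter> ball x 1 = at x within grid"
    by (rule at_within_nhd[of x "ball x 1"]) auto
  ultimately show "continuous (at x within grid) w" by (simp only:)
qed

end

lemma mass_two_eq: "mass 2 u = (\<integral>z. (on_edges u z)\<^sup>2 \<partial>arclength)"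
  by (simp add: mass_def powr_numeral)

lemma grid_energy_LIMSEQ:
  assumes lim: "\<And>x. x \<in> grid \<Longrightarrow> (\<lambda>k. u k x) \<longlonglongrightarrow> w x"
  shows "(\<lambda>k. grid_energy j (u k)) \<longlonglongrightarrow> grid_energy j w"
proof -
  have "(\<lambda>k. u k (edge_point e (real i / 2 ^ j))) \<longlonglongrightarrow> w (edge_point e (real i / 2 ^ j))"
    "(\<lambda>k. u k (edge_point e ((real i + 1) / 2 ^ j))) \<longlonglongrightarrow> w (edge_point e ((real i + 1) / 2 ^ j))"
    if e: "e \<in> edges_upto j" and i: "i \<in> {..<2 ^ j}" for e i
  proof -
    have e: "e \<in> edges" using e edges_upto_subset by blast
    have "real (Suc i) \<le> real (2 ^ j)" using i by (intro of_nat_mono) auto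
    then have "real i + 1 \<le> 2 ^ j" by (simp only: of_nat_Suc of_nat_power of_nat_numeral add.commute)
    then have "real i \<le> 2 ^ j" "real i + 1 \<le> 2 ^ j" by linarith+
    then have "real i / 2 ^ j \<in> {0..1}" "(real i + 1) / 2 ^ j \<in> {0..1}" by (simp_all add: divide_le_eq_1)
    then show "(\<lambda>k. u k (edge_point e (real i / 2 ^ j))) \<longlonglongrightarrow> w (edge_point e (real i / 2 ^ j))"
      "(\<lambda>k. u k (edge_point e ((real i + 1) / 2 ^ j))) \<longlonglongrightarrow> w (edge_point e ((real i + 1) / 2 ^ j))"
      using lim edge_point_in_grid[OF e] by blast+
  qed
  then show ?thesis
    unfolding grid_energy_def dyadic_energy_def by (intro tendsto_sum tendsto_mult tendsto_const tendsto_power tendsto_diff)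
qed

lemma on_edges_LIMSEQ:
  assumes lim: "\<And>x. x \<in> grid \<Longrightarrow> (\<lambda>k. u k x) \<longlonglongrightarrow> w x" and z: "z \<in> space arclength"
  shows "(\<lambda>k. on_edges (u k) z) \<longlonglongrightarrow> on_edges w z"
proof -
  obtain e t where et: "z = (e, t)" by (cases z)
  have "e \<in> edges" "t \<in> {0..1}" using z by (auto simp: et arclength_def space_pair_measure space_restrict_space)
  then show ?thesis unfolding et on_edges_def prod.case by (intro lim edge_point_in_grid)
qed

text \<open>An Arzela--Ascoli argument: diagonal selection at rational points of the edges, then
  uniform Holder bounds to reach all points. The limit lies in \<open>H1_grid\<close> because each
  \<open>grid_energy j\<close> is continuous under pointwise convergence and Fatou controls the
  square mass.\<close>

theorem H1_grid_compactness:
  fixes u :: "nat \<Rightarrow> real^'n \<Rightarrow> real"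
  assumes u: "\<And>k. u k \<in> H1_grid" and M: "\<And>k. mass 2 (u k) \<le> M" and D: "\<And>k. dirichlet (u k) \<le> D"
  obtains r w where "strict_mono (r :: nat \<Rightarrow> nat)" "w \<in> H1_grid" "\<And>x. x \<in> grid \<Longrightarrow> (\<lambda>k. u (r k) x) \<longlonglongrightarrow> w x"
proof -
  have S: "(u k (edge_point e t))\<^sup>2 \<le> 2 * M + 2 * D" if "e \<in> edges" "t \<in> {0..1}" for k e t
    using edge_sup_bound[OF u[of k] that, of 1] edge_square_integrable(2)[OF u[of k] that(1)]
      edge_energy_le_dirichlet[OF u[of k] that(1)] M[of k] D[of k] by simp
  have hold: "(u k (edge_point e t) - u k (edge_point e s))\<^sup>2 \<le> \<bar>t - s\<bar> * D"
    if "e \<in> edges" "s \<in> {0..1}" "t \<in> {0..1}" for k e s t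
  proof -
    have "edge_energy (u k) e \<le> D" using edge_energy_le_dirichlet[OF u[of k] that(1)] D[of k] by linarith
    then have "\<bar>t - s\<bar> * edge_energy (u k) e \<le> \<bar>t - s\<bar> * D" by (intro mult_left_mono) auto
    then show ?thesis using edge_holder[OF u[of k] that] by linarith
  qed
  define C :: "(real^'n) set" where "C = (\<lambda>(e, t). edge_point e t) ` (edges \<times> (\<rat> \<inter> {0..1})) "
  have C: "countable C" unfolding C_def
    by (intro countable_image countable_SIGMA countable_edges countable_Int1 countable_rat)
  have bd: "norm (u k x) \<le> sqrt (2 * M + 2 * D)" if x: "x \<in> C" for k x
  proof -
    obtain e t where e: "e \<in> edges" "t \<in> {0..1}" "x = edge_point e t" using x unfolding C_def by auto
    show ?thesis using real_sqrt_le_mono[OF S[OF e(1,2), of k]] unfolding e(3) by simp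
  qed
  have "\<exists>r :: nat \<Rightarrow> nat. strict_mono r \<and> (\<forall>x\<in>C. \<exists>l. (\<lambda>k. u (r k) x) \<longlonglongrightarrow> l)"
    by (rule function_convergent_subsequence[where f=u and M="sqrt (2 * M + 2 * D)", OF C], erule bd, blast)
  then obtain r :: "nat \<Rightarrow> nat" where r: "strict_mono r" and conv: "\<forall>x\<in>C. \<exists>l. (\<lambda>k. u (r k) x) \<longlonglongrightarrow> l"
    by blast
  have cv: "convergent (\<lambda>k. u (r k) x)" if x: "x \<in> grid" for x :: "real^'n"
  proof -
    obtain e t where e: "e \<in> edges" "t \<in> {0..1}" "x = edge_point e t" using x unfolding grid_def by blast
    have "Cauchy (\<lambda>k. u (r k) x)"
    proof (rule CauchyI)
      fix \<epsilon> :: real assume eps: "0 < \<epsilon>"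
      \<comment> \<open>A displacement below \<delta> moves every member of the sequence by less
        than \<open>\<epsilon> / 3\<close>; \<open>\<bar>D\<bar> + 1\<close> keeps the denominator
        positive.\<close>
      define \<delta> where "\<delta> = (\<epsilon> / 3)\<^sup>2 / (\<bar>D\<bar> + 1)"
      have \<delta>: "0 < \<delta>" using eps by (simp add: \<delta>_def)
      have "\<exists>s::real. s \<in> \<rat> \<and> s \<in> {0..1} \<and> \<bar>t - s\<bar> < \<delta>"
      proof (cases "t = 0")
        case True
        then show ?thesis using \<delta> by (intro exI[of _ 0]) auto
      next
        case False
        then have "max 0 (t - \<delta>) < t" using e(2) \<delta> by auto
        then obtain s where "s \<in> \<rat>" "max 0 (t - \<delta>) < s" "s < t" using Rats_dense_in_real by blast
        then show ?thesis using e(2) by (intro exI[of _ s]) auto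
      qed
      then obtain s where s: "s \<in> \<rat>" "s \<in> {0..1}" "\<bar>t - s\<bar> < \<delta>" by blast
      define y where "y = edge_point e s"
      have near: "\<bar>u k x - u k y\<bar> < \<epsilon> / 3" for k
      proof -
        have "(u k x - u k y)\<^sup>2 \<le> \<bar>t - s\<bar> * D" unfolding y_def e(3) by (rule hold[OF e(1) s(2) e(2)])
        also have "\<dots> \<le> \<bar>t - s\<bar> * (\<bar>D\<bar> + 1)" by (intro mult_left_mono) auto
        also have "\<dots> < \<delta> * (\<bar>D\<bar> + 1)" using s(3) by (intro mult_strict_right_mono) auto
        also have "\<dots> = (\<epsilon> / 3)\<^sup>2" by (simp add: \<delta>_def)
        finally have "\<bar>u k x - u k y\<bar>\<^sup>2 < (\<epsilon> / 3)\<^sup>2" by simp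
        then show ?thesis using eps by (intro power2_less_imp_less[of _ "\<epsilon> / 3"]) auto
      qed
      have "y \<in> C" unfolding C_def y_def using e(1) s by auto
      then have "Cauchy (\<lambda>k. u (r k) y)" using conv LIMSEQ_imp_Cauchy by blast
      moreover have "0 < \<epsilon> / 3" using eps by simp
      ultimately obtain N where N: "\<And>m n. N \<le> m \<Longrightarrow> N \<le> n \<Longrightarrow> norm (u (r m) y - u (r n) y) < \<epsilon> / 3"
        using CauchyD by blast
      have "norm (u (r m) x - u (r n) x) < \<epsilon>" if "N \<le> m" "N \<le> n" for m n
        using near[of "r m"] near[of "r n"] N[OF that] unfolding real_norm_def by linarith
      then show "\<exists>M. \<forall>m\<ge>M. \<forall>n\<ge>M. norm (u (r m) x - u (r n) x) < \<epsilon>" by blast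
    qed
    then show ?thesis by (rule Cauchy_convergent)
  qed
  define w where "w = (\<lambda>x. lim (\<lambda>k. u (r k) x))"
  have lim: "(\<lambda>k. u (r k) x) \<longlonglongrightarrow> w x" if "x \<in> grid" for x
    using cv[OF that] unfolding w_def convergent_LIMSEQ_iff .
  have cont: "continuous_on grid w"
  proof (rule holder_continuous_on_grid[where D=D])
    fix e :: "(real^'n) \<times> 'n" and s t :: real assume e: "e \<in> edges" "s \<in> {0..1}" "t \<in> {0..1}"
    have "(\<lambda>k. (u (r k) (edge_point e t) - u (r k) (edge_point e s))\<^sup>2) \<longlonglongrightarrow> (w (edge_point e t) - w (edge_point e s))\<^sup>2"
      by (intro tendsto_intros lim edge_point_in_grid e)
    then show "(w (edge_point e t) - w (edge_point e s))\<^sup>2 \<le> \<bar>t - s\<bar> * D"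
      by (rule LIMSEQ_le_const2) (use hold[OF e] in blast)
  qed
  have en: "grid_energy j w \<le> D" for j
  proof (rule LIMSEQ_le_const2)
    show "(\<lambda>k. grid_energy j (u (r k))) \<longlonglongrightarrow> grid_energy j w"
      by (rule grid_energy_LIMSEQ[OF lim])
    show "\<exists>N. \<forall>k\<ge>N. grid_energy j (u (r k)) \<le> D"
      using grid_energy_le_dirichlet[OF u] D by (meson order_trans)
  qed
  have onlim: "(\<lambda>k. on_edges (u (r k)) z) \<longlonglongrightarrow> on_edges w z" if "z \<in> space arclength" for z
    by (rule on_edges_LIMSEQ[OF lim that])
  have meas: "on_edges w \<in> borel_measurable arclength"
    by (rule borel_measurable_LIMSEQ_metric[OF on_edges_measurable[OF u] onlim])
  have "integrable arclength (\<lambda>z. (on_edges w z)\<^sup>2)"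
  proof (rule integrable_limit_bound(1)[where h="\<lambda>k z. (on_edges (u (r k)) z)\<^sup>2" and B=M])
    show "integrable arclength (\<lambda>z. (on_edges (u (r k)) z)\<^sup>2)" for k by (rule on_edges_square_integrable[OF u])
    show "(\<integral>z. (on_edges (u (r k)) z)\<^sup>2 \<partial>arclength) \<le> M" for k using M[of "r k"] unfolding mass_two_eq .
    show "AE z in arclength. (\<lambda>k. (on_edges (u (r k)) z)\<^sup>2) \<longlonglongrightarrow> (on_edges w z)\<^sup>2"
      by (intro AE_I2 tendsto_power onlim)
  qed (use meas in auto)
  then have "w \<in> H1_grid" unfolding H1_grid_iff using cont en by blast
  then show thesis using that r lim by blast
qed

section \<open>Exclusion of spreading and concentration\<close>

lemma Q_grid_eq:
  fixes u :: "real^'n \<Rightarrow> real"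
  assumes "2 < q"
  shows "Q_grid q u = mass q u / (mass 2 u powr ((real CARD('n) + (2 - real CARD('n)) * (q / 2)) / 2) *
     dirichlet u powr ((q / 2 - 1) * real CARD('n) / 2))"
proof -
  have "Lp_norm arclength q (on_edges u) = mass q u powr (1 / q)" "Lp_norm arclength 2 (on_edges u) = mass 2 u powr (1 / 2)"
    by (simp_all add: Lp_norm_def mass_def)
  moreover have "Lp_norm arclength 2 (edge_deriv u) = dirichlet u powr (1 / 2)"
    by (simp add: Lp_norm_def dirichlet_def powr_numeral)
  moreover have "(mass q u powr (1 / q)) powr q = mass q u"
    using assms mass_nonneg[of q u] by (simp add: powr_powr)
  ultimately show ?thesis
    unfolding Q_grid_def GN_quotient_def by (simp add: powr_powr)
qed

lemma mass_two_pos: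
  assumes u: "u \<in> (nonzero_H1_grid :: (real^'n \<Rightarrow> real) set)"
  shows "0 < mass 2 u"
proof (rule ccontr)
  assume "\<not> 0 < mass 2 u"
  then have m0: "mass 2 u = 0" using mass_nonneg[of 2 u] by linarith
  have uH: "u \<in> H1_grid" using u by (simp add: nonzero_H1_grid_def)
  obtain e t where e: "e \<in> edges" "t \<in> {0..1}" and nz: "u (edge_point e t) \<noteq> 0"
    using u unfolding nonzero_H1_grid_def grid_def by auto
  define c E where "c = (u (edge_point e t))\<^sup>2" and "E = edge_energy u e"
  have c: "0 < c" using nz by (simp add: c_def)
  have E: "0 \<le> E" unfolding E_def by (rule edge_energy_nonneg)
  \<comment> \<open>Without mass the sup bound reads \<open>c \<le> 2 * r * E\<close>, and this
    \<open>r\<close> makes the right side at most \<open>c / 2\<close>.\<close>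
  define r where "r = min 1 (c / (4 * E + 2))"
  have r: "0 < r" "r \<le> 1" "r \<le> c / (4 * E + 2)" using c E by (auto simp: r_def)
  have "c \<le> 2 * edge_mass u e / r + 2 * r * E" unfolding c_def E_def by (rule edge_sup_bound[OF uH e r(1,2)])
  also have "\<dots> \<le> 2 * r * E"
    using edge_square_integrable(2)[OF uH e(1)] r(1) unfolding m0 by (simp add: divide_nonpos_pos)
  also have "\<dots> \<le> r * (2 * E + 1)" using r(1) by (simp add: algebra_simps)
  also have "\<dots> \<le> c / (4 * E + 2) * (2 * E + 1)" using r(3) E by (intro mult_right_mono) auto
  also have "\<dots> = c / 2"
    using E by (simp add: field_simps)
  finally show False using c by simp
qed

lemma mass_zero_on_grid:
  fixes w :: "real^'n \<Rightarrow> real"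
  assumes q: "0 < q" and w: "\<And>x. x \<in> grid \<Longrightarrow> w x = 0"
  shows "mass q w = 0"
  unfolding mass_def
proof (rule integral_eq_zero_AE, rule AE_I2)
  fix z :: "((real^'n) \<times> 'n) \<times> real" assume z: "z \<in> space arclength"
  obtain e t where et: "z = (e, t)" by (cases z)
  have "e \<in> edges" "t \<in> {0..1}" using z by (auto simp: et arclength_def space_pair_measure space_restrict_space)
  then have "on_edges w z = 0" unfolding et on_edges_def prod.case by (intro w edge_point_in_grid)
  then show "\<bar>on_edges w z\<bar> powr q = 0" using q by simp
qed

lemma sup_bound_normalized:
  fixes u :: "real^'n \<Rightarrow> real"
  assumes u: "u \<in> H1_grid" "mass 2 u = 1" and e: "e \<in> edges" "t \<in> {0..1}" and r: "0 < r" "r \<le> 1"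
  shows "(u (edge_point e t))\<^sup>2 \<le> 2 / r + 2 * r * dirichlet u"
proof -
  have "(u (edge_point e t))\<^sup>2 \<le> 2 * edge_mass u e / r + 2 * r * edge_energy u e" by (rule edge_sup_bound[OF u(1) e r])
  also have "2 * edge_mass u e / r \<le> 2 / r"
    using edge_square_integrable(2)[OF u(1) e(1)] u(2) r by (intro divide_right_mono) auto
  also have "2 * r * edge_energy u e \<le> 2 * r * dirichlet u"
    using edge_energy_le_dirichlet[OF u(1) e(1)] r by (intro mult_left_mono) auto
  finally show ?thesis by simp
qed

context
  fixes q \<alpha> \<beta> :: real
  assumes q: "2 < q"
    and \<alpha>: "\<alpha> = real CARD('n::finite) + (2 - real CARD('n)) * (q / 2)" "0 < \<alpha>"
    and \<beta>: "\<beta> = (q / 2 - 1) * real CARD('n)"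
begin

text \<open>This is the homogeneity of the quotient: numerator and denominator both have degree
  \<open>q\<close> in the function.\<close>

lemma exponent_sum: "\<alpha> / 2 + \<beta> / 2 = q / 2" "0 < \<beta>"
  using q unfolding \<alpha> \<beta> by (simp_all add: field_simps)

lemma Q_grid_formula: "Q_grid q u = mass q u / (mass 2 u powr (\<alpha> / 2) * dirichlet u powr (\<beta> / 2))"
  for u :: "real^'n \<Rightarrow> real"
  unfolding \<alpha> \<beta> by (rule Q_grid_eq[OF q])

text \<open>The product form also covers functions that vanish on the grid, which can occur as
  remainders after subtracting a limit.\<close>

lemma Q_grid_bound_GN:
  fixes w :: "real^'n \<Rightarrow> real"
  assumes K: "\<And>u :: real^'n \<Rightarrow> real. u \<in> nonzero_H1_grid \<Longrightarrow> Q_grid q u \<le> K" "0 \<le> K"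
    and w: "w \<in> H1_grid"
  shows "mass q w \<le> K * mass 2 w powr (\<alpha> / 2) * dirichlet w powr (\<beta> / 2)"
proof (cases "w \<in> nonzero_H1_grid")
  case True
  have "0 < mass 2 w powr (\<alpha> / 2) * dirichlet w powr (\<beta> / 2)"
    using mass_two_pos[OF True] dirichlet_pos[OF True] by simp
  then show ?thesis using K(1)[OF True] unfolding Q_grid_formula by (simp only: pos_divide_le_eq mult.assoc)
next
  case False
  then have "mass q w = 0" using w q by (intro mass_zero_on_grid) (auto simp: nonzero_H1_grid_def)
  then show ?thesis using K(2) by simp
qed

lemma normalized_function:
  fixes u :: "real^'n \<Rightarrow> real"
  assumes u: "u \<in> nonzero_H1_grid"
  obtains v :: "real^'n \<Rightarrow> real" where "v \<in> nonzero_H1_grid" "mass 2 v = 1"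
    "mass q v = Q_grid q u * dirichlet v powr (\<beta> / 2)"
proof -
  define m where "m = mass 2 u"
  have m: "0 < m" unfolding m_def by (rule mass_two_pos[OF u])
  have D: "0 < dirichlet u" by (rule dirichlet_pos[OF u])
  have uH: "u \<in> H1_grid" using u by (simp add: nonzero_H1_grid_def)
  define c where "c = m powr (- 1 / 2)"
  have c: "0 < c" using m by (simp add: c_def)
  have c2: "c\<^sup>2 = m powr (- 1)" using m by (simp add: c_def powr_numeral[symmetric] powr_powr)
  let ?v = "\<lambda>x. c * u x"
  have vH: "?v \<in> H1_grid" by (rule H1_grid_scale(1)[OF uH])
  then have "?v \<in> nonzero_H1_grid" using u c by (auto simp: nonzero_H1_grid_def)
  moreover have "mass 2 ?v = 1"
    unfolding H1_grid_scale(3)[OF uH] using c m c2 by (simp add: powr_numeral powr_minus m_def[symmetric])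
  moreover have "mass q ?v = Q_grid q u * dirichlet ?v powr (\<beta> / 2)"
  proof -
    have 1: "\<bar>c\<bar> powr q = m powr (- \<alpha> / 2) * m powr (- \<beta> / 2)"
    proof -
      have "\<bar>c\<bar> powr q = m powr (- (q / 2))" using c by (simp add: c_def powr_powr)
      also have "- (q / 2) = - \<alpha> / 2 + - \<beta> / 2" using exponent_sum(1) by simp
      finally show ?thesis by (simp only: powr_add)
    qed
    have 2: "dirichlet ?v powr (\<beta> / 2) = m powr (- \<beta> / 2) * dirichlet u powr (\<beta> / 2)"
      unfolding H1_grid_scale(2)[OF uH] c2 powr_mult powr_powr by simp
    have 3: "Q_grid q u = mass q u * m powr (- \<alpha> / 2) / dirichlet u powr (\<beta> / 2)"
      unfolding Q_grid_formula m_def[symmetric] using m by (simp add: powr_minus divide_simps)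
    show ?thesis unfolding H1_grid_scale(3)[OF uH] 1 2 3 using D by simp
  qed
  ultimately show thesis by (rule that)
qed

text \<open>Two small parameters are fixed in order: first \<open>l\<close>, which brings the
  constants near 1, then the energy, which beats the negative powers of \<open>l\<close>. The errors
  carry \<open>dirichlet u powr (q / 2)\<close>, better than the main term by the positive power
  \<open>\<alpha> / 2\<close>.\<close>

lemma low_energy_regime:
  assumes \<kappa>: "\<And>v. v \<in> (nonzero_H1_space :: (real^'n \<Rightarrow> real) set) \<Longrightarrow> Q_space q v \<le> \<kappa>" "0 \<le> \<kappa>"
    and k: "real CARD('n) * \<kappa> * real CARD('n) powr (- \<alpha> / 2) < k"
  shows "\<exists>D0>0. \<forall>u :: real^'n \<Rightarrow> real. u \<in> H1_grid \<longrightarrow> mass 2 u = 1 \<longrightarrow> 0 < dirichlet u \<longrightarrow> dirichlet u \<le> D0 \<longrightarrow>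
     mass q u \<le> k * dirichlet u powr (\<beta> / 2)"
proof -
  let ?d = "real CARD('n)"
  have d0: "0 < ?d" by simp
  \<comment> \<open>\<open>F l D\<close> is the estimate of \<open>low_energy_bound\<close> at unit
    mass divided by \<open>D powr (\<beta> / 2)\<close>, and \<open>G l\<close> is its limit as
    \<open>D\<close> tends to 0.\<close>
  define F where "F l D = (1 - l) powr (1 - q) * ?d * (1 - l) powr (1 - q) * \<kappa> *
      (((1 - l) powr (- 1) + l powr (- 1) * D) / ?d) powr (\<alpha> / 2) +
      ((1 - l) powr (1 - q) * ?d * l powr (1 - q) * (4 ^ CARD('n)) powr (q / 2) + l powr (1 - q)) * D powr (\<alpha> / 2)" for l D :: real
  define G where "G l = (1 - l) powr (1 - q) * ?d * (1 - l) powr (1 - q) * \<kappa> * ((1 - l) powr (- 1) / ?d) powr (\<alpha> / 2)" for l :: real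
  have "(G \<longlongrightarrow> 1 * ?d * 1 * \<kappa> * (1 / ?d) powr (\<alpha> / 2)) (at_right 0)"
    unfolding G_def using weight_tendsto_1[of 2] by (intro tendsto_intros weight_tendsto_1) auto
  moreover have "1 * ?d * 1 * \<kappa> * (1 / ?d) powr (\<alpha> / 2) < k"
    using k by (simp add: powr_divide powr_minus divide_simps)
  ultimately have "\<forall>\<^sub>F l in at_right 0. G l < k" by (rule order_tendstoD(2))
  moreover have "\<forall>\<^sub>F l in at_right 0. l < (1::real)" by (rule eventually_at_right_less[THEN eventually_mono[rotated]] | rule order_tendstoD(2)[OF tendsto_ident_at]) simp
  moreover have "\<forall>\<^sub>F l in at_right 0. 0 < (l::real)" by (rule eventually_at_right_less)
  ultimately have "\<forall>\<^sub>F l in at_right 0. G l < k \<and> l < 1 \<and> 0 < l" by eventually_elim blast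
  then obtain l where l: "0 < l" "l < 1" "G l < k" using eventually_happens'[OF trivial_limit_at_right_real] by blast
  have "(F l \<longlongrightarrow> (1 - l) powr (1 - q) * ?d * (1 - l) powr (1 - q) * \<kappa> *
      (((1 - l) powr (- 1) + l powr (- 1) * 0) / ?d) powr (\<alpha> / 2) +
      ((1 - l) powr (1 - q) * ?d * l powr (1 - q) * (4 ^ CARD('n)) powr (q / 2) + l powr (1 - q)) * 0 powr (\<alpha> / 2)) (at_right 0)"
  proof -
    have 1: "((\<lambda>D. (((1 - l) powr (- 1) + l powr (- 1) * D) / ?d) powr (\<alpha> / 2)) \<longlongrightarrow>
        (((1 - l) powr (- 1) + l powr (- 1) * 0) / ?d) powr (\<alpha> / 2)) (at_right 0)"
      by (rule tendsto_powr[OF tendsto_divide[OF tendsto_add[OF tendsto_const tendsto_mult[OF tendsto_const tendsto_ident_at]] tendsto_const] tendsto_const])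
        (use l in auto)
    have 2: "((\<lambda>D. D powr (\<alpha> / 2)) \<longlongrightarrow> 0 powr (\<alpha> / 2)) (at_right (0::real))"
    proof (rule tendsto_powr2[OF tendsto_ident_at tendsto_const])
      show "\<forall>\<^sub>F D in at_right 0. 0 \<le> (D::real)" using eventually_at_right_less[of "0::real"] by eventually_elim simp
    qed (use \<alpha>(2) in simp)
    show ?thesis unfolding F_def by (intro tendsto_add tendsto_mult tendsto_const 1 2)
  qed
  then have "(F l \<longlongrightarrow> G l) (at_right 0)" unfolding G_def using \<alpha>(2) by simp
  then have "\<forall>\<^sub>F D in at_right 0. F l D < k" using l(3) by (rule order_tendstoD(2))
  then obtain b where b: "0 < b" "\<And>D. 0 < D \<Longrightarrow> D < b \<Longrightarrow> F l D < k" unfolding eventually_at_right_field by blast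
  have "mass q u \<le> k * dirichlet u powr (\<beta> / 2)"
    if u: "u \<in> H1_grid" "mass 2 u = 1" "0 < dirichlet u" "dirichlet u \<le> b / 2" for u :: "real^'n \<Rightarrow> real"
  proof -
    define D where "D = dirichlet u"
    have D: "0 < D" "D < b" using u(3,4) b(1) unfolding D_def by linarith+
    have dq: "D powr (q / 2) = D powr (\<alpha> / 2) * D powr (\<beta> / 2)" unfolding exponent_sum(1)[symmetric] by (rule powr_add)
    have "mass q u \<le> (1 - l) powr (1 - q) * (?d *
       ((1 - l) powr (1 - q) * (\<kappa> * (((1 - l) powr (- 1) * mass 2 u + l powr (- 1) * dirichlet u) / ?d) powr (\<alpha> / 2) * dirichlet u powr (\<beta> / 2))
         + l powr (1 - q) * (4 ^ CARD('n) * dirichlet u) powr (q / 2)))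
       + l powr (1 - q) * dirichlet u powr (q / 2)"
      using low_energy_bound(2)[OF u(1) l(1,2) q \<kappa> \<alpha> \<beta>] .
    also have "\<dots> = F l D * D powr (\<beta> / 2)"
      unfolding F_def D_def[symmetric] u(2) powr_mult dq by (simp add: algebra_simps)
    also have "\<dots> \<le> k * D powr (\<beta> / 2)" using b(2)[OF D] by (intro mult_right_mono) auto
    finally show ?thesis unfolding D_def .
  qed
  then show ?thesis using b(1) by (intro exI[of _ "b / 2"]) auto
qed

text \<open>The length \<open>1 / sqrt D\<close> balances the sup bound and gives a squared sup of
  order \<open>sqrt D\<close>, hence a \<open>q\<close>-mass of order
  \<open>D powr ((q - 2) / 4)\<close>. From dimension 2 on, \<open>\<beta> / 2\<close> is at least
  \<open>(q - 2) / 2\<close>, which leaves a negative power of \<open>D\<close>.\<close>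

lemma high_energy_regime:
  assumes d: "2 \<le> CARD('n)" and k: "0 < k"
  shows "\<exists>D1. \<forall>u :: real^'n \<Rightarrow> real. u \<in> H1_grid \<longrightarrow> mass 2 u = 1 \<longrightarrow> D1 \<le> dirichlet u \<longrightarrow>
     mass q u \<le> k * dirichlet u powr (\<beta> / 2)"
proof -
  define p where "p = (q - 2) / 2"
  have p: "0 < p" using q by (simp add: p_def)
  have "((\<lambda>D. 4 powr p * D powr (- (p / 2))) \<longlongrightarrow> 4 powr p * 0) at_top"
    by (intro tendsto_mult tendsto_const tendsto_neg_powr filterlim_ident) (use p in auto)
  then have "\<forall>\<^sub>F D in at_top. 4 powr p * D powr (- (p / 2)) < k" using k by (intro order_tendstoD(2)) simp_all
  then obtain D1 where D1: "\<And>D. D1 \<le> D \<Longrightarrow> 4 powr p * D powr (- (p / 2)) < k" unfolding eventually_at_top_linorder by blast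
  have "mass q u \<le> k * dirichlet u powr (\<beta> / 2)"
    if u: "u \<in> H1_grid" "mass 2 u = 1" "max 1 D1 \<le> dirichlet u" for u :: "real^'n \<Rightarrow> real"
  proof -
    define D where "D = dirichlet u"
    have D: "1 \<le> D" "D1 \<le> D" using u(3) by (auto simp: D_def)
    have "(u (edge_point e t))\<^sup>2 \<le> 4 * sqrt D" if e: "e \<in> edges" "t \<in> {0..1}" for e t
    proof -
      have "(u (edge_point e t))\<^sup>2 \<le> 2 / (1 / sqrt D) + 2 * (1 / sqrt D) * D"
        unfolding D_def by (rule sup_bound_normalized[OF u(1,2) e]) (use D in \<open>auto simp: D_def[symmetric] divide_simps\<close>)
      also have "\<dots> = 4 * sqrt D" using D real_div_sqrt[of D] by simp
      finally show ?thesis .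
    qed
    then have "mass q u \<le> (4 * sqrt D) powr p * mass 2 u" unfolding p_def by (rule mass_le_sup(2)[OF u(1) _ q])
    also have "\<dots> = 4 powr p * D powr (p / 2)" using D u(2) by (simp add: powr_mult powr_half_sqrt[symmetric] powr_powr)
    also have "D powr (p / 2) \<le> D powr (- (p / 2) + \<beta> / 2)"
    proof (rule powr_mono)
      have "p * 2 \<le> p * real CARD('n)" using d p by (intro mult_left_mono) auto
      then show "p / 2 \<le> - (p / 2) + \<beta> / 2" unfolding \<beta> p_def by (simp add: field_simps)
    qed (rule D(1))
    also have "4 powr p * D powr (- (p / 2) + \<beta> / 2) = (4 powr p * D powr (- (p / 2))) * D powr (\<beta> / 2)"
      unfolding powr_add by (rule mult.assoc[symmetric])
    also have "\<dots> \<le> k * D powr (\<beta> / 2)" using D1[OF D(2)] by (intro mult_right_mono) auto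
    finally show ?thesis by (simp add: D_def)
  qed
  then show ?thesis by blast
qed

end

section \<open>Existence of a maximizer\<close>

text \<open>Bounded convergence on a single edge, which has finite length.\<close>

lemma edge_mass_LIMSEQ:
  fixes u :: "nat \<Rightarrow> real^'n \<Rightarrow> real"
  assumes u: "\<And>k. u k \<in> H1_grid" "w \<in> H1_grid" and e: "e \<in> edges"
    and S: "\<And>k t. t \<in> {0..1} \<Longrightarrow> (u k (edge_point e t))\<^sup>2 \<le> S"
    and lim: "\<And>x. x \<in> grid \<Longrightarrow> (\<lambda>k. u k x) \<longlonglongrightarrow> w x"
  shows "(\<lambda>k. edge_mass (u k) e) \<longlonglongrightarrow> edge_mass w e"
  unfolding edge_mass_def
proof (rule integral_dominated_convergence[where w="\<lambda>_. S"])
  have "(\<lambda>t. on_edges (v :: real^'n \<Rightarrow> real) (e, t)) \<in> borel_measurable unit_lebesgue" if "v \<in> H1_grid" for v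
    using edge_section_measurable[OF that e] by (simp add: on_edges_def)
  then show "(\<lambda>t. (on_edges w (e, t))\<^sup>2) \<in> borel_measurable unit_lebesgue"
    "(\<lambda>t. (on_edges (u k) (e, t))\<^sup>2) \<in> borel_measurable unit_lebesgue" for k
    using u by simp_all
  show "integrable unit_lebesgue (\<lambda>_. S)" by (rule finite_measure.integrable_const[OF finite_measure_unit_lebesgue])
  show "AE t in unit_lebesgue. (\<lambda>k. (on_edges (u k) (e, t))\<^sup>2) \<longlonglongrightarrow> (on_edges w (e, t))\<^sup>2"
  proof (rule AE_I2)
    fix t assume "t \<in> space unit_lebesgue"
    then have "t \<in> {0..1}" by (simp add: space_restrict_space)
    then show "(\<lambda>k. (on_edges (u k) (e, t))\<^sup>2) \<longlonglongrightarrow> (on_edges w (e, t))\<^sup>2"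
      unfolding on_edges_def prod.case by (intro tendsto_power lim edge_point_in_grid e)
  qed
  show "AE t in unit_lebesgue. norm ((on_edges (u k) (e, t))\<^sup>2) \<le> S" for k
  proof (rule AE_I2)
    fix t assume "t \<in> space unit_lebesgue"
    then have "t \<in> {0..1}" by (simp add: space_restrict_space)
    then show "norm ((on_edges (u k) (e, t))\<^sup>2) \<le> S" using S[of t k] by (simp add: on_edges_def)
  qed
qed

text \<open>If every edge carried little mass, the sup bound would make \<open>u\<close> uniformly
  small and push its \<open>q\<close>-mass below \<open>m0\<close>. This excludes vanishing of a
  maximizing sequence.\<close>

lemma nonvanishing_edge:
  fixes D1 m0 q :: real
  assumes q: "2 < q" and m0: "0 < m0" and D1: "0 < D1"
  shows "\<exists>c>0. \<forall>u :: real^'n \<Rightarrow> real. u \<in> H1_grid \<longrightarrow> mass 2 u = 1 \<longrightarrow> dirichlet u \<le> D1 \<longrightarrow> m0 \<le> mass q u \<longrightarrow>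
    (\<exists>e\<in>edges. c \<le> edge_mass u e)"
proof -
  define p where "p = (q - 2) / 2"
  have p: "0 < p" using q by (simp add: p_def)
  \<comment> \<open>A squared sup of at most \<open>S\<close> would give \<open>q\<close>-mass at
    most \<open>m0 / 2\<close>; \<open>r\<close> and \<open>c\<close> below make the energy term and
    the mass term of the sup bound at most \<open>S / 2\<close> each.\<close>
  define S where "S = (m0 / 2) powr (1 / p)"
  have S: "0 < S" "S powr p = m0 / 2" using m0 p by (simp_all add: S_def powr_powr)
  define r where "r = min 1 (S / (4 * D1))"
  have r: "0 < r" "r \<le> 1" using S D1 by (auto simp: r_def)
  have "r \<le> S / (4 * D1)" by (simp add: r_def)
  then have rD: "2 * r * D1 \<le> S / 2" using D1 by (simp add: field_simps)
  define c where "c = r * S / 4"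
  have c: "0 < c" using r S by (simp add: c_def)
  have "\<exists>e\<in>edges. c \<le> edge_mass u e"
    if u: "u \<in> H1_grid" "mass 2 u = 1" "dirichlet u \<le> D1" "m0 \<le> mass q u" for u :: "real^'n \<Rightarrow> real"
  proof (rule ccontr)
    assume "\<not> (\<exists>e\<in>edges. c \<le> edge_mass u e)"
    then have small: "edge_mass u e < c" if "e \<in> edges" for e using that by force
    have "(u (edge_point e t))\<^sup>2 \<le> S" if e: "e \<in> edges" "t \<in> {0..1}" for e t
    proof -
      have "(u (edge_point e t))\<^sup>2 \<le> 2 * edge_mass u e / r + 2 * r * edge_energy u e" by (rule edge_sup_bound[OF u(1) e r])
      also have "2 * edge_mass u e / r \<le> 2 * c / r" using small[OF e(1)] r(1) by (intro divide_right_mono) auto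
      also have "2 * c / r = S / 2" using r(1) by (simp add: c_def)
      also have "2 * r * edge_energy u e \<le> 2 * r * D1"
        using edge_energy_le_dirichlet[OF u(1) e(1)] u(3) r by (intro mult_left_mono) auto
      also have "2 * r * D1 \<le> S / 2" by (rule rD)
      finally show ?thesis by simp
    qed
    then have "mass q u \<le> S powr p * mass 2 u" unfolding p_def by (rule mass_le_sup(2)[OF u(1) _ q])
    then show False using u(2,4) S(2) m0 by simp
  qed
  then show ?thesis using c by blast
qed

context
  fixes q \<alpha> \<beta> K D0 D1 m0 :: real and u :: "nat \<Rightarrow> real^'n \<Rightarrow> real"
  assumes q: "2 < q" and \<alpha>\<beta>: "0 < \<alpha>" "0 < \<beta>" "\<alpha> / 2 + \<beta> / 2 = q / 2" and K: "0 < K"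
    and GN: "\<And>w :: real^'n \<Rightarrow> real. w \<in> H1_grid \<Longrightarrow> mass q w \<le> K * mass 2 w powr (\<alpha> / 2) * dirichlet w powr (\<beta> / 2)"
    and D: "0 < D0" "\<And>k. D0 \<le> dirichlet (u k)" "\<And>k. dirichlet (u k) \<le> D1"
    and u: "\<And>k. u k \<in> H1_grid" "\<And>k. mass 2 (u k) = 1"
    and lim: "(\<lambda>k. mass q (u k) / dirichlet (u k) powr (\<beta> / 2)) \<longlonglongrightarrow> K"
begin

lemma sup_bound: "e \<in> edges \<Longrightarrow> t \<in> {0..1} \<Longrightarrow> (u k (edge_point e t))\<^sup>2 \<le> 2 + 2 * D1"
  using sup_bound_normalized[OF u(1) u(2), of e t 1 k] D(3)[of k] by simp

text \<open>With \<open>m = mass 2 w\<close> and \<open>x = dirichlet w / L\<close>, Brezis--Lieb splitting and the inequality for both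
  \<open>w\<close> and the remainders \<open>u k - w\<close> give \<open>1 \<le> m\<^sup>s x\<^sup>t + (1 - m)\<^sup>s (1 - x)\<^sup>t\<close> with
  \<open>s + t = q / 2 > 1\<close>, which forces \<open>m = x = 1\<close>.\<close>

lemma weak_limit_maximizes:
  fixes w :: "real^'n \<Rightarrow> real"
  assumes w: "w \<in> nonzero_H1_grid" and pt: "\<And>x. x \<in> grid \<Longrightarrow> (\<lambda>k. u k x) \<longlonglongrightarrow> w x"
    and L: "(\<lambda>k. dirichlet (u k)) \<longlonglongrightarrow> L"
  shows "mass q w = K * mass 2 w powr (\<alpha> / 2) * dirichlet w powr (\<beta> / 2)"
proof -
  have wH: "w \<in> H1_grid" using w by (simp add: nonzero_H1_grid_def)
  define m where "m = mass 2 w"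
  have m0: "0 < m" unfolding m_def by (rule mass_two_pos[OF w])
  have L0: "0 < L" using LIMSEQ_le_const[OF L, of D0] D(1,2) by fastforce
  let ?z = "\<lambda>k x. u k x - w x"
  have zH: "?z k \<in> H1_grid" for k by (rule H1_grid_diff(1)[OF u(1) wH])
  have on: "on_edges (?z k) x = on_edges (u k) x - on_edges w x" for k x by (cases x) (simp add: on_edges_def)
  have ae: "AE x in arclength. (\<lambda>k. on_edges (u k) x) \<longlonglongrightarrow> on_edges w x"
    by (intro AE_I2 on_edges_LIMSEQ pt)
  have int2: "integrable arclength (\<lambda>x. \<bar>on_edges (u k) x\<bar> powr 2)" for k
    using on_edges_square_integrable[OF u(1)] by (simp add: powr_numeral)
  note intq = mass_le_sup(1)[OF u(1) sup_bound q]
  have bq: "mass q (u k) \<le> (2 + 2 * D1) powr ((q - 2) / 2)" for k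
    using mass_le_sup(2)[OF u(1) sup_bound q, of k] u(2) by simp
  have m1: "m \<le> 1"
    using brezis_lieb(2)[of 2 "\<lambda>k. on_edges (u k)" arclength "on_edges w" 1, OF _ on_edges_measurable[OF u(1)] on_edges_measurable[OF wH] ae int2]
      u(2) unfolding m_def mass_def by simp
  have "(\<lambda>k. mass 2 (u k) - mass 2 (?z k)) \<longlonglongrightarrow> m"
    using brezis_lieb(4)[of 2 "\<lambda>k. on_edges (u k)" arclength "on_edges w" 1, OF _ on_edges_measurable[OF u(1)] on_edges_measurable[OF wH] ae int2]
      u(2) unfolding m_def mass_def on by simp
  then have "(\<lambda>k. 1 - (1 - mass 2 (?z k))) \<longlonglongrightarrow> 1 - m" unfolding u(2) by (intro tendsto_diff tendsto_const)
  then have zm: "(\<lambda>k. mass 2 (?z k)) \<longlonglongrightarrow> 1 - m" by simp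
  have "(\<lambda>k. mass q (u k) - mass q (?z k)) \<longlonglongrightarrow> mass q w"
    using brezis_lieb(4)[of q "\<lambda>k. on_edges (u k)" arclength "on_edges w" "(2 + 2 * D1) powr ((q - 2) / 2)",
        OF _ on_edges_measurable[OF u(1)] on_edges_measurable[OF wH] ae intq] q bq
    unfolding mass_def on by simp
  moreover have "(\<lambda>k. mass q (u k)) \<longlonglongrightarrow> K * L powr (\<beta> / 2)"
  proof -
    have "(\<lambda>k. mass q (u k) / dirichlet (u k) powr (\<beta> / 2) * dirichlet (u k) powr (\<beta> / 2)) \<longlonglongrightarrow> K * L powr (\<beta> / 2)"
      by (intro tendsto_mult lim tendsto_powr L tendsto_const) (use L0 in simp)
    moreover have "mass q (u k) / dirichlet (u k) powr (\<beta> / 2) * dirichlet (u k) powr (\<beta> / 2) = mass q (u k)" for k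
      using D(1) D(2)[of k] by simp
    ultimately show ?thesis by (simp only:)
  qed
  ultimately have "(\<lambda>k. mass q (u k) - (mass q (u k) - mass q (?z k))) \<longlonglongrightarrow> K * L powr (\<beta> / 2) - mass q w"
    by (intro tendsto_diff)
  then have zq: "(\<lambda>k. mass q (?z k)) \<longlonglongrightarrow> K * L powr (\<beta> / 2) - mass q w" by simp
  have gw: "grid_energy j w \<le> L" for j
    by (rule LIMSEQ_le[OF grid_energy_LIMSEQ[OF pt] L], assumption, intro exI allI impI, rule grid_energy_le_dirichlet[OF u(1)])
  have dw: "dirichlet w \<le> L" by (rule LIMSEQ_le_const2[OF grid_energy_tendsto[OF wH]]) (use gw in blast)
  \<comment> \<open>The limit in \<open>k\<close> of the bound from \<open>H1_grid_diff\<close> for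
    the energy of \<open>u k - w\<close>. Limits are taken in the order \<open>k\<close>,
    \<open>j\<close>, \<open>e\<close>: the limit in \<open>j\<close> removes the term with
    \<open>1 / e\<close>, and only then may \<open>e\<close> tend to 0.\<close>
  define R where "R j e = (1 + e) * (L - grid_energy j w) + (1 + 1 / e) * (dirichlet w - grid_energy j w)" for j and e :: real
  have R0: "0 \<le> R j e" if "0 < e" for j e
    unfolding R_def using that gw[of j] grid_energy_le_dirichlet[OF wH, of j] by (intro add_nonneg_nonneg mult_nonneg_nonneg) auto
  have bound_R: "K * L powr (\<beta> / 2) - mass q w \<le> K * (1 - m) powr (\<alpha> / 2) * R j e powr (\<beta> / 2)" if e: "0 < e" for j e
  proof -
    define T where "T k = grid_energy j (?z k) + (1 + e) * (dirichlet (u k) - grid_energy j (u k)) + (1 + 1 / e) * (dirichlet w - grid_energy j w)" for k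
    have T: "dirichlet (?z k) \<le> T k" for k
      unfolding T_def by (rule H1_grid_diff(2)[OF u(1)[of k] wH e])
    have "(\<lambda>k. grid_energy j (?z k)) \<longlonglongrightarrow> grid_energy j (\<lambda>x. w x - w x)"
      by (rule grid_energy_LIMSEQ) (intro tendsto_diff pt tendsto_const)
    then have g0: "(\<lambda>k. grid_energy j (?z k)) \<longlonglongrightarrow> 0" by (simp add: grid_energy_def dyadic_energy_def)
    have "T \<longlonglongrightarrow> 0 + R j e"
      unfolding T_def R_def add.assoc
      by (intro tendsto_add tendsto_mult tendsto_const tendsto_diff g0 L grid_energy_LIMSEQ[OF pt])
    then have TR: "T \<longlonglongrightarrow> R j e" by simp
    have "(\<lambda>k. K * mass 2 (?z k) powr (\<alpha> / 2) * T k powr (\<beta> / 2)) \<longlonglongrightarrow> K * (1 - m) powr (\<alpha> / 2) * R j e powr (\<beta> / 2)"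
    proof (intro tendsto_mult tendsto_const)
      show "(\<lambda>k. mass 2 (?z k) powr (\<alpha> / 2)) \<longlonglongrightarrow> (1 - m) powr (\<alpha> / 2)"
        by (rule tendsto_powr2[OF zm tendsto_const]) (simp add: mass_nonneg, use \<alpha>\<beta> in simp)
      show "(\<lambda>k. T k powr (\<beta> / 2)) \<longlonglongrightarrow> R j e powr (\<beta> / 2)"
        by (rule tendsto_powr2[OF TR tendsto_const]) (intro always_eventually allI order_trans[OF dirichlet_nonneg T], use \<alpha>\<beta> in simp)
    qed
    moreover have "mass q (?z k) \<le> K * mass 2 (?z k) powr (\<alpha> / 2) * T k powr (\<beta> / 2)" for k
    proof -
      have "mass q (?z k) \<le> K * mass 2 (?z k) powr (\<alpha> / 2) * dirichlet (?z k) powr (\<beta> / 2)" by (rule GN[OF zH])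
      also have "\<dots> \<le> K * mass 2 (?z k) powr (\<alpha> / 2) * T k powr (\<beta> / 2)"
        by (intro mult_left_mono powr_mono2 dirichlet_nonneg T) (use K \<alpha>\<beta> in auto)
      finally show ?thesis .
    qed
    ultimately show ?thesis by (intro LIMSEQ_le[OF zq]) auto
  qed
  have bound_e: "K * L powr (\<beta> / 2) - mass q w \<le> K * (1 - m) powr (\<alpha> / 2) * ((1 + e) * (L - dirichlet w)) powr (\<beta> / 2)" if e: "0 < e" for e
  proof (rule LIMSEQ_le_const)
    have "(\<lambda>j. R j e) \<longlonglongrightarrow> (1 + e) * (L - dirichlet w) + (1 + 1 / e) * (dirichlet w - dirichlet w)"
      unfolding R_def by (intro tendsto_intros grid_energy_tendsto[OF wH])
    then have "(\<lambda>j. R j e) \<longlonglongrightarrow> (1 + e) * (L - dirichlet w)" by simp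
    then have "(\<lambda>j. R j e powr (\<beta> / 2)) \<longlonglongrightarrow> ((1 + e) * (L - dirichlet w)) powr (\<beta> / 2)"
      by (rule tendsto_powr2[OF _ tendsto_const]) (use R0[OF e] \<alpha>\<beta> in auto)
    then show "(\<lambda>j. K * (1 - m) powr (\<alpha> / 2) * R j e powr (\<beta> / 2)) \<longlonglongrightarrow>
       K * (1 - m) powr (\<alpha> / 2) * ((1 + e) * (L - dirichlet w)) powr (\<beta> / 2)"
      by (intro tendsto_mult tendsto_const)
    show "\<exists>N. \<forall>j\<ge>N. K * L powr (\<beta> / 2) - mass q w \<le> K * (1 - m) powr (\<alpha> / 2) * R j e powr (\<beta> / 2)"
      using bound_R[OF e] by blast
  qed
  have rem: "K * L powr (\<beta> / 2) - mass q w \<le> K * (1 - m) powr (\<alpha> / 2) * (L - dirichlet w) powr (\<beta> / 2)"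
  proof (rule LIMSEQ_le_const)
    have "(\<lambda>j. (1 + inverse (real (Suc j))) * (L - dirichlet w)) \<longlonglongrightarrow> (1 + 0) * (L - dirichlet w)"
      by (intro tendsto_mult tendsto_add tendsto_const LIMSEQ_inverse_real_of_nat)
    then have "(\<lambda>j. (1 + inverse (real (Suc j))) * (L - dirichlet w)) \<longlonglongrightarrow> L - dirichlet w" by simp
    then have "(\<lambda>j. ((1 + inverse (real (Suc j))) * (L - dirichlet w)) powr (\<beta> / 2)) \<longlonglongrightarrow> (L - dirichlet w) powr (\<beta> / 2)"
      by (rule tendsto_powr2[OF _ tendsto_const]) (use dw \<alpha>\<beta> in \<open>auto intro!: mult_nonneg_nonneg\<close>)
    then show "(\<lambda>j. K * (1 - m) powr (\<alpha> / 2) * ((1 + inverse (real (Suc j))) * (L - dirichlet w)) powr (\<beta> / 2)) \<longlonglongrightarrow>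
       K * (1 - m) powr (\<alpha> / 2) * (L - dirichlet w) powr (\<beta> / 2)"
      by (intro tendsto_mult tendsto_const)
    show "\<exists>N. \<forall>j\<ge>N. K * L powr (\<beta> / 2) - mass q w \<le> K * (1 - m) powr (\<alpha> / 2) * ((1 + inverse (real (Suc j))) * (L - dirichlet w)) powr (\<beta> / 2)"
      using bound_e by (auto simp del: of_nat_Suc)
  qed
  define y where "y = dirichlet w / L"
  have y: "0 \<le> y" "y \<le> 1" using dw L0 dirichlet_nonneg[of w] by (auto simp: y_def)
  have dy: "dirichlet w = L * y" "L - dirichlet w = L * (1 - y)" using L0 by (auto simp: y_def algebra_simps)
  \<comment> \<open>The inequality for \<open>w\<close> is added to the one for the remainders;
    division by \<open>K * L powr (\<beta> / 2)\<close> then produces the hypothesis of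
    \<open>split_powr_rigidity\<close>.\<close>
  have "K * L powr (\<beta> / 2) \<le> K * m powr (\<alpha> / 2) * dirichlet w powr (\<beta> / 2) + K * (1 - m) powr (\<alpha> / 2) * (L - dirichlet w) powr (\<beta> / 2)"
    using rem GN[OF wH] unfolding m_def by linarith
  also have "\<dots> = (K * L powr (\<beta> / 2)) * (m powr (\<alpha> / 2) * y powr (\<beta> / 2) + (1 - m) powr (\<alpha> / 2) * (1 - y) powr (\<beta> / 2))"
    unfolding dy(2) unfolding dy(1) powr_mult by (simp add: algebra_simps)
  finally have "(K * L powr (\<beta> / 2)) * 1 \<le> (K * L powr (\<beta> / 2)) * (m powr (\<alpha> / 2) * y powr (\<beta> / 2) + (1 - m) powr (\<alpha> / 2) * (1 - y) powr (\<beta> / 2))"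
    by (simp only: mult_1_right)
  then have "1 \<le> m powr (\<alpha> / 2) * y powr (\<beta> / 2) + (1 - m) powr (\<alpha> / 2) * (1 - y) powr (\<beta> / 2)"
    by (rule mult_left_le_imp_le) (use K L0 in simp)
  then have my: "m = 1 \<and> y = 1"
    by (intro split_powr_rigidity[of "\<alpha> / 2" "\<beta> / 2"]) (use \<alpha>\<beta> q m0 m1 y in auto)
  \<comment> \<open>For \<open>m = 1\<close> the right side of the remainder bound is 0, so no
    \<open>q\<close>-mass escapes.\<close>
  then have "K * L powr (\<beta> / 2) - mass q w \<le> 0" using rem by simp
  then have "K * mass 2 w powr (\<alpha> / 2) * dirichlet w powr (\<beta> / 2) \<le> mass q w"
    using my unfolding dy(1) m_def by simp
  then show ?thesis using GN[OF wH] by linarith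
qed

end

text \<open>Translations bring an edge with mass at least \<open>c\<close> to the origin. Edge
  masses converge on fixed edges, so the pointwise limit cannot vanish, and the splitting argument
  applies to it.\<close>

lemma maximizer_exists:
  fixes q \<alpha> \<beta> K D0 D1 m0 :: real and u :: "nat \<Rightarrow> real^'n \<Rightarrow> real"
  assumes q: "2 < q" and \<alpha>\<beta>: "0 < \<alpha>" "0 < \<beta>" "\<alpha> / 2 + \<beta> / 2 = q / 2" and K: "0 < K"
    and GN: "\<And>w :: real^'n \<Rightarrow> real. w \<in> H1_grid \<Longrightarrow> mass q w \<le> K * mass 2 w powr (\<alpha> / 2) * dirichlet w powr (\<beta> / 2)"
    and D: "0 < D0" "\<And>k. D0 \<le> dirichlet (u k)" "\<And>k. dirichlet (u k) \<le> D1"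
    and u: "\<And>k. u k \<in> H1_grid" "\<And>k. mass 2 (u k) = 1"
    and lim: "(\<lambda>k. mass q (u k) / dirichlet (u k) powr (\<beta> / 2)) \<longlonglongrightarrow> K"
    and m0: "0 < m0" "\<And>k. m0 \<le> mass q (u k)"
  shows "\<exists>w :: real^'n \<Rightarrow> real. w \<in> nonzero_H1_grid \<and> mass q w = K * mass 2 w powr (\<alpha> / 2) * dirichlet w powr (\<beta> / 2)"
proof -
  have D1: "0 < D1" using D(1) D(2)[of 0] D(3)[of 0] by linarith
  obtain c where c: "0 < c" and cE: "\<And>k. \<exists>e\<in>edges. c \<le> edge_mass (u k) e"
    using nonvanishing_edge[OF q m0(1) D1] u D(3) m0(2) by blast
  have e0: "(0, i) \<in> edges" for i :: 'n by (simp add: edges_def vertices_def)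
  have "\<exists>v :: real^'n \<Rightarrow> real. v \<in> H1_grid \<and> dirichlet v = dirichlet (u k) \<and> (\<forall>p. mass p v = mass p (u k)) \<and>
      (\<exists>i. c \<le> edge_mass v (0, i))" for k
  proof -
    obtain e where e: "e \<in> edges" "c \<le> edge_mass (u k) e" using cE by blast
    have k: "fst e \<in> vertices" using e(1) by (auto simp: edges_def)
    note tr = H1_grid_translate[OF k u(1)[of k]]
    have "edge_mass (\<lambda>x. u k (x + fst e)) (0, snd e) = edge_mass (u k) e"
      unfolding edge_mass_def tr(4) by simp
    then have "\<exists>i. c \<le> edge_mass (\<lambda>x. u k (x + fst e)) (0, i)" using e(2) by (intro exI[of _ "snd e"]) simp
    then show ?thesis using tr(1-3) by (intro exI[of _ "\<lambda>x. u k (x + fst e)"] conjI allI)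
  qed
  then obtain v :: "nat \<Rightarrow> real^'n \<Rightarrow> real" where v: "\<And>k. v k \<in> H1_grid" "\<And>k. dirichlet (v k) = dirichlet (u k)"
    "\<And>p k. mass p (v k) = mass p (u k)" "\<And>k. \<exists>i. c \<le> edge_mass (v k) (0, i)" by metis
  obtain r w where r: "strict_mono (r :: nat \<Rightarrow> nat)" and wH: "w \<in> H1_grid" and pt: "\<And>x. x \<in> grid \<Longrightarrow> (\<lambda>k. v (r k) x) \<longlonglongrightarrow> w x"
    by (rule H1_grid_compactness[of v 1 D1]) (rule v(1), simp add: v(3) u(2), simp add: v(2) D(3), rule that)
  have "seq_compact {D0..D1}" by (rule compact_imp_seq_compact) simp
  then obtain L s where s: "strict_mono (s :: nat \<Rightarrow> nat)" and L: "((\<lambda>k. dirichlet (v (r k))) \<circ> s) \<longlonglongrightarrow> L"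
    by (rule seq_compactE[where f="\<lambda>k. dirichlet (v (r k))"]) (simp add: D v(2), rule that)
  define y where "y k = v (r (s k))" for k
  have y: "y k \<in> H1_grid" "mass 2 (y k) = 1" "D0 \<le> dirichlet (y k)" "dirichlet (y k) \<le> D1" for k
    unfolding y_def using v(1-3) u(2) D(2,3) by simp_all
  have ypt: "(\<lambda>k. y k x) \<longlonglongrightarrow> w x" if "x \<in> grid" for x
    using LIMSEQ_subseq_LIMSEQ[OF pt[OF that] s] by (simp add: o_def y_def)
  have yL: "(\<lambda>k. dirichlet (y k)) \<longlonglongrightarrow> L" using L by (simp add: o_def y_def)
  have ylim: "(\<lambda>k. mass q (y k) / dirichlet (y k) powr (\<beta> / 2)) \<longlonglongrightarrow> K"
    using LIMSEQ_subseq_LIMSEQ[OF LIMSEQ_subseq_LIMSEQ[OF lim r] s] by (simp add: o_def y_def v(2,3))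
  have "w \<in> nonzero_H1_grid"
  proof (rule ccontr)
    assume "w \<notin> nonzero_H1_grid"
    then have w0: "w x = 0" if "x \<in> grid" for x using wH that by (auto simp: nonzero_H1_grid_def)
    have em0: "edge_mass w (0, i) = 0" for i
      unfolding edge_mass_def
    proof (rule integral_eq_zero_AE, rule AE_I2)
      fix t assume "t \<in> space unit_lebesgue"
      then have "edge_point (0, i) t \<in> grid" by (intro edge_point_in_grid e0) (simp add: space_restrict_space)
      then show "(on_edges w ((0, i), t))\<^sup>2 = 0" unfolding on_edges_def prod.case by (simp add: w0)
    qed
    have S: "(y k (edge_point (0, i) t))\<^sup>2 \<le> 2 + 2 * D1" if "t \<in> {0..1}" for k i t
      using sup_bound_normalized[OF y(1,2) e0 that, of 1 k i] y(4)[of k] by simp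
    \<comment> \<open>The direction of the heavy edge may vary with \<open>k\<close>, but the sum
      over all edges starting at the origin is bounded below by \<open>c\<close>.\<close>
    have "(\<lambda>k. \<Sum>i\<in>UNIV. edge_mass (y k) (0, i)) \<longlonglongrightarrow> (\<Sum>i\<in>UNIV. edge_mass w (0, i))"
      by (intro tendsto_sum edge_mass_LIMSEQ[OF y(1) wH e0 S ypt])
    moreover have "c \<le> (\<Sum>i\<in>UNIV. edge_mass (y k) (0, i))" for k
    proof -
      obtain i where "c \<le> edge_mass (y k) (0, i)" using v(4) unfolding y_def by blast
      also have "\<dots> \<le> (\<Sum>i\<in>UNIV. edge_mass (y k) (0, i))"
        by (rule member_le_sum) (auto simp: edge_mass_def)
      finally show ?thesis .
    qed
    ultimately have "c \<le> (\<Sum>i\<in>UNIV. edge_mass w (0, i))" by (intro LIMSEQ_le_const) auto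
    then show False using c em0 by simp
  qed
  then have "mass q w = K * mass 2 w powr (\<alpha> / 2) * dirichlet w powr (\<beta> / 2)"
    using weak_limit_maximizes[OF q \<alpha>\<beta> K GN D(1) y(3,4,1,2) ylim _ ypt yL] by blast
  with \<open>w \<in> nonzero_H1_grid\<close> show ?thesis by blast
qed

theorem proposition2p6:
  fixes q :: real
  assumes "CARD('n::finite) \<ge> 2"
    and "q \<in> {2 <.. 2 + 4 / real CARD('n)}"
    and "\<exists>u \<in> (nonzero_H1_grid :: (real^'n \<Rightarrow> real) set).
           ereal (Q_grid q u) \<ge>
             ereal (real CARD('n) powr ((real CARD('n) - 2) * (q - 2) / 4)) * K_space TYPE('n) q"
  shows "K_grid_attained TYPE('n) q"
proof -
  let ?d = "real CARD('n)"
  let ?K = "K_grid TYPE('n) q"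
  have d: "2 \<le> ?d" using assms(1) by simp
  have q: "2 < q" "q \<le> 2 + 4 / ?d" using assms(2) by auto
  define \<alpha> \<beta> where \<alpha>_def: "\<alpha> = ?d + (2 - ?d) * (q / 2)" and \<beta>: "\<beta> = (q / 2 - 1) * ?d"
  \<comment> \<open>The upper end of the range of \<open>q\<close> gives
    \<open>(d - 2) * (q / 2) \<le> d - 4 / d\<close>, so the exponent of the square mass stays
    positive.\<close>
  have \<alpha>0: "0 < \<alpha>"
  proof -
    have "(?d - 2) * (q / 2) \<le> (?d - 2) * ((2 + 4 / ?d) / 2)" using d q(2) by (intro mult_left_mono divide_right_mono) auto
    also have "\<dots> = ?d - 4 / ?d" using d by (simp add: field_simps)
    also have "\<dots> < ?d" using d by simp
    finally show ?thesis unfolding \<alpha>_def by (simp add: algebra_simps)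
  qed
  note \<alpha> = \<alpha>_def \<alpha>0
  note ex = exponent_sum[OF q(1) \<alpha> \<beta>]
  note Qf = Q_grid_formula[OF q(1) \<alpha> \<beta>]
  obtain u0 :: "real^'n \<Rightarrow> real" where u0: "u0 \<in> nonzero_H1_grid"
    and hyp: "ereal (?d powr ((?d - 2) * (q - 2) / 4)) * K_space TYPE('n) q \<le> ereal (Q_grid q u0)"
    using assms(3) by blast
  have up: "ereal (Q_grid q u) \<le> ?K" if "u \<in> nonzero_H1_grid" for u :: "real^'n \<Rightarrow> real"
    unfolding K_grid_def using that by (rule SUP_upper)
  show ?thesis
  proof (cases "ereal (Q_grid q u0) = ?K")
    case True
    then show ?thesis unfolding K_grid_attained_def using u0 by blast
  next
    case False
    then have "ereal (Q_grid q u0) < ?K" using up[OF u0] by simp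
    \<comment> \<open>A level strictly between the given quotient and the supremum: low and high
      energies stay below it, and the maximizing sequence is chosen above it.\<close>
    then obtain k0 :: real where k0: "ereal (Q_grid q u0) < ereal k0" "ereal k0 < ?K" using ereal_dense2 by blast
    have Q0: "0 \<le> Q_grid q u0" unfolding Qf by (simp add: mass_nonneg)
    have k0': "Q_grid q u0 < k0" "0 < k0" using k0(1) Q0 by auto
    define c where "c = ?d powr ((?d - 2) * (q - 2) / 4)"
    have c: "0 < c" using d by (simp add: c_def)
    \<comment> \<open>A nonnegative real stand-in for the extended supremum, as
      \<open>low_energy_regime\<close> demands.\<close>
    define \<kappa> where "\<kappa> = max 0 (real_of_ereal (K_space TYPE('n) q))"
    have \<kappa>0: "0 \<le> \<kappa>" by (simp add: \<kappa>_def)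
    \<comment> \<open>By hypothesis a positive multiple of the supremum lies below a real
      number.\<close>
    have Kinf: "K_space TYPE('n) q \<noteq> \<infinity>" using hyp c by (auto simp: c_def[symmetric])
    have \<kappa>: "Q_space q v \<le> \<kappa>" if "v \<in> nonzero_H1_space" for v :: "real^'n \<Rightarrow> real"
    proof -
      have "ereal (Q_space q v) \<le> K_space TYPE('n) q" unfolding K_space_def using that by (rule SUP_upper)
      then show ?thesis using Kinf unfolding \<kappa>_def by (cases "K_space TYPE('n) q") auto
    qed
    have c\<kappa>: "c * \<kappa> \<le> Q_grid q u0"
    proof (cases "0 < real_of_ereal (K_space TYPE('n) q)")
      case True
      then show ?thesis using hyp Kinf unfolding \<kappa>_def c_def[symmetric] by (cases "K_space TYPE('n) q") auto
    next
      case False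
      then have "\<kappa> = 0" unfolding \<kappa>_def by simp
      then show ?thesis using Q0 by simp
    qed
    \<comment> \<open>Here the exponent of the hypothesis is matched:
      \<open>1 - \<alpha> / 2 = (d - 2) * (q - 2) / 4\<close>.\<close>
    have "?d * \<kappa> * ?d powr (- \<alpha> / 2) = c * \<kappa>"
    proof -
      have "1 + - \<alpha> / 2 = (?d - 2) * (q - 2) / 4" unfolding \<alpha>_def by (simp add: field_simps)
      then have "c = ?d powr 1 * ?d powr (- \<alpha> / 2)" unfolding c_def by (simp only: powr_add[symmetric])
      then show ?thesis using d by simp
    qed
    then have "?d * \<kappa> * ?d powr (- \<alpha> / 2) < k0" using c\<kappa> k0'(1) by linarith
    then obtain D0 where D0: "0 < D0" and lowE: "\<And>u :: real^'n \<Rightarrow> real. u \<in> H1_grid \<Longrightarrow> mass 2 u = 1 \<Longrightarrow> 0 < dirichlet u \<Longrightarrow>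
        dirichlet u \<le> D0 \<Longrightarrow> mass q u \<le> k0 * dirichlet u powr (\<beta> / 2)"
      using low_energy_regime[OF q(1) \<alpha> \<beta> \<kappa> \<kappa>0] by blast
    obtain D1 where highE: "\<And>u :: real^'n \<Rightarrow> real. u \<in> H1_grid \<Longrightarrow> mass 2 u = 1 \<Longrightarrow> D1 \<le> dirichlet u \<Longrightarrow>
        mass q u \<le> k0 * dirichlet u powr (\<beta> / 2)"
      using high_energy_regime[OF q(1) \<alpha> \<beta> assms(1) k0'(2)] by blast
    \<comment> \<open>A quotient above \<open>k0\<close> is incompatible with either regime, so the
      normalized function has energy between \<open>D0\<close> and \<open>D1\<close>.\<close>
    have norm: "\<exists>v :: real^'n \<Rightarrow> real. v \<in> nonzero_H1_grid \<and> mass 2 v = 1 \<and> mass q v = Q_grid q u * dirichlet v powr (\<beta> / 2) \<and>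
        D0 \<le> dirichlet v \<and> dirichlet v \<le> D1"
      if u: "u \<in> nonzero_H1_grid" "k0 < Q_grid q u" for u :: "real^'n \<Rightarrow> real"
    proof -
      obtain v :: "real^'n \<Rightarrow> real" where v: "v \<in> nonzero_H1_grid" "mass 2 v = 1" "mass q v = Q_grid q u * dirichlet v powr (\<beta> / 2)"
        by (rule normalized_function[OF q(1) \<alpha> \<beta> u(1)])
      have vH: "v \<in> H1_grid" using v(1) by (simp add: nonzero_H1_grid_def)
      have D: "0 < dirichlet v" by (rule dirichlet_pos[OF v(1)])
      then have "k0 * dirichlet v powr (\<beta> / 2) < mass q v" unfolding v(3) using u(2) by (intro mult_strict_right_mono) auto
      then have "D0 \<le> dirichlet v" "dirichlet v \<le> D1" using lowE[OF vH v(2) D] highE[OF vH v(2)] by linarith+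
      then show ?thesis using v by blast
    qed
    \<comment> \<open>Finiteness of the supremum: quotients above \<open>k0\<close> come with
      energies in the window, where the sup bound with \<open>r = 1\<close> limits the
      \<open>q\<close>-mass and \<open>D0\<close> limits the denominator.\<close>
    define C where "C = max k0 ((2 + 2 * D1) powr ((q - 2) / 2) / D0 powr (\<beta> / 2))"
    have "Q_grid q u \<le> C" if u: "u \<in> nonzero_H1_grid" for u :: "real^'n \<Rightarrow> real"
    proof (cases "k0 < Q_grid q u")
      case True
      obtain v :: "real^'n \<Rightarrow> real" where v: "v \<in> nonzero_H1_grid" "mass 2 v = 1" "mass q v = Q_grid q u * dirichlet v powr (\<beta> / 2)"
        "D0 \<le> dirichlet v" "dirichlet v \<le> D1" using norm[OF u True] by blast
      have vH: "v \<in> H1_grid" using v(1) by (simp add: nonzero_H1_grid_def)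
      have "(v (edge_point e t))\<^sup>2 \<le> 2 + 2 * D1" if "e \<in> edges" "t \<in> {0..1}" for e t
        using sup_bound_normalized[OF vH v(2) that, of 1] v(5) by simp
      then have "mass q v \<le> (2 + 2 * D1) powr ((q - 2) / 2)" using mass_le_sup(2)[OF vH _ q(1)] v(2) by fastforce
      moreover have "Q_grid q u * D0 powr (\<beta> / 2) \<le> mass q v"
        unfolding v(3) using True k0'(2) D0 v(4) ex(2) by (intro mult_left_mono powr_mono2) auto
      ultimately have "Q_grid q u \<le> (2 + 2 * D1) powr ((q - 2) / 2) / D0 powr (\<beta> / 2)" using D0 by (simp add: pos_le_divide_eq)
      then show ?thesis by (simp add: C_def)
    next
      case False
      then show ?thesis by (simp add: C_def)
    qed
    then have "?K \<le> ereal C" unfolding K_grid_def by (intro SUP_least) simp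
    then obtain Kr where Kr: "?K = ereal Kr" using k0(2) by (cases ?K) auto
    have k0K: "k0 < Kr" using k0(2) unfolding Kr by simp
    have QK: "Q_grid q u \<le> Kr" if "u \<in> nonzero_H1_grid" for u :: "real^'n \<Rightarrow> real" using up[OF that] unfolding Kr by simp
    have Kr0: "0 < Kr" using k0K k0'(2) by linarith
    note GN = Q_grid_bound_GN[OF q(1) \<alpha> \<beta> QK less_imp_le[OF Kr0]]
    \<comment> \<open>The quotient is carried along as a number \<open>x\<close> that normalization
      does not change; \<open>k0 < x\<close> keeps the energies in the window and the
      \<open>q\<close>-masses away from 0.\<close>
    have "\<exists>v x. v \<in> (nonzero_H1_grid :: (real^'n \<Rightarrow> real) set) \<and> mass 2 v = 1 \<and> mass q v = x * dirichlet v powr (\<beta> / 2) \<and>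
        D0 \<le> dirichlet v \<and> dirichlet v \<le> D1 \<and> k0 < x \<and> Kr - inverse (real (Suc n)) < x \<and> x \<le> Kr" for n
    proof -
      have "max k0 (Kr - inverse (real (Suc n))) < Kr" using k0K by simp
      then have "ereal (max k0 (Kr - inverse (real (Suc n)))) < ?K" unfolding Kr by simp
      then obtain u :: "real^'n \<Rightarrow> real" where u: "u \<in> nonzero_H1_grid" "max k0 (Kr - inverse (real (Suc n))) < Q_grid q u"
        unfolding K_grid_def less_SUP_iff by auto
      then have "k0 < Q_grid q u" by simp
      from norm[OF u(1) this] show ?thesis using u(2) QK[OF u(1)] by auto
    qed
    then obtain v :: "nat \<Rightarrow> real^'n \<Rightarrow> real" and x :: "nat \<Rightarrow> real" where v: "\<And>n. v n \<in> nonzero_H1_grid" "\<And>n. mass 2 (v n) = 1"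
      "\<And>n. mass q (v n) = x n * dirichlet (v n) powr (\<beta> / 2)" "\<And>n. D0 \<le> dirichlet (v n)" "\<And>n. dirichlet (v n) \<le> D1"
      and x: "\<And>n. k0 < x n" "\<And>n. Kr - inverse (real (Suc n)) < x n" "\<And>n. x n \<le> Kr" by metis
    have vH: "v n \<in> H1_grid" for n using v(1)[of n] by (simp add: nonzero_H1_grid_def)
    have xlim: "x \<longlonglongrightarrow> Kr"
    proof (rule tendsto_sandwich[of "\<lambda>n. Kr - inverse (real (Suc n))" x sequentially "\<lambda>_. Kr"])
      show "(\<lambda>n. Kr - inverse (real (Suc n))) \<longlonglongrightarrow> Kr"
        using tendsto_diff[OF tendsto_const LIMSEQ_inverse_real_of_nat, of Kr] by simp
    qed (use x in \<open>auto intro!: always_eventually less_imp_le simp del: of_nat_Suc\<close>)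
    have "mass q (v n) / dirichlet (v n) powr (\<beta> / 2) = x n" for n
      unfolding v(3) using dirichlet_pos[OF v(1)[of n]] by simp
    then have lim: "(\<lambda>n. mass q (v n) / dirichlet (v n) powr (\<beta> / 2)) \<longlonglongrightarrow> Kr" using xlim by simp
    have m0: "k0 * D0 powr (\<beta> / 2) \<le> mass q (v n)" for n
      unfolding v(3) using x(1)[of n] k0'(2) D0 v(4)[of n] ex(2) by (intro mult_mono powr_mono2) auto
    have m00: "0 < k0 * D0 powr (\<beta> / 2)" using k0'(2) D0 by simp
    obtain w :: "real^'n \<Rightarrow> real" where w: "w \<in> nonzero_H1_grid" "mass q w = Kr * mass 2 w powr (\<alpha> / 2) * dirichlet w powr (\<beta> / 2)"
      using maximizer_exists[OF q(1) \<alpha>0 ex(2,1) Kr0 GN D0 v(4,5) vH v(2) lim m00 m0] by blast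
    have "Q_grid q w = Kr" unfolding Qf w(2) using mass_two_pos[OF w(1)] dirichlet_pos[OF w(1)] by simp
    then show ?thesis unfolding K_grid_attained_def Kr using w(1) by (intro bexI[of _ w]) auto
  qed
qed

end
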